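(* Let $G$ be a nonabelian finite simple group and let $p$ be a prime divisor of $|G|$. Then $\mathrm{Pr}_p(G) = \frac{p^2+p-1}{p^3}$ if and only if $p \geq 5$ and $G$ is isomorphic to $\mathrm{PSL}_2(p)$.
   Context: For a finite group $G$ and a prime $p$, $G_p$ denotes the set of $p$-elements of $G$, i.e. the elements of order $p^m$ for some $m \geq 0$ (so $1 \in G_p$), and $$\mathrm{Pr}_p(G) = \frac{|\{(x,y) \in G_p \times G_p : xy = yx\}|}{|G_p|^2}$$ is the probability that two random $p$-elements of $G$ commute. *)

theory Defs
  imports "HOL-Algebra.SimpleGroups" "HOL-Number_Theory.Residues"
begin

definition p_elements :: "('a, 'b) monoid_scheme \<Rightarrow> nat \<Rightarrow> 'a set"
  where "p_elements G p = {x \<in> carrier G. \<exists>m::nat. group.ord G x = p ^ m}"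

definition Pr_p :: "nat \<Rightarrow> ('a, 'b) monoid_scheme \<Rightarrow> real"
  where "Pr_p p G =
    real (card {(x, y). x \<in> p_elements G p \<and> y \<in> p_elements G p \<and> x \<otimes>\<^bsub>G\<^esub> y = y \<otimes>\<^bsub>G\<^esub> x})
      / real (card (p_elements G p)) ^ 2"

definition group_center :: "('a, 'b) monoid_scheme \<Rightarrow> 'a set"
  where "group_center G = {z \<in> carrier G. \<forall>x \<in> carrier G. z \<otimes>\<^bsub>G\<^esub> x = x \<otimes>\<^bsub>G\<^esub> z}"

text \<open>The quadruple \<open>(a, b, c, d)\<close> stands for the matrix with rows \<open>(a, b)\<close> and \<open>(c, d)\<close>.
  The ring is a record rather than a type so that the field with \<open>p\<close> elements is available for a
  variable \<open>p\<close>, as \<open>residue_ring (int p)\<close>.\<close>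

definition SL2 :: "('a, 'b) ring_scheme \<Rightarrow> ('a \<times> 'a \<times> 'a \<times> 'a) monoid"
  where "SL2 R = \<lparr>
    carrier = {(a, b, c, d). a \<in> carrier R \<and> b \<in> carrier R \<and> c \<in> carrier R \<and> d \<in> carrier R \<and>
      a \<otimes>\<^bsub>R\<^esub> d \<ominus>\<^bsub>R\<^esub> b \<otimes>\<^bsub>R\<^esub> c = \<one>\<^bsub>R\<^esub>},
    monoid.mult = (\<lambda>(a, b, c, d) (a', b', c', d').
      (a \<otimes>\<^bsub>R\<^esub> a' \<oplus>\<^bsub>R\<^esub> b \<otimes>\<^bsub>R\<^esub> c', a \<otimes>\<^bsub>R\<^esub> b' \<oplus>\<^bsub>R\<^esub> b \<otimes>\<^bsub>R\<^esub> d',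
       c \<otimes>\<^bsub>R\<^esub> a' \<oplus>\<^bsub>R\<^esub> d \<otimes>\<^bsub>R\<^esub> c', c \<otimes>\<^bsub>R\<^esub> b' \<oplus>\<^bsub>R\<^esub> d \<otimes>\<^bsub>R\<^esub> d')),
    one = (\<one>\<^bsub>R\<^esub>, \<zero>\<^bsub>R\<^esub>, \<zero>\<^bsub>R\<^esub>, \<one>\<^bsub>R\<^esub>)\<rparr>"

definition PSL2 :: "('a, 'b) ring_scheme \<Rightarrow> ('a \<times> 'a \<times> 'a \<times> 'a) set monoid"
  where "PSL2 R = SL2 R Mod group_center (SL2 R)"

lemma (in cring) group_SL2: "group (SL2 R)"
proof (rule groupI)
  fix x y assume "x \<in> carrier (SL2 R)" "y \<in> carrier (SL2 R)"
  then obtain a b c d a' b' c' d' where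
    xy: "x = (a, b, c, d)" "y = (a', b', c', d')" and
    cl [simp]: "a \<in> carrier R" "b \<in> carrier R" "c \<in> carrier R" "d \<in> carrier R"
      "a' \<in> carrier R" "b' \<in> carrier R" "c' \<in> carrier R" "d' \<in> carrier R" and
    det: "a \<otimes> d \<ominus> b \<otimes> c = \<one>" "a' \<otimes> d' \<ominus> b' \<otimes> c' = \<one>"
    by (cases x; cases y) (auto simp: SL2_def)
  have "(a \<otimes> a' \<oplus> b \<otimes> c') \<otimes> (c \<otimes> b' \<oplus> d \<otimes> d') \<ominus>
      (a \<otimes> b' \<oplus> b \<otimes> d') \<otimes> (c \<otimes> a' \<oplus> d \<otimes> c') =
      (a \<otimes> d \<ominus> b \<otimes> c) \<otimes> (a' \<otimes> d' \<ominus> b' \<otimes> c')"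
    using cl by algebra
  then show "x \<otimes>\<^bsub>SL2 R\<^esub> y \<in> carrier (SL2 R)"
    using det by (simp add: SL2_def xy)
next
  show "\<one>\<^bsub>SL2 R\<^esub> \<in> carrier (SL2 R)"
    by (simp add: SL2_def a_minus_def)
next
  fix x y z assume "x \<in> carrier (SL2 R)" "y \<in> carrier (SL2 R)" "z \<in> carrier (SL2 R)"
  then show "x \<otimes>\<^bsub>SL2 R\<^esub> y \<otimes>\<^bsub>SL2 R\<^esub> z = x \<otimes>\<^bsub>SL2 R\<^esub> (y \<otimes>\<^bsub>SL2 R\<^esub> z)"
    by (cases x; cases y; cases z)
      (simp add: SL2_def l_distr r_distr m_assoc a_ac)
next
  fix x assume "x \<in> carrier (SL2 R)"
  then show "\<one>\<^bsub>SL2 R\<^esub> \<otimes>\<^bsub>SL2 R\<^esub> x = x"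
    by (cases x) (auto simp: SL2_def)
next
  fix x assume "x \<in> carrier (SL2 R)"
  then obtain a b c d where
    x: "x = (a, b, c, d)" and
    cl [simp]: "a \<in> carrier R" "b \<in> carrier R" "c \<in> carrier R" "d \<in> carrier R" and
    det: "a \<otimes> d \<ominus> b \<otimes> c = \<one>"
    by (cases x) (auto simp: SL2_def)
  have "d \<otimes> a \<oplus> (\<ominus> b) \<otimes> c = a \<otimes> d \<ominus> b \<otimes> c" using cl by algebra
  moreover have "d \<otimes> b \<oplus> (\<ominus> b) \<otimes> d = \<zero>" using cl by algebra
  moreover have "(\<ominus> c) \<otimes> a \<oplus> a \<otimes> c = \<zero>" using cl by algebra
  moreover have "(\<ominus> c) \<otimes> b \<oplus> a \<otimes> d = a \<otimes> d \<ominus> b \<otimes> c" using cl by algebra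
  moreover have "d \<otimes> a \<ominus> (\<ominus> b) \<otimes> (\<ominus> c) = a \<otimes> d \<ominus> b \<otimes> c" using cl by algebra
  ultimately show "\<exists>y \<in> carrier (SL2 R). y \<otimes>\<^bsub>SL2 R\<^esub> x = \<one>\<^bsub>SL2 R\<^esub>"
    using det by (intro bexI [of _ "(d, \<ominus> b, \<ominus> c, a)"]) (simp_all add: SL2_def x)
qed

lemma (in group) normal_group_center: "group_center G \<lhd> G"
proof -
  have "subgroup (group_center G) G"
  proof (rule subgroupI)
    fix a assume "a \<in> group_center G"
    then have a: "a \<in> carrier G" "\<And>x. x \<in> carrier G \<Longrightarrow> a \<otimes> x = x \<otimes> a"
      by (auto simp: group_center_def)
    have "inv a \<otimes> x = x \<otimes> inv a" if x: "x \<in> carrier G" for x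
    proof -
      have "inv a \<otimes> x = inv a \<otimes> (x \<otimes> a) \<otimes> inv a" using a(1) x by (simp add: m_assoc)
      also have "\<dots> = inv a \<otimes> (a \<otimes> x) \<otimes> inv a" using a(2) [OF x] by simp
      also have "\<dots> = x \<otimes> inv a" using a(1) x by (simp flip: m_assoc)
      finally show ?thesis .
    qed
    with a(1) show "inv a \<in> group_center G" by (simp add: group_center_def)
  next
    fix a b assume "a \<in> group_center G" "b \<in> group_center G"
    then have ab: "a \<in> carrier G" "b \<in> carrier G"
      "\<And>x. x \<in> carrier G \<Longrightarrow> a \<otimes> x = x \<otimes> a" "\<And>x. x \<in> carrier G \<Longrightarrow> b \<otimes> x = x \<otimes> b"
      by (auto simp: group_center_def)
    have "a \<otimes> b \<otimes> x = x \<otimes> (a \<otimes> b)" if x: "x \<in> carrier G" for x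
    proof -
      have "a \<otimes> b \<otimes> x = a \<otimes> x \<otimes> b" using ab(1,2) ab(4) [OF x] x by (simp add: m_assoc)
      also have "\<dots> = x \<otimes> (a \<otimes> b)" using ab(1,2) ab(3) [OF x] x by (simp add: m_assoc)
      finally show ?thesis .
    qed
    then show "a \<otimes> b \<in> group_center G" using ab(1,2) by (simp add: group_center_def)
  qed (auto simp: group_center_def)
  moreover have "x \<otimes> h \<otimes> inv x \<in> group_center G"
    if x: "x \<in> carrier G" and h: "h \<in> group_center G" for x h
  proof -
    have "h \<in> carrier G" "x \<otimes> h = h \<otimes> x" using h x by (auto simp: group_center_def)
    then have "x \<otimes> h \<otimes> inv x = h" using x by (simp add: m_assoc)
    then show ?thesis using h by simp
  qed
  ultimately show ?thesis by (simp add: normal_inv_iff)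
qed

lemma (in cring) group_PSL2: "group (PSL2 R)"
  unfolding PSL2_def
  by (rule normal.factorgroup_is_group [OF group.normal_group_center [OF group_SL2]])

end

theory Submission
  imports Defs "HOL-Algebra.Sylow" "HOL-Algebra.Group_Action" "HOL-Algebra.Generated_Groups"
    "HOL-Number_Theory.Number_Theory" "HOL-Combinatorics.Cycles"
begin

text \<open>
  Let \<open>N\<close> be the number of \<open>p\<close>-elements of the simple group \<open>G\<close>. For a \<open>p\<close>-element \<open>x \<noteq> 1\<close> choose
  a subgroup \<open>H\<close> that is minimal with \<open>x \<in> H\<close> and \<open>x \<notin> O\<^sub>p(H)\<close>. By the argument of Wielandt's
  zipper lemma every conjugate of \<open>x\<close> in \<open>H\<close> lies in only one maximal subgroup of \<open>H\<close>, and this maximal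
  subgroup has at least \<open>p + 1\<close> conjugates. Counting with these conjugates gives \<open>N \<ge> p\<^sup>2\<close> and
  shows that \<open>x\<close> commutes with at most \<open>N / p\<close> of the \<open>p\<close>-elements. Hence
  \<open>Pr\<^sub>p(G) \<le> 1 / N + (N - 1) / (p N)\<close>, and the value \<open>(p\<^sup>2 + p - 1) / p\<^sup>3\<close> is attained only if
  \<open>N = p\<^sup>2\<close>. Then the Sylow \<open>p\<close>-subgroups have order \<open>p\<close> and there are \<open>p + 1\<close> of them.

  One of them, acting by conjugation on the other \<open>p\<close>, identifies the Sylow subgroups with the projective line over
  \<open>F\<^sub>p\<close>. The stabilizer of \<open>\<infinity>\<close> consists of maps \<open>x \<mapsto> a x + b\<close> with slopes \<open>a\<close> from a subgroup
  \<open>A\<close> of the units; let \<open>w\<close> swap \<open>0\<close> and \<open>\<infinity>\<close>. Since \<open>G\<close> is simple, all transfers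
  vanish; this gives \<open>A \<noteq> 1\<close> and \<open>(a a')\<^sup>2 = 1\<close> if \<open>w\<close> conjugates \<open>x \<mapsto> a x\<close> to
  \<open>x \<mapsto> a' x\<close>. If \<open>-1 \<notin> A\<close>, then \<open>w\<close> is an involution inverting \<open>A\<close>, and a computation with
  power sums shows that the slope cocycle of \<open>w\<close> is a quadratic monomial. If \<open>-1 \<in> A\<close>, counting fixed points of
  involutions shows that \<open>A\<close> has index at most 2, and it has index 2 because a cycle of length \<open>p - 1\<close> is
  odd. In both cases \<open>A\<close> is the group of squares and \<open>x \<mapsto> -1/x\<close> lies in \<open>G\<close>, so that
  \<open>G\<close> is \<open>PSL\<^sub>2(p)\<close>.

  Conversely, \<open>|PSL\<^sub>2(p)|\<close> divides \<open>p (p\<^sup>2 - 1)\<close>, so the number of Sylow \<open>p\<close>-subgroups divides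
  \<open>p\<^sup>2 - 1\<close>, is congruent to 1 modulo \<open>p\<close>, and is not 1; it is therefore \<open>p + 1\<close>.
\<close>

text \<open>The bound in the overview equals 1/p + (1 - 1/p)/N. It decreases in N and takes the
  prescribed value exactly at N = p^2, so N >= p^2 leaves only equality. A subgroup of order p^2
  would then be the whole set of p-elements, hence normal; so Sylow subgroups have order p, and 1 +
  n (p - 1) = p^2 gives their number n = p + 1. The split on whether -1 lies in A is forced by the
  involutions. An involution that fixes a point has slope -1 there. If -1 lies in A, such
  involutions exist and their fixed points can be counted, which compensates for transfer leaving a
  a' = -1 possible. If -1 is not in A, transfer does determine a a', but no involution fixes a point
  and there is nothing to count. What is left are the relations between w and the translations;
  power sums exploit them because the moments of the slope function are, up to unit factors, the
  coefficients of the polynomial over F_p that represents it.\<close>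

section \<open>Arithmetic modulo a prime\<close>

text \<open>The three rules reduce a congruence to an identity of integer polynomials:
  \<open>u\<close>, \<open>v\<close>, \<open>w\<close> are the cofactors that write
  \<open>x - y\<close> as a combination of the differences in the hypotheses. Below they are given
  by hand and the identity is left to \<open>algebra_simps\<close>.\<close>

lemma cong_comb1:
  fixes x y :: int
  assumes "[a = b] (mod n)" "x - y = u * (a - b)"
  shows "[x = y] (mod n)"
  using assms by (auto simp: cong_iff_dvd_diff)

lemma cong_comb2:
  fixes x y :: int
  assumes "[a = b] (mod n)" "[c = d] (mod n)" "x - y = u * (a - b) + v * (c - d)"
  shows "[x = y] (mod n)"
  using assms by (auto simp: cong_iff_dvd_diff intro: dvd_add)

lemma cong_comb3:
  fixes x y :: int
  assumes "[a = b] (mod n)" "[c = d] (mod n)" "[e = f] (mod n)"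
    "x - y = u * (a - b) + v * (c - d) + w * (e - f)"
  shows "[x = y] (mod n)"
  using assms by (auto simp: cong_iff_dvd_diff intro!: dvd_add)

locale prime_modulus =
  fixes p :: nat
  assumes p_prime: "prime p"
begin

abbreviation cg :: "int \<Rightarrow> int \<Rightarrow> bool" (infix \<open>\<approx>\<close> 50)
  where "x \<approx> y \<equiv> [x = y] (mod int p)"

abbreviation unit :: "int \<Rightarrow> bool"
  where "unit x \<equiv> \<not> int p dvd x"

definition residue_sum :: "(int \<Rightarrow> int) \<Rightarrow> int"
  where "residue_sum f = (\<Sum>x\<in>{0..<int p}. f x)"

text \<open>These functions on the integers induce functions on F_p; for them a sum modulo
  \<open>p\<close> does not depend on the representatives of the residues.\<close>

definition periodic :: "(int \<Rightarrow> int) \<Rightarrow> bool"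
  where "periodic f \<longleftrightarrow> (\<forall>x y. x \<approx> y \<longrightarrow> f x \<approx> f y)"

lemma p_gt_1: "p > 1" using p_prime by (rule prime_gt_1_nat)

lemma pint: "prime (int p)" using p_prime by simp

lemma unit_mult: "unit (x * y) \<longleftrightarrow> unit x \<and> unit y"
  using pint by (simp add: prime_dvd_mult_iff)

lemma unit_power: "unit x \<Longrightarrow> unit (x ^ k)"
  using pint by (meson prime_dvd_power)

lemma unit_cong: "x \<approx> y \<Longrightarrow> unit x \<longleftrightarrow> unit y"
  by (simp add: cong_dvd_iff)

lemma unit_one: "unit 1" using p_gt_1 by auto

lemma cancel: "unit a \<Longrightarrow> a * x \<approx> a * y \<Longrightarrow> x \<approx> y"
  using pint by (metis cong_mult_lcancel prime_imp_coprime coprime_commute)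

lemma cancel': "unit a \<Longrightarrow> x * a \<approx> y * a \<Longrightarrow> x \<approx> y"
  by (rule cancel) (auto simp: mult.commute)

lemma unit_inverse:
  assumes "unit x" obtains y where "unit y" "x * y \<approx> 1"
proof -
  have "coprime x (int p)" using prime_imp_coprime [OF pint assms] by (simp add: coprime_commute)
  then obtain y where y: "x * y \<approx> 1" using cong_solve_coprime_int by blast
  moreover have "unit y"
    using unit_cong [OF y] unit_one by (simp add: unit_mult)
  ultimately show ?thesis using that by blast
qed

lemma mult_zero: "x * y \<approx> 0 \<Longrightarrow> x \<approx> 0 \<or> y \<approx> 0"
  using pint by (simp add: cong_0_iff prime_dvd_mult_iff)

lemma fermat: "unit x \<Longrightarrow> x ^ (p - 1) \<approx> 1"
proof -
  assume u: "unit x"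
  define m where "m = nat (x mod int p)"
  have m: "int m = x mod int p" using p_gt_1 by (simp add: m_def)
  have "\<not> p dvd m"
  proof
    assume "p dvd m"
    then have "int p dvd x mod int p" using m by (metis of_nat_dvd_iff)
    then show False using u by (simp add: dvd_mod_iff)
  qed
  then have "[m ^ (p - 1) = 1] (mod p)" using fermat_theorem p_prime by blast
  then have "[int m ^ (p - 1) = 1] (mod int p)"
    by (metis cong_int_iff of_nat_1 of_nat_power)
  moreover have "x ^ (p - 1) \<approx> int m ^ (p - 1)" unfolding m by (intro cong_pow) simp
  ultimately show ?thesis using cong_trans by blast
qed

lemma exists_primitive:
  obtains g :: int where "unit g" "\<And>k. g ^ k \<approx> 1 \<longleftrightarrow> p - 1 dvd k"
proof -
  obtain h where h: "residue_primroot p h"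
    using prime_primitive_root_exists p_gt_1 p_prime by blast
  then have o: "ord p h = p - 1" and c: "coprime p h"
    using p_prime by (auto simp: residue_primroot_def totient_prime)
  have "int h ^ k \<approx> 1 \<longleftrightarrow> p - 1 dvd k" for k
  proof -
    have "int h ^ k \<approx> 1 \<longleftrightarrow> [h ^ k = 1] (mod p)"
      by (metis cong_int_iff of_nat_1 of_nat_power)
    then show ?thesis using ord_divides [of h k p] o by simp
  qed
  moreover have "unit (int h)" using c p_gt_1 coprime_absorb_left [of p h] by auto
  ultimately show ?thesis using that by blast
qed

lemma periodicI: "(\<And>x y. x \<approx> y \<Longrightarrow> f x \<approx> f y) \<Longrightarrow> periodic f"
  by (simp add: periodic_def)

lemma periodicD: "periodic f \<Longrightarrow> x \<approx> y \<Longrightarrow> f x \<approx> f y"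
  by (simp add: periodic_def)

lemma sum_cong: "(\<And>x. x \<in> {0..<int p} \<Longrightarrow> f x \<approx> g x) \<Longrightarrow> residue_sum f \<approx> residue_sum g"
  unfolding residue_sum_def by (rule cong_sum)

lemma sum_cong_nz:
  assumes "\<And>x. unit x \<Longrightarrow> f x \<approx> g x" "f 0 \<approx> g 0"
  shows "residue_sum f \<approx> residue_sum g"
proof (rule sum_cong)
  fix x assume x: "x \<in> {0..<int p}"
  show "f x \<approx> g x"
  proof (cases "x = 0")
    case False
    then have "unit x" using x zdvd_not_zless [of x "int p"] by auto
    then show ?thesis using assms by blast
  qed (use assms in simp)
qed

text \<open>Reduced modulo \<open>p\<close>, an injective map of the finite set of residues into
  itself is a permutation.\<close>

lemma sum_reindex:
  assumes f: "periodic f" and inj: "\<And>x y. \<phi> x \<approx> \<phi> y \<Longrightarrow> x \<approx> y"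
  shows "residue_sum (\<lambda>x. f (\<phi> x)) \<approx> residue_sum f"
proof -
  let ?I = "{0..<int p}"
  let ?h = "\<lambda>x. \<phi> x mod int p"
  have "inj_on ?h ?I"
  proof (rule inj_onI)
    fix x y assume "x \<in> ?I" "y \<in> ?I" "?h x = ?h y"
    moreover from this have "\<phi> x \<approx> \<phi> y" by (simp add: cong_def)
    ultimately show "x = y" using inj [of x y] cong_less_imp_eq_int [of x "int p" y] by simp
  qed
  moreover have sub: "?h ` ?I \<subseteq> ?I" using p_gt_1 by auto
  ultimately have "?h ` ?I = ?I" by (intro card_subset_eq) (auto simp: card_image)
  then have bij: "bij_betw ?h ?I ?I" using \<open>inj_on ?h ?I\<close> by (simp add: bij_betw_def)
  have "residue_sum (\<lambda>x. f (\<phi> x)) \<approx> residue_sum (\<lambda>x. f (?h x))"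
    by (rule sum_cong, rule periodicD [OF f]) simp
  also have "residue_sum (\<lambda>x. f (?h x)) = residue_sum f"
    unfolding residue_sum_def by (rule sum.reindex_bij_betw [OF bij])
  finally show ?thesis .
qed

lemma sum_shift: "periodic f \<Longrightarrow> residue_sum (\<lambda>x. f (x + c)) \<approx> residue_sum f"
  by (rule sum_reindex [where \<phi> = "\<lambda>x. x + c"]) (simp_all add: cong_add_rcancel)

lemma sum_neg: "periodic f \<Longrightarrow> residue_sum (\<lambda>x. f (- x)) \<approx> residue_sum f"
  by (rule sum_reindex [where \<phi> = "\<lambda>x. - x"]) (auto simp: cong_minus_minus_iff)

lemma sum_scale: "periodic f \<Longrightarrow> unit b \<Longrightarrow> residue_sum (\<lambda>x. f (b * x)) \<approx> residue_sum f"
  by (rule sum_reindex [where \<phi> = "\<lambda>x. b * x"]) (auto intro: cancel)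

lemma sum_const: "residue_sum (\<lambda>x. c) \<approx> 0"
  by (simp add: residue_sum_def cong_0_iff)

lemma sum_mult: "residue_sum (\<lambda>x. c * f x) = c * residue_sum f"
  by (simp add: residue_sum_def sum_distrib_left)

lemma sum_mult_right: "residue_sum (\<lambda>x. f x * c) = residue_sum f * c"
  by (simp add: residue_sum_def sum_distrib_right)

lemma sum_add: "residue_sum (\<lambda>x. f x + g x) = residue_sum f + residue_sum g"
  by (simp add: residue_sum_def sum.distrib)

lemma sum_swap: "residue_sum (\<lambda>x. residue_sum (\<lambda>y. f x y)) = residue_sum (\<lambda>y. residue_sum (\<lambda>x. f x y))"
  unfolding residue_sum_def by (rule sum.swap)

lemma sum_sum: "residue_sum (\<lambda>x. \<Sum>i\<in>I. f i x) = (\<Sum>i\<in>I. residue_sum (f i))"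
  unfolding residue_sum_def by (rule sum.swap)

text \<open>The substitution x -> g x with a primitive root g multiplies the sum by
  \<open>g ^ k\<close>, which is not 1.\<close>

lemma sum_power_eq_0:
  assumes "\<not> p - 1 dvd k"
  shows "residue_sum (\<lambda>x. x ^ k) \<approx> 0"
proof -
  obtain g :: int where g: "unit g" "\<And>k. g ^ k \<approx> 1 \<longleftrightarrow> p - 1 dvd k"
    using exists_primitive by metis
  have "residue_sum (\<lambda>x. (g * x) ^ k) \<approx> residue_sum (\<lambda>x. x ^ k)"
    by (rule sum_scale [OF _ g(1)]) (simp add: periodic_def cong_pow)
  then have "g ^ k * residue_sum (\<lambda>x. x ^ k) \<approx> residue_sum (\<lambda>x. x ^ k)"
    by (simp add: power_mult_distrib sum_mult)
  then have "(g ^ k - 1) * residue_sum (\<lambda>x. x ^ k) \<approx> 0"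
    by (rule cong_comb1 [where u = 1]) (simp add: algebra_simps)
  moreover have "\<not> g ^ k - 1 \<approx> 0" using g(2) assms by (simp add: cong_diff_iff_cong_0)
  ultimately show ?thesis using mult_zero by blast
qed

text \<open>Each of the p - 1 units contributes 1 and, as \<open>k > 0\<close>, zero contributes
  nothing.\<close>

lemma sum_power_eq_m1:
  assumes "p - 1 dvd k" "k > 0"
  shows "residue_sum (\<lambda>x. x ^ k) \<approx> - 1"
proof -
  have "x ^ k \<approx> 1" if "unit x" for x
  proof -
    obtain j where j: "k = (p - 1) * j" using assms(1) by blast
    show ?thesis using cong_pow [OF fermat [OF that], of j] by (simp add: j power_mult)
  qed
  then have "residue_sum (\<lambda>x. x ^ k) \<approx> residue_sum (\<lambda>x. 1 + (if x = 0 then - 1 else 0))"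
    using assms(2) unit_one by (intro sum_cong_nz) (auto simp: power_0_left)
  also have "residue_sum (\<lambda>x. 1 + (if x = 0 then - 1 else 0)) = residue_sum (\<lambda>x. 1) - 1"
  proof -
    have "residue_sum (\<lambda>x. if x = 0 then - 1 else 0) = - 1"
      unfolding residue_sum_def by (subst sum.delta) (use p_gt_1 in auto)
    then show ?thesis by (simp only: sum_add)
  qed
  also have "residue_sum (\<lambda>x. 1) - 1 \<approx> 0 - 1" by (intro cong_diff sum_const) simp
  finally show ?thesis by simp
qed

lemma unit_less: "x \<in> {1..<int p} \<Longrightarrow> unit x"
  using zdvd_not_zless [of x "int p"] by auto

lemma unit_mod: "unit x \<Longrightarrow> x mod int p \<in> {1..<int p}"
proof -
  assume u: "unit x"
  have "0 \<le> x mod int p" "x mod int p < int p" using p_gt_1 by simp_all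
  moreover have "x mod int p \<noteq> 0" using u by (simp add: dvd_eq_mod_eq_0)
  ultimately show ?thesis by simp
qed

lemma exists_generator:
  obtains g :: int where "unit g" "\<And>k. g ^ k \<approx> 1 \<longleftrightarrow> p - 1 dvd k"
    "bij_betw (\<lambda>i. g ^ i mod int p) {..<p - 1} {1..<int p}"
proof -
  obtain g :: int where g: "unit g" "\<And>k. g ^ k \<approx> 1 \<longleftrightarrow> p - 1 dvd k"
    using exists_primitive by metis
  have eq: "i = j" if "i \<le> j" "j < p - 1" "g ^ i \<approx> g ^ j" for i j
  proof -
    have "g ^ j = g ^ i * g ^ (j - i)" using that(1) by (simp flip: power_add)
    then have "g ^ i * 1 \<approx> g ^ i * g ^ (j - i)" using that(3) by simp
    then have "1 \<approx> g ^ (j - i)" by (rule cancel [OF unit_power [OF g(1)]])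
    then have "p - 1 dvd j - i" using g(2) by (simp add: cong_sym_eq)
    then show ?thesis using that by (auto dest: dvd_imp_le)
  qed
  have inj: "inj_on (\<lambda>i. g ^ i mod int p) {..<p - 1}"
  proof (rule inj_onI)
    fix i j assume ij: "i \<in> {..<p - 1}" "j \<in> {..<p - 1}" "g ^ i mod int p = g ^ j mod int p"
    then have c: "g ^ i \<approx> g ^ j" by (simp add: cong_def)
    show "i = j"
    proof (cases "i \<le> j")
      case True
      then show ?thesis using eq [of i j] ij c by simp
    next
      case False
      then show ?thesis using eq [of j i] ij cong_sym [OF c] by simp
    qed
  qed
  have "(\<lambda>i. g ^ i mod int p) ` {..<p - 1} \<subseteq> {1..<int p}"
    using unit_mod [OF unit_power [OF g(1)]] by blast
  moreover have "card ((\<lambda>i. g ^ i mod int p) ` {..<p - 1}) = card {1..<int p}"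
    using card_image [OF inj] by simp
  ultimately have "(\<lambda>i. g ^ i mod int p) ` {..<p - 1} = {1..<int p}"
    by (intro card_subset_eq) simp_all
  then have "bij_betw (\<lambda>i. g ^ i mod int p) {..<p - 1} {1..<int p}" using inj by (simp add: bij_betw_def)
  then show ?thesis using that g by blast
qed

lemma square_one: "x ^ 2 \<approx> 1 \<Longrightarrow> x \<approx> 1 \<or> x \<approx> - 1"
proof -
  assume "x ^ 2 \<approx> 1"
  then have "(x - 1) * (x + 1) \<approx> 0"
    by (rule cong_comb1 [where u = 1]) (simp add: algebra_simps power2_eq_square)
  then consider "x - 1 \<approx> 0" | "x + 1 \<approx> 0" using mult_zero by blast
  then show ?thesis
  proof cases
    case 1
    then have "x \<approx> 1" by (rule cong_comb1 [where u = 1]) simp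
    then show ?thesis ..
  next
    case 2
    then have "x \<approx> - 1" by (rule cong_comb1 [where u = 1]) simp
    then show ?thesis ..
  qed
qed

section \<open>Cosets in the multiplicative group modulo p\<close>

definition residues_in :: "int set \<Rightarrow> int set"
  where "residues_in C = {x \<in> {1..<int p}. x \<in> C}"

lemma finite_residues_in: "finite (residues_in C)"
  unfolding residues_in_def by (rule finite_subset [of _ "{1..<int p}"]) (blast, simp)

text \<open>Reduction modulo \<open>p\<close> places the cosets of units inside
  \<open>{1..<int p}\<close>, so that pairwise disjoint cosets bound the number of residues in
  \<open>C\<close>.\<close>

definition coset :: "int \<Rightarrow> int set \<Rightarrow> int set"
  where "coset y C = (\<lambda>c. y * c mod int p) ` residues_in C"

lemma coset_subset: "unit y \<Longrightarrow> coset y C \<subseteq> {1..<int p}"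
proof
  fix z assume y: "unit y" and "z \<in> coset y C"
  then obtain c where c: "c \<in> {1..<int p}" "z = y * c mod int p" unfolding coset_def residues_in_def by blast
  show "z \<in> {1..<int p}" unfolding c(2) by (rule unit_mod) (simp add: unit_mult y unit_less [OF c(1)])
qed

lemma card_coset: "unit y \<Longrightarrow> card (coset y C) = card (residues_in C)"
  unfolding coset_def
proof (rule card_image, rule inj_onI)
  fix c d assume y: "unit y" and c: "c \<in> residues_in C" and d: "d \<in> residues_in C"
    and "y * c mod int p = y * d mod int p"
  then have "y * c \<approx> y * d" by (simp add: cong_def)
  then have "c \<approx> d" by (rule cancel [OF y])
  then show "c = d" using c d cong_less_imp_eq_int [of c "int p" d] unfolding residues_in_def by simp
qed

lemma coset_disjoint:
  assumes "\<And>c d. c \<in> C \<Longrightarrow> d \<in> C \<Longrightarrow> \<not> y * c \<approx> z * d"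
  shows "coset y C \<inter> coset z C = {}"
proof -
  have False if x: "x \<in> coset y C" "x \<in> coset z C" for x
  proof -
    obtain c where c: "c \<in> C" "x = y * c mod int p" using x(1) unfolding coset_def residues_in_def by blast
    obtain d where d: "d \<in> C" "x = z * d mod int p" using x(2) unfolding coset_def residues_in_def by blast
    have "y * c \<approx> z * d" unfolding cong_def using c(2) d(2) by simp
    then show False using assms [OF c(1) d(1)] by simp
  qed
  then show ?thesis by blast
qed

lemma finite_coset: "finite (coset y C)"
  unfolding coset_def by (intro finite_imageI finite_residues_in)

end

section \<open>Power sums of a cocycle\<close>

text \<open>In the application \<open>w\<close> swaps \<open>0\<close> and \<open>\<infinity>\<close>, \<open>W x = w x\<close>, and \<open>\<mu> x\<close> is the slope of
  the affine map that fixes \<open>\<infinity>\<close> and differs from \<open>w\<close> by the chosen representatives of \<open>x\<close> and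
  \<open>w x\<close>. Assumption \<open>chain\<close> is the cocycle identity for \<open>w\<close>.\<close>

locale cocycle_data = prime_modulus +
  fixes W \<mu> :: "int \<Rightarrow> int" and A :: "int set" and e :: nat
  assumes W_cong: "x \<approx> y \<Longrightarrow> W x \<approx> W y"
    and mu_cong: "x \<approx> y \<Longrightarrow> \<mu> x \<approx> \<mu> y"
    and W_unit: "unit x \<Longrightarrow> unit (W x)"
    and W_zero: "W 0 \<approx> 0"
    and mu_zero: "\<mu> 0 \<approx> 0"
    and W_W: "unit x \<Longrightarrow> W (W x) \<approx> x"
    and mu_W: "unit x \<Longrightarrow> \<mu> x * \<mu> (W x) \<approx> 1"
    and chain: "unit x \<Longrightarrow> unit y \<Longrightarrow> \<mu> x * \<mu> (W x + y) \<approx> \<mu> y * \<mu> (x - W (- y))"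
    and diff: "unit x \<Longrightarrow> unit z \<Longrightarrow> \<not> x \<approx> z \<Longrightarrow> W (W x - W z) * \<mu> (W z) \<approx> W (x - z) - W (- z)"
    and mu_scale: "b \<in> A \<Longrightarrow> \<mu> (b * x) \<approx> b ^ 2 * \<mu> x"
    and mu_even: "\<mu> (- x) \<approx> \<mu> x"
    and A_unit: "b \<in> A \<Longrightarrow> unit b"
    and exponent: "(\<forall>b\<in>A. b ^ i \<approx> 1) \<longleftrightarrow> e dvd i"
    and mu_pow: "unit x \<Longrightarrow> \<mu> x ^ e \<approx> 1"
    and e: "odd e" "e > 1" and p_odd: "odd p"
begin

text \<open>Power moments of \<open>\<mu>\<close>. Since \<open>\<mu> 0\<close> vanishes modulo
  \<open>p\<close>, the point that \<open>w\<close> sends to infinity contributes nothing.\<close>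

definition M :: "nat \<Rightarrow> nat \<Rightarrow> int"
  where "M m i = residue_sum (\<lambda>x. \<mu> x * W x ^ m * x ^ i)"

lemmas cong_intros = cong_add cong_diff cong_mult cong_pow cong_uminus W_cong mu_cong cong_refl

lemma zero_cases: "unit x \<or> x \<approx> 0" by (simp add: cong_0_iff)

lemma W_nonunit: "\<not> unit x \<Longrightarrow> W x \<approx> 0"
  using W_cong [of x 0] W_zero zero_cases cong_trans by blast

lemma W_unit_iff: "unit (W x) \<longleftrightarrow> unit x"
  using W_unit [of x] W_nonunit [of x] by (auto simp: cong_0_iff)

text \<open>The default value at 0 makes \<open>W\<close> injective on all residues: it is an
  involution on the units and sends 0 to 0.\<close>

lemma W_inj:
  assumes "W x \<approx> W y"
  shows "x \<approx> y"
proof (cases "unit x")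
  case True
  then have "unit y" using unit_cong [OF assms] by (simp add: W_unit_iff)
  have "x \<approx> W (W x)" using W_W [OF True] cong_sym by blast
  also have "W (W x) \<approx> W (W y)" using assms by (rule W_cong)
  also have "W (W y) \<approx> y" using W_W [OF \<open>unit y\<close>] .
  finally show ?thesis .
next
  case False
  moreover from this have "\<not> unit y" using unit_cong [OF assms] by (simp add: W_unit_iff)
  ultimately have "x \<approx> 0" "y \<approx> 0" using zero_cases by blast+
  then show ?thesis using cong_sym cong_trans by blast
qed

lemma e_dvd: "e dvd p - 1"
  using exponent fermat A_unit by blast

lemma two_e_dvd: "2 * e dvd p - 1"
  using e e_dvd p_odd by (intro divides_mult) (auto simp: coprime_commute)

text \<open>For b in \<open>A\<close> the substitution x -> b x multiplies the moment by
  \<open>b ^ (i + 2)\<close>, so e divides i + 2. The substitution x -> -x, under which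
  \<open>\<mu>\<close> is even, forces i to be even. As e is odd, the two conditions
  combine.\<close>

lemma M0_weight:
  assumes "\<not> M 0 i \<approx> 0"
  shows "2 * e dvd i + 2"
proof -
  have per: "periodic (\<lambda>x. \<mu> x * x ^ i)" by (intro periodicI cong_intros)
  have "e dvd i + 2"
  proof -
    have "b ^ (i + 2) \<approx> 1" if b: "b \<in> A" for b
    proof -
      have "residue_sum (\<lambda>x. b ^ (i + 2) * (\<mu> x * x ^ i)) \<approx> residue_sum (\<lambda>x. \<mu> (b * x) * (b * x) ^ i)"
      proof (rule sum_cong)
        fix x
        have "b ^ 2 * \<mu> x * (b * x) ^ i \<approx> \<mu> (b * x) * (b * x) ^ i"
          using cong_sym [OF mu_scale [OF b]] by (intro cong_mult) auto
        then show "b ^ (i + 2) * (\<mu> x * x ^ i) \<approx> \<mu> (b * x) * (b * x) ^ i"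
          by (simp only: power_add power_mult_distrib mult_ac)
      qed
      also have "residue_sum (\<lambda>x. \<mu> (b * x) * (b * x) ^ i) \<approx> residue_sum (\<lambda>x. \<mu> x * x ^ i)"
        using sum_scale [OF per A_unit [OF b]] .
      finally have "b ^ (i + 2) * M 0 i \<approx> 1 * M 0 i"
        by (simp add: M_def sum_mult)
      then show ?thesis using cancel' assms by (metis cong_0_iff)
    qed
    then show ?thesis using exponent by blast
  qed
  moreover have "even i"
  proof (rule ccontr)
    assume "odd i"
    have "residue_sum (\<lambda>x. - 1 * (\<mu> x * x ^ i)) \<approx> residue_sum (\<lambda>x. \<mu> (- x) * (- x) ^ i)"
    proof (rule sum_cong)
      fix x
      have "\<mu> x * (- x) ^ i \<approx> \<mu> (- x) * (- x) ^ i"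
        using cong_sym [OF mu_even] by (intro cong_mult) auto
      then show "- 1 * (\<mu> x * x ^ i) \<approx> \<mu> (- x) * (- x) ^ i" using \<open>odd i\<close> by simp
    qed
    also have "residue_sum (\<lambda>x. \<mu> (- x) * (- x) ^ i) \<approx> residue_sum (\<lambda>x. \<mu> x * x ^ i)"
      using sum_neg [OF per] .
    finally have "- 1 * M 0 i \<approx> M 0 i" by (subst (asm) sum_mult) (simp add: M_def)
    then have "2 * M 0 i \<approx> 0" by (rule cong_comb1 [where u = "- 1"]) simp
    then have "2 \<approx> 0" using assms mult_zero by blast
    then have "int p dvd int 2" by (simp add: cong_0_iff)
    then have "p dvd 2" by presburger
    then have "p = 2" using p_gt_1 by (auto dest: dvd_imp_le)
    then show False using p_odd by simp
  qed
  ultimately show ?thesis using e by (intro divides_mult) (auto simp: coprime_commute)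
qed

lemma M00: "M 0 0 \<approx> 0"
proof (rule ccontr)
  assume "\<not> M 0 0 \<approx> 0"
  then have "2 * e dvd 0 + 2" by (rule M0_weight)
  then have "2 * e \<le> 2" by (auto dest: dvd_imp_le)
  then show False using e by simp
qed

lemma M0_last: "M 0 (p - 1) \<approx> 0"
proof -
  have "M 0 (p - 1) \<approx> M 0 0"
    unfolding M_def
  proof (rule sum_cong_nz)
    fix x assume "unit x"
    from fermat [OF this] show "\<mu> x * W x ^ 0 * x ^ (p - 1) \<approx> \<mu> x * W x ^ 0 * x ^ 0"
      by (intro cong_mult) auto
  next
    show "\<mu> 0 * W 0 ^ 0 * 0 ^ (p - 1) \<approx> \<mu> 0 * W 0 ^ 0 * 0 ^ 0"
      using mu_zero p_gt_1 by (simp add: power_0_left cong_sym_eq)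
  qed
  then show ?thesis using M00 cong_trans by blast
qed

text \<open>Interpolation: the indicator function of \<open>c\<close> is \<open>1 - (x - c) ^ (p - 1)\<close>.\<close>

lemma mu_expand:
  assumes c: "unit c"
  shows "\<mu> c \<approx> M 0 0 - (\<Sum>j\<le>p - 1. of_nat ((p - 1) choose j) * (- c) ^ (p - 1 - j) * M 0 j)"
proof -
  have "residue_sum (\<lambda>x. \<mu> x * (1 - (x + - c) ^ (p - 1)))
      \<approx> residue_sum (\<lambda>x. if x = c mod int p then \<mu> c else 0)"
  proof (rule sum_cong)
    fix x assume x: "x \<in> {0..<int p}"
    show "\<mu> x * (1 - (x + - c) ^ (p - 1)) \<approx> (if x = c mod int p then \<mu> c else 0)"
    proof (cases "x = c mod int p")
      case True
      then have "x \<approx> c" by (simp add: cong_def)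
      then have "x + - c \<approx> 0" by (auto simp: cong_iff_dvd_diff)
      then have "(x + - c) ^ (p - 1) \<approx> 0 ^ (p - 1)" by (rule cong_pow)
      then have "\<mu> x * (1 - (x + - c) ^ (p - 1)) \<approx> \<mu> c * (1 - 0 ^ (p - 1))"
        using \<open>x \<approx> c\<close> by (intro cong_mult cong_diff mu_cong cong_refl)
      then show ?thesis unfolding if_P [OF True] using p_gt_1 by (simp add: power_0_left)
    next
      case False
      have "unit (x + - c)"
      proof
        assume "int p dvd x + - c"
        then have "x \<approx> c" by (simp add: cong_iff_dvd_diff)
        then show False using False x by (simp add: cong_def)
      qed
      then have "(x + - c) ^ (p - 1) \<approx> 1" by (rule fermat)
      then have "\<mu> x * (1 - (x + - c) ^ (p - 1)) \<approx> \<mu> x * (1 - 1)"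
        by (intro cong_mult cong_diff cong_refl)
      then show ?thesis using False by simp
    qed
  qed
  also have "residue_sum (\<lambda>x. if x = c mod int p then \<mu> c else 0) = \<mu> c"
    using p_gt_1 by (simp add: residue_sum_def)
  finally have "\<mu> c \<approx> residue_sum (\<lambda>x. \<mu> x * (1 - (x + - c) ^ (p - 1)))" by (rule cong_sym)
  also have "(\<lambda>x. \<mu> x * (1 - (x + - c) ^ (p - 1)))
      = (\<lambda>x. \<mu> x + - 1 * (\<Sum>j\<le>p - 1. of_nat ((p - 1) choose j) * (- c) ^ (p - 1 - j) * (\<mu> x * x ^ j)))"
  proof
    fix x
    show "\<mu> x * (1 - (x + - c) ^ (p - 1))
      = \<mu> x + - 1 * (\<Sum>j\<le>p - 1. of_nat ((p - 1) choose j) * (- c) ^ (p - 1 - j) * (\<mu> x * x ^ j))"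
      unfolding binomial_ring by (simp add: right_diff_distrib sum_distrib_left sum_negf mult_ac)
  qed
  also have "residue_sum (\<lambda>x. \<mu> x + - 1 * (\<Sum>j\<le>p - 1. of_nat ((p - 1) choose j) * (- c) ^ (p - 1 - j) * (\<mu> x * x ^ j)))
      = M 0 0 - (\<Sum>j\<le>p - 1. of_nat ((p - 1) choose j) * (- c) ^ (p - 1 - j) * M 0 j)"
    unfolding sum_add sum_mult sum_sum by (simp add: M_def)
  finally show ?thesis .
qed

text \<open>By \<open>mu_expand\<close> the moment \<open>M 0 j\<close> controls the coefficient of
  \<open>c ^ (p - 1 - j)\<close>, so p - 1 - K is the degree of \<open>\<mu>\<close> as a polynomial
  function. The aim is K = p - 3.\<close>

definition K :: nat where "K = (LEAST i. \<not> M 0 i \<approx> 0)"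

text \<open>By \<open>mu_expand\<close>, vanishing of all moments would make \<open>\<mu> 1\<close>
  vanish, but it is invertible by \<open>mu_W\<close>.\<close>

lemma K_exists: "\<exists>i. \<not> M 0 i \<approx> 0"
proof (rule ccontr)
  assume "\<nexists>i. \<not> M 0 i \<approx> 0"
  then have z: "M 0 j \<approx> 0" for j by blast
  have "\<mu> 1 \<approx> M 0 0 - (\<Sum>j\<le>p - 1. of_nat ((p - 1) choose j) * (- 1) ^ (p - 1 - j) * M 0 j)"
    by (rule mu_expand [OF unit_one])
  also have "M 0 0 - (\<Sum>j\<le>p - 1. of_nat ((p - 1) choose j) * (- 1) ^ (p - 1 - j) * M 0 j)
     \<approx> 0 - (\<Sum>j\<le>p - 1. of_nat ((p - 1) choose j) * (- 1) ^ (p - 1 - j) * 0)"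
    by (intro cong_diff cong_sum cong_mult cong_refl z)
  finally have "\<mu> 1 \<approx> 0" by simp
  then have "\<mu> 1 * \<mu> (W 1) \<approx> 0 * \<mu> (W 1)" by (intro cong_mult cong_refl)
  then have "1 \<approx> 0" using mu_W [OF unit_one] cong_sym cong_trans by (metis mult_zero_left)
  then show False using unit_one by (simp add: cong_0_iff)
qed

lemma M_K: "\<not> M 0 K \<approx> 0"
  unfolding K_def using K_exists by (rule LeastI_ex)

lemma M_less_K: "i < K \<Longrightarrow> M 0 i \<approx> 0"
  unfolding K_def using not_less_Least by blast

lemma K_dvd: "2 * e dvd K + 2"
  using M0_weight [OF M_K] .

lemma K_pos: "K \<ge> 2 * e - 2" "K > e"
proof -
  have "2 * e \<le> K + 2" using K_dvd by (rule dvd_imp_le) simp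
  then show "K \<ge> 2 * e - 2" by simp
  have "e \<ge> 3" using e by presburger
  then show "K > e" using \<open>2 * e \<le> K + 2\<close> by linarith
qed

text \<open>The argument of \<open>K_exists\<close> needs only the moments up to p - 1, and the last
  of them is zero anyway; hence K < p - 1. Both numbers are even, which improves the bound by
  one.\<close>

lemma K_le: "K + 2 \<le> p - 1"
proof -
  have "K < p - 1"
  proof (rule ccontr)
    assume a: "\<not> K < p - 1"
    then have z: "M 0 j \<approx> 0" if "j \<le> p - 1" for j
      using M_less_K [of j] M0_last that by (cases "j = p - 1") auto
    have "\<mu> 1 \<approx> M 0 0 - (\<Sum>j\<le>p - 1. of_nat ((p - 1) choose j) * (- 1) ^ (p - 1 - j) * M 0 j)"
      by (rule mu_expand [OF unit_one])
    also have "M 0 0 - (\<Sum>j\<le>p - 1. of_nat ((p - 1) choose j) * (- 1) ^ (p - 1 - j) * M 0 j)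
       \<approx> 0 - (\<Sum>j\<le>p - 1. of_nat ((p - 1) choose j) * (- 1) ^ (p - 1 - j) * 0)"
      by (intro cong_diff cong_sum cong_mult cong_refl z) auto
    finally have "\<mu> 1 \<approx> 0" by simp
    then have "\<mu> 1 * \<mu> (W 1) \<approx> 0 * \<mu> (W 1)" by (intro cong_mult cong_refl)
    then have "1 \<approx> 0" using mu_W [OF unit_one] cong_sym cong_trans by (metis mult_zero_left)
    then show False using unit_one by (simp add: cong_0_iff)
  qed
  moreover have "even K" using K_dvd by (metis dvd_add_left_iff dvd_mult_left even_numeral even_add)
  moreover have "even (p - 1)" using p_odd by simp
  ultimately show ?thesis by (elim evenE) simp
qed

text \<open>For units x and y, \<open>chain\<close> replaces the two values of \<open>\<mu>\<close>
  by \<open>\<mu> y\<close> times a translate of \<open>\<mu>\<close>; translating back and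
  expanding \<open>(x + v) ^ i\<close> leaves moments of order at most i < K. The identity excludes
  x = 0, where its right side would contribute \<open>0 ^ i\<close>: this is the origin of the -1.
  For y = 0 the sum is a power sum over the units.\<close>

lemma moment_zero_step:
  assumes i: "i < K"
  shows "residue_sum (\<lambda>x. \<mu> x * x ^ i * \<mu> (W x + y)) \<approx> (if i = 0 then - 1 else 0)"
proof (cases "unit y")
  case True
  define v where "v = W (- y)"
  have v: "\<mu> y * \<mu> (- v) \<approx> 1"
  proof -
    have "\<mu> y * \<mu> (- v) \<approx> \<mu> (- y) * \<mu> v"
      using mu_even cong_sym by (intro cong_mult) blast+
    also have "\<mu> (- y) * \<mu> v \<approx> 1" unfolding v_def by (rule mu_W) (simp add: True)
    finally show ?thesis .
  qed
  have "residue_sum (\<lambda>x. \<mu> x * x ^ i * \<mu> (W x + y))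
      \<approx> residue_sum (\<lambda>x. \<mu> y * (\<mu> (x - v) * x ^ i) + (if x = 0 then - (0 ^ i) else 0))"
  proof (rule sum_cong_nz)
    fix x assume x: "unit x"
    have "\<mu> x * \<mu> (W x + y) * x ^ i \<approx> \<mu> y * \<mu> (x - v) * x ^ i"
      unfolding v_def by (intro cong_mult chain x True cong_refl)
    then show "\<mu> x * x ^ i * \<mu> (W x + y) \<approx> \<mu> y * (\<mu> (x - v) * x ^ i) + (if x = 0 then - (0 ^ i) else 0)"
      using x by (auto simp: mult_ac)
  next
    have "\<mu> 0 * (0 ^ i * \<mu> (W 0 + y)) \<approx> 0 * (0 ^ i * \<mu> (W 0 + y))"
      by (intro cong_mult mu_zero cong_refl)
    moreover have "(\<mu> y * \<mu> (- v)) * 0 ^ i - 0 ^ i \<approx> 1 * 0 ^ i - 0 ^ i"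
      by (intro cong_diff cong_mult v cong_refl)
    ultimately show "\<mu> 0 * 0 ^ i * \<mu> (W 0 + y) \<approx> \<mu> y * (\<mu> (0 - v) * 0 ^ i) + (if (0::int) = 0 then - (0 ^ i) else 0)"
      by (simp add: mult_ac) (metis cong_sym cong_trans)
  qed
  also have "residue_sum (\<lambda>x. \<mu> y * (\<mu> (x - v) * x ^ i) + (if x = 0 then - (0 ^ i) else 0))
      = \<mu> y * residue_sum (\<lambda>x. \<mu> (x - v) * x ^ i) - 0 ^ i"
  proof -
    have "residue_sum (\<lambda>x. if x = 0 then - (0 ^ i) else 0) = - (0 ^ i)"
      unfolding residue_sum_def by (subst sum.delta) (use p_gt_1 in auto)
    then show ?thesis by (simp only: sum_add sum_mult)
  qed
  also have "\<mu> y * residue_sum (\<lambda>x. \<mu> (x - v) * x ^ i) - 0 ^ i \<approx> \<mu> y * 0 - 0 ^ i"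
  proof (intro cong_diff cong_mult cong_refl)
    have "residue_sum (\<lambda>x. \<mu> (x - v) * x ^ i) \<approx> residue_sum (\<lambda>x. \<mu> (x + v - v) * (x + v) ^ i)"
      by (rule cong_sym, rule sum_shift [where f = "\<lambda>x. \<mu> (x - v) * x ^ i"])
        (intro periodicI cong_mult cong_pow mu_cong cong_diff cong_refl)
    also have "residue_sum (\<lambda>x. \<mu> (x + v - v) * (x + v) ^ i)
        = residue_sum (\<lambda>x. \<Sum>j\<le>i. of_nat (i choose j) * v ^ (i - j) * (\<mu> x * x ^ j))"
      unfolding binomial_ring by (simp add: sum_distrib_left mult_ac)
    also have "residue_sum (\<lambda>x. \<Sum>j\<le>i. of_nat (i choose j) * v ^ (i - j) * (\<mu> x * x ^ j))
        = (\<Sum>j\<le>i. of_nat (i choose j) * v ^ (i - j) * M 0 j)"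
      unfolding sum_sum sum_mult by (simp add: M_def)
    also have "(\<Sum>j\<le>i. of_nat (i choose j) * v ^ (i - j) * M 0 j)
        \<approx> (\<Sum>j\<le>i. of_nat (i choose j) * v ^ (i - j) * 0)"
      using i by (intro cong_sum cong_mult cong_refl M_less_K) auto
    finally show "residue_sum (\<lambda>x. \<mu> (x - v) * x ^ i) \<approx> 0" by simp
  qed
  finally show ?thesis by (auto simp: power_0_left)
next
  case False
  have "residue_sum (\<lambda>x. \<mu> x * x ^ i * \<mu> (W x + y))
      \<approx> residue_sum (\<lambda>x. x ^ i + (if x = 0 then - (0 ^ i) else 0))"
  proof (rule sum_cong_nz)
    fix x assume x: "unit x"
    have "W x + y \<approx> W x + 0" using False by (intro cong_add cong_refl) (simp add: cong_0_iff)
    then have "\<mu> x * x ^ i * \<mu> (W x + y) \<approx> \<mu> x * x ^ i * \<mu> (W x + 0)"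
      by (intro cong_mult mu_cong cong_refl)
    also have "\<mu> x * x ^ i * \<mu> (W x + 0) = \<mu> x * \<mu> (W x) * x ^ i" by simp
    also have "\<mu> x * \<mu> (W x) * x ^ i \<approx> 1 * x ^ i" by (intro cong_mult mu_W x cong_refl)
    finally show "\<mu> x * x ^ i * \<mu> (W x + y) \<approx> x ^ i + (if x = 0 then - (0 ^ i) else 0)"
      using x by auto
  next
    have "\<mu> 0 * (0 ^ i * \<mu> (W 0 + y)) \<approx> 0 * (0 ^ i * \<mu> (W 0 + y))"
      by (intro cong_mult mu_zero cong_refl)
    then show "\<mu> 0 * 0 ^ i * \<mu> (W 0 + y) \<approx> 0 ^ i + (if (0::int) = 0 then - (0 ^ i) else 0)"
      by (simp add: mult_ac)
  qed
  also have "residue_sum (\<lambda>x. x ^ i + (if x = 0 then - (0 ^ i) else 0)) = residue_sum (\<lambda>x. x ^ i) - 0 ^ i"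
  proof -
    have "residue_sum (\<lambda>x. if x = 0 then - (0 ^ i) else 0) = - (0 ^ i)"
      unfolding residue_sum_def by (subst sum.delta) (use p_gt_1 in auto)
    then show ?thesis by (simp only: sum_add)
  qed
  also have "residue_sum (\<lambda>x. x ^ i) - 0 ^ i \<approx> 0 - 0 ^ i"
  proof (intro cong_diff cong_refl)
    show "residue_sum (\<lambda>x. x ^ i) \<approx> 0"
    proof (cases "i = 0")
      case True
      then show ?thesis using sum_const by simp
    next
      case False
      then have "\<not> p - 1 dvd i" using i K_le by (auto dest: dvd_imp_le)
      then show ?thesis by (rule sum_power_eq_0)
    qed
  qed
  finally show ?thesis by (auto simp: power_0_left)
qed

text \<open>The double sum \<open>?S\<close> is evaluated in both orders. Summing over x first gives
  0 by \<open>moment_zero_step\<close>, because K + m is no multiple of p - 1. Summing over y first,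
  after the shift by \<open>W x\<close>, gives products of \<open>M 0 j\<close> and
  \<open>M (K + m - j) i\<close>: those with j < K vanish by minimality, those with j > K by
  induction, and j = K leaves a unit times \<open>M m i\<close>.\<close>

lemma moment_zero: "K + m < p - 1 \<Longrightarrow> i < K \<Longrightarrow> M m i \<approx> 0"
proof (induction m rule: less_induct)
  case (less m)
  let ?n = "K + m"
  let ?c = "\<lambda>j. of_nat (?n choose j) * (- 1) ^ (?n - j) * M 0 j"
  let ?S = "residue_sum (\<lambda>y. residue_sum (\<lambda>x. y ^ ?n * (\<mu> x * x ^ i * \<mu> (W x + y))))"
  have S0: "?S \<approx> 0"
  proof -
    have "residue_sum (\<lambda>y. y ^ ?n * residue_sum (\<lambda>x. \<mu> x * x ^ i * \<mu> (W x + y)))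
        \<approx> residue_sum (\<lambda>y. y ^ ?n * (if i = 0 then - 1 else 0))"
      by (intro sum_cong cong_mult cong_refl moment_zero_step less.prems)
    also have "residue_sum (\<lambda>y. y ^ ?n * (if i = 0 then - 1 else 0))
        = residue_sum (\<lambda>y. y ^ ?n) * (if i = 0 then - 1 else 0)"
      by (simp only: sum_mult_right)
    also have "residue_sum (\<lambda>y. y ^ ?n) * (if i = 0 then - 1 else 0) \<approx> 0 * (if i = 0 then - 1 else 0)"
      using less.prems by (intro cong_mult cong_refl sum_power_eq_0) (auto dest: dvd_imp_le)
    finally show ?thesis by (simp only: sum_mult mult_zero_left)
  qed
  have "?S \<approx> (\<Sum>j\<le>?n. ?c j * M (?n - j) i)"
  proof -
    have S: "?S = residue_sum (\<lambda>x. \<mu> x * x ^ i * residue_sum (\<lambda>y. y ^ ?n * \<mu> (W x + y)))"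
      by (subst sum_swap) (simp only: mult_ac flip: sum_mult)
    have "residue_sum (\<lambda>x. \<mu> x * x ^ i * residue_sum (\<lambda>y. y ^ ?n * \<mu> (W x + y)))
        \<approx> residue_sum (\<lambda>x. \<mu> x * x ^ i * (\<Sum>j\<le>?n. ?c j * W x ^ (?n - j)))"
    proof (intro sum_cong cong_mult cong_refl)
      fix x
      have "residue_sum (\<lambda>y. y ^ ?n * \<mu> (W x + y)) = residue_sum (\<lambda>y. (y + W x + - W x) ^ ?n * \<mu> (y + W x))"
        by (simp add: add.commute)
      also have "residue_sum (\<lambda>y. (y + W x + - W x) ^ ?n * \<mu> (y + W x))
          \<approx> residue_sum (\<lambda>y. (y + - W x) ^ ?n * \<mu> y)"
        by (rule sum_shift [where f = "\<lambda>y. (y + - W x) ^ ?n * \<mu> y"])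
          (intro periodicI cong_mult cong_pow cong_add mu_cong cong_refl)
      also have "residue_sum (\<lambda>y. (y + - W x) ^ ?n * \<mu> y)
          = residue_sum (\<lambda>y. \<Sum>j\<le>?n. of_nat (?n choose j) * (- W x) ^ (?n - j) * (\<mu> y * y ^ j))"
        unfolding binomial_ring by (simp add: sum_distrib_left mult_ac)
      also have "residue_sum (\<lambda>y. \<Sum>j\<le>?n. of_nat (?n choose j) * (- W x) ^ (?n - j) * (\<mu> y * y ^ j))
          = (\<Sum>j\<le>?n. of_nat (?n choose j) * (- W x) ^ (?n - j) * M 0 j)"
        unfolding sum_sum sum_mult by (simp add: M_def)
      also have "(\<Sum>j\<le>?n. of_nat (?n choose j) * (- W x) ^ (?n - j) * M 0 j)
          = (\<Sum>j\<le>?n. ?c j * W x ^ (?n - j))"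
        by (intro sum.cong refl) (simp add: power_minus [of "W x"] mult_ac)
      finally show "residue_sum (\<lambda>y. y ^ ?n * \<mu> (W x + y)) \<approx> (\<Sum>j\<le>?n. ?c j * W x ^ (?n - j))" .
    qed
    also have "residue_sum (\<lambda>x. \<mu> x * x ^ i * (\<Sum>j\<le>?n. ?c j * W x ^ (?n - j)))
        = residue_sum (\<lambda>x. \<Sum>j\<le>?n. ?c j * (\<mu> x * W x ^ (?n - j) * x ^ i))"
      by (simp add: sum_distrib_left mult_ac)
    also have "residue_sum (\<lambda>x. \<Sum>j\<le>?n. ?c j * (\<mu> x * W x ^ (?n - j) * x ^ i))
        = (\<Sum>j\<le>?n. ?c j * M (?n - j) i)"
      unfolding sum_sum sum_mult by (simp only: M_def)
    finally show ?thesis unfolding S .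
  qed
  also have "(\<Sum>j\<le>?n. ?c j * M (?n - j) i) \<approx> (\<Sum>j\<le>?n. if j = K then ?c K * M m i else 0)"
  proof (rule cong_sum)
    fix j assume j: "j \<in> {..?n}"
    consider "j < K" | "j = K" | "j > K" by linarith
    then show "?c j * M (?n - j) i \<approx> (if j = K then ?c K * M m i else 0)"
    proof cases
      case 1
      then have "?c j * M (?n - j) i \<approx> of_nat (?n choose j) * (- 1) ^ (?n - j) * 0 * M (?n - j) i"
        by (intro cong_mult cong_refl M_less_K)
      then show ?thesis using 1 by simp
    next
      case 2
      then show ?thesis by simp
    next
      case 3
      then have "?c j * M (?n - j) i \<approx> ?c j * 0"
        using j less.prems by (intro cong_mult cong_refl less.IH) auto
      then show ?thesis using 3 by simp
    qed
  qed
  also have "(\<Sum>j\<le>?n. if j = K then ?c K * M m i else 0) = ?c K * M m i" by simp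
  finally have "?S \<approx> ?c K * M m i" .
  then have z: "?c K * M m i \<approx> 0" using S0 by (blast intro: cong_sym cong_trans)
  \<comment> \<open>The binomial coefficient divides the factorial of a number below
    \<open>p\<close>.\<close>
  have "\<not> p dvd (?n choose K)"
  proof
    assume "p dvd (?n choose K)"
    then have "p dvd fact ?n" using binomial_fact_lemma [of K ?n] by (metis dvd_mult le_add1)
    then show False using less.prems p_prime by (simp add: prime_dvd_fact_iff)
  qed
  then have "unit (of_nat (?n choose K))" by simp
  moreover have "unit (- 1)" using unit_one by simp
  ultimately have "unit (?c K)" using M_K unit_power by (simp only: unit_mult cong_0_iff simp_thms)
  then show "M m i \<approx> 0" using z mult_zero cong_0_iff by blast
qed

text \<open>An autocorrelation of \<open>\<mu>\<close>: what remains of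
  \<open>\<mu> x * M n 0\<close> once \<open>x ^ n\<close> is split off.\<close>

definition Q :: "nat \<Rightarrow> int \<Rightarrow> int"
  where "Q n x = residue_sum (\<lambda>z. \<mu> z * \<mu> (x + z) * (W (x + z) - W z) ^ n)"

text \<open>The sum \<open>M n 0\<close> is reindexed by the permutation z ->
  \<open>W x - W z\<close>. For units z, \<open>chain\<close> and \<open>diff\<close> turn the
  summand into that of \<open>Q\<close> at -z; the summand at z = 0 is \<open>x ^ n\<close>.\<close>

lemma invariant_kernel:
  assumes x: "unit x" and n: "n > 0" "e dvd n - 2" "n \<ge> 2"
  shows "x ^ n + Q n x \<approx> \<mu> x * M n 0"
proof -
  let ?f = "\<lambda>y. \<mu> y * W y ^ n"
  let ?g = "\<lambda>z. \<mu> (- z) * \<mu> (x - z) * (W (x - z) - W (- z)) ^ n"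
  have f: "periodic ?f" by (intro periodicI cong_mult cong_pow mu_cong W_cong)
  have "residue_sum ?f \<approx> residue_sum (\<lambda>z. ?f (W x - W z))"
  proof (rule cong_sym, rule sum_reindex [OF f])
    fix z y assume "W x - W z \<approx> W x - W y"
    then have "W z \<approx> W y" by (rule cong_comb1 [where u = "- 1"]) simp
    then show "z \<approx> y" by (rule W_inj)
  qed
  then have "\<mu> x * residue_sum ?f \<approx> \<mu> x * residue_sum (\<lambda>z. ?f (W x - W z))"
    by (intro cong_mult cong_refl)
  also have "\<mu> x * residue_sum (\<lambda>z. ?f (W x - W z)) = residue_sum (\<lambda>z. \<mu> x * ?f (W x - W z))"
    by (rule sum_mult [symmetric])
  also have "residue_sum (\<lambda>z. \<mu> x * ?f (W x - W z))
      \<approx> residue_sum (\<lambda>z. ?g z + (if z = 0 then x ^ n else 0))"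
  proof (rule sum_cong_nz)
    fix z assume z: "unit z"
    have "\<mu> x * ?f (W x - W z) \<approx> ?g z"
    proof (cases "x \<approx> z")
      case True
      have "\<mu> (W x - W z) \<approx> \<mu> (W z - W z)" by (intro mu_cong cong_diff W_cong True cong_refl)
      then have 1: "\<mu> (W x - W z) \<approx> 0" using mu_zero cong_trans by simp
      have "\<mu> (x - z) \<approx> \<mu> (z - z)" by (intro mu_cong cong_diff True cong_refl)
      then have 2: "\<mu> (x - z) \<approx> 0" using mu_zero cong_trans by simp
      have "\<mu> x * ?f (W x - W z) \<approx> \<mu> x * (0 * W (W x - W z) ^ n)"
        by (intro cong_mult cong_refl 1)
      also have "\<mu> x * (0 * W (W x - W z) ^ n) = \<mu> (- z) * 0 * (W (x - z) - W (- z)) ^ n" by simp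
      also have "\<mu> (- z) * 0 * (W (x - z) - W (- z)) ^ n \<approx> ?g z"
        by (intro cong_mult cong_refl cong_sym [OF 2])
      finally show ?thesis .
    next
      case False
      let ?a = "\<mu> (W z)" and ?u = "W (W x - W z)"
      have Wz: "unit (W z)" using z by (rule W_unit)
      have "?g z \<approx> \<mu> z * \<mu> (x - z) * (?u * ?a) ^ n"
        by (intro cong_mult cong_pow cong_refl mu_even cong_sym [OF diff] x z False)
      \<comment> \<open>Of the n factors \<open>?a\<close>, one cancels \<open>\<mu> z\<close>, one
        is needed to apply \<open>chain\<close>, and the remaining n - 2 have product 1 because e
        divides n - 2.\<close>
      also have "\<mu> z * \<mu> (x - z) * (?u * ?a) ^ n = (\<mu> z * ?a) * (?a * (?a ^ (n - 2) * \<mu> (x - z))) * ?u ^ n"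
      proof -
        have "n = 2 + (n - 2)" using n(3) by simp
        then have "?a ^ n = ?a ^ (2 + (n - 2))" by (rule arg_cong)
        then have "?a ^ n = ?a * ?a * ?a ^ (n - 2)" by (simp only: power_add power2_eq_square)
        then show ?thesis by (simp add: power_mult_distrib)
      qed
      also have "(\<mu> z * ?a) * (?a * (?a ^ (n - 2) * \<mu> (x - z))) * ?u ^ n
          \<approx> 1 * (?a * (1 * \<mu> (x - z))) * ?u ^ n"
      proof (intro cong_mult cong_refl mu_W z)
        obtain k where "n - 2 = e * k" using n(2) by blast
        then show "?a ^ (n - 2) \<approx> 1"
          using cong_pow [OF mu_pow [OF Wz], of k] by (simp add: power_mult)
      qed
      also have "1 * (?a * (1 * \<mu> (x - z))) * ?u ^ n = ?a * \<mu> (x - z) * ?u ^ n" by simp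
      also have "?a * \<mu> (x - z) * ?u ^ n \<approx> \<mu> (- W z) * \<mu> (x - W (- (- W z))) * ?u ^ n"
        using W_W [OF z] by (intro cong_mult cong_refl cong_sym [OF mu_even] mu_cong cong_diff) (simp add: cong_sym_eq)
      also have "\<mu> (- W z) * \<mu> (x - W (- (- W z))) * ?u ^ n \<approx> \<mu> x * \<mu> (W x + - W z) * ?u ^ n"
        using Wz by (intro cong_mult cong_refl cong_sym [OF chain] x) simp
      finally have "?g z \<approx> \<mu> x * ?f (W x - W z)" by (simp add: mult_ac)
      then show ?thesis by (rule cong_sym)
    qed
    then show "\<mu> x * ?f (W x - W z) \<approx> ?g z + (if z = 0 then x ^ n else 0)" using z by auto
  next
    have W0: "W x - W 0 \<approx> W x - 0" by (intro cong_diff cong_refl W_zero)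
    have "\<mu> x * ?f (W x - W 0) \<approx> \<mu> x * (\<mu> (W x - 0) * W (W x - 0) ^ n)"
      by (intro cong_mult cong_pow mu_cong W_cong W0 cong_refl)
    also have "\<mu> x * (\<mu> (W x - 0) * W (W x - 0) ^ n) = \<mu> x * \<mu> (W x) * W (W x) ^ n" by simp
    also have "\<mu> x * \<mu> (W x) * W (W x) ^ n \<approx> 1 * x ^ n"
      by (intro cong_mult cong_pow mu_W W_W x)
    finally have 1: "\<mu> x * ?f (W x - W 0) \<approx> x ^ n" by simp
    have "?g 0 \<approx> 0 * \<mu> (x - 0) * (W (x - 0) - W (- 0)) ^ n"
      using mu_zero by (intro cong_mult cong_refl) simp
    then have "?g 0 + x ^ n \<approx> 0 + x ^ n" by (intro cong_add cong_refl) simp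
    then have "x ^ n \<approx> ?g 0 + x ^ n" by (simp only: cong_sym_eq add_0)
    from cong_trans [OF 1 this]
    show "\<mu> x * ?f (W x - W 0) \<approx> ?g 0 + (if (0::int) = 0 then x ^ n else 0)"
      by (simp only: if_True refl)
  qed
  also have "residue_sum (\<lambda>z. ?g z + (if z = 0 then x ^ n else 0)) = residue_sum ?g + x ^ n"
  proof -
    have "residue_sum (\<lambda>z. if z = 0 then x ^ n else 0) = x ^ n"
      unfolding residue_sum_def by (subst sum.delta) (use p_gt_1 in auto)
    then show ?thesis by (simp only: sum_add)
  qed
  also have "residue_sum ?g + x ^ n \<approx> Q n x + x ^ n"
  proof (intro cong_add cong_refl)
    have "periodic (\<lambda>z. \<mu> z * \<mu> (x + z) * (W (x + z) - W z) ^ n)"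
      by (intro periodicI cong_mult cong_pow cong_diff mu_cong W_cong cong_add cong_refl)
    from sum_neg [OF this] show "residue_sum ?g \<approx> Q n x" unfolding Q_def by simp
  qed
  finally have "\<mu> x * residue_sum ?f \<approx> x ^ n + Q n x" by (simp only: add.commute)
  then show ?thesis by (simp add: M_def cong_sym_eq)
qed

text \<open>Expanding both powers after a shift of x gives products
  \<open>M (n - a) (k - b) * M a b\<close>. As k < 2 K, one of b and k - b is less than K, and
  \<open>moment_zero\<close> kills the corresponding factor.\<close>

lemma Q_moment_zero:
  assumes nK: "n + K < p - 1" and k: "k < 2 * K"
  shows "residue_sum (\<lambda>x. x ^ k * Q n x) \<approx> 0"
proof -
  let ?c = "\<lambda>a b. of_nat (n choose a) * (- 1) ^ (n - a) * (of_nat (k choose b) * (- 1) ^ (k - b)) :: int"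
  have "residue_sum (\<lambda>x. x ^ k * Q n x)
      = residue_sum (\<lambda>z. residue_sum (\<lambda>x. x ^ k * (\<mu> z * \<mu> (x + z) * (W (x + z) - W z) ^ n)))"
    unfolding Q_def by (subst sum_swap) (simp only: sum_mult)
  also have "residue_sum (\<lambda>z. residue_sum (\<lambda>x. x ^ k * (\<mu> z * \<mu> (x + z) * (W (x + z) - W z) ^ n)))
      \<approx> residue_sum (\<lambda>z. residue_sum (\<lambda>x. (x + - z) ^ k * (\<mu> z * \<mu> x * (W x + - W z) ^ n)))"
  proof (rule sum_cong)
    fix z
    have "periodic (\<lambda>x. (x + - z) ^ k * (\<mu> z * \<mu> x * (W x + - W z) ^ n))"
      by (intro periodicI cong_mult cong_pow cong_add mu_cong W_cong cong_refl)
    from sum_shift [OF this, of z]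
    show "residue_sum (\<lambda>x. x ^ k * (\<mu> z * \<mu> (x + z) * (W (x + z) - W z) ^ n))
      \<approx> residue_sum (\<lambda>x. (x + - z) ^ k * (\<mu> z * \<mu> x * (W x + - W z) ^ n))"
      by simp
  qed
  also have "residue_sum (\<lambda>z. residue_sum (\<lambda>x. (x + - z) ^ k * (\<mu> z * \<mu> x * (W x + - W z) ^ n)))
      = residue_sum (\<lambda>z. residue_sum (\<lambda>x. \<Sum>a\<le>n. \<Sum>b\<le>k.
          ?c a b * (\<mu> z * W z ^ (n - a) * z ^ (k - b)) * (\<mu> x * W x ^ a * x ^ b)))"
  proof -
    have "(x + - z) ^ k * (\<mu> z * \<mu> x * (W x + - W z) ^ n) = (\<Sum>a\<le>n. \<Sum>b\<le>k.
          ?c a b * (\<mu> z * W z ^ (n - a) * z ^ (k - b)) * (\<mu> x * W x ^ a * x ^ b))" for x z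
    proof -
      have "(x + - z) ^ k * (\<mu> z * \<mu> x * (W x + - W z) ^ n)
          = (W x + - W z) ^ n * ((x + - z) ^ k * (\<mu> z * \<mu> x))" by (simp only: mult_ac)
      also have "\<dots> = (\<Sum>a\<le>n. \<Sum>b\<le>k. of_nat (n choose a) * W x ^ a * (- W z) ^ (n - a) *
          (of_nat (k choose b) * x ^ b * (- z) ^ (k - b) * (\<mu> z * \<mu> x)))"
        unfolding binomial_ring by (simp only: sum_distrib_right sum_distrib_left)
          (rule sum.swap)
      also have "\<dots> = (\<Sum>a\<le>n. \<Sum>b\<le>k.
          ?c a b * (\<mu> z * W z ^ (n - a) * z ^ (k - b)) * (\<mu> x * W x ^ a * x ^ b))"
        by (intro sum.cong refl) (simp only: power_minus [of "W z"] power_minus [of z] mult_ac)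
      finally show ?thesis .
    qed
    then show ?thesis by (simp only:)
  qed
  also have "residue_sum (\<lambda>z. residue_sum (\<lambda>x. \<Sum>a\<le>n. \<Sum>b\<le>k.
          ?c a b * (\<mu> z * W z ^ (n - a) * z ^ (k - b)) * (\<mu> x * W x ^ a * x ^ b)))
      = (\<Sum>a\<le>n. \<Sum>b\<le>k. ?c a b * M (n - a) (k - b) * M a b)"
    unfolding sum_sum sum_mult sum_mult_right by (simp only: M_def)
  also have "(\<Sum>a\<le>n. \<Sum>b\<le>k. ?c a b * M (n - a) (k - b) * M a b) \<approx> (\<Sum>a\<le>n. \<Sum>b\<le>k. 0)"
  proof (intro cong_sum)
    fix a b assume a: "a \<in> {..n}" and b: "b \<in> {..k}"
    show "?c a b * M (n - a) (k - b) * M a b \<approx> 0"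
    proof (cases "b < K")
      case True
      then have "?c a b * M (n - a) (k - b) * M a b \<approx> ?c a b * M (n - a) (k - b) * 0"
        using a nK by (intro cong_mult cong_refl moment_zero) auto
      then show ?thesis by simp
    next
      case False
      then have "?c a b * M (n - a) (k - b) * M a b \<approx> ?c a b * 0 * M a b"
        using a b nK k by (intro cong_mult cong_refl moment_zero) auto
      then show ?thesis by simp
    qed
  qed
  finally show ?thesis by simp
qed

text \<open>If \<open>K < p - 3\<close>, then multiplying \<open>invariant_kernel\<close> by \<open>x ^ K\<close> and summing yields \<open>M n 0 = 0\<close>, after
  which the same with \<open>x ^ (K + e)\<close> yields \<open>- 1 = 0\<close>.\<close>

lemma K_eq: "K + 2 = p - 1"
proof (rule ccontr)
  assume ne: "K + 2 \<noteq> p - 1"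
  obtain u v where u: "p - 1 = 2 * e * u" and v: "K + 2 = 2 * e * v"
    using two_e_dvd K_dvd by (metis dvdE)
  have "v < u" using ne K_le u v by (metis le_neq_implies_less mult_less_cancel1)
  then have "2 * e * (v + 1) \<le> 2 * e * u" by (intro mult_le_mono) auto
  then have large: "K + 2 + 2 * e \<le> p - 1" using u v by simp
  \<comment> \<open>The choice keeps n + K below p - 1, as \<open>Q_moment_zero\<close> requires; it
    makes n - 2 = (p - 1) - (K + 2) - e divisible by e; and it makes K + e + n equal to p - 1, the
    exponent whose power sum is -1.\<close>
  define n where "n = p - 1 - K - e"
  have n: "n \<ge> 2" "n + K + e = p - 1" using large by (simp_all add: n_def)
  have "n - 2 = e * (2 * u - 2 * v - 1)"
    using n u v by (simp add: diff_mult_distrib2 algebra_simps) 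
  then have edvd: "e dvd n - 2" by simp
  have main: "residue_sum (\<lambda>x. x ^ (k + n)) + residue_sum (\<lambda>x. x ^ k * Q n x) \<approx> M n 0 * M 0 k"
    if "k > 0" for k
  proof -
    have "residue_sum (\<lambda>x. x ^ k * (x ^ n + Q n x)) \<approx> residue_sum (\<lambda>x. x ^ k * (\<mu> x * M n 0))"
    proof (rule sum_cong_nz)
      fix x assume "unit x"
      then show "x ^ k * (x ^ n + Q n x) \<approx> x ^ k * (\<mu> x * M n 0)"
        using n edvd by (intro cong_mult cong_refl invariant_kernel) auto
    next
      show "0 ^ k * (0 ^ n + Q n 0) \<approx> 0 ^ k * (\<mu> 0 * M n 0)"
        using that by (simp add: power_0_left)
    qed
    also have "residue_sum (\<lambda>x. x ^ k * (x ^ n + Q n x))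
        = residue_sum (\<lambda>x. x ^ (k + n)) + residue_sum (\<lambda>x. x ^ k * Q n x)"
      by (simp only: distrib_left sum_add power_add)
    also have "residue_sum (\<lambda>x. x ^ k * (\<mu> x * M n 0)) = M n 0 * M 0 k"
      unfolding M_def [of 0] sum_mult [symmetric] by (simp add: mult_ac)
    finally show ?thesis .
  qed
  have "M n 0 * M 0 K \<approx> residue_sum (\<lambda>x. x ^ (K + n)) + residue_sum (\<lambda>x. x ^ K * Q n x)"
    using K_pos by (intro cong_sym [OF main]) auto
  also have "residue_sum (\<lambda>x. x ^ (K + n)) + residue_sum (\<lambda>x. x ^ K * Q n x) \<approx> 0 + 0"
  proof (intro cong_add sum_power_eq_0 Q_moment_zero)
    show "\<not> p - 1 dvd K + n" using n e by (auto dest!: dvd_imp_le)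
  qed (use n K_pos e in auto)
  finally have "M n 0 \<approx> 0" using M_K mult_zero by auto
  have "- 1 + 0 \<approx> residue_sum (\<lambda>x. x ^ (K + e + n)) + residue_sum (\<lambda>x. x ^ (K + e) * Q n x)"
    using n K_pos e by (intro cong_add cong_sym [OF sum_power_eq_m1] cong_sym [OF Q_moment_zero])
      (auto simp: add_ac)
  also have "residue_sum (\<lambda>x. x ^ (K + e + n)) + residue_sum (\<lambda>x. x ^ (K + e) * Q n x) \<approx> M n 0 * M 0 (K + e)"
    using K_pos by (intro main) auto
  also have "M n 0 * M 0 (K + e) \<approx> 0 * M 0 (K + e)"
    by (intro cong_mult cong_refl) fact
  finally have "- 1 \<approx> 0" by simp
  then show False using unit_one by (simp add: cong_0_iff)
qed

text \<open>In the interpolation formula only j = K = p - 3 survives: smaller j vanish by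
  minimality, j = K + 1 by parity, and j = p - 1 by \<open>M0_last\<close>. The remaining power of
  the argument has exponent 2.\<close>

theorem mu_quadratic:
  assumes x: "unit x"
  shows "\<mu> x \<approx> \<mu> 1 * x ^ 2"
proof -
  define \<kappa> where "\<kappa> = - of_nat ((p - 1) choose K) * M 0 K"
  have "\<mu> c \<approx> \<kappa> * c ^ 2" if c: "unit c" for c
  proof -
    let ?t = "\<lambda>j. of_nat ((p - 1) choose j) * (- c) ^ (p - 1 - j) * M 0 j"
    have "\<mu> c \<approx> M 0 0 - (\<Sum>j\<le>p - 1. ?t j)" by (rule mu_expand [OF c])
    also have "M 0 0 - (\<Sum>j\<le>p - 1. ?t j) \<approx> 0 - (\<Sum>j\<le>p - 1. if j = K then ?t K else 0)"
    proof (intro cong_diff cong_sum M00)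
      fix j assume j: "j \<in> {..p - 1}"
      have z: "M 0 j \<approx> 0" if "j \<noteq> K"
      proof -
        have "j \<noteq> K + 1 \<or> M 0 j \<approx> 0"
        proof -
          have "even K" using K_dvd by (metis dvd_add_left_iff dvd_mult_left even_numeral even_add)
          then have "\<not> 2 dvd (K + 1) + 2" by simp
          then show ?thesis using M0_weight [of "K + 1"] dvd_mult_left by blast
        qed
        moreover have "j < K \<or> j = K + 1 \<or> j = p - 1" using that j K_eq by auto
        ultimately show ?thesis using M_less_K M0_last by blast
      qed
      have "?t j \<approx> of_nat ((p - 1) choose j) * (- c) ^ (p - 1 - j) * 0" if "j \<noteq> K"
        by (intro cong_mult cong_refl z that)
      then show "?t j \<approx> (if j = K then ?t K else 0)" by auto
    qed
    also have "(\<Sum>j\<le>p - 1. if j = K then ?t K else 0) = ?t K"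
      using K_eq by simp
    also have "0 - ?t K = \<kappa> * c ^ 2"
    proof -
      have "p - 1 - K = 2" using K_eq by simp
      then show ?thesis by (simp add: \<kappa>_def)
    qed
    finally show ?thesis .
  qed
  note k = this
  have "\<mu> x \<approx> \<kappa> * x ^ 2" by (rule k [OF x])
  also have "\<kappa> * x ^ 2 \<approx> \<mu> 1 * x ^ 2"
    using k [OF unit_one] by (intro cong_mult cong_refl) (simp add: cong_sym_eq)
  finally show ?thesis .
qed

end

section \<open>Conjugation and subgroups of p-elements\<close>

definition (in group) conjg :: "'a \<Rightarrow> 'a \<Rightarrow> 'a"
  where "conjg g x = g \<otimes> x \<otimes> inv g"

context group begin

lemma inv_cancel:
  assumes "a \<in> carrier G" "b \<in> carrier G"
  shows "inv a \<otimes> (a \<otimes> b) = b" "a \<otimes> (inv a \<otimes> b) = b"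
  using assms by (simp_all flip: m_assoc)

lemma conjg_closed [simp]: "g \<in> carrier G \<Longrightarrow> x \<in> carrier G \<Longrightarrow> conjg g x \<in> carrier G"
  by (simp add: conjg_def)

lemma conjg_mult:
  "g \<in> carrier G \<Longrightarrow> x \<in> carrier G \<Longrightarrow> y \<in> carrier G \<Longrightarrow> conjg g (x \<otimes> y) = conjg g x \<otimes> conjg g y"
  by (simp add: conjg_def m_assoc) (simp flip: m_assoc)

lemma conjg_conj:
  "g \<in> carrier G \<Longrightarrow> h \<in> carrier G \<Longrightarrow> x \<in> carrier G \<Longrightarrow> conjg g (conjg h x) = conjg (g \<otimes> h) x"
  by (simp add: conjg_def m_assoc inv_mult_group)

lemma conjg_one [simp]: "x \<in> carrier G \<Longrightarrow> conjg \<one> x = x" "g \<in> carrier G \<Longrightarrow> conjg g \<one> = \<one>"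
  by (simp_all add: conjg_def)

lemma conjg_cancel [simp]:
  "g \<in> carrier G \<Longrightarrow> x \<in> carrier G \<Longrightarrow> conjg (inv g) (conjg g x) = x"
  "g \<in> carrier G \<Longrightarrow> x \<in> carrier G \<Longrightarrow> conjg g (conjg (inv g) x) = x"
  by (simp_all add: conjg_conj)

lemma conjg_inv: "g \<in> carrier G \<Longrightarrow> x \<in> carrier G \<Longrightarrow> conjg g (inv x) = inv (conjg g x)"
  by (simp add: conjg_def m_assoc inv_mult_group)

lemma conjg_pow:
  "g \<in> carrier G \<Longrightarrow> x \<in> carrier G \<Longrightarrow> conjg g (x [^] (n::nat)) = conjg g x [^] n"
  by (induction n) (simp_all add: conjg_mult)

lemma conjg_eq_iff:
  "g \<in> carrier G \<Longrightarrow> x \<in> carrier G \<Longrightarrow> y \<in> carrier G \<Longrightarrow> conjg g x = conjg g y \<longleftrightarrow> x = y"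
  by (metis conjg_cancel(1))

lemma conjg_fix_iff: "g \<in> carrier G \<Longrightarrow> x \<in> carrier G \<Longrightarrow> conjg g x = x \<longleftrightarrow> g \<otimes> x = x \<otimes> g"
  by (metis conjg_def inv_solve_right' m_closed)

lemma conjg_in_subgroup: "subgroup H G \<Longrightarrow> g \<in> H \<Longrightarrow> x \<in> H \<Longrightarrow> conjg g x \<in> H"
  by (simp add: conjg_def subgroup.m_closed subgroup.m_inv_closed)

lemma subgroup_conjg_image:
  assumes H: "subgroup H G" and g: "g \<in> carrier G"
  shows "subgroup (conjg g ` H) G"
proof (rule subgroupI)
  have sub: "H \<subseteq> carrier G" using H by (rule subgroup.subset)
  show "conjg g ` H \<subseteq> carrier G" using g sub by auto
  show "conjg g ` H \<noteq> {}" using subgroup.one_closed [OF H] by auto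
  show "inv a \<in> conjg g ` H" if "a \<in> conjg g ` H" for a
    using that g sub subgroup.m_inv_closed [OF H] by (auto simp flip: conjg_inv)
  show "a \<otimes> b \<in> conjg g ` H" if "a \<in> conjg g ` H" "b \<in> conjg g ` H" for a b
    using that g sub subgroup.m_closed [OF H] by (auto simp: subset_iff simp flip: conjg_mult)
qed

lemma conjg_image_conjg_image:
  "g \<in> carrier G \<Longrightarrow> h \<in> carrier G \<Longrightarrow> S \<subseteq> carrier G \<Longrightarrow> conjg g ` conjg h ` S = conjg (g \<otimes> h) ` S"
  unfolding image_image by (intro image_cong refl conjg_conj) auto

lemma conjg_image_one: "S \<subseteq> carrier G \<Longrightarrow> conjg \<one> ` S = S"
  by (force simp: subset_iff)

lemma conjg_image_cancel:
  assumes "g \<in> carrier G" "S \<subseteq> carrier G"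
  shows "conjg (inv g) ` conjg g ` S = S" "conjg g ` conjg (inv g) ` S = S"
  using assms by (simp_all add: conjg_image_conjg_image conjg_image_one)

lemma conjg_image_self:
  assumes H: "subgroup H G" "h \<in> H"
  shows "conjg h ` H = H"
proof
  have c: "h \<in> carrier G" "H \<subseteq> carrier G" using H subgroup.subset by auto
  show "conjg h ` H \<subseteq> H" using conjg_in_subgroup [OF H] by blast
  have "conjg (inv h) ` H \<subseteq> H" using conjg_in_subgroup [OF H(1) subgroup.m_inv_closed [OF H]] by blast
  then have "conjg h ` conjg (inv h) ` H \<subseteq> conjg h ` H" by (rule image_mono)
  then show "H \<subseteq> conjg h ` H" using c by (simp only: conjg_image_cancel)
qed

lemma card_conjg_image:
  assumes "g \<in> carrier G" "S \<subseteq> carrier G"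
  shows "card (conjg g ` S) = card S"
  using assms by (intro card_image inj_onI) (auto simp: conjg_eq_iff subset_iff)

lemma conjg_image_subset_imp_eq:
  assumes "g \<in> carrier G" "S \<subseteq> carrier G" "finite S" "conjg g ` S \<subseteq> S"
  shows "conjg g ` S = S"
  using assms card_conjg_image [of g S] by (intro card_subset_eq) auto

text \<open>Besides normalizers this covers centralizers of elements, by taking a singleton for
  \<open>S\<close>.\<close>

lemma subgroup_normalizing:
  assumes H: "subgroup H G" and S: "S \<subseteq> carrier G"
  shows "subgroup {h \<in> H. conjg h ` S = S} G"
proof (rule subgroupI)
  have sub: "H \<subseteq> carrier G" using H by (rule subgroup.subset)
  show "{h \<in> H. conjg h ` S = S} \<subseteq> carrier G" using sub by auto
  show "{h \<in> H. conjg h ` S = S} \<noteq> {}"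
    using subgroup.one_closed [OF H] conjg_image_one [OF S] by auto
  show "inv a \<in> {h \<in> H. conjg h ` S = S}" if "a \<in> {h \<in> H. conjg h ` S = S}" for a
    using that sub S subgroup.m_inv_closed [OF H] conjg_image_cancel(1) [of a S] by auto
  show "a \<otimes> b \<in> {h \<in> H. conjg h ` S = S}"
    if "a \<in> {h \<in> H. conjg h ` S = S}" "b \<in> {h \<in> H. conjg h ` S = S}" for a b
    using that sub S subgroup.m_closed [OF H] conjg_image_conjg_image [of a b S] by auto
qed

lemma generate_normalized:
  assumes "g \<in> carrier G" "S \<subseteq> carrier G" "finite (carrier G)" "\<And>s. s \<in> S \<Longrightarrow> conjg g s \<in> S"
  shows "conjg g ` generate G S = generate G S"
proof (rule conjg_image_subset_imp_eq)
  show sub: "generate G S \<subseteq> carrier G" using assms(2) by (rule generate_incl)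
  then show "finite (generate G S)" using assms(3) finite_subset by blast
  have "conjg g x \<in> generate G S" if "x \<in> generate G S" for x
    using that
  proof (induction rule: generate.induct)
    case one
    then show ?case using assms(1) generate.one by simp
  next
    case (incl h)
    then show ?case by (intro generate.incl assms(4))
  next
    case (inv h)
    then show ?case using assms conjg_inv [of g h] generate.inv [of "conjg g h" S G] by auto
  next
    case (eng h1 h2)
    then have "h1 \<in> carrier G" "h2 \<in> carrier G" using sub by blast+
    with eng show ?case using assms(1) by (simp add: conjg_mult generate.eng)
  qed
  then show "conjg g ` generate G S \<subseteq> generate G S" by blast
qed (use assms in auto)

end

locale finite_group_prime = group G for G :: "('a, 'b) monoid_scheme" (structure) +
  fixes p :: nat
  assumes fin: "finite (carrier G)" and p_prime: "prime p"
begin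

abbreviation Gp :: "'a set" where "Gp \<equiv> p_elements G p"

lemma p_gt_1: "p > 1" using p_prime by (rule prime_gt_1_nat)

lemma Gp_iff: "x \<in> Gp \<longleftrightarrow> x \<in> carrier G \<and> (\<exists>m. x [^] (p ^ m) = \<one>)"
proof
  assume "x \<in> Gp"
  then obtain m where "x \<in> carrier G" "ord x = p ^ m" by (auto simp: p_elements_def)
  then show "x \<in> carrier G \<and> (\<exists>m. x [^] (p ^ m) = \<one>)"
    using pow_ord_eq_1 [of x] by auto
next
  assume "x \<in> carrier G \<and> (\<exists>m. x [^] (p ^ m) = \<one>)"
  then obtain m where "x \<in> carrier G" "ord x dvd p ^ m" using pow_eq_id by blast
  then show "x \<in> Gp" using divides_primepow_nat [OF p_prime] by (auto simp: p_elements_def)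
qed

lemma Gp_carrier: "x \<in> Gp \<Longrightarrow> x \<in> carrier G" by (simp add: Gp_iff)

lemma Gp_subset: "Gp \<subseteq> carrier G" using Gp_carrier by blast

lemma finite_Gp: "finite Gp" using Gp_subset fin finite_subset by blast

lemma one_Gp: "\<one> \<in> Gp" by (simp add: Gp_iff)

lemma conjg_Gp: "g \<in> carrier G \<Longrightarrow> x \<in> Gp \<Longrightarrow> conjg g x \<in> Gp"
proof -
  assume g: "g \<in> carrier G" "x \<in> Gp"
  then obtain m where m: "x \<in> carrier G" "x [^] (p ^ m) = \<one>" by (auto simp: Gp_iff)
  then have "conjg g x [^] (p ^ m) = \<one>" using g(1) by (simp flip: conjg_pow)
  then show ?thesis unfolding Gp_iff using g m by (auto intro: exI [of _ m])
qed

lemma pow_eq_one_dvd: "x \<in> carrier G \<Longrightarrow> x [^] (m::nat) = \<one> \<Longrightarrow> m dvd n \<Longrightarrow> x [^] n = \<one>"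
  using pow_eq_id dvd_trans by blast

lemma mult_Gp: "x \<in> Gp \<Longrightarrow> y \<in> Gp \<Longrightarrow> x \<otimes> y = y \<otimes> x \<Longrightarrow> x \<otimes> y \<in> Gp"
proof -
  assume a: "x \<in> Gp" "y \<in> Gp" "x \<otimes> y = y \<otimes> x"
  then obtain m n where mn: "x [^] (p ^ m) = \<one>" "y [^] (p ^ n) = \<one>" by (auto simp: Gp_iff)
  have c: "x \<in> carrier G" "y \<in> carrier G" using a Gp_carrier by auto
  have "x [^] (p ^ (m + n)) = \<one>" "y [^] (p ^ (m + n)) = \<one>"
    using mn c by (auto intro: pow_eq_one_dvd simp: power_add)
  then have "(x \<otimes> y) [^] (p ^ (m + n)) = \<one>" using c a(3) by (simp add: pow_mult_distrib)
  then show ?thesis unfolding Gp_iff using c by blast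
qed

lemma pow_Gp: "x \<in> Gp \<Longrightarrow> x [^] (k::nat) \<in> Gp"
  by (auto simp: Gp_iff nat_pow_pow) (metis mult.commute nat_pow_one nat_pow_pow)

lemma subgroup_finite: "subgroup H G \<Longrightarrow> finite H"
  using subgroup.subset fin finite_subset by blast

text \<open>If a prime q other than \<open>p\<close> divided the order, Sylow's theorem would give a
  nontrivial element whose order divides q and is a power of \<open>p\<close>.\<close>

lemma p_group_card:
  assumes B: "subgroup B G" "B \<subseteq> Gp"
  obtains n where "card B = p ^ n"
proof -
  interpret B: group "G\<lparr>carrier := B\<rparr>" using B(1) by (rule subgroup.subgroup_is_group) (rule is_group)
  have fB: "finite B" using B(1) by (rule subgroup_finite)
  have pos: "card B > 0" using fB subgroup.one_closed [OF B(1)] card_gt_0_iff by blast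
  define m where "m = card B div p ^ multiplicity p (card B)"
  have m: "card B = p ^ multiplicity p (card B) * m" "\<not> p dvd m"
    using pos p_gt_1 multiplicity_decompose [of "card B" p] by (auto simp: m_def multiplicity_dvd)
  have "m = 1"
  proof (rule ccontr)
    assume "m \<noteq> 1"
    then obtain q where q: "prime q" "q dvd m" using prime_factor_nat by blast
    then obtain k where "card B = q ^ 1 * k" using m(1) by (metis dvdE dvd_mult power_one_right)
    then have "\<exists>H. subgroup H (G\<lparr>carrier := B\<rparr>) \<and> card H = q ^ 1"
      using fB q(1) B.is_group by (intro sylow_thm) (auto simp: order_def)
    then obtain H where H: "subgroup H (G\<lparr>carrier := B\<rparr>)" "card H = q" by auto
    have HG: "subgroup H G" using H(1) B(1) incl_subgroup by blast
    have HB: "H \<subseteq> B" using subgroup.subset [OF H(1)] by simp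
    have "H \<noteq> {\<one>}" using H(2) q(1) by (auto simp: prime_nat_iff)
    then obtain x where x: "x \<in> H" "x \<noteq> \<one>" using subgroup.one_closed [OF HG] by blast
    interpret H: group "G\<lparr>carrier := H\<rparr>" using HG by (rule subgroup.subgroup_is_group) (rule is_group)
    have "x [^] q = \<one>"
      using H.pow_order_eq_1 [of x] x(1) H(2) by (simp add: order_def nat_pow_consistent [symmetric])
    then have "ord x dvd q" using x(1) HB B(2) Gp_carrier pow_eq_id by blast
    moreover obtain j where "ord x = p ^ j" using x(1) HB B(2) by (auto simp: p_elements_def)
    ultimately have "p ^ j dvd q" by simp
    moreover have "p \<noteq> q" using q m(2) by blast
    ultimately have "j = 0" using q(1) p_prime
      by (metis dvd_power dvd_trans gr0I primes_dvd_imp_eq)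
    then have "ord x = 1" using \<open>ord x = p ^ j\<close> by simp
    then show False using x HB B(2) Gp_carrier ord_eq_1 by blast
  qed
  then show ?thesis using m(1) that by simp
qed

text \<open>Orbits have p-power size, so modulo \<open>p\<close> only the orbits of size 1 count.
  The action is a bare function \<open>f\<close>, so that the result serves for conjugation of
  elements and of subgroups alike.\<close>

lemma p_group_fixed_points:
  assumes B: "subgroup B G" "B \<subseteq> Gp" and X: "finite X"
    and f: "\<And>b x. b \<in> B \<Longrightarrow> x \<in> X \<Longrightarrow> f b x \<in> X" "\<And>x. x \<in> X \<Longrightarrow> f \<one> x = x"
      "\<And>b c x. b \<in> B \<Longrightarrow> c \<in> B \<Longrightarrow> x \<in> X \<Longrightarrow> f (b \<otimes> c) x = f b (f c x)"
  shows "card X mod p = card {x \<in> X. \<forall>b\<in>B. f b x = x} mod p"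
proof -
  let ?B = "G\<lparr>carrier := B\<rparr>"
  \<comment> \<open>\<open>BijGroup\<close> consists of extensional maps, so the action is cut off
    outside \<open>X\<close>.\<close>
  define \<phi> where "\<phi> b = restrict (f b) X" for b
  interpret B: group ?B using B(1) by (rule subgroup.subgroup_is_group) (rule is_group)
  have inv: "inv b \<in> B" "f (inv b) (f b x) = x" "f b (f (inv b) x) = x" if "b \<in> B" "x \<in> X" for b x
  proof -
    show i: "inv b \<in> B" using that B(1) subgroup.m_inv_closed by metis
    have bc: "b \<in> carrier G" using that B(1) subgroup.mem_carrier by metis
    show "f (inv b) (f b x) = x" "f b (f (inv b) x) = x"
      using f(3) [OF i that(1) that(2)] f(3) [OF that(1) i that(2)] f(2) [OF that(2)] bc by simp_all
  qed
  have bij: "\<phi> b \<in> Bij X" if "b \<in> B" for b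
    unfolding Bij_def \<phi>_def
  proof (intro IntI CollectI)
    show "bij_betw (restrict (f b) X) X X"
      using inv that f(1) by (intro bij_betwI [where g = "f (inv b)"]) auto
  qed auto
  interpret group_action ?B X \<phi>
  proof (unfold group_action_def group_hom_def group_hom_axioms_def, intro conjI)
    show "\<phi> \<in> hom ?B (BijGroup X)"
    proof (rule homI)
      fix b assume "b \<in> carrier ?B"
      then show "\<phi> b \<in> carrier (BijGroup X)" using bij by (simp add: BijGroup_def)
    next
      fix b c assume "b \<in> carrier ?B" "c \<in> carrier ?B"
      then show "\<phi> (b \<otimes>\<^bsub>?B\<^esub> c) = \<phi> b \<otimes>\<^bsub>BijGroup X\<^esub> \<phi> c"
        using bij f(1,3) by (auto simp: BijGroup_def \<phi>_def compose_def fun_eq_iff)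
    qed
  qed (use B.is_group group_BijGroup in auto)
  have orb: "orbit ?B \<phi> x = (\<lambda>b. f b x) ` B" if "x \<in> X" for x
    using that by (auto simp: orbit_def \<phi>_def)
  obtain n where n: "card B = p ^ n" using B by (rule p_group_card)
  let ?F = "{x \<in> X. \<forall>b\<in>B. f b x = x}"
  let ?O = "orbits ?B X \<phi>"
  have orbs: "finite ?O" using X by (simp add: orbits_def)
  have card_orbit: "card Q mod p = (if card Q = 1 then 1 else 0)" if Q: "Q \<in> ?O" for Q
  proof -
    obtain x where x: "x \<in> X" "Q = orbit ?B \<phi> x" using Q unfolding orbits_def by blast
    have "card Q * card (stabilizer ?B \<phi> x) = p ^ n"
      using orbit_stabilizer_theorem [OF x(1)] x(2) n by (simp add: order_def)
    then have "card Q dvd p ^ n" by (metis dvd_triv_left)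
    then obtain k where "card Q = p ^ k" using divides_primepow_nat [OF p_prime] by auto
    then show ?thesis using p_gt_1 by (cases k) auto
  qed
  have "card X = (\<Sum>Q\<in>?O. card Q)"
    using disjoint_sum [OF X, of "\<lambda>_. 1 :: nat"] by simp
  then have "card X mod p = (\<Sum>Q\<in>?O. card Q mod p) mod p" by (simp add: mod_sum_eq)
  also have "(\<Sum>Q\<in>?O. card Q mod p) = (\<Sum>Q\<in>?O. if card Q = 1 then 1 else 0)"
    using card_orbit by (intro sum.cong) auto
  also have "\<dots> = card {Q \<in> ?O. card Q = 1}"
    using orbs by (simp add: sum.If_cases Int_def)
  also have "{Q \<in> ?O. card Q = 1} = (\<lambda>x. {x}) ` ?F"
  proof (intro equalityI subsetI)
    fix Q assume Q: "Q \<in> {Q \<in> ?O. card Q = 1}"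
    then obtain x where x: "x \<in> X" "Q = (\<lambda>b. f b x) ` B" using orb unfolding orbits_def by blast
    obtain y where y: "Q = {y}" using Q card_1_singletonE by blast
    have "x \<in> Q"
      unfolding x(2) by (rule image_eqI [where x = "\<one>"]) (use f(2) [OF x(1)] subgroup.one_closed [OF B(1)] in auto)
    then have Qx: "Q = {x}" using y by blast
    then have "\<forall>b\<in>B. f b x = x" using x(2) by blast
    then show "Q \<in> (\<lambda>x. {x}) ` ?F" using x(1) Qx by blast
  next
    fix Q assume "Q \<in> (\<lambda>x. {x}) ` ?F"
    then obtain x where x: "x \<in> X" "\<forall>b\<in>B. f b x = x" "Q = {x}" by auto
    then have "orbit ?B \<phi> x = {x}" using orb subgroup.one_closed [OF B(1)] by auto
    then show "Q \<in> {Q \<in> ?O. card Q = 1}" using x by (auto simp: orbits_def)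
  qed
  also have "card ((\<lambda>x. {x}) ` ?F) = card ?F" by (rule card_image) simp
  finally show ?thesis .
qed

text \<open>Let \<open>A\<close> act on its conjugates under \<open>B\<close>. If \<open>A\<close>
  is not normal in \<open>B\<close>, then \<open>B\<close> fixes none of them, so their number is
  divisible by \<open>p\<close>. Now \<open>A\<close> fixes itself, hence also another conjugate by
  some b. Then the conjugate of \<open>A\<close> by the inverse of b normalizes \<open>A\<close> and
  is not contained in it.\<close>

lemma normalizer_grows:
  assumes A: "subgroup A G" and B: "subgroup B G" "B \<subseteq> Gp" and AB: "A \<subset> B"
  shows "\<exists>b\<in>B - A. conjg b ` A = A"
proof -
  let ?X = "(\<lambda>b. conjg b ` A) ` B"
  have Bc: "B \<subseteq> carrier G" and Ac: "A \<subseteq> carrier G" using A B subgroup.subset by metis+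
  have fX: "finite ?X" using subgroup_finite [OF B(1)] by simp
  have act: "conjg b ` Y \<in> ?X" if "b \<in> B" "Y \<in> ?X" for b Y
    using that Bc Ac subgroup.m_closed [OF B(1)] by (auto simp: conjg_image_conjg_image subset_iff)
  have sub: "Y \<subseteq> carrier G" if "Y \<in> ?X" for Y using that Bc Ac by (auto simp: subset_iff)
  have A_in: "A \<in> ?X" using conjg_image_one [OF Ac] subgroup.one_closed [OF B(1)] by force
  have fixD: "card ?X mod p = card {Y \<in> ?X. \<forall>b\<in>D. conjg b ` Y = Y} mod p"
    if D: "subgroup D G" "D \<subseteq> B" for D
  proof (rule p_group_fixed_points [OF D(1) _ fX])
    show "D \<subseteq> Gp" using D(2) B(2) by (rule subset_trans)
    show "conjg b ` Y \<in> ?X" if "b \<in> D" "Y \<in> ?X" for b Y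
      using act [OF _ that(2)] that(1) D(2) by (simp add: subset_iff)
    show "conjg \<one> ` Y = Y" if "Y \<in> ?X" for Y by (rule conjg_image_one [OF sub [OF that]])
    show "conjg (b \<otimes> c) ` Y = conjg b ` conjg c ` Y" if "b \<in> D" "c \<in> D" "Y \<in> ?X" for b c Y
      using that D(2) Bc sub [OF that(3)] by (intro conjg_image_conjg_image [symmetric]) auto
  qed
  note fixA = fixD [OF A psubset_imp_subset [OF AB]] and fixB = fixD [OF B(1) subset_refl]
  show ?thesis
  proof (cases "\<forall>b\<in>B. conjg b ` A = A")
    case True
    then show ?thesis using AB by blast
  next
    case False
    have "{Y \<in> ?X. \<forall>b\<in>B. conjg b ` Y = Y} = {}"
    proof (rule ccontr)
      assume "{Y \<in> ?X. \<forall>b\<in>B. conjg b ` Y = Y} \<noteq> {}"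
      then obtain c where c: "c \<in> B" "\<forall>b\<in>B. conjg b ` conjg c ` A = conjg c ` A" by auto
      have "inv c \<in> B" using c(1) B(1) subgroup.m_inv_closed by metis
      then have "conjg c ` A = A" using c Bc Ac conjg_image_cancel(1) [of c A] by auto
      then show False using c False by simp
    qed
    then have "card ?X mod p = 0" using fixB by (simp only: card.empty mod_0)
    then have "p dvd card {Y \<in> ?X. \<forall>b\<in>A. conjg b ` Y = Y}" (is "p dvd card ?F")
      using fixA by (simp add: mod_eq_0_iff_dvd)
    moreover have "A \<in> ?F"
    proof -
      have "conjg b ` A = A" if "b \<in> A" for b
        using A that by (rule conjg_image_self)
      then show ?thesis using A_in by simp
    qed
    ultimately have A_F: "A \<in> ?F" "p dvd card ?F" by blast+
    have "?F \<noteq> {A}"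
    proof
      assume F: "?F = {A}"
      have "card ?F = 1" unfolding F by simp
      with A_F(2) show False using p_gt_1 by simp
    qed
    then obtain Y where Y: "Y \<in> ?F" "Y \<noteq> A" using A_F(1) by blast
    note mem = CollectD [OF Y(1)]
    have fixY: "conjg a ` Y = Y" if "a \<in> A" for a
      using bspec [OF conjunct2 [OF mem] that] .
    obtain b where b: "b \<in> B" "Y = conjg b ` A"
      using conjunct1 [OF mem] by (rule imageE)
    have bc: "b \<in> carrier G" using b(1) Bc by blast
    have ib: "inv b \<in> B" using subgroup.m_inv_closed [OF B(1) b(1)] .
    have norm: "conjg (conjg (inv b) a) ` A = A" if a: "a \<in> A" for a
    proof -
      have ac: "a \<in> carrier G" using a Ac by blast
      have bA: "conjg b ` A \<subseteq> carrier G" using bc Ac by (intro image_subsetI conjg_closed) auto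
      have "conjg a ` conjg b ` A = conjg b ` A" using fixY [OF a] unfolding b(2) .
      then have "conjg (inv b) ` conjg a ` conjg b ` A = A"
        using conjg_image_cancel(1) [OF bc Ac] by (simp only:)
      moreover have "conjg (inv b) ` conjg a ` conjg b ` A = conjg (inv b \<otimes> a \<otimes> b) ` A"
        using bc ac Ac bA by (simp only: conjg_image_conjg_image m_closed inv_closed m_assoc)
      ultimately have "conjg (inv b \<otimes> a \<otimes> b) ` A = A" by simp
      then show ?thesis using bc by (simp add: conjg_def)
    qed
    have "\<not> conjg (inv b) ` A \<subseteq> A"
    proof
      assume "conjg (inv b) ` A \<subseteq> A"
      then have "conjg (inv b) ` A = A"
        using bc Ac subgroup_finite [OF A] by (intro conjg_image_subset_imp_eq) auto
      then have "conjg b ` A = A" using conjg_image_cancel(2) [OF bc Ac] by simp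
      then show False using Y b by simp
    qed
    then obtain a where a: "a \<in> A" "conjg (inv b) a \<notin> A" unfolding image_subset_iff by auto
    have "a \<in> B" using a(1) AB by auto
    then have "conjg (inv b) a \<in> B" by (rule conjg_in_subgroup [OF B(1) ib])
    then show ?thesis using norm [OF a(1)] a(2) by (intro bexI [of _ "conjg (inv b) a"]) auto
  qed
qed

section \<open>The largest normal p-subgroup\<close>

definition pnormal :: "'a set \<Rightarrow> 'a set \<Rightarrow> bool"
  where "pnormal N S \<longleftrightarrow> subgroup N G \<and> N \<subseteq> S \<and> N \<subseteq> Gp \<and> (\<forall>s\<in>S. \<forall>n\<in>N. conjg s n \<in> N)"

text \<open>For a subgroup \<open>S\<close>, this is \<open>O\<^sub>p(S)\<close>.\<close>

definition core :: "'a set \<Rightarrow> 'a set"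
  where "core S = \<Union>{N. pnormal N S}"

text \<open>The product consists of p-elements: as b normalizes \<open>M\<close>, the k-th power of
  \<open>a \<otimes> b\<close> is an element of \<open>M\<close> times \<open>b [^] k\<close>. A
  suitable p-power of \<open>a \<otimes> b\<close> therefore lies in \<open>M\<close>.\<close>

lemma pnormal_mult:
  assumes S: "subgroup S G" and M: "pnormal M S" and N: "pnormal N S"
  shows "pnormal {a \<otimes> b |a b. a \<in> M \<and> b \<in> N} S" (is "pnormal ?P S")
proof -
  have Mg: "subgroup M G" and Ng: "subgroup N G" and MS: "M \<subseteq> S" and NS: "N \<subseteq> S"
    and MGp: "M \<subseteq> Gp" and NGp: "N \<subseteq> Gp"
    and Mc: "\<And>s n. s \<in> S \<Longrightarrow> n \<in> M \<Longrightarrow> conjg s n \<in> M"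
    and Nc: "\<And>s n. s \<in> S \<Longrightarrow> n \<in> N \<Longrightarrow> conjg s n \<in> N"
    using M N unfolding pnormal_def by simp_all
  have car: "x \<in> carrier G" if "x \<in> S" for x using S that by (rule subgroup.mem_carrier)
  have carM: "x \<in> carrier G" "x \<in> S" if "x \<in> M" for x using that MS car by auto
  have carN: "x \<in> carrier G" "x \<in> S" if "x \<in> N" for x using that NS car by auto
  have Gp: "a \<otimes> b \<in> Gp" if a: "a \<in> M" and b: "b \<in> N" for a b
  proof -
    have "\<exists>c\<in>M. (a \<otimes> b) [^] k = c \<otimes> b [^] k" for k :: nat
    proof (induction k)
      case 0
      show ?case using subgroup.one_closed [OF Mg] by (intro bexI [of _ \<one>]) auto
    next
      case (Suc k)
      then obtain c where c: "c \<in> M" "(a \<otimes> b) [^] k = c \<otimes> b [^] k" by blast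
      have bS: "b [^] k \<in> S" using S carN(2) [OF b] by (induction k) (auto intro: subgroup.m_closed subgroup.one_closed)
      have "c \<otimes> conjg (b [^] k) a \<in> M" by (intro subgroup.m_closed [OF Mg] c(1) Mc bS a)
      moreover have "(a \<otimes> b) [^] Suc k = c \<otimes> conjg (b [^] k) a \<otimes> b [^] Suc k"
        using c carM [OF a] carN [OF b] carM [OF c(1)] by (simp add: conjg_def m_assoc inv_cancel)
      ultimately show ?case by blast
    qed
    note * = this
    obtain m where m: "b [^] (p ^ m) = \<one>" using subsetD [OF NGp b] unfolding Gp_iff by blast
    obtain c where c: "c \<in> M" "(a \<otimes> b) [^] (p ^ m) = c \<otimes> b [^] (p ^ m)" using * by blast
    then have eq: "(a \<otimes> b) [^] (p ^ m) = c" using m carM by simp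
    obtain l where l: "c [^] (p ^ l) = \<one>" using subsetD [OF MGp c(1)] unfolding Gp_iff by blast
    have ab: "a \<otimes> b \<in> carrier G" using carM [OF a] carN [OF b] by simp
    have "(a \<otimes> b) [^] (p ^ (m + l)) = \<one>"
      using l ab eq by (simp add: power_add flip: nat_pow_pow)
    then show ?thesis unfolding Gp_iff using ab by blast
  qed
  have "subgroup ?P G"
  proof (rule subgroupI)
    show "?P \<subseteq> carrier G" using carM carN by auto
    show "?P \<noteq> {}" using subgroup.one_closed [OF Mg] subgroup.one_closed [OF Ng] by blast
  next
    fix x assume "x \<in> ?P"
    then obtain a b where x: "x = a \<otimes> b" and a: "a \<in> M" and b: "b \<in> N" by blast
    have ia: "inv a \<in> M" using Mg a by (rule subgroup.m_inv_closed)
    have ib: "inv b \<in> N" using Ng b by (rule subgroup.m_inv_closed)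
    have "inv x = conjg (inv b) (inv a) \<otimes> inv b"
      using carM [OF a] carN [OF b] by (simp add: x conjg_def inv_mult_group m_assoc)
    then show "inv x \<in> ?P" using Mc [OF carN(2) [OF ib] ia] ib by blast
  next
    fix x y assume "x \<in> ?P" "y \<in> ?P"
    then obtain a b c d where x: "x = a \<otimes> b" "y = c \<otimes> d"
      and a: "a \<in> M" and b: "b \<in> N" and c: "c \<in> M" and d: "d \<in> N" by blast
    have "x \<otimes> y = (a \<otimes> conjg b c) \<otimes> (b \<otimes> d)"
      using carM [OF a] carN [OF b] carM [OF c] carN [OF d]
      by (simp add: x conjg_def m_assoc inv_cancel)
    moreover have "a \<otimes> conjg b c \<in> M" by (intro subgroup.m_closed [OF Mg] a Mc carN(2) b c)
    moreover have "b \<otimes> d \<in> N" by (intro subgroup.m_closed [OF Ng] b d)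
    ultimately show "x \<otimes> y \<in> ?P" by blast
  qed
  moreover have "?P \<subseteq> S" using carM(2) carN(2) subgroup.m_closed [OF S] by blast
  moreover have "?P \<subseteq> Gp" using Gp by blast
  moreover have "conjg s x \<in> ?P" if s: "s \<in> S" and x: "x \<in> ?P" for s x
  proof -
    obtain a b where ab: "x = a \<otimes> b" and a: "a \<in> M" and b: "b \<in> N" using x by blast
    have "conjg s x = conjg s a \<otimes> conjg s b"
      unfolding ab by (rule conjg_mult [OF car [OF s] carM(1) [OF a] carN(1) [OF b]])
    then show ?thesis using Mc [OF s a] Nc [OF s b] by blast
  qed
  ultimately show ?thesis unfolding pnormal_def by blast
qed

lemma pnormal_one:
  assumes S: "subgroup S G"
  shows "pnormal {\<one>} S"
proof -
  have "conjg s \<one> = \<one>" if "s \<in> S" for s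
    using subgroup.mem_carrier [OF S that] by (rule conjg_one(2))
  then show ?thesis
    using subgroup.one_closed [OF S] one_Gp triv_subgroup by (simp add: pnormal_def)
qed

text \<open>The union is closed under multiplication because two normal p-subgroups lie in their
  product, which is again one by \<open>pnormal_mult\<close>.\<close>

lemma pnormal_core:
  assumes S: "subgroup S G"
  shows "pnormal (core S) S"
proof -
  have mem: "x \<in> core S \<longleftrightarrow> (\<exists>N. pnormal N S \<and> x \<in> N)" for x by (auto simp: core_def)
  have Gp: "core S \<subseteq> Gp" and sub: "core S \<subseteq> S"
    and con: "\<forall>s\<in>S. \<forall>n\<in>core S. conjg s n \<in> core S"
    unfolding core_def pnormal_def by blast+
  have "subgroup (core S) G"
  proof (rule subgroupI)
    show "core S \<subseteq> carrier G" using Gp Gp_subset by (rule subset_trans)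
    show "core S \<noteq> {}" using pnormal_one [OF S] mem by blast
  next
    fix a assume "a \<in> core S"
    then obtain N where N: "pnormal N S" "a \<in> N" using mem by blast
    have "subgroup N G" using N(1) by (simp add: pnormal_def)
    then have "inv a \<in> N" using N(2) by (rule subgroup.m_inv_closed)
    then show "inv a \<in> core S" using N(1) mem by blast
  next
    fix a b assume "a \<in> core S" "b \<in> core S"
    then obtain M N where MN: "pnormal M S" "a \<in> M" "pnormal N S" "b \<in> N" using mem by blast
    have "pnormal {a \<otimes> b |a b. a \<in> M \<and> b \<in> N} S" using S MN(1,3) by (rule pnormal_mult)
    moreover have "a \<otimes> b \<in> {a \<otimes> b |a b. a \<in> M \<and> b \<in> N}" using MN by blast
    ultimately show "a \<otimes> b \<in> core S" unfolding mem by blast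
  qed
  then show ?thesis unfolding pnormal_def using Gp sub con by blast
qed

lemma
  assumes "subgroup S G"
  shows core_subgroup: "subgroup (core S) G"
    and core_subset: "core S \<subseteq> S"
    and core_Gp: "core S \<subseteq> Gp"
    and core_conjg: "s \<in> S \<Longrightarrow> x \<in> core S \<Longrightarrow> conjg s x \<in> core S"
proof -
  note c = pnormal_core [OF assms, unfolded pnormal_def]
  show "subgroup (core S) G" "core S \<subseteq> S" "core S \<subseteq> Gp"
    by (rule conjunct1 [OF c] conjunct1 [OF conjunct2 [OF c]] conjunct1 [OF conjunct2 [OF conjunct2 [OF c]]])+
  show "s \<in> S \<Longrightarrow> x \<in> core S \<Longrightarrow> conjg s x \<in> core S"
    by (rule bspec [OF bspec [OF conjunct2 [OF conjunct2 [OF conjunct2 [OF c]]]]])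
qed

lemma pnormal_subset_core: "pnormal N S \<Longrightarrow> N \<subseteq> core S"
  unfolding core_def by blast

lemma pnormal_conjg:
  assumes S: "subgroup S G" and g: "g \<in> carrier G" and N: "pnormal N S"
  shows "pnormal (conjg g ` N) (conjg g ` S)"
proof -
  have NG: "subgroup N G" and NS: "N \<subseteq> S" and NGp: "N \<subseteq> Gp"
    and Nc: "\<And>s n. s \<in> S \<Longrightarrow> n \<in> N \<Longrightarrow> conjg s n \<in> N"
    using N unfolding pnormal_def by simp_all
  have Sc: "S \<subseteq> carrier G" using S by (rule subgroup.subset)
  have "conjg (conjg g s) (conjg g n) = conjg g (conjg s n)" if "s \<in> S" "n \<in> N" for s n
  proof -
    have "s \<in> carrier G" "n \<in> carrier G" using that NS Sc by auto
    then show ?thesis using g by (simp add: conjg_def inv_mult_group m_assoc inv_cancel)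
  qed
  then have "\<forall>s\<in>conjg g ` S. \<forall>n\<in>conjg g ` N. conjg s n \<in> conjg g ` N" using Nc by auto
  moreover have "subgroup (conjg g ` N) G" using NG g by (rule subgroup_conjg_image)
  moreover have "conjg g ` N \<subseteq> Gp" using NGp conjg_Gp [OF g] by auto
  moreover have "conjg g ` N \<subseteq> conjg g ` S" using NS by (rule image_mono)
  ultimately show ?thesis unfolding pnormal_def by (intro conjI)
qed

lemma conjg_core:
  assumes S: "subgroup S G" and g: "g \<in> carrier G" and x: "x \<in> core S"
  shows "conjg g x \<in> core (conjg g ` S)"
  using pnormal_subset_core [OF pnormal_conjg [OF S g pnormal_core [OF S]]] x by auto

lemma core_p_group:
  assumes "subgroup S G" "S \<subseteq> Gp"
  shows "core S = S"
proof
  show "core S \<subseteq> S" using assms(1) by (rule core_subset)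
  have "pnormal S S" unfolding pnormal_def
    by (intro conjI ballI conjg_in_subgroup [OF assms(1)] assms subset_refl)
  then show "S \<subseteq> core S" by (rule pnormal_subset_core)
qed

text \<open>k is invertible modulo the order of x, which is a power of \<open>p\<close>, so x is a
  power of \<open>x [^] k\<close>.\<close>

lemma pow_mem_imp_mem:
  assumes x: "x \<in> Gp" and k: "\<not> p dvd k" and S: "subgroup S G" "x [^] k \<in> S"
  shows "x \<in> S"
proof -
  have xc: "x \<in> carrier G" using x by (rule Gp_carrier)
  obtain m where m: "ord x = p ^ m" using x by (auto simp: p_elements_def)
  have "coprime k (ord x)"
    unfolding m using prime_imp_coprime [OF p_prime k] by (simp add: coprime_commute)
  then obtain l where l: "[k * l = Suc 0] (mod ord x)" using cong_solve_coprime_nat by blast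
  have "x [^] (k * l) = x [^] Suc 0"
  proof (rule iffD2 [OF int_pow_eq [OF xc, of "int (k * l)" "int (Suc 0)", unfolded int_pow_int]])
    from l have "[int (k * l) = int (Suc 0)] (mod int (ord x))" unfolding cong_int_iff .
    then show "int (ord x) dvd int (Suc 0) - int (k * l)"
      by (subst (asm) cong_sym_eq) (simp only: cong_iff_dvd_diff)
  qed
  then have "x = (x [^] k) [^] l" using xc by (simp add: nat_pow_pow)
  also have "\<dots> \<in> S"
  proof (induction l)
    case 0
    show ?case using subgroup.one_closed [OF S(1)] by simp
  next
    case (Suc l)
    show ?case using subgroup.m_closed [OF S(1) Suc S(2)] by simp
  qed
  finally show ?thesis .
qed

end

section \<open>The zipper lemma\<close>

locale zipper = finite_group_prime +
  fixes H x
  assumes H: "subgroup H G" and xH: "x \<in> H" and xGp: "x \<in> Gp" and x_core: "x \<notin> core H"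
    and minimal: "\<And>S. subgroup S G \<Longrightarrow> S \<subset> H \<Longrightarrow> x \<in> S \<Longrightarrow> x \<in> core S"
begin

definition C :: "'a set" where "C = (\<lambda>h. conjg h x) ` H"

definition maxsub :: "'a set \<Rightarrow> bool"
  where "maxsub M \<longleftrightarrow> subgroup M G \<and> M \<subset> H \<and> (\<forall>S. subgroup S G \<longrightarrow> M \<subseteq> S \<longrightarrow> S \<subset> H \<longrightarrow> S = M)"

lemma H_carrier: "h \<in> H \<Longrightarrow> h \<in> carrier G"
  using H by (rule subgroup.mem_carrier)

lemma H_inv: "h \<in> H \<Longrightarrow> inv h \<in> H"
  using H by (rule subgroup.m_inv_closed)

lemma x_carrier: "x \<in> carrier G" using xH by (rule H_carrier)

lemma C_H: "c \<in> C \<Longrightarrow> c \<in> H"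
  unfolding C_def using conjg_in_subgroup [OF H _ xH] by auto

lemma x_C: "x \<in> C"
  unfolding C_def
proof (rule image_eqI)
  show "x = conjg \<one> x" using x_carrier by simp
  show "\<one> \<in> H" using H by (rule subgroup.one_closed)
qed

lemma C_conjg:
  assumes "c \<in> C" "h \<in> H"
  shows "conjg h c \<in> C"
proof -
  obtain k where k: "k \<in> H" "c = conjg k x" using assms(1) unfolding C_def by (rule imageE)
  then have "conjg h c = conjg (h \<otimes> k) x" using assms(2) H_carrier x_carrier by (simp add: conjg_conj)
  moreover have "h \<otimes> k \<in> H" by (rule subgroup.m_closed [OF H assms(2) k(1)])
  ultimately show ?thesis unfolding C_def by (rule image_eqI)
qed

lemma proper_conjg:
  assumes h: "h \<in> H" and S: "S \<subset> H"
  shows "conjg h ` S \<subset> H"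
proof (rule psubsetI)
  have Sc: "S \<subseteq> carrier G" using S subgroup.subset [OF H] by simp
  show "conjg h ` S \<subseteq> H" using S conjg_in_subgroup [OF H h] by auto
  have "card (conjg h ` S) = card S" by (rule card_conjg_image [OF H_carrier [OF h] Sc])
  also have "card S < card H" by (rule psubset_card_mono [OF subgroup_finite [OF H] S])
  finally show "conjg h ` S \<noteq> H" by (intro notI) simp
qed

text \<open>Conjugation by elements of \<open>H\<close> carries the minimality of \<open>H\<close>
  over from \<open>x\<close> to all its conjugates.\<close>

lemma C_core:
  assumes c: "c \<in> C" and S: "subgroup S G" "S \<subset> H" "c \<in> S"
  shows "c \<in> core S"
proof -
  obtain h where h: "h \<in> H" "c = conjg h x" using c unfolding C_def by (rule imageE)
  have hc: "h \<in> carrier G" "inv h \<in> carrier G" using H_carrier [OF h(1)] by auto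
  have Sc: "S \<subseteq> carrier G" using S(1) by (rule subgroup.subset)
  let ?S = "conjg (inv h) ` S"
  have sub: "subgroup ?S G" using S(1) hc(2) by (rule subgroup_conjg_image)
  have "x = conjg (inv h) c" using h hc x_carrier by simp
  then have "x \<in> ?S" using S(3) by (rule image_eqI)
  then have "x \<in> core ?S" by (rule minimal [OF sub proper_conjg [OF H_inv [OF h(1)] S(2)]])
  then have "conjg h x \<in> core (conjg h ` ?S)" by (rule conjg_core [OF sub hc(1)])
  then show ?thesis by (simp only: conjg_image_cancel(2) [OF hc(1) Sc] h(2))
qed

lemma C_not_core:
  assumes "c \<in> C"
  shows "c \<notin> core H"
proof
  assume a: "c \<in> core H"
  obtain h where h: "h \<in> H" "c = conjg h x" using assms unfolding C_def by (rule imageE)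
  have "conjg (inv h) c \<in> core H" by (rule core_conjg [OF H H_inv [OF h(1)] a])
  then show False using h x_core H_carrier x_carrier by simp
qed

lemma maxsubD: "maxsub M \<Longrightarrow> subgroup M G" "maxsub M \<Longrightarrow> M \<subset> H"
  "maxsub M \<Longrightarrow> subgroup S G \<Longrightarrow> M \<subseteq> S \<Longrightarrow> S \<subset> H \<Longrightarrow> S = M"
  by (simp_all add: maxsub_def)

lemma finite_proper: "finite {T. subgroup T G \<and> T \<subset> H}"
  by (rule finite_subset [of _ "Pow H"]) (use subgroup_finite [OF H] in auto)

lemma maxsub_exists:
  assumes "subgroup S G" "S \<subset> H"
  obtains M where "maxsub M" "S \<subseteq> M"
proof -
  have "S \<in> {T. subgroup T G \<and> T \<subset> H}" using assms by simp
  from finite_has_maximal2 [OF finite_proper this]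
  obtain M where M: "M \<in> {T. subgroup T G \<and> T \<subset> H}" "S \<subseteq> M"
    "\<forall>T\<in>{T. subgroup T G \<and> T \<subset> H}. M \<subseteq> T \<longrightarrow> M = T" by blast
  then have "maxsub M" by (auto simp: maxsub_def)
  then show ?thesis using M(2) that by blast
qed

abbreviation nmz :: "'a set \<Rightarrow> 'a set" where "nmz A \<equiv> {h \<in> H. conjg h ` A = A}"

text \<open>Otherwise \<open>A\<close> would be a normal p-subgroup of \<open>H\<close>, and c would
  lie in \<open>core H\<close>.\<close>

lemma nmz_proper:
  assumes A: "subgroup A G" "A \<subseteq> H" "A \<subseteq> Gp" and c: "c \<in> C" "c \<in> A"
  shows "nmz A \<subset> H"
proof (rule psubsetI)
  show "nmz A \<noteq> H"
  proof
    assume eq: "nmz A = H"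
    have "pnormal A H" unfolding pnormal_def
    proof (intro conjI A ballI)
      fix s n assume "s \<in> H" "n \<in> A"
      then have "s \<in> nmz A" using eq by simp
      then have "conjg s ` A = A" by simp
      then show "conjg s n \<in> A" using \<open>n \<in> A\<close> by (metis imageI)
    qed
    then have "c \<in> core H" using c(2) pnormal_subset_core by blast
    then show False using C_not_core [OF c(1)] by simp
  qed
qed auto

text \<open>This is how minimality is used: conjugates of \<open>x\<close> inside a proper subgroup
  generate a p-group, where normalizers grow.\<close>

lemma generate_core:
  assumes S: "subgroup S G" "S \<subset> H" and D: "D \<subseteq> C" "D \<subseteq> S"
  shows "generate G D \<subseteq> core S"
proof (rule generate_subgroup_incl [OF _ core_subgroup [OF S(1)]])
  show "D \<subseteq> core S" using C_core [OF _ S] D by blast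
qed

text \<open>The conjugates in \<open>M\<close> generate a p-group \<open>B\<close> containing
  \<open>A\<close>. If they all lay in \<open>A\<close>, then \<open>A = B\<close> would be
  normalized by \<open>M\<close>, giving \<open>M \<subseteq> M'\<close> and so equality. Otherwise
  some conjugate in \<open>B\<close> outside \<open>A\<close> normalizes \<open>A\<close>, and hence
  lies in \<open>M'\<close>.\<close>

lemma zipper_step:
  assumes M: "maxsub M" and M': "maxsub M'" "M \<noteq> M'"
    and A: "subgroup A G" "A \<subseteq> M" "A = generate G (C \<inter> A)" "nmz A \<subseteq> M'"
  shows "\<exists>c. c \<in> C \<and> c \<in> M \<and> c \<in> M' \<and> c \<notin> A"
proof -
  have MG: "subgroup M G" and MH: "M \<subset> H" using M by (auto dest: maxsubD)
  have CH: "C \<subseteq> H" using C_H by blast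
  have Hc: "H \<subseteq> carrier G" using H by (rule subgroup.subset)
  define B where "B = generate G (C \<inter> M)"
  have CM: "C \<inter> M \<subseteq> carrier G" using CH Hc by blast
  have BG: "subgroup B G" unfolding B_def using CM by (rule generate_is_subgroup)
  have "B \<subseteq> core M" unfolding B_def by (rule generate_core [OF MG MH]) auto
  then have BM: "B \<subseteq> M" and BGp: "B \<subseteq> Gp" using core_subset [OF MG] core_Gp [OF MG] by auto
  have CB: "C \<inter> M \<subseteq> B" unfolding B_def by (auto intro: generate.incl)
  have AB: "A \<subseteq> B"
    by (subst A(3)) (rule generate_subgroup_incl [OF _ BG], use A(2) CB in blast)
  have nB: "\<not> C \<inter> B \<subseteq> A"
  proof
    assume "C \<inter> B \<subseteq> A"
    then have "C \<inter> M \<subseteq> A" using CB by blast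
    then have "B \<subseteq> A" unfolding B_def by (rule generate_subgroup_incl [OF _ A(1)])
    then have eq: "A = generate G (C \<inter> M)" using AB B_def by simp
    have "M \<subseteq> nmz A"
    proof
      fix m assume m: "m \<in> M"
      then have mH: "m \<in> H" using MH by blast
      have "conjg m ` generate G (C \<inter> M) = generate G (C \<inter> M)"
      proof (rule generate_normalized [OF H_carrier [OF mH] CM fin])
        fix s assume "s \<in> C \<inter> M"
        then show "conjg m s \<in> C \<inter> M" using C_conjg [of s m] mH conjg_in_subgroup [OF MG m] by simp
      qed
      then show "m \<in> nmz A" using mH eq by simp
    qed
    then have "M \<subseteq> M'" using A(4) by (rule subset_trans)
    then have "M' = M" by (rule maxsubD(3) [OF M maxsubD(1) [OF M'(1)] _ maxsubD(2) [OF M'(1)]])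
    then show False using M'(2) by simp
  qed
  \<comment> \<open>The normalizer of \<open>A\<close> in \<open>B\<close> is larger than
    \<open>A\<close> but might contain no new conjugate of \<open>x\<close>. Taking T maximal
    without new conjugates forces its normalizer to contain one; that conjugate preserves
    \<open>C \<inter> T = C \<inter> A\<close>, and therefore \<open>A\<close>.\<close>
  define F where "F = {T. subgroup T G \<and> A \<subseteq> T \<and> T \<subseteq> B \<and> C \<inter> T \<subseteq> A}"
  have finF: "finite F" unfolding F_def
    by (rule finite_subset [of _ "Pow B"]) (use subgroup_finite [OF BG] in auto)
  have AF: "A \<in> F" unfolding F_def using A(1) AB by auto
  obtain T where T: "T \<in> F" "\<forall>U\<in>F. T \<subseteq> U \<longrightarrow> T = U"
    using finite_has_maximal2 [OF finF AF] by (elim bexE conjE)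
  have TG: "subgroup T G" and AT: "A \<subseteq> T" and TB: "T \<subseteq> B" and CT: "C \<inter> T \<subseteq> A"
    using T(1) by (auto simp: F_def)
  have "T \<noteq> B" using CT nB by blast
  then have "T \<subset> B" using TB by blast
  from normalizer_grows [OF TG BG BGp this]
  obtain b where b: "b \<in> B" "b \<notin> T" "conjg b ` T = T" by blast
  define U where "U = {h \<in> B. conjg h ` T = T}"
  have Tc: "T \<subseteq> carrier G" using TG by (rule subgroup.subset)
  have UG: "subgroup U G" unfolding U_def by (rule subgroup_normalizing [OF BG Tc])
  have TU: "T \<subseteq> U"
  proof
    fix t assume t: "t \<in> T"
    have "conjg t ` T = T" using TG t by (rule conjg_image_self)
    then show "t \<in> U" unfolding U_def using t TB by blast
  qed
  have "U \<notin> F"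
  proof
    assume "U \<in> F"
    then have "T = U" by (rule T(2) [rule_format, OF _ TU])
    moreover have "b \<in> U" unfolding U_def using b by simp
    ultimately show False using b(2) by simp
  qed
  moreover have "A \<subseteq> U" using AT TU by (rule subset_trans)
  moreover have UB: "U \<subseteq> B" unfolding U_def by blast
  ultimately have "\<not> C \<inter> U \<subseteq> A" unfolding F_def using UG by simp
  then obtain c where c: "c \<in> C" "c \<in> U" "c \<notin> A" by blast
  have cH: "c \<in> H" using c(1) by (rule C_H)
  have CTA: "C \<inter> T = C \<inter> A" using CT AT by blast
  have cT: "conjg c ` T = T" using c(2) by (simp add: U_def)
  have "conjg c ` generate G (C \<inter> A) = generate G (C \<inter> A)"
  proof (rule generate_normalized [OF H_carrier [OF cH] _ fin])
    show "C \<inter> A \<subseteq> carrier G" using CH Hc by blast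
    fix s assume "s \<in> C \<inter> A"
    then have s: "s \<in> C" "s \<in> T" using AT by auto
    have "conjg c s \<in> T" using imageI [OF s(2), of "conjg c"] cT by simp
    then show "conjg c s \<in> C \<inter> A" using CTA C_conjg [OF s(1) cH] by blast
  qed
  then have "c \<in> nmz A" using A(3) cH by simp
  then have "c \<in> M'" using A(4) by blast
  moreover have "c \<in> M" using c(2) UB BM by blast
  ultimately show ?thesis using c by blast
qed

text \<open>A counterexample with \<open>card (C \<inter> M1 \<inter> M2)\<close> maximal is improved by passing to a maximal subgroup that
  contains the normalizer of the subgroup generated by \<open>C \<inter> M1 \<inter> M2\<close>.\<close>

theorem unique_maxsub:
  assumes "maxsub M1" "maxsub M2" "c \<in> C" "c \<in> M1" "c \<in> M2"
  shows "M1 = M2"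
proof (rule ccontr)
  assume "M1 \<noteq> M2"
  define P where "P = {(M, N). maxsub M \<and> maxsub N \<and> M \<noteq> N}"
  define f where "f = (\<lambda>(M, N). card (C \<inter> M \<inter> N))"
  have "P \<subseteq> {T. subgroup T G \<and> T \<subset> H} \<times> {T. subgroup T G \<and> T \<subset> H}"
    unfolding P_def using maxsubD(1,2) by auto
  then have finP: "finite P" using finite_proper finite_cartesian_product finite_subset by metis
  have P12: "(M1, M2) \<in> P" unfolding P_def using assms \<open>M1 \<noteq> M2\<close> by simp
  then have "Max (f ` P) \<in> f ` P" using finP by (intro Max_in) auto
  then obtain M N where MN: "(M, N) \<in> P" "f (M, N) = Max (f ` P)" by (metis (no_types, lifting) imageE surj_pair)
  have max: "f (S, T) \<le> f (M, N)" if "(S, T) \<in> P" for S T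
    unfolding MN(2) using finP that by (intro Max_ge) auto
  have M: "maxsub M" and N: "maxsub N" and ne: "M \<noteq> N" using MN(1) by (auto simp: P_def)
  have MG: "subgroup M G" and NG: "subgroup N G" and MH: "M \<subset> H" and NH: "N \<subset> H"
    using M N maxsubD by auto
  have finC: "finite C" unfolding C_def using subgroup_finite [OF H] by simp
  have "c \<in> C \<inter> M1 \<inter> M2" using assms by simp
  then have "0 < f (M1, M2)" unfolding f_def using finC by (auto simp: card_gt_0_iff)
  then have "0 < f (M, N)" using max [OF P12] by linarith
  then have "C \<inter> M \<inter> N \<noteq> {}" unfolding f_def by (auto simp: card_gt_0_iff)
  then obtain d where d: "d \<in> C" "d \<in> M" "d \<in> N" by blast
  define A where "A = generate G (C \<inter> M \<inter> N)"
  have CMN: "C \<inter> M \<inter> N \<subseteq> carrier G" using C_H H_carrier by blast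
  have AG: "subgroup A G" unfolding A_def using CMN by (rule generate_is_subgroup)
  have CA: "C \<inter> M \<inter> N \<subseteq> A" unfolding A_def by (auto intro: generate.incl)
  have AM: "A \<subseteq> M" unfolding A_def by (rule generate_subgroup_incl [OF _ MG]) auto
  have AN: "A \<subseteq> N" unfolding A_def by (rule generate_subgroup_incl [OF _ NG]) auto
  have "A \<subseteq> core M" unfolding A_def by (rule generate_core [OF MG MH]) auto
  then have AGp: "A \<subseteq> Gp" using core_Gp [OF MG] by (rule subset_trans)
  have CA_eq: "C \<inter> A = C \<inter> M \<inter> N" using CA AM AN by blast
  have A_gen: "A = generate G (C \<inter> A)" unfolding CA_eq by (rule A_def)
  have dA: "d \<in> A" using d CA by blast
  have AH: "A \<subseteq> H" using AM MH by blast
  have "nmz A \<subset> H" by (rule nmz_proper [OF AG AH AGp d(1) dA])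
  moreover have "subgroup (nmz A) G" by (rule subgroup_normalizing [OF H subgroup.subset [OF AG]])
  ultimately obtain L where L: "maxsub L" "nmz A \<subseteq> L" using maxsub_exists by metis
  have AL: "A \<subseteq> L"
  proof
    fix a assume a: "a \<in> A"
    have "conjg a ` A = A" using AG a by (rule conjg_image_self)
    then have "a \<in> nmz A" using a AH by blast
    then show "a \<in> L" using L(2) by blast
  qed
  \<comment> \<open>At least one of \<open>M\<close> and \<open>N\<close> differs from
    \<open>L\<close>; by \<open>zipper_step\<close> it meets \<open>L\<close> in more conjugates
    than \<open>M\<close> meets \<open>N\<close>, against the choice of the pair.\<close>
  have contra: False if Q: "maxsub Q" "Q \<noteq> L" "A \<subseteq> Q" for Q
  proof -
    obtain e where e: "e \<in> C" "e \<in> Q" "e \<in> L" "e \<notin> A"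
      using zipper_step [OF Q(1) L(1) Q(2) AG Q(3) A_gen L(2)] by blast
    have "C \<inter> A \<subset> C \<inter> Q \<inter> L" using AL Q(3) e by blast
    then have "card (C \<inter> A) < card (C \<inter> Q \<inter> L)" using finC by (intro psubset_card_mono) auto
    then have "f (M, N) < f (Q, L)" unfolding f_def CA_eq by simp
    moreover have "(Q, L) \<in> P" unfolding P_def using Q L by simp
    ultimately show False using max by fastforce
  qed
  show False
  proof (cases "M = L")
    case True
    then show False using contra [OF N _ AN] ne by simp
  next
    case False
    then show False by (rule contra [OF M _ AM])
  qed
qed

text \<open>By maximality the normalizer of \<open>M\<close> is \<open>M\<close> or
  \<open>H\<close>. If it were \<open>H\<close>, then \<open>core M\<close> would be a normal
  p-subgroup of \<open>H\<close> containing c.\<close>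

lemma self_normalizing:
  assumes M: "maxsub M" and c: "c \<in> C" "c \<in> M" and h: "h \<in> H" "conjg h ` M = M"
  shows "h \<in> M"
proof -
  have MG: "subgroup M G" and MH: "M \<subset> H" using M by (auto dest: maxsubD)
  have Mc: "M \<subseteq> carrier G" using MG by (rule subgroup.subset)
  have sub: "subgroup (nmz M) G" by (rule subgroup_normalizing [OF H Mc])
  have M_nmz: "M \<subseteq> nmz M"
  proof
    fix m assume m: "m \<in> M"
    have "conjg m ` M = M" using MG m by (rule conjg_image_self)
    then show "m \<in> nmz M" using m MH by blast
  qed
  have "nmz M \<noteq> H"
  proof
    assume eq: "nmz M = H"
    have "pnormal (core M) H" unfolding pnormal_def
    proof (intro conjI ballI core_subgroup [OF MG] core_Gp [OF MG])
      show "core M \<subseteq> H" using core_subset [OF MG] MH by blast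
      fix s n assume s: "s \<in> H" and n: "n \<in> core M"
      have "s \<in> nmz M" using s eq by simp
      then have "conjg s ` M = M" by simp
      then show "conjg s n \<in> core M" using conjg_core [OF MG H_carrier [OF s] n] by simp
    qed
    then have "c \<in> core H" using pnormal_subset_core C_core [OF c(1) MG MH c(2)] by blast
    then show False using C_not_core [OF c(1)] by simp
  qed
  then have "nmz M \<subset> H" by blast
  then have "nmz M = M" by (rule maxsubD(3) [OF M sub M_nmz])
  then show ?thesis using h by blast
qed

lemma maxsub_conjg:
  assumes M: "maxsub M" and h: "h \<in> H"
  shows "maxsub (conjg h ` M)"
proof -
  have MG: "subgroup M G" and MH: "M \<subset> H" using M by (auto dest: maxsubD)
  have hc: "h \<in> carrier G" "inv h \<in> carrier G" using H_carrier [OF h] by auto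
  have "S = conjg h ` M" if S: "subgroup S G" "conjg h ` M \<subseteq> S" "S \<subset> H" for S
  proof -
    have Sc: "S \<subseteq> carrier G" using S(1) by (rule subgroup.subset)
    have "conjg (inv h) ` conjg h ` M \<subseteq> conjg (inv h) ` S" using S(2) by (rule image_mono)
    then have "M \<subseteq> conjg (inv h) ` S"
      by (simp only: conjg_image_cancel(1) [OF hc(1) subgroup.subset [OF MG]])
    then have "conjg (inv h) ` S = M"
      using subgroup_conjg_image [OF S(1) hc(2)] proper_conjg [OF H_inv [OF h] S(3)]
      by (intro maxsubD(3) [OF M])
    then have "conjg h ` conjg (inv h) ` S = conjg h ` M" by (rule arg_cong)
    then show ?thesis by (simp only: conjg_image_cancel(2) [OF hc(1) Sc])
  qed
  then show ?thesis
    unfolding maxsub_def using subgroup_conjg_image [OF MG hc(1)] proper_conjg [OF h MH] by blast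
qed

text \<open>The cyclic group generated by \<open>x\<close> is proper: a p-group coincides with its
  \<open>core\<close>, and \<open>x\<close> is not in \<open>core H\<close>.\<close>

lemma exists_maxsub:
  obtains M where "maxsub M" "x \<in> M"
proof -
  have sub: "subgroup (generate G {x}) G" using x_carrier by (intro generate_is_subgroup) simp
  have "generate G {x} \<subseteq> Gp"
    using generate_pow_on_finite_carrier [OF fin x_carrier] pow_Gp [OF xGp] by auto
  then have "generate G {x} \<noteq> H" using core_p_group [OF H] x_core xH by auto
  moreover have "generate G {x} \<subseteq> H" using xH by (intro generate_subgroup_incl [OF _ H]) simp
  ultimately have "generate G {x} \<subset> H" by blast
  from maxsub_exists [OF sub this] obtain M where "maxsub M" "generate G {x} \<subseteq> M" .
  moreover have "x \<in> generate G {x}" by (rule generate.incl) simp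
  ultimately show ?thesis using that by blast
qed

text \<open>A conjugate \<open>M'\<close> of \<open>M\<close> other than \<open>M\<close> does not
  contain \<open>x\<close>, by \<open>unique_maxsub\<close>, nor any power of \<open>x\<close> with
  exponent prime to \<open>p\<close>. Since \<open>M'\<close> is self-normalizing, its conjugates by
  \<open>x [^] i\<close> for i < p are distinct; none is \<open>M\<close>, which \<open>x\<close>
  normalizes.\<close>

lemma exists_conjugates:
  assumes M: "maxsub M" "x \<in> M"
  obtains r :: "nat \<Rightarrow> 'a" and h where
    "\<And>i. i \<le> p \<Longrightarrow> r i \<in> H"
    "\<And>i j. i \<le> p \<Longrightarrow> j \<le> p \<Longrightarrow> conjg (r i) ` M = conjg (r j) ` M \<Longrightarrow> i = j"
    "h \<in> H" "x \<notin> conjg h ` M"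
proof -
  have MG: "subgroup M G" and MH: "M \<subset> H" using M by (auto dest: maxsubD)
  have Mc: "M \<subseteq> carrier G" using MG by (rule subgroup.subset)
  obtain h where h: "h \<in> H" "h \<notin> M" using MH by blast
  have hc: "h \<in> carrier G" using h(1) by (rule H_carrier)
  define M' where "M' = conjg h ` M"
  have ne: "M' \<noteq> M"
    unfolding M'_def using self_normalizing [OF M(1) x_C M(2) h(1)] h(2) by blast
  have M': "maxsub M'" unfolding M'_def by (rule maxsub_conjg [OF M(1) h(1)])
  have M'G: "subgroup M' G" using M' by (rule maxsubD)
  have M'c: "M' \<subseteq> carrier G" using M'G by (rule subgroup.subset)
  have xM': "x \<notin> M'" using unique_maxsub [OF M(1) M' x_C M(2)] ne by blast
  have cM': "conjg h x \<in> C" "conjg h x \<in> M'" using h(1) M(2) by (simp_all add: C_def M'_def)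
  have xpow: "x [^] (i::nat) \<in> H" "x [^] i \<in> M" for i
    by (induction i) (use subgroup.one_closed [OF H] subgroup.m_closed [OF H _ xH]
        subgroup.one_closed [OF MG] subgroup.m_closed [OF MG _ M(2)] in auto)
  have xc: "x [^] (i::nat) \<in> carrier G" for i using x_carrier by simp
  have eq1: "i = j" if ij: "i \<le> j" "j < p" "conjg (x [^] i) ` M' = conjg (x [^] j) ` M'" for i j :: nat
  proof (rule ccontr)
    assume "i \<noteq> j"
    have "x [^] j = x [^] i \<otimes> x [^] (j - i)" using ij(1) x_carrier by (simp add: nat_pow_mult)
    then have "conjg (x [^] i) ` conjg (x [^] (j - i)) ` M' = conjg (x [^] i) ` M'"
      using ij(3) conjg_image_conjg_image [OF xc xc M'c, of i "j - i"] by simp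
    then have "conjg (inv (x [^] i)) ` conjg (x [^] i) ` conjg (x [^] (j - i)) ` M'
        = conjg (inv (x [^] i)) ` conjg (x [^] i) ` M'" by (rule arg_cong)
    moreover have "conjg (x [^] (j - i)) ` M' \<subseteq> carrier G" using xc M'c by auto
    ultimately have "conjg (x [^] (j - i)) ` M' = M'"
      by (simp only: conjg_image_cancel(1) [OF xc] M'c)
    then have "x [^] (j - i) \<in> M'" by (rule self_normalizing [OF M' cM' xpow(1)])
    moreover have "\<not> p dvd j - i" using ij \<open>i \<noteq> j\<close> by (auto dest: dvd_imp_le)
    ultimately show False using pow_mem_imp_mem [OF xGp _ M'G] xM' by blast
  qed
  have eq2: "conjg (x [^] i) ` M' \<noteq> M" for i :: nat
  proof
    assume eq: "conjg (x [^] i) ` M' = M"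
    have "conjg (x [^] i) ` M = M" using MG xpow(2) by (rule conjg_image_self)
    then have "conjg (inv (x [^] i)) ` conjg (x [^] i) ` M' = conjg (inv (x [^] i)) ` conjg (x [^] i) ` M"
      using eq by simp
    then show False using ne by (simp only: conjg_image_cancel(1) [OF xc] M'c Mc)
  qed
  \<comment> \<open>The index p stands for \<open>M\<close> itself, the indices below it for the
    conjugates of \<open>M'\<close>.\<close>
  define r where "r i = (if i = p then \<one> else x [^] i \<otimes> h)" for i
  have rM: "conjg (r i) ` M = (if i = p then M else conjg (x [^] i) ` M')" for i
    unfolding r_def M'_def using conjg_image_conjg_image [OF xc hc Mc] conjg_image_one [OF Mc] by simp
  show ?thesis
  proof (rule that [of r h])
    show "r i \<in> H" if "i \<le> p" for i
      unfolding r_def using subgroup.one_closed [OF H] subgroup.m_closed [OF H xpow(1) h(1)] by simp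
    show "i = j" if ij: "i \<le> p" "j \<le> p" "conjg (r i) ` M = conjg (r j) ` M" for i j
    proof (cases "i = p \<or> j = p")
      case True
      then show ?thesis using ij(3) eq2 unfolding rM by (metis (full_types))
    next
      case False
      then have "conjg (x [^] i) ` M' = conjg (x [^] j) ` M'" "i < p" "j < p"
        using ij unfolding rM by auto
      then show ?thesis using eq1 [of i j] eq1 [of j i] by (cases "i \<le> j") auto
    qed
    show "h \<in> H" "x \<notin> conjg h ` M" using h xM' by (simp_all add: M'_def)
  qed
qed

section \<open>Counting the p-elements that commute with x\<close>

definition Y :: "'a set" where "Y = {y \<in> Gp. \<forall>h\<in>H. h \<otimes> y = y \<otimes> h}"

definition D :: "'a set" where "D = {y \<in> Gp. y \<otimes> x = x \<otimes> y}"

definition Z :: "'a set" where "Z = {z \<in> H. \<forall>h\<in>H. h \<otimes> z = z \<otimes> h}"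

lemma conjg_Y: "v \<in> Y \<Longrightarrow> h \<in> H \<Longrightarrow> conjg h v = v"
  using conjg_fix_iff [OF H_carrier, of h v] Gp_carrier by (simp add: Y_def)

lemma subgroup_commuting:
  assumes v: "v \<in> carrier G"
  shows "subgroup {h \<in> H. h \<otimes> v = v \<otimes> h} G"
proof -
  have "{h \<in> H. h \<otimes> v = v \<otimes> h} = {h \<in> H. conjg h ` {v} = {v}}"
    using conjg_fix_iff [OF H_carrier v] by auto
  then show ?thesis using subgroup_normalizing [OF H, of "{v}"] v by simp
qed

text \<open>The map \<open>(i, y) \<mapsto> conjg (r i) y\<close> is injective: the centralizer in \<open>H\<close> of the value lies in a maximal
  subgroup, which can only be \<open>conjg (r i) ` M\<close>.\<close>

lemma card_commuting_outside:
  "(p + 1) * card (D - Y) \<le> card (Gp - Y)"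
proof -
  obtain M where M: "maxsub M" "x \<in> M" by (rule exists_maxsub)
  obtain r :: "nat \<Rightarrow> 'a" where r: "\<And>i. i \<le> p \<Longrightarrow> r i \<in> H"
    "\<And>i j. i \<le> p \<Longrightarrow> j \<le> p \<Longrightarrow> conjg (r i) ` M = conjg (r j) ` M \<Longrightarrow> i = j"
    by (rule exists_conjugates [OF M]) blast
  have rc: "r i \<in> carrier G" if "i \<le> p" for i using r(1) [OF that] by (rule H_carrier)
  let ?f = "\<lambda>(i, y). conjg (r i) y"
  have notY: "conjg (r i) y \<notin> Y" if "i \<le> p" "y \<in> Gp" "y \<notin> Y" for i y
  proof
    assume v: "conjg (r i) y \<in> Y"
    have "conjg (inv (r i)) (conjg (r i) y) = conjg (r i) y"
      by (rule conjg_Y [OF v H_inv [OF r(1) [OF that(1)]]])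
    then have "y = conjg (r i) y" using rc [OF that(1)] Gp_carrier [OF that(2)] by simp
    then show False using v that(3) by simp
  qed
  have "inj_on ?f ({..p} \<times> (D - Y))"
  proof (rule inj_onI, unfold split_paired_all)
    fix i y j y'
    assume "(i, y) \<in> {..p} \<times> (D - Y)" "(j, y') \<in> {..p} \<times> (D - Y)" "?f (i, y) = ?f (j, y')"
    then have ij: "i \<in> {..p}" "j \<in> {..p}" and y: "y \<in> D" "y \<notin> Y" and y': "y' \<in> D" "y' \<notin> Y"
      and eq: "conjg (r i) y = conjg (r j) y'" by simp_all
    define v where "v = conjg (r i) y"
    have yc: "y \<in> Gp" "y' \<in> Gp" using y y' by (simp_all add: D_def)
    have yG: "y \<in> carrier G" "y' \<in> carrier G" using yc Gp_carrier by auto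
    have i: "i \<le> p" and j: "j \<le> p" using ij by auto
    have vY: "v \<notin> Y" unfolding v_def by (rule notY [OF i yc(1) y(2)])
    have vG: "v \<in> Gp" unfolding v_def by (rule conjg_Gp [OF rc [OF i] yc(1)])
    have vc: "v \<in> carrier G" using vG by (rule Gp_carrier)
    define S where "S = {h \<in> H. h \<otimes> v = v \<otimes> h}"
    have SG: "subgroup S G" unfolding S_def by (rule subgroup_commuting [OF vc])
    have "S \<noteq> H" using vY vG unfolding S_def Y_def by blast
    then have "S \<subset> H" unfolding S_def by blast
    from maxsub_exists [OF SG this] obtain L where L: "maxsub L" "S \<subseteq> L" .
    have comm: "conjg g x \<in> S" if g: "g \<in> H" and u: "u \<in> D" and uv: "v = conjg g u" for g u
    proof -
      have gc: "g \<in> carrier G" using g by (rule H_carrier)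
      have uc: "u \<in> carrier G" and ux: "u \<otimes> x = x \<otimes> u" using u Gp_carrier by (auto simp: D_def)
      have "conjg g (x \<otimes> u) = conjg g (u \<otimes> x)" using ux by simp
      then have "conjg g x \<otimes> v = v \<otimes> conjg g x"
        unfolding uv by (simp only: conjg_mult gc uc x_carrier)
      moreover have "conjg g x \<in> H" by (rule conjg_in_subgroup [OF H g xH])
      ultimately show ?thesis by (simp add: S_def)
    qed
    have key: "conjg (r k) ` M = L" if k: "k \<le> p" and u: "u \<in> D" "v = conjg (r k) u" for k u
    proof (rule unique_maxsub [OF maxsub_conjg [OF M(1) r(1) [OF k]] L(1)])
      show "conjg (r k) x \<in> C" unfolding C_def using r(1) [OF k] by blast
      show "conjg (r k) x \<in> conjg (r k) ` M" using M(2) by blast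
      show "conjg (r k) x \<in> L" using comm [OF r(1) [OF k] u] L(2) by blast
    qed
    have "conjg (r i) ` M = L" by (rule key [OF i y(1) v_def])
    moreover have "conjg (r j) ` M = L" by (rule key [OF j y'(1)]) (simp only: v_def eq)
    ultimately have "i = j" using r(2) [OF i j] by simp
    then show "(i, y) = (j, y')" using eq conjg_eq_iff [OF rc [OF i] yG] by simp
  qed
  moreover have "?f ` ({..p} \<times> (D - Y)) \<subseteq> Gp - Y"
  proof (rule image_subsetI, unfold split_paired_all)
    fix i y assume "(i, y) \<in> {..p} \<times> (D - Y)"
    then have "i \<le> p" "y \<in> Gp" "y \<notin> Y" by (simp_all add: D_def)
    then show "?f (i, y) \<in> Gp - Y" using notY conjg_Gp rc by simp
  qed
  ultimately have "card ({..p} \<times> (D - Y)) \<le> card (Gp - Y)"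
    using finite_Gp by (intro card_inj_on_le) auto
  then show ?thesis by (simp add: card_cartesian_product)
qed

lemma subgroup_Z: "subgroup Z G"
proof -
  have "Z = (\<Inter>h\<in>H. {k \<in> H. k \<otimes> h = h \<otimes> k})"
    unfolding Z_def using subgroup.one_closed [OF H] by fastforce
  also have "subgroup \<dots> G"
    using subgroup.one_closed [OF H] subgroup_commuting H_carrier
    by (intro subgroups_Inter) auto
  finally show ?thesis .
qed

text \<open>z centralizes \<open>M\<close>, hence normalizes it.\<close>

lemma Z_maxsub:
  assumes "maxsub M" "c \<in> C" "c \<in> M" "z \<in> Z"
  shows "z \<in> M"
proof (rule self_normalizing [OF assms(1-3)])
  show zH: "z \<in> H" using assms(4) by (simp add: Z_def)
  have "conjg z m = m" if "m \<in> M" for m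
  proof -
    have "m \<in> H" using that maxsubD(2) [OF assms(1)] by blast
    then show ?thesis using assms(4) conjg_fix_iff [OF H_carrier [OF zH] H_carrier] by (simp add: Z_def)
  qed
  then show "conjg z ` M = M" by (simp add: image_def)
qed

text \<open>The elements \<open>\<one>\<close> and \<open>c\<^sub>i\<^sup>k\<close> with \<open>i \<le> p\<close>, \<open>0 < k < p\<close>, where \<open>c\<^sub>i = conjg (r i) x\<close>, are
  \<open>p\<^sup>2\<close> elements in different cosets of \<open>Z\<close>.\<close>

lemma card_central_le: "p ^ 2 * card Y \<le> card Gp"
proof -
  obtain M where M: "maxsub M" "x \<in> M" by (rule exists_maxsub)
  obtain r :: "nat \<Rightarrow> 'a" and h where r: "\<And>i. i \<le> p \<Longrightarrow> r i \<in> H"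
    "\<And>i j. i \<le> p \<Longrightarrow> j \<le> p \<Longrightarrow> conjg (r i) ` M = conjg (r j) ` M \<Longrightarrow> i = j"
    and h: "h \<in> H" "x \<notin> conjg h ` M"
    by (rule exists_conjugates [OF M]) blast
  have rc: "r i \<in> carrier G" if "i \<le> p" for i using r(1) [OF that] by (rule H_carrier)
  define c where "c i = conjg (r i) x" for i
  have cC: "c i \<in> C" if "i \<le> p" for i unfolding c_def C_def using r(1) [OF that] by blast
  have cH: "c i \<in> H" if "i \<le> p" for i by (rule C_H [OF cC [OF that]])
  have cc: "c i \<in> carrier G" if "i \<le> p" for i by (rule H_carrier [OF cH [OF that]])
  have cGp: "c i \<in> Gp" if "i \<le> p" for i unfolding c_def by (rule conjg_Gp [OF rc [OF that] xGp])
  have cM: "c i \<in> conjg (r i) ` M" for i unfolding c_def using M(2) by blast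
  have maxM: "maxsub (conjg (r i) ` M)" if "i \<le> p" for i by (rule maxsub_conjg [OF M(1) r(1) [OF that]])
  have MG: "subgroup (conjg (r i) ` M) G" if "i \<le> p" for i by (rule maxsubD(1) [OF maxM [OF that]])
  have pow_S: "u [^] (k::nat) \<in> S" if "subgroup S G" "u \<in> S" for u S k
    by (induction k) (use subgroup.one_closed [OF that(1)] subgroup.m_closed [OF that(1) _ that(2)] in auto)
  have cpH: "c i [^] (k::nat) \<in> H" if "i \<le> p" for i k by (rule pow_S [OF H cH [OF that]])
  have xZ: "x \<notin> Z"
  proof
    assume "x \<in> Z"
    moreover have "conjg h x \<in> C" using h(1) by (simp add: C_def)
    moreover have "conjg h x \<in> conjg h ` M" using M(2) by blast
    ultimately show False using Z_maxsub [OF maxsub_conjg [OF M(1) h(1)]] h(2) by blast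
  qed
  have cZ: "c i [^] k \<notin> Z" if i: "i \<le> p" and k: "0 < k" "k < p" for i k :: nat
  proof
    assume "c i [^] k \<in> Z"
    moreover have "\<not> p dvd k" using k by (auto dest: dvd_imp_le)
    ultimately have z: "c i \<in> Z" using pow_mem_imp_mem [OF cGp [OF i] _ subgroup_Z] by blast
    have "inv (r i) \<in> H" by (rule H_inv [OF r(1) [OF i]])
    then have "inv (r i) \<otimes> c i = c i \<otimes> inv (r i)" using z by (simp add: Z_def)
    then have "conjg (inv (r i)) (c i) = c i" using rc [OF i] cc [OF i] by (simp add: conjg_fix_iff)
    then have "x = c i" unfolding c_def using rc [OF i] x_carrier by simp
    then show False using z xZ by simp
  qed
  have less: "\<not> k < l" if i: "i \<le> p" and l: "l < p" and z: "z \<in> Z" "c i [^] l = z \<otimes> c i [^] k" for i k l :: nat and z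
  proof
    assume kl: "k < l"
    have zc: "z \<in> carrier G" using z(1) H_carrier by (simp add: Z_def)
    have "c i [^] (l - k) \<otimes> c i [^] k = z \<otimes> c i [^] k"
      using kl cc [OF i] z(2) by (simp add: nat_pow_mult)
    then have "c i [^] (l - k) = z" using cc [OF i] zc by simp
    moreover have "0 < l - k" "l - k < p" using kl l by linarith+
    ultimately show False using cZ [OF i] z(1) by blast
  qed
  \<comment> \<open>Central elements of \<open>H\<close> lie in every conjugate of \<open>M\<close>.
    So a power of \<open>c j\<close> lies in the i-th conjugate of \<open>M\<close>, then
    \<open>c j\<close> itself does, and \<open>unique_maxsub\<close> applies.\<close>
  have diff: "i = j" if ij: "i \<le> p" "j \<le> p" and l: "0 < l" "l < p" and z: "z \<in> Z" "c j [^] l = z \<otimes> c i [^] k"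
    for i j k l :: nat and z
  proof -
    have "z \<in> conjg (r i) ` M" by (rule Z_maxsub [OF maxM [OF ij(1)] cC [OF ij(1)] cM z(1)])
    then have "c j [^] l \<in> conjg (r i) ` M"
      unfolding z(2) by (rule subgroup.m_closed [OF MG [OF ij(1)] _ pow_S [OF MG [OF ij(1)] cM]])
    moreover have "\<not> p dvd l" using l by (auto dest: dvd_imp_le)
    ultimately have "c j \<in> conjg (r i) ` M"
      using pow_mem_imp_mem [OF cGp [OF ij(2)] _ MG [OF ij(1)]] by blast
    then have "conjg (r i) ` M = conjg (r j) ` M"
      by (rule unique_maxsub [OF maxM [OF ij(1)] maxM [OF ij(2)] cC [OF ij(2)] _ cM])
    then show ?thesis by (rule r(2) [OF ij])
  qed
  \<comment> \<open>Exponent 0 gives \<open>\<one>\<close> for every i, so only the pair (0, 0) is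
    kept; this makes 1 + (p + 1)(p - 1) pairs.\<close>
  define J where "J = insert (0, 0) ({..p} \<times> {1..<p})"
  have "card J = Suc ((p + 1) * (p - 1))" unfolding J_def by (simp add: card_cartesian_product)
  also have "\<dots> = p ^ 2"
    using p_gt_1 by (cases p) (simp_all add: power2_eq_square)
  finally have card_J: "card J = p ^ 2" .
  have J: "i \<le> p \<and> k < p \<and> (k = 0 \<longrightarrow> i = 0)" if "(i, k) \<in> J" for i k
    using that p_gt_1 by (auto simp: J_def)
  let ?f = "\<lambda>(y, i, k). y \<otimes> c i [^] (k::nat)"
  have Yc: "y \<in> carrier G" if "y \<in> Y" for y using that Gp_carrier by (simp add: Y_def)
  have "inj_on ?f (Y \<times> J)"
  proof (rule inj_onI, unfold split_paired_all)
    fix y i k y' j l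
    assume "(y, i, k) \<in> Y \<times> J" "(y', j, l) \<in> Y \<times> J" "?f (y, i, k) = ?f (y', j, l)"
    then have y: "y \<in> Y" and y': "y' \<in> Y" and ik: "(i, k) \<in> J" and jl: "(j, l) \<in> J"
      and eq: "y \<otimes> c i [^] k = y' \<otimes> c j [^] l" by simp_all
    have b: "i \<le> p" "k < p" "k = 0 \<Longrightarrow> i = 0" "j \<le> p" "l < p" "l = 0 \<Longrightarrow> j = 0" using J ik jl by auto
    have C: "c i [^] k \<in> carrier G" "c j [^] l \<in> carrier G" using cc b by simp_all
    \<comment> \<open>If two products agree, z is a quotient of powers of conjugates of
      \<open>x\<close>, hence in \<open>H\<close>, and also a quotient of elements of
      \<open>Y\<close>, hence central in \<open>H\<close>.\<close>
    define z where "z = inv y' \<otimes> y"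
    have zc: "z \<in> carrier G" unfolding z_def using Yc y y' by simp
    have z: "z \<otimes> c i [^] k = c j [^] l"
    proof -
      have "z \<otimes> c i [^] k = inv y' \<otimes> (y \<otimes> c i [^] k)" unfolding z_def using Yc y y' C by (simp add: m_assoc)
      then show ?thesis unfolding eq using Yc [OF y'] C by (simp add: inv_cancel)
    qed
    have "z = c j [^] l \<otimes> inv (c i [^] k)" using z zc C by (simp add: inv_solve_right)
    then have zH: "z \<in> H"
      using subgroup.m_closed [OF H cpH [OF b(4)] H_inv [OF cpH [OF b(1)]]] by simp
    have "h \<otimes> z = z \<otimes> h" if "h \<in> H" for h
    proof -
      have hc: "h \<in> carrier G" using that by (rule H_carrier)
      have "conjg h z = inv (conjg h y') \<otimes> conjg h y"
        unfolding z_def using Yc y y' hc by (simp add: conjg_mult conjg_inv)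
      also have "\<dots> = z" using conjg_Y [OF y that] conjg_Y [OF y' that] by (simp add: z_def)
      finally show ?thesis using hc zc by (simp add: conjg_fix_iff)
    qed
    then have zZ: "z \<in> Z" using zH by (simp add: Z_def)
    have izZ: "inv z \<in> Z" using subgroup_Z zZ by (rule subgroup.m_inv_closed)
    have z': "inv z \<otimes> c j [^] l = c i [^] k" using z zc C by (simp add: inv_cancel flip: z)
    have "i = j"
    proof (cases "l = 0")
      case True
      show ?thesis
      proof (cases "k = 0")
        case True
        then show ?thesis using b \<open>l = 0\<close> by simp
      next
        case False
        then show ?thesis using diff [OF b(4) b(1) _ b(2) izZ z' [symmetric]] by simp
      qed
    next
      case False
      then show ?thesis using diff [OF b(1) b(4) _ b(5) zZ z [symmetric]] by simp
    qed
    have "k = l"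
      using less [OF b(1) b(5) zZ, of k] less [OF b(1) b(2) izZ, of l] z z' \<open>i = j\<close> by (metis linorder_neqE_nat)
    have "y = y'" using eq Yc y y' C \<open>i = j\<close> \<open>k = l\<close> by simp
    with \<open>i = j\<close> \<open>k = l\<close> show "(y, i, k) = (y', j, l)" by simp
  qed
  moreover have "?f ` (Y \<times> J) \<subseteq> Gp"
  proof (rule image_subsetI, unfold split_paired_all)
    fix y i k assume "(y, i, k) \<in> Y \<times> J"
    then have y: "y \<in> Y" and ik: "(i, k) \<in> J" by simp_all
    have i: "i \<le> p" using J [OF ik] by simp
    have "c i [^] k \<otimes> y = y \<otimes> c i [^] k" using y cpH [OF i] by (simp add: Y_def)
    then have "y \<otimes> c i [^] k \<in> Gp"
      using y pow_Gp [OF cGp [OF i]] by (intro mult_Gp) (simp_all add: Y_def)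
    then show "?f (y, i, k) \<in> Gp" by simp
  qed
  ultimately have "card (Y \<times> J) \<le> card Gp" using finite_Gp by (intro card_inj_on_le)
  then show ?thesis by (simp add: card_cartesian_product card_J mult.commute)
qed

text \<open>\<open>D\<close> is split along \<open>Y\<close>, whose elements are fixed under
  conjugation by \<open>H\<close> and so escape the first count. With N = \<open>card Gp\<close> the
  two counts give p (p + 1) |D| <= p N + p^2 |Y| <= (p + 1) N. The second claim uses that
  \<open>\<one>\<close> lies in \<open>Y\<close>.\<close>

lemma card_commuting_le: "p * card D \<le> card Gp" and p_square_le: "p ^ 2 \<le> card Gp"
proof -
  have YD: "Y \<subseteq> D" unfolding Y_def D_def using xH by (auto simp: eq_commute)
  have DG: "D \<subseteq> Gp" unfolding D_def by blast
  have fin: "finite D" "finite Y" using YD DG finite_Gp finite_subset by metis+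
  have d: "card (D - Y) + card Y = card D" using card_Diff_subset [OF fin(2) YD] card_mono [OF fin(1) YD] by simp
  have n: "card (Gp - Y) + card Y = card Gp"
    using card_Diff_subset [OF fin(2), of Gp] card_mono [OF finite_Gp, of Y] YD DG by auto
  have "p * ((p + 1) * card (D - Y)) \<le> p * card (Gp - Y)"
    using card_commuting_outside by (rule mult_le_mono2)
  then have "p * (p + 1) * card D \<le> p * card (Gp - Y) + p * (p + 1) * card Y"
    unfolding d [symmetric] by (simp add: algebra_simps)
  also have "\<dots> = p * card Gp + p ^ 2 * card Y"
    unfolding n [symmetric] by (simp add: algebra_simps power2_eq_square)
  also have "\<dots> \<le> p * card Gp + card Gp" using card_central_le by simp
  finally have "(p + 1) * (p * card D) \<le> (p + 1) * card Gp" by (simp add: algebra_simps)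
  then show "p * card D \<le> card Gp" by (rule mult_left_le_imp_le) simp
  have "\<one> \<in> Y" unfolding Y_def using one_Gp H_carrier by simp
  then have "card Y > 0" using fin(2) by (auto simp: card_gt_0_iff)
  then have "card Y \<ge> 1" by simp
  then have "p ^ 2 * 1 \<le> p ^ 2 * card Y" by (intro mult_le_mono) auto
  then show "p ^ 2 \<le> card Gp" using card_central_le unfolding mult_1_right by (rule le_trans)
qed

end

section \<open>From the probability to the number of p-elements\<close>

context finite_group_prime begin

lemma noncore_bounds:
  assumes x: "x \<in> Gp" "x \<notin> core (carrier G)"
  shows "p * card {y \<in> Gp. y \<otimes> x = x \<otimes> y} \<le> card Gp" and "p ^ 2 \<le> card Gp"
proof -
  define F where "F = {S. subgroup S G \<and> x \<in> S \<and> x \<notin> core S}"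
  have finF: "finite F" unfolding F_def
    by (rule finite_subset [of _ "Pow (carrier G)"]) (use fin subgroup.subset in auto)
  have "carrier G \<in> F" unfolding F_def using x Gp_carrier subgroup_self by simp
  from finite_has_minimal2 [OF finF this]
  obtain H where H: "H \<in> F" "\<forall>S\<in>F. S \<subseteq> H \<longrightarrow> H = S" by (elim bexE conjE)
  interpret zipper G p H x
  proof (rule zipper.intro [OF finite_group_prime_axioms], rule zipper_axioms.intro)
    show "subgroup H G" "x \<in> H" "x \<in> Gp" "x \<notin> core H" using H(1) x(1) by (simp_all add: F_def)
    fix S assume S: "subgroup S G" "S \<subset> H" "x \<in> S"
    show "x \<in> core S"
    proof (rule ccontr)
      assume "x \<notin> core S"
      then have "S \<in> F" using S by (simp add: F_def)
      then have "H = S" using H(2) S(2) by (simp add: psubset_imp_subset)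
      then show False using S(2) by simp
    qed
  qed
  show "p * card {y \<in> Gp. y \<otimes> x = x \<otimes> y} \<le> card Gp" using card_commuting_le by (simp add: D_def)
  show "p ^ 2 \<le> card Gp" by (rule p_square_le)
qed

lemma normal_conjg_iff:
  "N \<lhd> G \<longleftrightarrow> subgroup N G \<and> (\<forall>g\<in>carrier G. \<forall>n\<in>N. conjg g n \<in> N)"
  by (simp add: normal_inv_iff conjg_def)

lemma group_center_eq_carrier: "group_center G = carrier G \<Longrightarrow> comm_group G"
  by (rule group_comm_groupI) (auto simp: group_center_def)

lemma p_group_center:
  assumes "carrier G = Gp" "p dvd order G"
  shows "group_center G \<noteq> {\<one>}"
proof
  assume c: "group_center G = {\<one>}"
  have "card (carrier G) mod p = card {x \<in> carrier G. \<forall>b\<in>carrier G. conjg b x = x} mod p"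
  proof (rule p_group_fixed_points [OF subgroup_self _ fin])
    show "carrier G \<subseteq> Gp" using assms(1) by simp
  qed (simp_all add: conjg_conj)
  also have "{x \<in> carrier G. \<forall>b\<in>carrier G. conjg b x = x} = group_center G"
    unfolding group_center_def by (auto simp: conjg_fix_iff)
  finally have "1 mod p = 0" using assms(2) by (simp add: c order_def)
  then show False using p_gt_1 by simp
qed

text \<open>If the largest normal p-subgroup were everything, the group would be a p-group with
  nontrivial center; by simplicity it would equal its center.\<close>

lemma simple_core:
  assumes s: "simple_group G" "\<not> comm_group G" and p: "p dvd order G"
  shows "core (carrier G) = {\<one>}"
proof -
  have pn: "pnormal (core (carrier G)) (carrier G)" by (rule pnormal_core [OF subgroup_self])
  then have "core (carrier G) \<lhd> G" unfolding normal_conjg_iff pnormal_def by simp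
  then consider "core (carrier G) = carrier G" | "core (carrier G) = {\<one>}"
    using simple_group.no_real_normal_subgroup [OF s(1)] by blast
  then show ?thesis
  proof cases
    case 1
    then have "carrier G = Gp" using core_Gp [OF subgroup_self] Gp_subset by simp
    then have "group_center G \<noteq> {\<one>}" using p by (rule p_group_center)
    then have "group_center G = carrier G"
      using simple_group.no_real_normal_subgroup [OF s(1) normal_group_center] by blast
    then show ?thesis using group_center_eq_carrier s(2) by simp
  qed
qed

lemma subgroup_pow_card:
  assumes S: "subgroup S G" and x: "x \<in> S"
  shows "x [^] card S = \<one>"
proof -
  interpret S: group "G\<lparr>carrier := S\<rparr>" using S by (rule subgroup.subgroup_is_group) (rule is_group)
  show ?thesis
    using S.pow_order_eq_1 [of x] x by (simp add: order_def nat_pow_consistent [symmetric])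
qed

lemma p_power_card_Gp:
  assumes S: "subgroup S G" "card S = p ^ k"
  shows "S \<subseteq> Gp"
proof
  fix x assume x: "x \<in> S"
  have "x [^] (p ^ k) = \<one>" using subgroup_pow_card [OF S(1) x] S(2) by simp
  then show "x \<in> Gp" unfolding Gp_iff using subgroup.mem_carrier [OF S(1) x] by blast
qed

lemma sylow_exists:
  assumes "p ^ k dvd order G"
  obtains S where "subgroup S G" "card S = p ^ k"
proof -
  obtain m where "order G = p ^ k * m" using assms by blast
  from sylow_thm [OF p_prime is_group this fin] show ?thesis using that by blast
qed

definition commuting :: "'a \<Rightarrow> 'a set" where "commuting x = {y \<in> Gp. y \<otimes> x = x \<otimes> y}"

lemma card_commuting_pairs:
  "card {(x, y). x \<in> Gp \<and> y \<in> Gp \<and> x \<otimes> y = y \<otimes> x} = (\<Sum>x\<in>Gp. card (commuting x))"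
proof -
  have "{(x, y). x \<in> Gp \<and> y \<in> Gp \<and> x \<otimes> y = y \<otimes> x} = Sigma Gp commuting"
    unfolding commuting_def by auto
  moreover have "finite (commuting x)" for x unfolding commuting_def using finite_Gp by simp
  ultimately show ?thesis using finite_Gp by (simp add: card_SigmaI)
qed

lemma Pr_p_eq: "Pr_p p G = real (\<Sum>x\<in>Gp. card (commuting x)) / real (card Gp) ^ 2"
  unfolding Pr_p_def card_commuting_pairs ..

lemma commuting_one: "commuting \<one> = Gp"
  unfolding commuting_def using Gp_carrier by auto

text \<open>Dividing \<open>le\<close> by P N^2 bounds S / N^2 by 1/P + (1 - 1/P)/N, which decreases
  in N and has the prescribed value at N = P^2.\<close>

lemma commuting_count_bound:
  fixes P N S :: real
  assumes P: "P > 1" and N: "N > 0" and S: "S / N ^ 2 = (P ^ 2 + P - 1) / P ^ 3"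
    and le: "P * S \<le> P * N + (N - 1) * N"
  shows "N \<le> P ^ 2"
proof -
  have "S * P ^ 3 = (P ^ 2 + P - 1) * N ^ 2" using S P N by (simp add: frac_eq_eq)
  then have "N * (N * (P ^ 2 + P - 1)) = P ^ 2 * (P * S)"
    by (simp add: power2_eq_square power3_eq_cube mult_ac)
  also have "\<dots> \<le> P ^ 2 * (P * N + (N - 1) * N)" using le by (rule mult_left_mono) simp
  also have "\<dots> = N * (P ^ 2 * (P + N - 1))" by (simp add: algebra_simps)
  finally have "N * (P ^ 2 + P - 1) \<le> P ^ 2 * (P + N - 1)" using N by simp
  then have "(P - 1) * N \<le> (P - 1) * P ^ 2" by (simp add: algebra_simps power2_eq_square)
  then show ?thesis using P by simp
qed

theorem card_Gp_eq:
  assumes s: "simple_group G" "\<not> comm_group G" and p: "p dvd order G"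
    and Pr: "Pr_p p G = (real p ^ 2 + real p - 1) / real p ^ 3"
  shows "card Gp = p ^ 2"
proof -
  let ?N = "card Gp"
  have core: "core (carrier G) = {\<one>}" by (rule simple_core [OF s p])
  have "p ^ 1 dvd order G" using p by simp
  then obtain S where S: "subgroup S G" "card S = p ^ 1" by (rule sylow_exists)
  have "S \<noteq> {\<one>}" using S(2) p_gt_1 by auto
  then obtain x where x: "x \<in> S" "x \<noteq> \<one>" using subgroup.one_closed [OF S(1)] by blast
  then have "x \<in> Gp" "x \<notin> core (carrier G)" using p_power_card_Gp [OF S] core by auto
  then have ge: "p ^ 2 \<le> ?N" by (rule noncore_bounds(2))
  then have pos: "?N > 0" using p_gt_1 by (metis gr0I le_0_eq power_not_zero not_one_less_zero)
  have "p * (\<Sum>x\<in>Gp. card (commuting x)) = p * ?N + (\<Sum>x\<in>Gp - {\<one>}. p * card (commuting x))"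
    using sum.remove [OF finite_Gp one_Gp, of "\<lambda>x. card (commuting x)"]
    by (simp add: commuting_one sum_distrib_left distrib_left)
  also have "(\<Sum>x\<in>Gp - {\<one>}. p * card (commuting x)) \<le> (\<Sum>x\<in>Gp - {\<one>}. ?N)"
  proof (rule sum_mono)
    fix x assume "x \<in> Gp - {\<one>}"
    then have "x \<in> Gp" "x \<notin> core (carrier G)" using core by auto
    then show "p * card (commuting x) \<le> ?N" unfolding commuting_def by (rule noncore_bounds(1))
  qed
  also have "(\<Sum>x\<in>Gp - {\<one>}. ?N) = (?N - 1) * ?N" using one_Gp finite_Gp by simp
  finally have le: "p * (\<Sum>x\<in>Gp. card (commuting x)) \<le> p * ?N + (?N - 1) * ?N" by simp
  let ?n = "real ?N" and ?p = "real p"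
  have n: "?n > 0" using pos by simp
  have p0: "?p > 1" using p_gt_1 by simp
  have "real (p * (\<Sum>x\<in>Gp. card (commuting x))) \<le> real (p * ?N + (?N - 1) * ?N)"
    using le by (rule of_nat_mono)
  then have le': "?p * real (\<Sum>x\<in>Gp. card (commuting x)) \<le> ?p * ?n + (?n - 1) * ?n"
    using pos by (simp add: of_nat_diff)
  have "?n \<le> ?p ^ 2"
    using commuting_count_bound [OF p0 n _ le'] Pr unfolding Pr_p_eq by blast
  then have "?N \<le> p ^ 2" by (metis of_nat_le_iff of_nat_power)
  then show ?thesis using ge by simp
qed

text \<open>A subgroup of order \<open>p ^ 2\<close> consists of p-elements, so it would be all of
  \<open>Gp\<close>, which is invariant under conjugation.\<close>

lemma p_square_not_dvd:
  assumes s: "simple_group G" "\<not> comm_group G" and p: "p dvd order G" and c: "card Gp = p ^ 2"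
  shows "\<not> p ^ 2 dvd order G"
proof
  assume "p ^ 2 dvd order G"
  then obtain S where S: "subgroup S G" "card S = p ^ 2" by (rule sylow_exists)
  then have "S = Gp" using p_power_card_Gp [OF S] c finite_Gp by (intro card_subset_eq) simp_all
  then have "pnormal Gp (carrier G)"
    unfolding pnormal_def using S(1) Gp_subset conjg_Gp by simp
  then have "Gp \<subseteq> {\<one>}" using pnormal_subset_core simple_core [OF s p] by blast
  then have "card Gp \<le> 1" using card_mono [of "{\<one>}" Gp] by simp
  then show False using c p_gt_1 by (metis not_less one_less_power pos2)
qed

end

section \<open>Sylow subgroups of prime order\<close>

locale cyclic_sylow = finite_group_prime +
  assumes p_dvd: "p dvd order G" and p2_dvd: "\<not> p ^ 2 dvd order G"
begin

text \<open>As \<open>p ^ 2\<close> does not divide the order, these are the Sylow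
  p-subgroups.\<close>

definition Syl :: "'a set set" where "Syl = {P. subgroup P G \<and> card P = p}"

lemma finite_Syl: "finite Syl"
  unfolding Syl_def by (rule finite_subset [of _ "Pow (carrier G)"]) (use fin subgroup.subset in auto)

lemma SylD: "P \<in> Syl \<Longrightarrow> subgroup P G" "P \<in> Syl \<Longrightarrow> card P = p" "P \<in> Syl \<Longrightarrow> P \<subseteq> carrier G"
  "P \<in> Syl \<Longrightarrow> \<one> \<in> P" "P \<in> Syl \<Longrightarrow> P \<subseteq> Gp"
  using subgroup.subset subgroup.one_closed p_power_card_Gp [of P 1] by (auto simp: Syl_def)

lemma Syl_nonempty: "Syl \<noteq> {}"
proof -
  have "p ^ 1 dvd order G" using p_dvd by simp
  then obtain S where "subgroup S G" "card S = p ^ 1" by (rule sylow_exists)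
  then have "S \<in> Syl" by (simp add: Syl_def)
  then show ?thesis by blast
qed

lemma Syl_conjg:
  assumes P: "P \<in> Syl" and g: "g \<in> carrier G"
  shows "conjg g ` P \<in> Syl"
  using subgroup_conjg_image [OF SylD(1) [OF P] g] card_conjg_image [OF g SylD(3) [OF P]] SylD(2) [OF P]
  by (simp add: Syl_def)

lemma ord_eq_p:
  assumes x: "x \<in> Gp" "x \<noteq> \<one>"
  shows "ord x = p"
proof -
  obtain m where m: "ord x = p ^ m" using x by (auto simp: p_elements_def)
  have xc: "x \<in> carrier G" using x(1) by (rule Gp_carrier)
  have "p ^ m dvd order G" using ord_dvd_group_order [OF xc] m by simp
  then have "\<not> 2 \<le> m" using p2_dvd le_imp_power_dvd dvd_trans by blast
  moreover have "m \<noteq> 0" using m x(2) ord_eq_1 [OF xc] by auto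
  ultimately have "m = 1" by simp
  then show ?thesis using m by simp
qed

lemma generate_Syl:
  assumes x: "x \<in> Gp" "x \<noteq> \<one>"
  shows "generate G {x} \<in> Syl" "generate G {x} = (\<lambda>i. x [^] i) ` {..<p}"
proof -
  have xc: "x \<in> carrier G" using x(1) by (rule Gp_carrier)
  have "card (generate G {x}) = p" using generate_pow_card [OF xc] ord_eq_p [OF x] by simp
  then show "generate G {x} \<in> Syl" unfolding Syl_def using generate_is_subgroup [of "{x}"] xc by simp
  have "generate G {x} = {x [^] k |k. k \<in> {0..ord x - 1}}"
    using generate_pow_on_finite_carrier [OF fin xc] ord_elems [OF fin xc] by simp
  also have "\<dots> = (\<lambda>i. x [^] i) ` {..<p}"
    using ord_eq_p [OF x] p_gt_1 by (auto simp: image_def) 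
  finally show "generate G {x} = (\<lambda>i. x [^] i) ` {..<p}" .
qed

lemma Syl_eq_generate:
  assumes P: "P \<in> Syl" and x: "x \<in> P" "x \<noteq> \<one>"
  shows "P = generate G {x}"
proof -
  have xG: "x \<in> Gp" using SylD(5) [OF P] x by blast
  have "generate G {x} \<subseteq> P" using x by (intro generate_subgroup_incl [OF _ SylD(1) [OF P]]) simp
  moreover have "card (generate G {x}) = card P" using generate_Syl(1) [OF xG x(2)] P SylD(2) by simp
  moreover have "finite P" using subgroup_finite SylD(1) [OF P] by blast
  ultimately show ?thesis using card_subset_eq by blast
qed

lemma Syl_inter:
  assumes "P \<in> Syl" "Q \<in> Syl" "x \<in> P" "x \<in> Q" "x \<noteq> \<one>"
  shows "P = Q"
  using Syl_eq_generate [OF assms(1,3,5)] Syl_eq_generate [OF assms(2,4,5)] by simp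

text \<open>If \<open>P\<close> normalized a different \<open>Q\<close>, the product of the two
  would be a subgroup of order \<open>p ^ 2\<close>.\<close>

lemma Syl_normalizing:
  assumes P: "P \<in> Syl" and Q: "Q \<in> Syl" and n: "\<And>a. a \<in> P \<Longrightarrow> conjg a ` Q = Q"
  shows "P = Q"
proof (rule ccontr)
  assume ne: "P \<noteq> Q"
  have PG: "subgroup P G" and QG: "subgroup Q G" and Pc: "P \<subseteq> carrier G" and Qc: "Q \<subseteq> carrier G"
    using P Q SylD by auto
  define S where "S = {s \<in> carrier G. conjg s ` Q = Q}"
  have SG: "subgroup S G" unfolding S_def by (rule subgroup_normalizing [OF subgroup_self Qc])
  interpret S: group "G\<lparr>carrier := S\<rparr>" using SG by (rule subgroup.subgroup_is_group) (rule is_group)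
  have PS: "P \<subseteq> S" unfolding S_def using n Pc by blast
  have QS: "Q \<subseteq> S"
  proof
    fix q assume q: "q \<in> Q"
    have "conjg q ` Q = Q" using QG q by (rule conjg_image_self)
    then show "q \<in> S" unfolding S_def using q Qc by blast
  qed
  define R where "R = (\<lambda>(a, b). a \<otimes> b) ` (P \<times> Q)"
  have R: "u \<in> R \<longleftrightarrow> (\<exists>a\<in>P. \<exists>b\<in>Q. u = a \<otimes> b)" for u unfolding R_def by auto
  have RI: "a \<otimes> b \<in> R" if "a \<in> P" "b \<in> Q" for a b using that R by blast
  have Qn: "conjg a b \<in> Q" if "a \<in> P" "b \<in> Q" for a b
    using n [OF that(1)] that(2) by (metis imageI)
  have "subgroup R G"
  proof (rule subgroupI)
    show "R \<subseteq> carrier G" using R Pc Qc by fastforce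
    show "R \<noteq> {}" unfolding R_def using SylD(4) [OF P] SylD(4) [OF Q] by auto
  next
    fix u assume "u \<in> R"
    then obtain a b where ab: "a \<in> P" "b \<in> Q" "u = a \<otimes> b" using R by blast
    have c: "a \<in> carrier G" "b \<in> carrier G" using ab Pc Qc by auto
    have "inv u = inv a \<otimes> conjg a (inv b)" using c ab(3) by (simp add: conjg_def inv_mult_group m_assoc inv_cancel)
    then show "inv u \<in> R"
      using RI [OF subgroup.m_inv_closed [OF PG ab(1)] Qn [OF ab(1) subgroup.m_inv_closed [OF QG ab(2)]]]
      by simp
  next
    fix u v assume "u \<in> R" "v \<in> R"
    then obtain a b a' b' where ab: "a \<in> P" "b \<in> Q" "u = a \<otimes> b" "a' \<in> P" "b' \<in> Q" "v = a' \<otimes> b'"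
      using R by blast
    have c: "a \<in> carrier G" "b \<in> carrier G" "a' \<in> carrier G" "b' \<in> carrier G" using ab Pc Qc by auto
    have ia: "inv a' \<in> P" by (rule subgroup.m_inv_closed [OF PG ab(4)])
    have "u \<otimes> v = (a \<otimes> a') \<otimes> (conjg (inv a') b \<otimes> b')"
      using c ab(3,6) by (simp add: conjg_def m_assoc inv_cancel)
    moreover have "a \<otimes> a' \<in> P" by (rule subgroup.m_closed [OF PG ab(1,4)])
    moreover have "conjg (inv a') b \<otimes> b' \<in> Q" by (rule subgroup.m_closed [OF QG Qn [OF ia ab(2)] ab(5)])
    ultimately show "u \<otimes> v \<in> R" using RI by simp
  qed
  moreover have "card R = p ^ 2"
  proof -
    have "inj_on (\<lambda>(a, b). a \<otimes> b) (P \<times> Q)"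
    proof (rule inj_onI, unfold split_paired_all)
      fix a b a' b' assume "(a, b) \<in> P \<times> Q" "(a', b') \<in> P \<times> Q" "(\<lambda>(a, b). a \<otimes> b) (a, b) = (\<lambda>(a, b). a \<otimes> b) (a', b')"
      then have ab: "a \<in> P" "b \<in> Q" "a' \<in> P" "b' \<in> Q" and eq: "a \<otimes> b = a' \<otimes> b'" by simp_all
      have c: "a \<in> carrier G" "b \<in> carrier G" "a' \<in> carrier G" "b' \<in> carrier G" using ab Pc Qc by auto
      have "inv a' \<otimes> a \<otimes> b = b'" using eq c by (simp add: m_assoc inv_cancel)
      then have z: "inv a' \<otimes> a = b' \<otimes> inv b" using c by (simp add: inv_solve_right)
      have "inv a' \<otimes> a \<in> P" "b' \<otimes> inv b \<in> Q"
        using ab PG QG subgroup.m_inv_closed subgroup.m_closed by metis+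
      then have "inv a' \<otimes> a = \<one>" using Syl_inter [OF P Q] ne z by metis
      then have "a' = a" using c by (metis inv_equality inv_inv inv_closed)
      moreover have "b = b'" using eq c \<open>a' = a\<close> by simp
      ultimately show "(a, b) = (a', b')" by simp
    qed
    then have "card R = card P * card Q" unfolding R_def by (simp add: card_image card_cartesian_product)
    then show ?thesis using SylD(2) P Q by (simp add: power2_eq_square)
  qed
  ultimately have "p ^ 2 dvd order G" using lagrange [of R] by (metis dvd_triv_right)
  then show False using p2_dvd by simp
qed

lemma Gp_Union: "Gp = \<Union>Syl"
proof
  show "\<Union>Syl \<subseteq> Gp" using SylD(5) by blast
  show "Gp \<subseteq> \<Union>Syl"
  proof
    fix x assume x: "x \<in> Gp"
    show "x \<in> \<Union>Syl"
    proof (cases "x = \<one>")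
      case True
      then show ?thesis using Syl_nonempty SylD(4) by blast
    next
      case False
      have "x \<in> generate G {x}" by (rule generate.incl) simp
      then show ?thesis using generate_Syl(1) [OF x False] by blast
    qed
  qed
qed

lemma card_Gp: "card Gp = 1 + card Syl * (p - 1)"
proof -
  have "Gp - {\<one>} = (\<Union>P\<in>Syl. P - {\<one>})" unfolding Gp_Union by blast
  also have "card \<dots> = (\<Sum>P\<in>Syl. card (P - {\<one>}))"
  proof (rule card_UN_disjoint [OF finite_Syl])
    show "\<forall>P\<in>Syl. finite (P - {\<one>})" using subgroup_finite SylD(1) by blast
    show "\<forall>P\<in>Syl. \<forall>Q\<in>Syl. P \<noteq> Q \<longrightarrow> (P - {\<one>}) \<inter> (Q - {\<one>}) = {}" using Syl_inter by blast
  qed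
  also have "\<dots> = (\<Sum>P\<in>Syl. p - 1)"
    by (rule sum.cong) (use SylD(2,4) in auto)
  finally have "card (Gp - {\<one>}) = card Syl * (p - 1)" by simp
  then show ?thesis using one_Gp finite_Gp card_Suc_Diff1 [of Gp \<one>] by simp
qed

text \<open>If y commutes with x, the group generated by x normalizes the group generated by y, and
  the two coincide by \<open>Syl_normalizing\<close>.\<close>

lemma commuting_eq:
  assumes x: "x \<in> Gp" "x \<noteq> \<one>"
  shows "commuting x = generate G {x}"
proof
  let ?P = "generate G {x}"
  have P: "?P \<in> Syl" by (rule generate_Syl(1) [OF x])
  have xc: "x \<in> carrier G" using x(1) by (rule Gp_carrier)
  have xP: "x \<in> ?P" by (rule generate.incl) simp
  show "?P \<subseteq> commuting x"
  proof
    fix y assume y: "y \<in> ?P"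
    then obtain i :: nat where i: "y = x [^] i" using generate_Syl(2) [OF x] by auto
    have "y \<otimes> x = x \<otimes> y" unfolding i using xc by (metis nat_pow_Suc nat_pow_Suc2)
    then show "y \<in> commuting x" unfolding commuting_def using SylD(5) [OF P] y by blast
  qed
  show "commuting x \<subseteq> ?P"
  proof
    fix y assume "y \<in> commuting x"
    then have y: "y \<in> Gp" "y \<otimes> x = x \<otimes> y" by (simp_all add: commuting_def)
    have yc: "y \<in> carrier G" using y(1) by (rule Gp_carrier)
    show "y \<in> ?P"
    proof (cases "y = \<one>")
      case True
      then show ?thesis using SylD(4) [OF P] by simp
    next
      case False
      let ?Q = "generate G {y}"
      have Q: "?Q \<in> Syl" by (rule generate_Syl(1) [OF y(1) False])
      have yQ: "y \<in> ?Q" by (rule generate.incl) simp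
      have "conjg x y = y" using xc yc y(2) by (simp add: conjg_fix_iff)
      then have "conjg x ` ?Q = ?Q" using xc yc fin by (intro generate_normalized) auto
      then have "{x} \<subseteq> {s \<in> carrier G. conjg s ` ?Q = ?Q}" using xc by blast
      then have "?P \<subseteq> {s \<in> carrier G. conjg s ` ?Q = ?Q}"
        by (rule generate_subgroup_incl [OF _ subgroup_normalizing [OF subgroup_self SylD(3) [OF Q]]])
      then have "?P = ?Q" by (intro Syl_normalizing [OF P Q]) blast
      then show ?thesis using yQ by simp
    qed
  qed
qed

lemma Pr_p_formula:
  assumes "card Syl = p + 1"
  shows "Pr_p p G = (real p ^ 2 + real p - 1) / real p ^ 3"
proof -
  have N: "card Gp = p ^ 2"
    unfolding card_Gp assms using p_gt_1 by (cases p) (simp_all add: power2_eq_square)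
  have "(\<Sum>x\<in>Gp. card (commuting x)) = card Gp + (\<Sum>x\<in>Gp - {\<one>}. card (commuting x))"
    using sum.remove [OF finite_Gp one_Gp, of "\<lambda>x. card (commuting x)"] by (simp add: commuting_one)
  also have "(\<Sum>x\<in>Gp - {\<one>}. card (commuting x)) = (\<Sum>x\<in>Gp - {\<one>}. p)"
    using commuting_eq generate_Syl(1) SylD(2) by (intro sum.cong) auto
  also have "\<dots> = (p ^ 2 - 1) * p" using N one_Gp finite_Gp by simp
  finally have s: "(\<Sum>x\<in>Gp. card (commuting x)) = p ^ 2 + (p ^ 2 - 1) * p" unfolding N .
  have "p ^ 2 \<ge> 1" using p_gt_1 by simp
  then have "real (p ^ 2 + (p ^ 2 - 1) * p) = real p ^ 2 + (real p ^ 2 - 1) * real p"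
    by (simp add: of_nat_diff)
  also have "\<dots> / real (p ^ 2) ^ 2 = (real p ^ 2 + real p - 1) / real p ^ 3"
    using p_gt_1 by (simp add: field_simps power2_eq_square power3_eq_cube)
  finally show ?thesis unfolding Pr_p_eq s N by simp
qed

end

section \<open>Transfer for groups acting on the projective line\<close>

text \<open>Integers commute, so the elements on which \<open>\<tau>\<close> agrees with
  \<open>\<tau> \<one>\<close> form a normal subgroup containing all commutators. Values of
  \<open>\<tau>\<close> need not be invertible modulo m, which is why they are compared with
  \<open>\<tau> \<one>\<close> and not with 1.\<close>

lemma (in simple_group) invariant_trivial:
  assumes nc: "\<not> comm_group G"
    and hom: "\<And>g h. g \<in> carrier G \<Longrightarrow> h \<in> carrier G \<Longrightarrow> [\<tau> (g \<otimes> h) = \<tau> g * \<tau> h] (mod m)"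
    and g: "g \<in> carrier G"
  shows "[\<tau> g = \<tau> \<one>] (mod (m :: int))"
proof -
  define N where "N = {g \<in> carrier G. [\<tau> g = \<tau> \<one>] (mod m)}"
  have comm: "[\<tau> (g \<otimes> h) = \<tau> (h \<otimes> g)] (mod m)" if "g \<in> carrier G" "h \<in> carrier G" for g h
  proof -
    have "[\<tau> (g \<otimes> h) = \<tau> g * \<tau> h] (mod m)" by (rule hom [OF that])
    also have "\<tau> g * \<tau> h = \<tau> h * \<tau> g" by simp
    also have "[\<tau> h * \<tau> g = \<tau> (h \<otimes> g)] (mod m)" by (rule cong_sym [OF hom [OF that(2,1)]])
    finally show ?thesis .
  qed
  have absorb: "[\<tau> (x \<otimes> n) = \<tau> x] (mod m)" if "x \<in> carrier G" "n \<in> N" for x n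
  proof -
    have n: "n \<in> carrier G" "[\<tau> n = \<tau> \<one>] (mod m)" using that(2) by (simp_all add: N_def)
    have "[\<tau> (x \<otimes> n) = \<tau> x * \<tau> n] (mod m)" by (rule hom [OF that(1) n(1)])
    also have "[\<tau> x * \<tau> n = \<tau> x * \<tau> \<one>] (mod m)" by (intro cong_mult cong_refl n(2))
    also have "[\<tau> x * \<tau> \<one> = \<tau> (x \<otimes> \<one>)] (mod m)" by (rule cong_sym [OF hom [OF that(1) one_closed]])
    finally show ?thesis using that(1) by simp
  qed
  have "N \<lhd> G"
    unfolding normal_inv_iff
  proof (intro conjI ballI)
    show "subgroup N G"
    proof (rule subgroupI)
      show "N \<subseteq> carrier G" unfolding N_def by blast
      show "N \<noteq> {}" unfolding N_def by (auto intro: exI [of _ \<one>])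
    next
      fix a assume a: "a \<in> N"
      then have ac: "a \<in> carrier G" by (simp add: N_def)
      have "[\<tau> (inv a) = \<tau> (inv a \<otimes> a)] (mod m)" by (rule cong_sym [OF absorb [OF inv_closed [OF ac] a]])
      then show "inv a \<in> N" unfolding N_def using ac by simp
    next
      fix a b assume a: "a \<in> N" and b: "b \<in> N"
      then have c: "a \<in> carrier G" "b \<in> carrier G" "[\<tau> a = \<tau> \<one>] (mod m)" by (simp_all add: N_def)
      have "[\<tau> (a \<otimes> b) = \<tau> \<one>] (mod m)" by (rule cong_trans [OF absorb [OF c(1) b] c(3)])
      then show "a \<otimes> b \<in> N" unfolding N_def using c by simp
    qed
  next
    fix x n assume x: "x \<in> carrier G" and n: "n \<in> N"
    then have nc: "n \<in> carrier G" by (simp add: N_def)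
    have "[\<tau> (x \<otimes> n \<otimes> inv x) = \<tau> (inv x \<otimes> (x \<otimes> n))] (mod m)"
      by (rule comm) (use x nc in auto)
    also have "inv x \<otimes> (x \<otimes> n) = n" using x nc by (rule inv_cancel)
    also have "[\<tau> n = \<tau> \<one>] (mod m)" using n by (simp add: N_def)
    finally show "x \<otimes> n \<otimes> inv x \<in> N" unfolding N_def using x nc by simp
  qed
  then consider "N = carrier G" | "N = {\<one>}" using no_real_normal_subgroup by blast
  then show ?thesis
  proof cases
    case 1
    then have "g \<in> N" using g by simp
    then show ?thesis by (simp add: N_def)
  next
    case 2
    have "x \<otimes> y = y \<otimes> x" if x: "x \<in> carrier G" and y: "y \<in> carrier G" for x y
    proof -
      have "[\<tau> ((x \<otimes> y) \<otimes> inv (y \<otimes> x)) = \<tau> (x \<otimes> y) * \<tau> (inv (y \<otimes> x))] (mod m)"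
        using x y by (intro hom) auto
      also have "[\<tau> (x \<otimes> y) * \<tau> (inv (y \<otimes> x)) = \<tau> (y \<otimes> x) * \<tau> (inv (y \<otimes> x))] (mod m)"
        by (intro cong_mult cong_refl comm x y)
      also have "[\<tau> (y \<otimes> x) * \<tau> (inv (y \<otimes> x)) = \<tau> ((y \<otimes> x) \<otimes> inv (y \<otimes> x))] (mod m)"
        using x y by (intro cong_sym [OF hom]) auto
      finally have "(x \<otimes> y) \<otimes> inv (y \<otimes> x) \<in> N" unfolding N_def using x y by simp
      then have "(x \<otimes> y) \<otimes> inv (y \<otimes> x) = \<one>" using 2 by simp
      then show ?thesis using x y by (metis inv_equality inv_inv inv_closed m_closed)
    qed
    then have "comm_group G" by (rule group_comm_groupI)
    then show ?thesis using nc by simp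
  qed
qed

text \<open>\<open>None\<close> is the point at infinity of the projective line, \<open>Some x\<close> with \<open>0 \<le> x < p\<close> a finite point.\<close>

locale affine_stabilizer = group G + prime_modulus p for G :: "('a, 'b) monoid_scheme" (structure) and p :: nat +
  fixes act :: "'a \<Rightarrow> int option \<Rightarrow> int option" and T :: 'a and w :: 'a
  assumes fin: "finite (carrier G)"
    and act_None_or: "g \<in> carrier G \<Longrightarrow> act g z = None \<or> (\<exists>x. act g z = Some (x mod int p))"
    and act_mult: "g \<in> carrier G \<Longrightarrow> h \<in> carrier G \<Longrightarrow> z = None \<or> (\<exists>x. z = Some (x mod int p)) \<Longrightarrow>
      act (g \<otimes> h) z = act g (act h z)"
    and act_one: "z = None \<or> (\<exists>x. z = Some (x mod int p)) \<Longrightarrow> act \<one> z = z"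
    and faithful: "g \<in> carrier G \<Longrightarrow> act g None = None \<Longrightarrow> (\<And>x. act g (Some (x mod int p)) = Some (x mod int p)) \<Longrightarrow> g = \<one>"
    and T_closed: "T \<in> carrier G" and T_None: "act T None = None"
    and T_Some: "act T (Some (x mod int p)) = Some ((x + 1) mod int p)"
    and affine: "g \<in> carrier G \<Longrightarrow> act g None = None \<Longrightarrow>
      \<exists>a b. unit a \<and> (\<forall>x. act g (Some (x mod int p)) = Some ((a * x + b) mod int p))"
    and w_closed: "w \<in> carrier G" and w_None: "act w None = Some (0 mod int p)"
    and w_0: "act w (Some (0 mod int p)) = None"
begin

definition pt :: "int \<Rightarrow> int option" where "pt x = Some (x mod int p)"

definition \<Omega> :: "int option set" where "\<Omega> = insert None (range pt)"

lemma pt_eq_iff [simp]: "pt x = pt y \<longleftrightarrow> x \<approx> y"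
  by (simp add: pt_def cong_def)

lemma pt_neq_None [simp]: "pt x \<noteq> None" "None \<noteq> pt x"
  by (simp_all add: pt_def)

lemma Omega_cases: "z \<in> \<Omega> \<Longrightarrow> (z = None \<Longrightarrow> P) \<Longrightarrow> (\<And>x. z = pt x \<Longrightarrow> P) \<Longrightarrow> P"
  unfolding \<Omega>_def by blast

lemma in_Omega [simp]: "None \<in> \<Omega>" "pt x \<in> \<Omega>" by (simp_all add: \<Omega>_def rangeI)

lemma Omega_iff: "z \<in> \<Omega> \<longleftrightarrow> z = None \<or> (\<exists>x. z = Some (x mod int p))"
  by (auto simp: \<Omega>_def pt_def)

lemma Omega_alt: "\<Omega> = insert None (pt ` {0..<int p})"
proof -
  have "range pt \<subseteq> pt ` {0..<int p}"
  proof
    fix z assume "z \<in> range pt"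
    then obtain x where "z = pt x" by blast
    then have "z = pt (x mod int p)" by simp
    moreover have "x mod int p \<in> {0..<int p}" using p_gt_1 by simp
    ultimately show "z \<in> pt ` {0..<int p}" by blast
  qed
  then show ?thesis unfolding \<Omega>_def by blast
qed

lemma finite_Omega: "finite \<Omega>" unfolding Omega_alt by simp

lemma act_Omega [simp]: "g \<in> carrier G \<Longrightarrow> act g z \<in> \<Omega>"
  unfolding Omega_iff by (rule act_None_or)

lemma act_act: "g \<in> carrier G \<Longrightarrow> h \<in> carrier G \<Longrightarrow> z \<in> \<Omega> \<Longrightarrow> act (g \<otimes> h) z = act g (act h z)"
  unfolding Omega_iff by (rule act_mult)

lemma act_id [simp]: "z \<in> \<Omega> \<Longrightarrow> act \<one> z = z"
  unfolding Omega_iff by (rule act_one)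

lemma act_inv [simp]:
  assumes "g \<in> carrier G" "z \<in> \<Omega>"
  shows "act (inv g) (act g z) = z" "act g (act (inv g) z) = z"
  using act_act [of "inv g" g z] act_act [of g "inv g" z] assms by simp_all

lemma act_inj: "g \<in> carrier G \<Longrightarrow> y \<in> \<Omega> \<Longrightarrow> z \<in> \<Omega> \<Longrightarrow> act g y = act g z \<longleftrightarrow> y = z"
  using act_inv(1) by metis

lemma act_eqI:
  assumes "g \<in> carrier G" "h \<in> carrier G" "\<And>z. z \<in> \<Omega> \<Longrightarrow> act g z = act h z"
  shows "g = h"
proof -
  have id: "act (inv h \<otimes> g) z = z" if "z \<in> \<Omega>" for z
    using act_act [of "inv h" g z] assms that by simp
  have "inv h \<otimes> g = \<one>"
  proof (rule faithful)
    show "act (inv h \<otimes> g) None = None" by (rule id) simp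
    show "act (inv h \<otimes> g) (Some (x mod int p)) = Some (x mod int p)" for x
      using id [OF in_Omega(2), of x] by (simp only: pt_def)
  qed (use assms in simp)
  moreover have "h \<otimes> (inv h \<otimes> g) = g" using assms(1,2) by (simp add: inv_cancel)
  ultimately show ?thesis using assms(2) by simp
qed

lemma bij_act: "g \<in> carrier G \<Longrightarrow> bij_betw (act g) \<Omega> \<Omega>"
  by (rule bij_betwI [where g = "act (inv g)"]) auto

lemma T_pt: "act T (pt x) = pt (x + 1)" using T_Some by (simp add: pt_def)

lemma w_infinity: "act w None = pt 0" and w_zero: "act w (pt 0) = None"
  using w_None w_0 by (simp_all add: pt_def)

lemma affine_pt: "g \<in> carrier G \<Longrightarrow> act g None = None \<Longrightarrow> \<exists>a b. unit a \<and> (\<forall>x. act g (pt x) = pt (a * x + b))"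
  using affine by (simp add: pt_def)

definition shift :: "int \<Rightarrow> 'a" where "shift x = T [^] nat (x mod int p)"

lemma shift_closed [simp]: "shift x \<in> carrier G" by (simp add: shift_def T_closed)

lemma T_pow: "act (T [^] (n::nat)) None = None" "act (T [^] n) (pt x) = pt (x + int n)"
proof -
  show "act (T [^] n) None = None"
    by (induction n) (simp_all add: act_act T_closed T_None)
  show "act (T [^] n) (pt x) = pt (x + int n)"
    by (induction n arbitrary: x) (simp_all add: act_act T_closed T_pt add_ac)
qed

lemma shift_None [simp]: "act (shift y) None = None" by (simp add: shift_def T_pow)

lemma shift_pt [simp]: "act (shift y) (pt x) = pt (x + y)"
proof -
  have "int (nat (y mod int p)) = y mod int p" using p_gt_1 by simp
  then have "act (shift y) (pt x) = pt (x + y mod int p)" by (simp add: shift_def T_pow)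
  also have "\<dots> = pt (x + y)" by (simp add: cong_add_lcancel)
  finally show ?thesis .
qed

lemma shift_eqI: "x \<approx> y \<Longrightarrow> shift x = shift y" by (simp add: shift_def cong_def)

lemma act_inv_eq: "g \<in> carrier G \<Longrightarrow> y \<in> \<Omega> \<Longrightarrow> z \<in> \<Omega> \<Longrightarrow> act (inv g) y = z \<longleftrightarrow> y = act g z"
  using act_inv by metis

lemma inv_shift: "inv (shift x) = shift (- x)"
proof (rule act_eqI)
  fix z assume "z \<in> \<Omega>"
  then show "act (inv (shift x)) z = act (shift (- x)) z"
    by (rule Omega_cases) (simp_all add: act_inv_eq)
qed simp_all

definition N :: "'a set" where "N = {g \<in> carrier G. act g None = None}"

lemma N_D: "g \<in> N \<Longrightarrow> g \<in> carrier G" "g \<in> N \<Longrightarrow> act g None = None" by (simp_all add: N_def)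

lemma N_mult: "g \<in> N \<Longrightarrow> h \<in> N \<Longrightarrow> g \<otimes> h \<in> N" by (simp add: N_def act_act)

lemma N_inv: "g \<in> N \<Longrightarrow> inv g \<in> N" by (simp add: N_def act_inv_eq)

lemma N_shift [simp]: "shift x \<in> N" by (simp add: N_def)

lemma N_one [simp]: "\<one> \<in> N" by (simp add: N_def)

text \<open>The slope of an affine map, read off from the images of 0 and 1. For elements that move
  infinity the value has no meaning.\<close>

definition scale :: "'a \<Rightarrow> int"
  where "scale g = (the (act g (pt 1)) - the (act g (pt 0))) mod int p"

lemma scale_eqI:
  assumes "\<And>x. act g (pt x) = pt (a * x + b)"
  shows "scale g \<approx> a"
proof -
  have "scale g = ((a + b) mod int p - b mod int p) mod int p"
    unfolding scale_def assms by (simp add: pt_def)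
  also have "\<dots> = a mod int p" by (simp add: mod_diff_eq)
  finally show ?thesis by simp
qed

lemma N_affine:
  assumes g: "g \<in> N"
  obtains b where "unit (scale g)" "\<And>x. act g (pt x) = pt (scale g * x + b)"
proof -
  obtain a b where a: "unit a" and ab: "\<And>x. act g (pt x) = pt (a * x + b)"
    using affine_pt [OF N_D [OF g]] by blast
  have s: "scale g \<approx> a" by (rule scale_eqI [OF ab])
  then have "unit (scale g)" using a unit_cong by blast
  moreover have "act g (pt x) = pt (scale g * x + b)" for x
    using s cong_sym by (auto simp: ab intro!: cong_add cong_mult)
  ultimately show ?thesis using that by blast
qed

lemma scale_unit: "g \<in> N \<Longrightarrow> unit (scale g)" by (rule N_affine)

lemma scale_mult:
  assumes "g \<in> N" "h \<in> N"
  shows "scale (g \<otimes> h) \<approx> scale g * scale h"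
proof -
  obtain b c where "\<And>x. act g (pt x) = pt (scale g * x + b)" "\<And>x. act h (pt x) = pt (scale h * x + c)"
    using N_affine assms by metis
  then have "act (g \<otimes> h) (pt x) = pt (scale g * scale h * x + (scale g * c + b))" for x
    using assms N_D(1) by (simp add: act_act algebra_simps)
  then show ?thesis by (rule scale_eqI)
qed

lemma scale_shift: "scale (shift y) \<approx> 1"
  by (rule scale_eqI [where b = y]) simp

lemma scale_one: "scale \<one> \<approx> 1"
  by (rule scale_eqI [where b = 0]) simp

lemma scale_inv:
  assumes "g \<in> N"
  shows "scale g * scale (inv g) \<approx> 1"
proof -
  have "scale g * scale (inv g) \<approx> scale (g \<otimes> inv g)"
    by (rule cong_sym [OF scale_mult [OF assms N_inv [OF assms]]])
  also have "g \<otimes> inv g = \<one>" using N_D(1) [OF assms] by simp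
  also note scale_one
  finally show ?thesis .
qed

text \<open>Representatives for the cosets of the stabilizer \<open>N\<close>, indexed by the image
  of infinity.\<close>

definition sec :: "int option \<Rightarrow> 'a"
  where "sec z = (case z of None \<Rightarrow> \<one> | Some x \<Rightarrow> shift x \<otimes> w)"

text \<open>The Schreier cocycle: the amount by which \<open>g\<close> fails to permute the
  representatives.\<close>

definition cocycle :: "'a \<Rightarrow> int option \<Rightarrow> 'a"
  where "cocycle g z = inv (sec (act g z)) \<otimes> g \<otimes> sec z"

lemma sec_None [simp]: "sec None = \<one>" by (simp add: sec_def)

lemma sec_pt [simp]: "sec (pt x) = shift x \<otimes> w"
  using shift_eqI [of "x mod int p" x] by (simp add: sec_def pt_def)

lemma sec_closed [simp]: "sec z \<in> carrier G"
  by (cases z) (simp_all add: sec_def w_closed)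

lemma sec_act: "z \<in> \<Omega> \<Longrightarrow> act (sec z) None = z"
  by (erule Omega_cases) (simp_all add: act_act w_closed w_infinity)

lemma cocycle_closed [simp]: "g \<in> carrier G \<Longrightarrow> cocycle g z \<in> carrier G"
  by (simp add: cocycle_def)

lemma cocycle_N: "g \<in> carrier G \<Longrightarrow> z \<in> \<Omega> \<Longrightarrow> cocycle g z \<in> N"
  unfolding N_def cocycle_def by (simp add: act_act sec_act act_inv_eq)

lemma cocycle_mult:
  "g \<in> carrier G \<Longrightarrow> h \<in> carrier G \<Longrightarrow> z \<in> \<Omega> \<Longrightarrow> cocycle (g \<otimes> h) z = cocycle g (act h z) \<otimes> cocycle h z"
  by (simp add: cocycle_def act_act m_assoc inv_cancel)

lemma cocycle_one: "z \<in> \<Omega> \<Longrightarrow> cocycle \<one> z = \<one>"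
  by (simp add: cocycle_def)

text \<open>For \<open>f\<close> multiplicative on \<open>N\<close>, this is the transfer from the
  group to the abelianization of \<open>N\<close>, followed by \<open>f\<close>.\<close>

definition transfer :: "('a \<Rightarrow> int) \<Rightarrow> 'a \<Rightarrow> int"
  where "transfer f g = (\<Prod>z\<in>\<Omega>. f (cocycle g z))"

text \<open>Each factor splits by the cocycle identity, and the first halves can be reindexed
  because h permutes the points.\<close>

lemma transfer_mult:
  assumes f: "\<And>n n'. n \<in> N \<Longrightarrow> n' \<in> N \<Longrightarrow> [f (n \<otimes> n') = f n * f n'] (mod m)"
    and g: "g \<in> carrier G" and h: "h \<in> carrier G"
  shows "[transfer f (g \<otimes> h) = transfer f g * transfer f h] (mod m)"
proof -
  have "[transfer f (g \<otimes> h) = (\<Prod>z\<in>\<Omega>. f (cocycle g (act h z)) * f (cocycle h z))] (mod m)"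
    unfolding transfer_def
  proof (rule cong_prod)
    fix z assume z: "z \<in> \<Omega>"
    show "[f (cocycle (g \<otimes> h) z) = f (cocycle g (act h z)) * f (cocycle h z)] (mod m)"
      unfolding cocycle_mult [OF g h z] by (rule f) (simp_all add: cocycle_N g h z)
  qed
  also have "(\<Prod>z\<in>\<Omega>. f (cocycle g (act h z)) * f (cocycle h z))
      = (\<Prod>z\<in>\<Omega>. f (cocycle g (act h z))) * (\<Prod>z\<in>\<Omega>. f (cocycle h z))" by (rule prod.distrib)
  also have "(\<Prod>z\<in>\<Omega>. f (cocycle g (act h z))) = (\<Prod>z\<in>\<Omega>. f (cocycle g z))"
    by (rule prod.reindex_bij_betw [OF bij_act [OF h]])
  finally show ?thesis unfolding transfer_def .
qed

end

section \<open>The group of slopes and what transfer says about it\<close>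

locale simple_affine_stabilizer = affine_stabilizer +
  assumes simple: "simple_group G" and noncomm: "\<not> comm_group G"
begin

lemma transfer_trivial:
  assumes "\<And>n n'. n \<in> N \<Longrightarrow> n' \<in> N \<Longrightarrow> [f (n \<otimes> n') = f n * f n'] (mod m)" "g \<in> carrier G"
  shows "[transfer f g = transfer f \<one>] (mod m)"
  using simple_group.invariant_trivial [OF simple noncomm transfer_mult [OF assms(1)] assms(2)] by blast

lemma shift_mult: "shift x \<otimes> shift y = shift (x + y)"
proof (rule act_eqI)
  fix z assume "z \<in> \<Omega>"
  then show "act (shift x \<otimes> shift y) z = act (shift (x + y)) z"
    by (rule Omega_cases) (simp_all add: act_act algebra_simps)
qed simp_all

lemma shift_0 [simp]: "shift 0 = \<one>"
proof (rule act_eqI)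
  fix z assume "z \<in> \<Omega>"
  then show "act (shift 0) z = act \<one> z" by (rule Omega_cases) simp_all
qed simp_all

definition H :: "'a set" where "H = {h \<in> N. act h (pt 0) = pt 0}"

lemma H_N: "h \<in> H \<Longrightarrow> h \<in> N" and H_closed: "h \<in> H \<Longrightarrow> h \<in> carrier G"
  by (simp_all add: H_def N_def)

lemma H_None: "h \<in> H \<Longrightarrow> act h None = None" by (simp add: H_def N_def)

lemma H_pt:
  assumes h: "h \<in> H"
  shows "act h (pt x) = pt (scale h * x)"
proof -
  obtain b where b: "\<And>x. act h (pt x) = pt (scale h * x + b)" using N_affine [OF H_N [OF h]] by metis
  have "b \<approx> 0" using b [of 0] h by (simp add: H_def cong_sym_eq)
  then have "scale h * x + b \<approx> scale h * x + 0" by (intro cong_add cong_refl)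
  then show ?thesis using b by simp
qed

lemma H_one [simp]: "\<one> \<in> H" by (simp add: H_def)

lemma H_mult: "g \<in> H \<Longrightarrow> h \<in> H \<Longrightarrow> g \<otimes> h \<in> H"
  unfolding H_def using N_D by (simp add: N_mult act_act)

lemma H_inv: "h \<in> H \<Longrightarrow> inv h \<in> H"
  unfolding H_def using N_D by (simp add: N_inv act_inv_eq)

lemma H_eqI:
  assumes "g \<in> H" "h \<in> H" "scale g \<approx> scale h"
  shows "g = h"
proof (rule act_eqI)
  fix z assume "z \<in> \<Omega>"
  then show "act g z = act h z"
  proof (rule Omega_cases)
    fix x assume "z = pt x"
    then show ?thesis using H_pt assms by (simp add: cong_mult)
  qed (use H_None assms in simp)
qed (use H_closed assms in auto)

text \<open>Saturated under congruence, so that membership can be tested on any integer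
  representative of a slope.\<close>

definition A :: "int set" where "A = {a. \<exists>h\<in>H. scale h \<approx> a}"

lemma A_cong: "a \<in> A \<Longrightarrow> a \<approx> b \<Longrightarrow> b \<in> A"
  unfolding A_def using cong_trans by blast

lemma A_unit: "a \<in> A \<Longrightarrow> unit a"
  unfolding A_def using scale_unit H_N unit_cong by blast

lemma A_one: "1 \<in> A" unfolding A_def using scale_one H_one by blast

lemma A_mult:
  assumes "a \<in> A" "b \<in> A" shows "a * b \<in> A"
proof -
  obtain g h where gh: "g \<in> H" "h \<in> H" "scale g \<approx> a" "scale h \<approx> b"
    using assms unfolding A_def by blast
  have "scale (g \<otimes> h) \<approx> scale g * scale h" by (rule scale_mult [OF H_N [OF gh(1)] H_N [OF gh(2)]])
  also have "scale g * scale h \<approx> a * b" by (intro cong_mult gh)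
  finally show ?thesis unfolding A_def using H_mult gh by blast
qed

lemma A_power: "a \<in> A \<Longrightarrow> a ^ k \<in> A"
  by (induction k) (simp_all add: A_one A_mult)

lemma A_inverse:
  assumes "a \<in> A" "a * b \<approx> 1" shows "b \<in> A"
proof -
  obtain g where g: "g \<in> H" "scale g \<approx> a" using assms unfolding A_def by blast
  have "a * scale (inv g) \<approx> scale g * scale (inv g)" by (intro cong_mult cong_sym [OF g(2)] cong_refl)
  also note scale_inv [OF H_N [OF g(1)]]
  also have "1 \<approx> a * b" by (rule cong_sym [OF assms(2)])
  finally have "scale (inv g) \<approx> b" by (rule cancel [OF A_unit [OF assms(1)]])
  then show ?thesis unfolding A_def using H_inv [OF g(1)] by blast
qed

text \<open>A suitable translation moves the image of 0 back to 0 without changing the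
  slope.\<close>

lemma scale_A: assumes n: "n \<in> N" shows "scale n \<in> A"
proof -
  obtain b where b: "\<And>x. act n (pt x) = pt (scale n * x + b)" using N_affine [OF n] by metis
  have s: "shift (- b) \<otimes> n \<in> H"
    unfolding H_def using n N_D [OF n] by (simp add: N_mult act_act b)
  have "scale (shift (- b) \<otimes> n) \<approx> scale (shift (- b)) * scale n" by (rule scale_mult) (simp_all add: n)
  also have "scale (shift (- b)) * scale n \<approx> 1 * scale n" by (intro cong_mult scale_shift cong_refl)
  finally show ?thesis unfolding A_def using s by auto
qed

definition hh :: "int \<Rightarrow> 'a" where "hh a = (SOME h. h \<in> H \<and> scale h \<approx> a)"

lemma hh: assumes "a \<in> A" shows hh_H: "hh a \<in> H" and scale_hh: "scale (hh a) \<approx> a"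
proof -
  have "\<exists>h. h \<in> H \<and> scale h \<approx> a" using assms unfolding A_def by blast
  then have "hh a \<in> H \<and> scale (hh a) \<approx> a" unfolding hh_def by (rule someI_ex)
  then show "hh a \<in> H" "scale (hh a) \<approx> a" by simp_all
qed

lemma hh_closed: "a \<in> A \<Longrightarrow> hh a \<in> carrier G" by (rule H_closed [OF hh_H])

lemma hh_pt: "a \<in> A \<Longrightarrow> act (hh a) (pt x) = pt (a * x)"
  by (simp add: H_pt hh_H) (intro cong_mult scale_hh cong_refl)

lemma hh_None: "a \<in> A \<Longrightarrow> act (hh a) None = None"
  by (rule H_None [OF hh_H])

lemma hh_eqI: "a \<in> A \<Longrightarrow> h \<in> H \<Longrightarrow> scale h \<approx> a \<Longrightarrow> hh a = h"
  by (rule H_eqI) (auto intro: hh_H cong_trans [OF scale_hh] cong_sym)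

lemma hh_mult: "a \<in> A \<Longrightarrow> b \<in> A \<Longrightarrow> hh (a * b) = hh a \<otimes> hh b"
proof (rule hh_eqI)
  assume ab: "a \<in> A" "b \<in> A"
  show "scale (hh a \<otimes> hh b) \<approx> a * b"
    by (rule cong_trans [OF scale_mult cong_mult]) (simp_all add: ab H_N hh_H scale_hh)
qed (simp_all add: A_mult H_mult hh_H)

lemma hh_cong: "a \<in> A \<Longrightarrow> a \<approx> b \<Longrightarrow> hh a = hh b"
  using A_cong [of a b] hh_eqI [of a "hh b"] hh_H [of b] scale_hh [of b] cong_trans cong_sym by blast

lemma wconj_H: "h \<in> H \<Longrightarrow> inv w \<otimes> h \<otimes> w \<in> H"
  unfolding H_def N_def
  by (simp add: w_closed act_act w_infinity w_zero act_inv_eq)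

text \<open>Conjugation by \<open>w\<close>, which exchanges 0 and infinity, preserves
  \<open>H\<close>; this is its effect on slopes, the map a -> a' of the overview.\<close>

definition tw :: "int \<Rightarrow> int" where "tw a = scale (inv w \<otimes> hh a \<otimes> w)"

lemma tw_A: "a \<in> A \<Longrightarrow> tw a \<in> A"
  unfolding tw_def by (intro scale_A H_N wconj_H hh_H)

lemma tw_cong: "a \<in> A \<Longrightarrow> a \<approx> b \<Longrightarrow> tw a = tw b"
  unfolding tw_def by (simp add: hh_cong)

lemma wconj_hh: "a \<in> A \<Longrightarrow> inv w \<otimes> hh a \<otimes> w = hh (tw a)"
  by (rule hh_eqI [symmetric, OF tw_A wconj_H [OF hh_H]]) (simp_all add: tw_def)

lemma tw_mult:
  assumes "a \<in> A" "b \<in> A" shows "tw (a * b) \<approx> tw a * tw b"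
proof -
  have "inv w \<otimes> hh (a * b) \<otimes> w = (inv w \<otimes> hh a \<otimes> w) \<otimes> (inv w \<otimes> hh b \<otimes> w)"
    using hh_closed [OF assms(1)] hh_closed [OF assms(2)] w_closed
    by (simp add: hh_mult assms m_assoc inv_cancel)
  then show ?thesis unfolding tw_def
    using scale_mult [OF H_N [OF wconj_H [OF hh_H [OF assms(1)]]] H_N [OF wconj_H [OF hh_H [OF assms(2)]]]]
    by simp
qed

lemma ww_H: "w \<otimes> w \<in> H"
  unfolding H_def N_def by (simp add: w_closed act_act w_infinity w_zero)

text \<open>\<open>w \<otimes> w\<close> lies in \<open>H\<close>, which is commutative because its
  elements are determined by their slopes.\<close>

lemma tw_tw:
  assumes a: "a \<in> A" shows "tw (tw a) \<approx> a"
proof -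
  define v where "v = w \<otimes> w"
  have v: "v \<in> H" unfolding v_def by (rule ww_H)
  have vc: "v \<in> carrier G" using v by (rule H_closed)
  have ac: "hh a \<in> carrier G" using a by (rule hh_closed)
  have "inv w \<otimes> hh (tw a) \<otimes> w = inv v \<otimes> hh a \<otimes> v"
    unfolding wconj_hh [OF a, symmetric] v_def using w_closed ac by (simp add: m_assoc inv_mult_group)
  also have "inv v \<otimes> hh a \<otimes> v = hh a"
  proof (rule H_eqI)
    show "inv v \<otimes> hh a \<otimes> v \<in> H" by (intro H_mult H_inv v hh_H a)
    have "scale (inv v \<otimes> hh a \<otimes> v) \<approx> scale (inv v \<otimes> hh a) * scale v"
      by (intro scale_mult N_mult H_N H_inv v hh_H a)
    also have "scale (inv v \<otimes> hh a) * scale v \<approx> scale (inv v) * scale (hh a) * scale v"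
      by (intro cong_mult cong_refl scale_mult H_N H_inv v hh_H a)
    also have "scale (inv v) * scale (hh a) * scale v = scale (hh a) * (scale v * scale (inv v))" by simp
    also have "scale (hh a) * (scale v * scale (inv v)) \<approx> scale (hh a) * 1"
      by (intro cong_mult cong_refl scale_inv H_N v)
    finally show "scale (inv v \<otimes> hh a \<otimes> v) \<approx> scale (hh a)" by simp
  qed (rule hh_H [OF a])
  finally have "tw (tw a) = scale (hh a)" by (simp add: tw_def)
  then show ?thesis using scale_hh [OF a] by simp
qed

lemma cocycle_shift: "cocycle (shift y) None = shift y" "cocycle (shift y) (pt x) = \<one>"
proof -
  show "cocycle (shift y) None = shift y" by (simp add: cocycle_def)
  have "shift y \<otimes> (shift x \<otimes> w) = shift (x + y) \<otimes> w"
    using shift_mult [of y x] w_closed by (simp add: add.commute flip: m_assoc)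
  then show "cocycle (shift y) (pt x) = \<one>"
    using w_closed by (simp add: cocycle_def m_assoc)
qed

lemma cocycle_w: "cocycle w None = \<one>" "cocycle w (pt 0) = w \<otimes> w"
  using w_closed by (simp_all add: cocycle_def w_infinity w_zero)

text \<open>Moving h past a translation only rescales the translation, so every finite point
  contributes the same conjugate of h.\<close>

lemma cocycle_H:
  assumes h: "h \<in> H"
  shows "cocycle h None = h" "cocycle h (pt x) = inv w \<otimes> h \<otimes> w"
proof -
  have hc: "h \<in> carrier G" using h by (rule H_closed)
  show "cocycle h None = h" using hc by (simp add: cocycle_def H_None h)
  have "h \<otimes> shift x = shift (scale h * x) \<otimes> h"
  proof (rule act_eqI)
    fix z assume "z \<in> \<Omega>"
    then show "act (h \<otimes> shift x) z = act (shift (scale h * x) \<otimes> h) z"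
      by (rule Omega_cases) (simp_all add: act_act hc H_None h H_pt algebra_simps)
  qed (simp_all add: hc)
  then have "h \<otimes> (shift x \<otimes> w) = shift (scale h * x) \<otimes> (h \<otimes> w)"
    using hc w_closed by (simp flip: m_assoc)
  then show "cocycle h (pt x) = inv w \<otimes> h \<otimes> w"
    using hc w_closed by (simp add: cocycle_def H_pt h m_assoc inv_mult_group inv_cancel)
qed

lemma inj_pt: "inj_on pt {0..<int p}"
proof (rule inj_onI)
  fix x y assume "x \<in> {0..<int p}" "y \<in> {0..<int p}" "pt x = pt y"
  then show "x = y" using cong_less_imp_eq_int [of x "int p" y] by simp
qed

lemma prod_Omega: "(\<Prod>z\<in>\<Omega>. f z) = f None * (\<Prod>x\<in>{0..<int p}. f (pt x))"
  unfolding Omega_alt using inj_pt by (subst prod.insert) (auto simp: prod.reindex)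

text \<open>Transfer along \<open>n \<mapsto> scale n * tw (scale n)\<close>: each of the \<open>p + 1\<close> points contributes the factor
  \<open>a * tw a\<close>, and \<open>a ^ (p + 1) = a ^ 2\<close>.\<close>

lemma twist_square:
  assumes a: "a \<in> A"
  shows "(a * tw a) ^ 2 \<approx> 1"
proof -
  define f where "f n = scale n * tw (scale n)" for n
  define l where "l = a * tw a"
  have f_mult: "f (n \<otimes> n') \<approx> f n * f n'" if n: "n \<in> N" "n' \<in> N" for n n'
  proof -
    have s: "scale (n \<otimes> n') \<approx> scale n * scale n'" by (rule scale_mult [OF n])
    have t: "tw (scale (n \<otimes> n')) = tw (scale n * scale n')"
      by (rule tw_cong [OF _ s]) (intro scale_A N_mult n)
    have "f (n \<otimes> n') \<approx> scale n * scale n' * (tw (scale n) * tw (scale n'))"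
      unfolding f_def t by (intro cong_mult s tw_mult scale_A n)
    then show ?thesis unfolding f_def by (simp add: mult_ac)
  qed
  have fh: "f (hh b) \<approx> b * tw b" if b: "b \<in> A" for b
  proof -
    have "tw (scale (hh b)) = tw b" by (rule tw_cong [OF scale_A [OF H_N [OF hh_H [OF b]]] scale_hh [OF b]])
    then show ?thesis unfolding f_def by (simp only:) (intro cong_mult scale_hh b cong_refl)
  qed
  have "transfer f (hh a) = f (hh a) * (\<Prod>x\<in>{0..<int p}. f (hh (tw a)))"
    unfolding transfer_def prod_Omega by (simp add: cocycle_H hh_H a wconj_hh)
  also have "f (hh a) * (\<Prod>x\<in>{0..<int p}. f (hh (tw a))) \<approx> l * (\<Prod>x\<in>{0..<int p}. l)"
  proof (intro cong_mult cong_prod)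
    show "f (hh a) \<approx> l" unfolding l_def by (rule fh [OF a])
    have "f (hh (tw a)) \<approx> tw a * tw (tw a)" by (rule fh [OF tw_A [OF a]])
    also have "tw a * tw (tw a) \<approx> tw a * a" by (intro cong_mult cong_refl tw_tw a)
    finally show "f (hh (tw a)) \<approx> l" unfolding l_def by (simp add: mult.commute)
  qed
  also have "l * (\<Prod>x\<in>{0..<int p}. l) = l ^ 2 * l ^ (p - 1)"
    using p_gt_1 by (simp add: power2_eq_square power_eq_if [of l p])
  also have "l ^ 2 * l ^ (p - 1) \<approx> l ^ 2 * 1"
    unfolding l_def by (intro cong_mult cong_refl fermat A_unit A_mult a tw_A)
  finally have 1: "transfer f (hh a) \<approx> l ^ 2" by simp
  have "f \<one> \<approx> 1"
  proof -
    have "f \<one> * f \<one> \<approx> f \<one> * 1" using f_mult [of \<one> \<one>] by (simp add: cong_sym_eq)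
    moreover have "unit (f \<one>)" unfolding f_def by (intro A_unit A_mult scale_A tw_A) simp_all
    ultimately show ?thesis using cancel by blast
  qed
  then have "transfer f \<one> \<approx> (\<Prod>z\<in>\<Omega>. 1)"
    unfolding transfer_def by (intro cong_prod) (simp add: cocycle_one)
  then have 2: "transfer f \<one> \<approx> 1" by simp
  have "l ^ 2 \<approx> transfer f (hh a)" by (rule cong_sym [OF 1])
  also have "transfer f (hh a) \<approx> transfer f \<one>" by (rule transfer_trivial [OF f_mult hh_closed [OF a]])
  also note 2
  finally show ?thesis unfolding l_def .
qed

text \<open>If the stabilizer of \<open>\<infinity>\<close> consists of translations \<open>x \<mapsto> x + b\<close>, then transfer along the homomorphism
  \<open>b \<mapsto> 1 + p b\<close> modulo \<open>p\<^sup>2\<close> is nontrivial.\<close>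

lemma A_nontrivial: "\<exists>a\<in>A. \<not> a \<approx> 1"
proof (rule ccontr)
  assume "\<not> (\<exists>a\<in>A. \<not> a \<approx> 1)"
  then have A1: "a \<approx> 1" if "a \<in> A" for a using that by blast
  define v where "v n = the (act n (pt 0))" for n
  define f where "f n = 1 + int p * v n" for n
  have v: "act n (pt x) = pt (x + v n)" if n: "n \<in> N" for n x
  proof -
    obtain b where b: "\<And>x. act n (pt x) = pt (scale n * x + b)" using N_affine [OF n] by metis
    have "v n \<approx> b" unfolding v_def b by (simp add: pt_def)
    then have "scale n * x + b \<approx> 1 * x + v n"
      by (intro cong_add cong_mult A1 scale_A n cong_refl) (rule cong_sym)
    then show ?thesis unfolding b by simp
  qed
  have f_mult: "[f (n \<otimes> n') = f n * f n'] (mod int p ^ 2)" if n: "n \<in> N" "n' \<in> N" for n n'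
  proof -
    have "act (n \<otimes> n') (pt 0) = pt (0 + v n' + v n)"
      using N_D(1) [OF n(1)] N_D(1) [OF n(2)] by (simp add: act_act v n)
    moreover have "act (n \<otimes> n') (pt 0) = pt (0 + v (n \<otimes> n'))" by (rule v [OF N_mult [OF n]])
    ultimately have "0 + v (n \<otimes> n') \<approx> 0 + v n' + v n" by (simp only: pt_eq_iff)
    then have "int p dvd v (n \<otimes> n') - (v n + v n')" by (simp add: cong_iff_dvd_diff add.commute)
    then obtain k where "v (n \<otimes> n') - (v n + v n') = int p * k" by blast
    then have k: "v (n \<otimes> n') = v n + v n' + int p * k" by simp
    have "f (n \<otimes> n') - f n * f n' = int p ^ 2 * (k - v n * v n')"
      unfolding f_def k by (simp add: algebra_simps power2_eq_square)
    then show ?thesis by (simp add: cong_iff_dvd_diff)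
  qed
  have f1: "f \<one> = 1" unfolding f_def v_def act_id [OF in_Omega(2)] by (simp add: pt_def)
  have "transfer f \<one> = 1" unfolding transfer_def using f1 by (simp add: cocycle_one)
  moreover have "transfer f (shift 1) = f (shift 1)"
    unfolding transfer_def prod_Omega by (simp add: cocycle_shift f1)
  moreover have "f (shift 1) = 1 + int p"
    unfolding f_def v_def shift_pt using p_gt_1 by (simp add: pt_def)
  moreover have "[transfer f (shift 1) = transfer f \<one>] (mod int p ^ 2)"
    by (rule transfer_trivial [OF f_mult]) simp_all
  ultimately have "int p ^ 2 dvd int p" by (simp add: cong_iff_dvd_diff)
  then have "int p ^ 2 \<le> int p" using p_gt_1 by (intro zdvd_imp_le) auto
  then show False using p_gt_1 by (simp add: power2_eq_square)
qed

end

section \<open>Determination of the action\<close>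

text \<open>The favourable situation, reached below in both cases, possibly after a change of
  \<open>w\<close>: an involution that inverts the slopes.\<close>

locale inverting = simple_affine_stabilizer +
  assumes tw_inverse: "a \<in> A \<Longrightarrow> a * tw a \<approx> 1" and w_w: "w \<otimes> w = \<one>"
begin

text \<open>At 0 the image under \<open>w\<close> is infinity; the value 0 there is a
  convention.\<close>

definition W :: "int \<Rightarrow> int" where "W x = (if unit x then the (act w (pt x)) else 0)"

lemma zero_iff: "x \<approx> 0 \<longleftrightarrow> \<not> unit x" by (simp add: cong_0_iff)

lemma act_w_w: "z \<in> \<Omega> \<Longrightarrow> act w (act w z) = z"
  using act_act [OF w_closed w_closed, of z] by (simp add: w_w)

lemma w_pt:
  assumes "unit x" shows "act w (pt x) = pt (W x)"
proof -
  have "act w (pt x) \<noteq> act w (pt 0)" using assms by (simp add: act_inj w_closed zero_iff)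
  then have ne: "act w (pt x) \<noteq> None" by (simp add: w_zero)
  show ?thesis
  proof (rule Omega_cases [OF act_Omega [OF w_closed]])
    fix y assume y: "act w (pt x) = pt y"
    then have "W x = y mod int p" using assms by (simp add: W_def) (simp add: pt_def)
    then show ?thesis using y by simp
  qed (use ne in blast)
qed

lemma W_cong: "x \<approx> y \<Longrightarrow> W x = W y"
proof -
  assume xy: "x \<approx> y"
  then have "pt x = pt y" by simp
  then show ?thesis unfolding W_def by (simp only: unit_cong [OF xy])
qed

lemma W_unit:
  assumes "unit x" shows "unit (W x)"
proof
  assume "int p dvd W x"
  then have "act w (pt x) = act w None" using assms by (simp add: w_pt w_infinity cong_0_iff)
  then show False by (simp add: act_inj w_closed)
qed

lemma W_W: "unit x \<Longrightarrow> W (W x) \<approx> x"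
  using act_w_w [of "pt x"] by (simp add: w_pt W_unit)

lemma W_eqI: "unit x \<Longrightarrow> act w (pt x) = pt y \<Longrightarrow> W x \<approx> y" by (simp add: w_pt)

text \<open>\<open>w\<close> conjugates x -> a x into its inverse, so it turns multiplication by a
  into division by a.\<close>

lemma W_scale:
  assumes a: "a \<in> A" shows "a * W (a * x) \<approx> W x"
proof (cases "unit x")
  case True
  have ta: "tw a \<in> A" by (rule tw_A [OF a])
  have c: "hh (tw a) \<in> carrier G" "hh (tw (tw a)) \<in> carrier G"
    by (intro hh_closed tw_A a)+
  have "w \<otimes> hh (tw (tw a)) = hh (tw a) \<otimes> w"
    using wconj_hh [OF ta] c w_closed by (metis inv_solve_left m_assoc m_closed inv_closed)
  then have "act (w \<otimes> hh (tw (tw a))) (pt x) = act (hh (tw a) \<otimes> w) (pt x)" by simp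
  then have "act w (pt (tw (tw a) * x)) = pt (tw a * W x)"
    using c w_closed by (simp add: act_act hh_pt tw_A a w_pt True)
  moreover have "pt (tw (tw a) * x) = pt (a * x)" by simp (intro cong_mult tw_tw a cong_refl)
  ultimately have "W (a * x) \<approx> tw a * W x"
    using True A_unit [OF a] by (intro W_eqI) (simp_all add: unit_mult)
  then have "a * W (a * x) \<approx> a * (tw a * W x)" by (intro cong_mult cong_refl)
  also have "a * (tw a * W x) = (a * tw a) * W x" by simp
  also have "(a * tw a) * W x \<approx> 1 * W x" by (intro cong_mult cong_refl tw_inverse a)
  finally show ?thesis by simp
next
  case False
  then show ?thesis by (simp add: W_def unit_mult)
qed

text \<open>A multiplicative cocycle of slopes. The relations for \<open>\<mu>\<close> below come
  from evaluating it on both sides of identities in the group.\<close>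

definition D :: "'a \<Rightarrow> int option \<Rightarrow> int" where "D g z = scale (cocycle g z)"

definition \<mu> :: "int \<Rightarrow> int" where "\<mu> x = (if unit x then D w (pt x) else 0)"

lemma D_mult:
  "g \<in> carrier G \<Longrightarrow> h \<in> carrier G \<Longrightarrow> z \<in> \<Omega> \<Longrightarrow> D (g \<otimes> h) z \<approx> D g (act h z) * D h z"
  unfolding D_def by (simp add: cocycle_mult) (intro scale_mult cocycle_N act_Omega)

lemma D_shift: "z \<in> \<Omega> \<Longrightarrow> D (shift y) z \<approx> 1"
  unfolding D_def by (erule Omega_cases) (simp_all add: cocycle_shift scale_shift scale_one)

lemma D_w: "D w None \<approx> 1" "D w (pt 0) \<approx> 1"
  unfolding D_def by (simp_all add: cocycle_w scale_one w_w)

lemma D_one: "z \<in> \<Omega> \<Longrightarrow> D \<one> z \<approx> 1"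
  unfolding D_def by (simp add: cocycle_one scale_one)

lemma D_hh: "a \<in> A \<Longrightarrow> D (hh a) None \<approx> a" "a \<in> A \<Longrightarrow> D (hh a) (pt x) = tw a"
  unfolding D_def tw_def by (simp_all add: cocycle_H hh_H scale_hh)

lemma N_decompose:
  assumes n: "n \<in> N"
  obtains b where "n = shift b \<otimes> hh (scale n)"
proof -
  obtain b where b: "\<And>x. act n (pt x) = pt (scale n * x + b)" using N_affine [OF n] by metis
  have s: "scale n \<in> A" by (rule scale_A [OF n])
  have "n = shift b \<otimes> hh (scale n)"
  proof (rule act_eqI)
    fix z assume "z \<in> \<Omega>"
    then show "act n z = act (shift b \<otimes> hh (scale n)) z"
      by (rule Omega_cases) (simp_all add: act_act hh_closed s b hh_pt hh_None N_D(2) [OF n])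
  qed (simp_all add: N_D(1) [OF n] hh_closed s)
  then show ?thesis using that by blast
qed

text \<open>At infinity the cocycle of an affine map is the map itself; at a finite point its slope
  is that of a conjugate by \<open>w\<close>, which inverts slopes.\<close>

lemma D_N:
  assumes n: "n \<in> N"
  shows "D n None = scale n" "scale n * D n (pt x) \<approx> 1"
proof -
  show "D n None = scale n" unfolding D_def cocycle_def using N_D [OF n] by simp
  have s: "scale n \<in> A" by (rule scale_A [OF n])
  obtain b where b: "n = shift b \<otimes> hh (scale n)" using n by (rule N_decompose)
  have "D n (pt x) \<approx> D (shift b) (act (hh (scale n)) (pt x)) * D (hh (scale n)) (pt x)"
    by (subst b) (intro D_mult, simp_all add: hh_closed s)
  also have "D (shift b) (act (hh (scale n)) (pt x)) * D (hh (scale n)) (pt x) \<approx> 1 * tw (scale n)"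
    by (intro cong_mult D_shift act_Omega hh_closed s) (simp add: D_hh s)
  finally have "D n (pt x) \<approx> tw (scale n)" by simp
  then have "scale n * D n (pt x) \<approx> scale n * tw (scale n)" by (intro cong_mult cong_refl)
  also note tw_inverse [OF s]
  finally show "scale n * D n (pt x) \<approx> 1" .
qed

lemma mu_A: "unit x \<Longrightarrow> \<mu> x \<in> A"
  unfolding \<mu>_def D_def by (simp add: scale_A cocycle_N w_closed)

lemma mu_cong: "x \<approx> y \<Longrightarrow> \<mu> x = \<mu> y"
proof -
  assume xy: "x \<approx> y"
  then have "pt x = pt y" by simp
  then show ?thesis unfolding \<mu>_def by (simp only: unit_cong [OF xy])
qed

lemma mu_W: "unit x \<Longrightarrow> \<mu> x * \<mu> (W x) \<approx> 1"
proof -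
  assume x: "unit x"
  have "D w (act w (pt x)) * D w (pt x) \<approx> D (w \<otimes> w) (pt x)"
    by (intro cong_sym [OF D_mult]) (simp_all add: w_closed)
  also have "D (w \<otimes> w) (pt x) \<approx> 1" unfolding w_w by (rule D_one) simp
  finally show ?thesis using x by (simp add: w_pt \<mu>_def W_unit mult.commute)
qed

text \<open>A Bruhat-type relation: two occurrences of \<open>w\<close> are reduced to one, at the
  cost of an affine factor of slope \<open>\<mu> c\<close>.\<close>

lemma w_shift_w:
  assumes c: "unit c"
  shows "w \<otimes> shift c \<otimes> w = shift (W c) \<otimes> w \<otimes> cocycle w (pt c)"
  using w_closed by (simp add: cocycle_def w_pt c m_assoc inv_mult_group inv_cancel)

text \<open>The slope is \<open>\<mu> c\<close>, and the zero can be read off from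
  \<open>w_shift_w\<close>: the left side sends \<open>W (- c)\<close> to infinity, so the affine
  factor must send it to 0.\<close>

lemma cocycle_w_pt:
  assumes c: "unit c"
  shows "act (cocycle w (pt c)) (pt x) = pt (\<mu> c * (x - W (- c)))"
proof -
  let ?n = "cocycle w (pt c)"
  have n: "?n \<in> N" by (rule cocycle_N) (simp_all add: w_closed)
  have nc: "?n \<in> carrier G" using n by (rule N_D)
  obtain b where b: "\<And>x. act ?n (pt x) = pt (scale ?n * x + b)" using N_affine [OF n] by metis
  have m: "scale ?n = \<mu> c" by (simp add: \<mu>_def D_def c)
  have u: "unit (- c)" "unit (W (- c))" using c W_unit [of "- c"] by simp_all
  have "act (w \<otimes> shift c \<otimes> w) (pt (W (- c))) = act w (pt (W (W (- c)) + c))"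
    using w_closed u by (simp add: act_act w_pt)
  also have "pt (W (W (- c)) + c) = pt 0"
    unfolding pt_eq_iff by (rule cong_comb1 [OF W_W [OF u(1)], where u = 1]) simp
  also have "act w (pt 0) = None" by (rule w_zero)
  finally have "act (shift (W c)) (act w (act ?n (pt (W (- c))))) = None"
    unfolding w_shift_w [OF c] using w_closed nc by (simp add: act_act)
  then have "act w (act ?n (pt (W (- c)))) = None"
    using act_inj [OF shift_closed, of "act w (act ?n (pt (W (- c))))" None] w_closed by simp
  then have "act ?n (pt (W (- c))) = pt 0"
    using act_inj [OF w_closed act_Omega [OF nc, of "pt (W (- c))"], of "pt 0"] by (simp add: w_zero)
  then have "\<mu> c * W (- c) + b \<approx> 0" by (simp add: b m)
  then have "\<mu> c * x + b \<approx> \<mu> c * (x - W (- c))"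
    by (rule cong_comb1 [where u = 1]) (simp add: algebra_simps)
  then show ?thesis by (simp add: b m)
qed

lemma W_shift_eq_0: "unit x \<Longrightarrow> unit c \<Longrightarrow> W x + c \<approx> 0 \<longleftrightarrow> x \<approx> W (- c)"
proof
  assume x: "unit x" and c: "unit c"
  have c': "unit (- c)" using c by simp
  {
    assume "W x + c \<approx> 0"
    then have "W x \<approx> - c" by (rule cong_comb1 [where u = 1]) simp
    then have "W (W x) = W (- c)" by (rule W_cong)
    then show "x \<approx> W (- c)" using W_W [OF x] by (simp add: cong_sym_eq)
  next
    assume "x \<approx> W (- c)"
    then have "W x = W (W (- c))" by (rule W_cong)
    then have "W x \<approx> - c" using W_W [OF c'] by simp
    then show "W x + c \<approx> 0" by (rule cong_comb1 [where u = 1]) simp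
  }
qed

lemma W_shift:
  assumes x: "unit x" and c: "unit c" and ne: "\<not> x \<approx> W (- c)"
  shows "W (W x + c) \<approx> W c + W (\<mu> c * (x - W (- c)))"
proof -
  have u1: "unit (W x + c)" using W_shift_eq_0 [OF x c] ne by (simp add: zero_iff)
  have "unit (x - W (- c))" using ne by (simp add: cong_iff_dvd_diff)
  then have u2: "unit (\<mu> c * (x - W (- c)))" using A_unit [OF mu_A [OF c]] by (simp add: unit_mult)
  have nc: "cocycle w (pt c) \<in> carrier G" by (simp add: w_closed)
  have "pt (W (W x + c)) = act (w \<otimes> shift c \<otimes> w) (pt x)"
    using w_closed x u1 by (simp add: act_act w_pt)
  also have "\<dots> = act (shift (W c) \<otimes> w \<otimes> cocycle w (pt c)) (pt x)" by (simp only: w_shift_w [OF c])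
  also have "act (shift (W c) \<otimes> w \<otimes> cocycle w (pt c)) (pt x) = pt (W (\<mu> c * (x - W (- c))) + W c)"
    using w_closed nc u2 by (simp add: act_act cocycle_w_pt [OF c] w_pt)
  finally show ?thesis by (simp only: pt_eq_iff add.commute)
qed

text \<open>The relation \<open>w_shift_w\<close> is evaluated at 0, which its left side fixes by
  way of infinity.\<close>

lemma mu_mult_W:
  assumes c: "unit c"
  shows "\<mu> c * W c \<approx> - W (- W (- c))"
proof -
  have mA: "\<mu> c \<in> A" by (rule mu_A [OF c])
  have u: "unit (W (- c))" using W_unit [of "- c"] c by simp
  have u2: "unit (\<mu> c * (0 - W (- c)))" using A_unit [OF mA] u by (simp add: unit_mult)
  have nc: "cocycle w (pt c) \<in> carrier G" by (simp add: w_closed)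
  have "act (w \<otimes> shift c \<otimes> w) (pt 0) = pt 0"
    using w_closed by (simp add: act_act w_zero w_infinity)
  moreover have "act (shift (W c) \<otimes> w \<otimes> cocycle w (pt c)) (pt 0) = pt (W (\<mu> c * (0 - W (- c))) + W c)"
    using w_closed nc u2 by (simp add: act_act cocycle_w_pt [OF c] w_pt)
  ultimately have 1: "W (\<mu> c * (0 - W (- c))) + W c \<approx> 0" using w_shift_w [OF c] by (simp add: cong_sym_eq)
  have 2: "\<mu> c * W (\<mu> c * (0 - W (- c))) \<approx> W (0 - W (- c))" by (rule W_scale [OF mA])
  show ?thesis
    by (rule cong_comb2 [OF 1 2, where u = "\<mu> c" and v = "- 1"]) (simp add: algebra_simps)
qed

text \<open>Evaluating \<open>D\<close> on both sides of
  \<open>w \<otimes> hh a = hh (tw a) \<otimes> w\<close> gives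
  \<open>\<mu> (a * x) * tw a = a * \<mu> x\<close> modulo \<open>p\<close>; multiplying by a
  removes \<open>tw a\<close>.\<close>

lemma mu_scale:
  assumes a: "a \<in> A" shows "\<mu> (a * x) \<approx> a ^ 2 * \<mu> x"
proof (cases "unit x")
  case True
  have ac: "hh a \<in> carrier G" "hh (tw a) \<in> carrier G" by (intro hh_closed tw_A a)+
  have ux: "unit (a * x)" using True A_unit [OF a] by (simp add: unit_mult)
  have "inv w = w" by (rule inv_equality [OF w_w w_closed w_closed])
  then have eq: "w \<otimes> hh a = hh (tw a) \<otimes> w"
    using wconj_hh [OF a] ac w_closed by (simp add: m_assoc w_w flip: wconj_hh [OF a])
  have "D (w \<otimes> hh a) (pt x) \<approx> D w (act (hh a) (pt x)) * D (hh a) (pt x)"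
    by (intro D_mult) (simp_all add: w_closed ac)
  then have 1: "D (w \<otimes> hh a) (pt x) \<approx> \<mu> (a * x) * tw a" by (simp add: hh_pt a D_hh \<mu>_def ux)
  have "D (hh (tw a) \<otimes> w) (pt x) \<approx> D (hh (tw a)) (act w (pt x)) * D w (pt x)"
    by (intro D_mult) (simp_all add: w_closed ac)
  then have 2: "D (hh (tw a) \<otimes> w) (pt x) \<approx> tw (tw a) * \<mu> x" by (simp add: w_pt True D_hh tw_A a \<mu>_def)
  have 3: "\<mu> (a * x) * tw a \<approx> a * \<mu> x"
  proof -
    have "\<mu> (a * x) * tw a \<approx> tw (tw a) * \<mu> x" using cong_trans [OF cong_sym [OF 1]] 2 eq by simp
    also have "tw (tw a) * \<mu> x \<approx> a * \<mu> x" by (intro cong_mult tw_tw a cong_refl)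
    finally show ?thesis .
  qed
  show ?thesis
    by (rule cong_comb2 [OF 3 tw_inverse [OF a], where u = a and v = "- \<mu> (a * x)"])
      (simp add: algebra_simps power2_eq_square)
next
  case False
  then show ?thesis by (simp add: \<mu>_def unit_mult)
qed

text \<open>Inverting \<open>w_shift_w\<close> and evaluating \<open>D\<close> at infinity gives
  \<open>\<mu> (- c)\<close> on one side. On the other stands the value at 0 for the inverse of the
  affine factor, which is again \<open>\<mu> c\<close> since \<open>D_N\<close> inverts slopes at
  finite points.\<close>

lemma mu_even: "\<mu> (- c) \<approx> \<mu> c"
proof (cases "unit c")
  case c: True
  let ?n = "cocycle w (pt c)"
  have n: "?n \<in> N" by (rule cocycle_N) (simp_all add: w_closed)
  have nc: "?n \<in> carrier G" using n by (rule N_D)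
  have iw: "inv w = w" by (rule inv_equality [OF w_w w_closed w_closed])
  have "inv (w \<otimes> shift c \<otimes> w) = inv (shift (W c) \<otimes> w \<otimes> ?n)" using w_shift_w [OF c] by simp
  then have eq: "w \<otimes> (shift (- c) \<otimes> w) = inv ?n \<otimes> (w \<otimes> shift (- W c))"
    using w_closed nc by (simp add: inv_mult_group inv_shift iw m_assoc)
  have "D (w \<otimes> (shift (- c) \<otimes> w)) None \<approx> D w (act (shift (- c) \<otimes> w) None) * D (shift (- c) \<otimes> w) None"
    by (intro D_mult) (simp_all add: w_closed)
  also have "act (shift (- c) \<otimes> w) None = pt (- c)" using w_closed by (simp add: act_act w_infinity)
  also have "D w (pt (- c)) * D (shift (- c) \<otimes> w) None
      \<approx> D w (pt (- c)) * (D (shift (- c)) (act w None) * D w None)"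
    by (intro cong_mult cong_refl D_mult) (simp_all add: w_closed)
  also have "D w (pt (- c)) * (D (shift (- c)) (act w None) * D w None) \<approx> D w (pt (- c)) * (1 * 1)"
    by (intro cong_mult cong_refl D_shift D_w) (simp add: w_closed)
  finally have 1: "D (w \<otimes> (shift (- c) \<otimes> w)) None \<approx> \<mu> (- c)" using c by (simp add: \<mu>_def)
  have ic: "inv ?n \<in> N" by (rule N_inv [OF n])
  have "D (inv ?n \<otimes> (w \<otimes> shift (- W c))) None
      \<approx> D (inv ?n) (act (w \<otimes> shift (- W c)) None) * D (w \<otimes> shift (- W c)) None"
    by (intro D_mult) (simp_all add: w_closed nc)
  also have "act (w \<otimes> shift (- W c)) None = pt 0" using w_closed by (simp add: act_act w_infinity)
  also have "D (inv ?n) (pt 0) * D (w \<otimes> shift (- W c)) None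
      \<approx> D (inv ?n) (pt 0) * (D w (act (shift (- W c)) None) * D (shift (- W c)) None)"
    by (intro cong_mult cong_refl D_mult) (simp_all add: w_closed)
  also have "D (inv ?n) (pt 0) * (D w (act (shift (- W c)) None) * D (shift (- W c)) None)
      \<approx> D (inv ?n) (pt 0) * (1 * 1)"
    by (intro cong_mult cong_refl D_shift) (simp_all add: D_w)
  finally have 2: "\<mu> (- c) \<approx> D (inv ?n) (pt 0)"
    using cong_trans [OF cong_sym [OF 1]] eq by simp
  have 3: "scale (inv ?n) * D (inv ?n) (pt 0) \<approx> 1" by (rule D_N [OF ic])
  have 4: "scale ?n * scale (inv ?n) \<approx> 1" by (rule scale_inv [OF n])
  have m: "scale ?n = \<mu> c" by (simp add: \<mu>_def D_def c)
  have "D (inv ?n) (pt 0) \<approx> \<mu> c"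
    by (rule cong_comb2 [OF 3 4 [unfolded m], where u = "\<mu> c" and v = "- D (inv ?n) (pt 0)"])
      (simp add: algebra_simps)
  with 2 show ?thesis by (rule cong_trans)
next
  case False
  then show ?thesis by (simp add: \<mu>_def)
qed

text \<open>\<open>D\<close> is evaluated at x on both sides of \<open>w_shift_w\<close> for y. On
  the right side \<open>mu_scale\<close> extracts \<open>\<mu> y ^ 2\<close>, and the affine factor
  divides by \<open>\<mu> y\<close>.\<close>

lemma mu_chain:
  assumes x: "unit x" and y: "unit y"
  shows "\<mu> x * \<mu> (W x + y) \<approx> \<mu> y * \<mu> (x - W (- y))"
proof (cases "W x + y \<approx> 0")
  case True
  then have "x \<approx> W (- y)" using W_shift_eq_0 [OF x y] by simp
  then have "\<not> unit (x - W (- y))" by (simp add: cong_iff_dvd_diff)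
  moreover have "\<not> unit (W x + y)" using True by (simp add: cong_0_iff)
  ultimately show ?thesis by (simp add: \<mu>_def)
next
  case False
  let ?n = "cocycle w (pt y)"
  have n: "?n \<in> N" by (rule cocycle_N) (simp_all add: w_closed)
  have nc: "?n \<in> carrier G" using n by (rule N_D)
  have m: "scale ?n = \<mu> y" by (simp add: \<mu>_def D_def y)
  have mA: "\<mu> y \<in> A" by (rule mu_A [OF y])
  have u: "unit (W x + y)" using False by (simp add: zero_iff)
  have u': "unit (x - W (- y))" using False W_shift_eq_0 [OF x y] by (simp add: cong_iff_dvd_diff)
  have u2: "unit (\<mu> y * (x - W (- y)))" using A_unit [OF mA] u' by (simp add: unit_mult)
  have "D (w \<otimes> (shift y \<otimes> w)) (pt x) \<approx> D w (act (shift y \<otimes> w) (pt x)) * D (shift y \<otimes> w) (pt x)"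
    by (intro D_mult) (simp_all add: w_closed)
  also have "act (shift y \<otimes> w) (pt x) = pt (W x + y)" using w_closed x by (simp add: act_act w_pt)
  also have "D w (pt (W x + y)) * D (shift y \<otimes> w) (pt x)
      \<approx> D w (pt (W x + y)) * (D (shift y) (act w (pt x)) * D w (pt x))"
    by (intro cong_mult cong_refl D_mult) (simp_all add: w_closed)
  also have "D w (pt (W x + y)) * (D (shift y) (act w (pt x)) * D w (pt x))
      \<approx> D w (pt (W x + y)) * (1 * D w (pt x))"
    by (intro cong_mult cong_refl D_shift) (simp add: w_closed)
  finally have 1: "D (w \<otimes> (shift y \<otimes> w)) (pt x) \<approx> \<mu> x * \<mu> (W x + y)"
    using x u by (simp add: \<mu>_def mult.commute)
  have "w \<otimes> (shift y \<otimes> w) = shift (W y) \<otimes> (w \<otimes> ?n)"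
    using w_shift_w [OF y] w_closed nc by (simp add: m_assoc)
  then have "D (w \<otimes> (shift y \<otimes> w)) (pt x) = D (shift (W y) \<otimes> (w \<otimes> ?n)) (pt x)" by simp
  also have "D (shift (W y) \<otimes> (w \<otimes> ?n)) (pt x)
      \<approx> D (shift (W y)) (act (w \<otimes> ?n) (pt x)) * D (w \<otimes> ?n) (pt x)"
    by (intro D_mult) (simp_all add: w_closed)
  also have "D (shift (W y)) (act (w \<otimes> ?n) (pt x)) * D (w \<otimes> ?n) (pt x)
      \<approx> 1 * (D w (act ?n (pt x)) * D ?n (pt x))"
    by (intro cong_mult D_shift D_mult) (simp_all add: w_closed)
  also have "1 * (D w (act ?n (pt x)) * D ?n (pt x)) = \<mu> (\<mu> y * (x - W (- y))) * D ?n (pt x)"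
    by (simp add: cocycle_w_pt [OF y] \<mu>_def [of "\<mu> y * (x - W (- y))"] u2)
  finally have 2: "\<mu> x * \<mu> (W x + y) \<approx> \<mu> (\<mu> y * (x - W (- y))) * D ?n (pt x)"
    using cong_trans [OF cong_sym [OF 1]] by blast
  have 3: "\<mu> (\<mu> y * (x - W (- y))) \<approx> \<mu> y ^ 2 * \<mu> (x - W (- y))" by (rule mu_scale [OF mA])
  have 4: "\<mu> y * D ?n (pt x) \<approx> 1" using D_N(2) [OF n] unfolding m .
  show ?thesis
    by (rule cong_comb3 [OF 2 3 4, where u = 1 and v = "D ?n (pt x)" and w = "\<mu> y * \<mu> (x - W (- y))"])
      (simp add: algebra_simps power2_eq_square)
qed

text \<open>This is \<open>W_shift\<close> for c = - W z, multiplied by \<open>\<mu> c\<close>,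
  which \<open>W_scale\<close> and \<open>mu_mult_W\<close> absorb on the right.\<close>

lemma W_diff:
  assumes x: "unit x" and z: "unit z" and ne: "\<not> x \<approx> z"
  shows "W (W x - W z) * \<mu> (W z) \<approx> W (x - z) - W (- z)"
proof -
  define c where "c = - W z"
  have Wz: "unit (W z)" by (rule W_unit [OF z])
  have c: "unit c" unfolding c_def using Wz by simp
  have Wc: "W (- c) \<approx> z" unfolding c_def using W_W [OF z] by simp
  then have ne': "\<not> x \<approx> W (- c)" using ne cong_trans by blast
  have mA: "\<mu> c \<in> A" by (rule mu_A [OF c])
  have "x - W (- c) \<approx> x - z" by (intro cong_diff Wc cong_refl)
  then have eq: "W (\<mu> c * (x - W (- c))) = W (\<mu> c * (x - z))"
    by (intro W_cong cong_mult cong_refl)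
  have 1: "W (W x + c) \<approx> W c + W (\<mu> c * (x - z))" using W_shift [OF x c ne'] by (simp only: eq)
  have 2: "\<mu> c * W (\<mu> c * (x - z)) \<approx> W (x - z)" by (rule W_scale [OF mA])
  have "W (- W (- c)) = W (- z)" by (intro W_cong cong_uminus Wc)
  then have 3: "\<mu> c * W c \<approx> - W (- z)" using mu_mult_W [OF c] by simp
  have 4: "\<mu> c \<approx> \<mu> (W z)" unfolding c_def by (rule mu_even)
  have "W (W x + c) * \<mu> c \<approx> W (x - z) - W (- z)"
    by (rule cong_comb3 [OF 1 2 3, where u = "\<mu> c" and v = 1 and w = 1]) (simp add: algebra_simps)
  then have "W (W x - W z) * \<mu> c \<approx> W (x - z) - W (- z)" by (simp add: c_def)
  moreover have "W (W x - W z) * \<mu> (W z) \<approx> W (W x - W z) * \<mu> c"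
    by (intro cong_mult cong_refl cong_sym [OF 4])
  ultimately show ?thesis by (blast intro: cong_trans)
qed

end

section \<open>Fixed points, involutions and the index of the slope group\<close>

context simple_affine_stabilizer begin

lemma p_odd: "odd p"
proof (rule ccontr)
  assume "\<not> odd p"
  then have "p = 2" using p_prime primes_dvd_imp_eq two_is_prime_nat by blast
  obtain a where a: "a \<in> A" "\<not> a \<approx> 1" using A_nontrivial by blast
  have "odd a" using A_unit [OF a(1)] \<open>p = 2\<close> by simp
  then have "even (a - 1)" by simp
  then have "a \<approx> 1" unfolding cong_iff_dvd_diff \<open>p = 2\<close> by simp
  then show False using a(2) by simp
qed

text \<open>In terms of a generator g of the units, \<open>A\<close> contains all even powers. It
  cannot contain an odd one, for then g and with it every unit would lie in
  \<open>A\<close>.\<close>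

lemma index_two:
  assumes sq': "\<forall>s. unit s \<longrightarrow> s ^ 2 \<in> A" and n: "unit n" "n \<notin> A"
  shows "unit x \<Longrightarrow> unit y \<Longrightarrow> x \<notin> A \<Longrightarrow> y \<notin> A \<Longrightarrow> x * y \<in> A"
    and "a \<in> A \<Longrightarrow> \<exists>s. unit s \<and> a \<approx> s ^ 2"
proof -
  note sq = sq' [rule_format]
  obtain g :: int where g: "unit g" "bij_betw (\<lambda>i. g ^ i mod int p) {..<p - 1} {1..<int p}"
    using exists_generator by metis
  have pow: "\<exists>i. x \<approx> g ^ i" if "unit x" for x
  proof -
    have "x mod int p \<in> (\<lambda>i. g ^ i mod int p) ` {..<p - 1}"
      using unit_mod [OF that] g(2) by (simp add: bij_betw_def)
    then obtain i where "x mod int p = g ^ i mod int p" by blast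
    then show ?thesis by (auto simp: cong_def)
  qed
  have gA: "g \<notin> A"
  proof
    assume gA: "g \<in> A"
    obtain i where "n \<approx> g ^ i" using pow [OF n(1)] by blast
    then show False using A_cong [OF A_power [OF gA] cong_sym] n(2) by blast
  qed
  have even: "even i" if i: "g ^ i \<in> A" for i
  proof (rule ccontr)
    assume "odd i"
    then obtain k where k: "i = 2 * k + 1" by (rule oddE)
    obtain y where y: "unit y" "g ^ k * y \<approx> 1" using unit_inverse [OF unit_power [OF g(1)]] by blast
    have "g ^ i * y ^ 2 = (g ^ k * y) ^ 2 * g"
      unfolding k by (simp add: power_add power_mult power2_eq_square algebra_simps power_even_eq)
    also have "(g ^ k * y) ^ 2 * g \<approx> 1 ^ 2 * g" by (intro cong_mult cong_pow y(2) cong_refl)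
    finally have "g ^ i * y ^ 2 \<approx> g" by simp
    then have "g \<in> A" by (rule A_cong [OF A_mult [OF i sq [OF y(1)]]])
    then show False using gA by simp
  qed
  have evenA: "g ^ i \<in> A" if i: "even i" for i
  proof -
    obtain k where "i = 2 * k" using i by (rule evenE)
    then have "g ^ i = (g ^ k) ^ 2" by (simp add: power_mult mult.commute [of 2])
    then show ?thesis using sq [OF unit_power [OF g(1)]] by simp
  qed
  show "x * y \<in> A" if xy: "unit x" "unit y" "x \<notin> A" "y \<notin> A"
  proof -
    obtain i j where ij: "x \<approx> g ^ i" "y \<approx> g ^ j" using pow xy by blast
    have "odd i" "odd j" using evenA [of i] evenA [of j] ij xy A_cong cong_sym by blast+
    then have "g ^ (i + j) \<in> A" by (intro evenA) simp
    moreover have "g ^ (i + j) \<approx> x * y"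
      unfolding power_add by (intro cong_mult cong_sym [OF ij(1)] cong_sym [OF ij(2)])
    ultimately show ?thesis by (rule A_cong)
  qed
  show "\<exists>s. unit s \<and> a \<approx> s ^ 2" if a: "a \<in> A"
  proof -
    obtain i where i: "a \<approx> g ^ i" using pow [OF A_unit [OF a]] by blast
    have "even i" using even A_cong [OF a i] by blast
    then obtain k where "i = 2 * k" by (rule evenE)
    then have "g ^ i = (g ^ k) ^ 2" by (simp add: power_mult mult.commute [of 2])
    then show ?thesis using i unit_power [OF g(1)] by (intro exI [of _ "g ^ k"]) simp
  qed
qed

lemma fixed_point_conjugate:
  assumes u: "u \<in> carrier G" "act u (pt c) = pt c"
  obtains g where "g \<in> carrier G" "act g (pt c) = None" "g \<otimes> u \<otimes> inv g \<in> N"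
proof -
  let ?g = "w \<otimes> shift (- c)"
  have g: "?g \<in> carrier G" using w_closed by simp
  have c: "act ?g (pt c) = None" using w_closed by (simp add: act_act w_zero)
  then have "act (inv ?g) None = pt c" using g by (simp add: act_inv_eq)
  then have "?g \<otimes> u \<otimes> inv ?g \<in> N" unfolding N_def using g u c by (simp add: act_act)
  then show ?thesis using that g c by blast
qed

lemma conjugate_eq_one:
  assumes "g \<in> carrier G" "u \<in> carrier G" "g \<otimes> u \<otimes> inv g = \<one>"
  shows "u = \<one>"
proof -
  have "u = inv g \<otimes> (g \<otimes> u \<otimes> inv g) \<otimes> g" using assms(1,2) by (simp add: m_assoc inv_cancel)
  then show ?thesis unfolding assms(3) using assms(1) by simp
qed

text \<open>After one fixed point is moved to infinity, an affine map with two fixed points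
  remains.\<close>

lemma three_fixed_points:
  assumes u: "u \<in> carrier G" and fixed: "act u (pt c) = pt c" "act u (pt d) = pt d" "act u (pt e) = pt e"
    and ne: "\<not> c \<approx> d" "\<not> c \<approx> e" "\<not> d \<approx> e"
  shows "u = \<one>"
proof -
  obtain g where g: "g \<in> carrier G" "act g (pt c) = None" "g \<otimes> u \<otimes> inv g \<in> N"
    using fixed_point_conjugate [OF u fixed(1)] .
  let ?n = "g \<otimes> u \<otimes> inv g"
  have pts: "\<exists>y. act g (pt x) = pt y" if "\<not> c \<approx> x" for x
  proof -
    have "act g (pt x) \<noteq> act g (pt c)" using that by (simp add: act_inj g(1) cong_sym_eq)
    then have ne: "act g (pt x) \<noteq> None" by (simp add: g(2))
    show ?thesis by (rule Omega_cases [OF act_Omega [OF g(1), of "pt x"]]) (use ne in blast)+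
  qed
  obtain y where y: "act g (pt d) = pt y" using pts [OF ne(1)] by blast
  obtain z where z: "act g (pt e) = pt z" using pts [OF ne(2)] by blast
  note yz = y z
  have "\<not> y \<approx> z" using act_inj [OF g(1), of "pt d" "pt e"] ne(3) yz by simp
  have fixn: "act ?n (act g (pt x)) = act g (pt x)" if "act u (pt x) = pt x" for x
    using g(1) u that by (simp add: act_act)
  obtain b where b: "\<And>x. act ?n (pt x) = pt (scale ?n * x + b)" using N_affine [OF g(3)] by metis
  have 1: "scale ?n * y + b \<approx> y" "scale ?n * z + b \<approx> z"
    using fixn [OF fixed(2)] fixn [OF fixed(3)] by (simp_all only: yz b pt_eq_iff)
  have "(scale ?n - 1) * (y - z) \<approx> 0"
    by (rule cong_comb2 [OF 1, where u = 1 and v = "- 1"]) (simp add: algebra_simps)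
  moreover have "\<not> y - z \<approx> 0" using \<open>\<not> y \<approx> z\<close> by (simp add: cong_diff_iff_cong_0)
  ultimately have s: "scale ?n - 1 \<approx> 0" using mult_zero by blast
  have fix_all: "scale ?n * x + b \<approx> x" for x
    by (rule cong_comb2 [OF s 1(1), where u = "x - y" and v = 1]) (simp add: algebra_simps)
  have "?n = \<one>"
  proof (rule act_eqI)
    fix v assume "v \<in> \<Omega>"
    then show "act ?n v = act \<one> v"
      by (rule Omega_cases) (use N_D [OF g(3)] fix_all in \<open>simp_all add: b\<close>)
  qed (use N_D [OF g(3)] in simp_all)
  then show ?thesis by (rule conjugate_eq_one [OF g(1) u])
qed

text \<open>After the fixed point is moved to infinity, the slope squares to 1. As it is not -1, the
  map is a translation, and for odd \<open>p\<close> a translation of order at most 2 is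
  trivial.\<close>

lemma involution_no_fixed_point:
  assumes m1: "- 1 \<notin> A" and u: "u \<in> carrier G" "u \<otimes> u = \<one>" and fixed: "act u (pt c) = pt c"
  shows "u = \<one>"
proof -
  obtain g where g: "g \<in> carrier G" "act g (pt c) = None" "g \<otimes> u \<otimes> inv g \<in> N"
    using fixed_point_conjugate [OF u(1) fixed] .
  let ?n = "g \<otimes> u \<otimes> inv g"
  have nn: "?n \<otimes> ?n = \<one>"
  proof -
    have "?n \<otimes> ?n = g \<otimes> (u \<otimes> u) \<otimes> inv g" using g u(1) by (simp add: m_assoc inv_cancel del: u)
    then show ?thesis using g u(2) by simp
  qed
  have "scale ?n * scale ?n \<approx> scale (?n \<otimes> ?n)" by (rule cong_sym [OF scale_mult [OF g(3) g(3)]])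
  also have "scale (?n \<otimes> ?n) \<approx> 1" unfolding nn by (rule scale_one)
  finally have "scale ?n ^ 2 \<approx> 1" by (simp add: power2_eq_square)
  then have s: "scale ?n \<approx> 1" using square_one A_cong [OF scale_A [OF g(3)]] m1 by blast
  obtain b where b: "\<And>x. act ?n (pt x) = pt (scale ?n * x + b)" using N_affine [OF g(3)] by metis
  have "act (?n \<otimes> ?n) (pt 0) = pt (scale ?n * b + b)" using N_D [OF g(3)] by (simp add: act_act b)
  then have 2: "scale ?n * b + b \<approx> 0" unfolding nn by (simp add: cong_sym_eq)
  have "2 * b \<approx> 0"
    by (rule cong_comb2 [OF 2 s, where u = 1 and v = "- b"]) (simp add: algebra_simps)
  moreover have "\<not> 2 \<approx> 0"
  proof
    assume "2 \<approx> 0"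
    then have "int p dvd int 2" by (simp add: cong_0_iff)
    then have "p dvd 2" by presburger
    then have "p = 2" using p_gt_1 by (auto dest: dvd_imp_le)
    then show False using p_odd by simp
  qed
  ultimately have b0: "b \<approx> 0" using mult_zero by blast
  have fix_all: "scale ?n * x + b \<approx> x" for x
    by (rule cong_comb2 [OF s b0, where u = x and v = 1]) (simp add: algebra_simps)
  have "?n = \<one>"
  proof (rule act_eqI)
    fix v assume "v \<in> \<Omega>"
    then show "act ?n v = act \<one> v"
      by (rule Omega_cases) (use N_D [OF g(3)] fix_all in \<open>simp_all add: b\<close>)
  qed (use N_D [OF g(3)] in simp_all)
  then show ?thesis by (rule conjugate_eq_one [OF g(1) u(1)])
qed

text \<open>The data that identify the action as that of PSL_2(p): the slopes are the squares of
  units, and x -> -1/x is present. The congruence \<open>x * y \<approx> - 1\<close> avoids choosing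
  inverses.\<close>

definition standard :: bool
  where "standard \<longleftrightarrow> (\<forall>s. unit s \<longrightarrow> s ^ 2 \<in> A) \<and> (\<forall>a\<in>A. \<exists>s. unit s \<and> a \<approx> s ^ 2) \<and>
    (\<exists>v\<in>carrier G. act v None = pt 0 \<and> act v (pt 0) = None \<and>
      (\<forall>x y. unit x \<longrightarrow> x * y \<approx> - 1 \<longrightarrow> act v (pt x) = pt y))"

end

section \<open>The two cases when w inverts the slopes\<close>

context inverting begin

lemma hh_w_involution: "a \<in> A \<Longrightarrow> (hh a \<otimes> w) \<otimes> (hh a \<otimes> w) = \<one>"
proof -
  assume a: "a \<in> A"
  have ac: "hh a \<in> carrier G" "hh (tw a) \<in> carrier G" by (intro hh_closed tw_A a)+
  have iw: "inv w = w" by (rule inv_equality [OF w_w w_closed w_closed])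
  have "(hh a \<otimes> w) \<otimes> (hh a \<otimes> w) = hh a \<otimes> (w \<otimes> hh a \<otimes> w)" using ac w_closed by (simp add: m_assoc)
  also have "w \<otimes> hh a \<otimes> w = hh (tw a)" using wconj_hh [OF a] by (simp add: iw)
  also have "hh a \<otimes> hh (tw a) = hh (a * tw a)" by (rule hh_mult [symmetric, OF a tw_A [OF a]])
  also have "\<dots> = hh 1" by (rule hh_cong [OF A_mult [OF a tw_A [OF a]] tw_inverse [OF a]])
  also have "\<dots> = \<one>" by (rule hh_eqI [OF A_one H_one scale_one])
  finally show ?thesis .
qed

lemma act_hh_w: "a \<in> A \<Longrightarrow> unit x \<Longrightarrow> act (hh a \<otimes> w) (pt x) = pt (a * W x)"
  by (simp add: act_act hh_closed w_closed w_pt hh_pt)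

lemma act_hh_w_0: "a \<in> A \<Longrightarrow> act (hh a \<otimes> w) None = pt 0" "a \<in> A \<Longrightarrow> act (hh a \<otimes> w) (pt 0) = None"
  by (simp_all add: act_act hh_closed w_closed w_infinity w_zero hh_pt hh_None)

lemma exponent_exists:
  obtains e :: nat where "e > 0" "\<And>i. (\<forall>b\<in>A. b ^ i \<approx> 1) \<longleftrightarrow> e dvd i"
proof -
  define P where "P i \<longleftrightarrow> i > 0 \<and> (\<forall>b\<in>A. b ^ i \<approx> 1)" for i :: nat
  have "P (p - 1)" unfolding P_def using p_gt_1 fermat A_unit by simp
  define e where "e = (LEAST i. P i)"
  have Pe: "P e" unfolding e_def by (rule LeastI) fact
  have least: "e \<le> i" if "P i" for i unfolding e_def using that by (rule Least_le)
  have iff: "(\<forall>b\<in>A. b ^ i \<approx> 1) \<longleftrightarrow> e dvd i" for i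
  proof
    assume i: "\<forall>b\<in>A. b ^ i \<approx> 1"
    have "b ^ (i mod e) \<approx> 1" if b: "b \<in> A" for b
    proof -
      have "b ^ i = (b ^ e) ^ (i div e) * b ^ (i mod e)"
        by (simp flip: power_mult power_add)
      moreover have "(b ^ e) ^ (i div e) * b ^ (i mod e) \<approx> 1 ^ (i div e) * b ^ (i mod e)"
        using Pe b unfolding P_def by (intro cong_mult cong_pow cong_refl) blast
      ultimately have "b ^ i \<approx> b ^ (i mod e)" by simp
      then show ?thesis using i b cong_sym cong_trans by blast
    qed
    then have "\<not> i mod e > 0" using least [of "i mod e"] Pe mod_less_divisor [of e i] unfolding P_def by fastforce
    then show "e dvd i" by (simp add: mod_eq_0_iff_dvd)
  next
    assume "e dvd i"
    then obtain k where k: "i = e * k" by blast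
    show "\<forall>b\<in>A. b ^ i \<approx> 1"
    proof
      fix b assume "b \<in> A"
      then have "b ^ e \<approx> 1" using Pe unfolding P_def by blast
      then have "(b ^ e) ^ k \<approx> 1 ^ k" by (rule cong_pow)
      then show "b ^ i \<approx> 1" unfolding k power_mult by simp
    qed
  qed
  show ?thesis using that [of e] Pe iff unfolding P_def by blast
qed

text \<open>By \<open>mu_quadratic\<close> the square of s is a quotient of two values of
  \<open>\<mu>\<close>, which lie in \<open>A\<close>. As -1 does not lie in \<open>A\<close>, the
  index is 2. It remains to correct \<open>w\<close> by an element of \<open>H\<close>.\<close>

theorem standard_minus_one_notin:
  assumes m1: "- 1 \<notin> A"
  shows standard
proof -
  obtain e :: nat where e0: "e > 0" and e: "\<And>i. (\<forall>b\<in>A. b ^ i \<approx> 1) \<longleftrightarrow> e dvd i"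
    using exponent_exists by blast
  have e1: "e > 1"
  proof (rule ccontr)
    assume "\<not> e > 1"
    then have "e dvd 1" using e0 by simp
    then have "\<forall>b\<in>A. b ^ 1 \<approx> 1" using e by blast
    then show False using A_nontrivial by simp
  qed
  have eodd: "odd e"
  proof (rule ccontr)
    assume "\<not> odd e"
    then obtain k where k: "e = k * 2" by (auto elim: evenE)
    \<comment> \<open>As e is the exponent, some \<open>b ^ k\<close> is not 1; its square is 1, so
      it is -1.\<close>
    have "\<not> e dvd k" using k e0 by (auto dest: dvd_imp_le)
    then obtain b where b: "b \<in> A" "\<not> b ^ k \<approx> 1" using e by blast
    have "b ^ e \<approx> 1" using e [of e] b(1) by simp
    then have "(b ^ k) ^ 2 \<approx> 1" unfolding k power_mult .
    then have "b ^ k \<approx> - 1" using square_one b(2) by blast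
    then have "- 1 \<in> A" by (rule A_cong [OF A_power [OF b(1)]])
    then show False using m1 by simp
  qed
  interpret cocycle_data p W \<mu> A e
  proof
    show "x \<approx> y \<Longrightarrow> W x \<approx> W y" for x y using W_cong [of x y] by simp
    show "x \<approx> y \<Longrightarrow> \<mu> x \<approx> \<mu> y" for x y using mu_cong [of x y] by simp
    show "W 0 \<approx> 0" "\<mu> 0 \<approx> 0" by (simp_all add: W_def \<mu>_def)
    show "\<mu> x ^ e \<approx> 1" if "unit x" for x
      using e [THEN iffD2, OF dvd_refl] by (rule bspec) (rule mu_A [OF that])
  qed ((fact W_unit W_W mu_W mu_chain W_diff mu_scale mu_even A_unit e eodd e1 p_odd)+)
  have m1u: "unit (- 1)" using unit_one by simp
  have sq: "s ^ 2 \<in> A" if s: "unit s" for s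
  proof -
    obtain z where z: "\<mu> 1 * z \<approx> 1" using unit_inverse [OF A_unit [OF mu_A [OF unit_one]]] by blast
    have zA: "z \<in> A" by (rule A_inverse [OF mu_A [OF unit_one] z])
    have q: "\<mu> s \<approx> \<mu> 1 * s ^ 2" by (rule mu_quadratic [OF s])
    have "\<mu> s * z \<approx> s ^ 2"
      by (rule cong_comb2 [OF q z, where u = z and v = "s ^ 2"]) (simp add: algebra_simps)
    then show ?thesis by (rule A_cong [OF A_mult [OF mu_A [OF s] zA]])
  qed
  have sq': "\<forall>s. unit s \<longrightarrow> s ^ 2 \<in> A" by (intro allI impI sq)
  note two = index_two [OF sq' m1u m1]
  have W1: "unit (W 1)" by (rule W_unit [OF unit_one])
  \<comment> \<open>Otherwise dividing by \<open>W 1\<close> would produce an involution that fixes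
    1.\<close>
  have W1A: "W 1 \<notin> A"
  proof
    assume a: "W 1 \<in> A"
    obtain z where z: "W 1 * z \<approx> 1" using unit_inverse [OF W1] by blast
    have zA: "z \<in> A" by (rule A_inverse [OF a z])
    have "act (hh z \<otimes> w) (pt 1) = pt 1" using act_hh_w [OF zA unit_one] z by (simp add: mult.commute)
    then have "hh z \<otimes> w = \<one>"
      by (intro involution_no_fixed_point [OF m1 _ hh_w_involution [OF zA]]) (simp_all add: hh_closed zA w_closed)
    then have "act (hh z \<otimes> w) None = None" by simp
    then show False by (simp add: act_hh_w_0 zA)
  qed
  have "- 1 * W 1 \<in> A" by (rule two(1) [OF m1u W1 m1 W1A])
  then have mW: "- W 1 \<in> A" by simp
  \<comment> \<open>Thus a = -1 / W 1, and \<open>hh a \<otimes> w\<close> sends 1 to -1.\<close>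
  obtain a where a: "- W 1 * a \<approx> 1" using unit_inverse [OF A_unit [OF mW]] by blast
  have aA: "a \<in> A" by (rule A_inverse [OF mW a])
  define v where "v = hh a \<otimes> w"
  have vc: "v \<in> carrier G" unfolding v_def by (simp add: hh_closed aA w_closed)
  have vA: "act v (pt x) = pt y" if x: "x \<in> A" and xy: "x * y \<approx> - 1" for x y
  proof -
    have 1: "x * W (x * 1) \<approx> W 1" by (rule W_scale [OF x])
    have "x * (a * W x) \<approx> x * y"
      by (rule cong_comb3 [OF 1 a xy, where u = a and v = "- 1" and w = "- 1"]) (simp add: algebra_simps)
    then have "a * W x \<approx> y" by (rule cancel [OF A_unit [OF x]])
    then show ?thesis unfolding v_def by (simp add: act_hh_w aA A_unit x)
  qed
  have "act v (pt x) = pt y" if x: "unit x" and xy: "x * y \<approx> - 1" for x y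
  proof (cases "x \<in> A")
    \<comment> \<open>Then y = -1/x lies in \<open>A\<close>, where the formula is known, and the
      involution \<open>v\<close> carries it back.\<close>
    case False
    have uy: "unit y" using unit_cong [OF xy] m1u by (simp add: unit_mult)
    have "y \<in> A"
    proof (rule ccontr)
      assume "y \<notin> A"
      then have "x * y \<in> A" by (rule two(1) [OF x uy False])
      then show False using A_cong [OF _ xy] m1 by blast
    qed
    then have "act v (pt y) = pt x" using xy by (intro vA) (simp_all add: mult.commute)
    then have "act v (pt x) = act (v \<otimes> v) (pt y)" using vc by (simp add: act_act)
    also have "v \<otimes> v = \<one>" unfolding v_def by (rule hh_w_involution [OF aA])
    finally show ?thesis by simp
  qed (rule vA [OF _ xy])
  then have 3: "\<exists>v\<in>carrier G. act v None = pt 0 \<and> act v (pt 0) = None \<and>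
      (\<forall>x y. unit x \<longrightarrow> x * y \<approx> - 1 \<longrightarrow> act v (pt x) = pt y)"
    using vc act_hh_w_0 [OF aA] unfolding v_def by blast
  have 1: "\<forall>s. unit s \<longrightarrow> s ^ 2 \<in> A" using sq by (intro allI impI)
  have 2: "\<forall>a\<in>A. \<exists>s. unit s \<and> a \<approx> s ^ 2" using two(2) by (intro ballI)
  show ?thesis unfolding standard_def using 1 2 3 by (intro conjI)
qed

text \<open>\<open>W 1 = 1\<close> and \<open>W_scale\<close> make \<open>W\<close> the inversion on
  \<open>A\<close>. A single relation suffices to pass to the other coset: \<open>W_shift\<close> at
  some x in \<open>A\<close> with x + 1 outside \<open>A\<close>.\<close>

theorem standard_minus_one_in:
  assumes m1: "- 1 \<in> A" and W1: "W 1 \<approx> 1"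
    and sq: "\<And>s. unit s \<Longrightarrow> s ^ 2 \<in> A" and n: "unit n" "n \<notin> A"
  shows standard
proof -
  have sq': "\<forall>s. unit s \<longrightarrow> s ^ 2 \<in> A" by (intro allI impI sq)
  note two = index_two [OF sq' n]
  have m1u: "unit (- 1)" using unit_one by simp
  have W_A: "y * W y \<approx> 1" if "y \<in> A" for y
    using cong_trans [OF W_scale [OF that, of 1] W1] by simp
  \<comment> \<open>The least positive integer outside \<open>A\<close> is at least 2, and its
    predecessor lies in \<open>A\<close>.\<close>
  have exm: "\<exists>x. x \<in> A \<and> unit (x + 1) \<and> x + 1 \<notin> A"
  proof -
    define m where "m = nat (n mod int p)"
    have nm: "n mod int p \<in> {1..<int p}" by (rule unit_mod [OF n(1)])
    then have m: "int m = n mod int p" by (simp add: m_def)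
    have mA: "int m \<notin> A"
    proof
      assume "int m \<in> A"
      then have "n \<in> A" by (rule A_cong) (simp add: m)
      then show False using n(2) by simp
    qed
    define P where "P k \<longleftrightarrow> 1 \<le> k \<and> int k \<notin> A" for k
    have Pm: "P m" unfolding P_def using mA nm m by auto
    define k where "k = (LEAST k. P k)"
    have Pk: "P k" unfolding k_def using Pm by (rule LeastI)
    have km: "k \<le> m" unfolding k_def using Pm by (rule Least_le)
    have k1: "k \<noteq> 1" using Pk A_one by (auto simp: P_def)
    have k2: "k \<ge> 2" using Pk k1 unfolding P_def by linarith
    have "\<not> P (k - 1)"
    proof
      assume "P (k - 1)"
      then have "k \<le> k - 1" unfolding k_def by (rule Least_le)
      then show False using k2 by simp
    qed
    then have "int (k - 1) \<in> A" unfolding P_def using k2 by simp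
    moreover have eq: "int (k - 1) + 1 = int k" using k2 by simp
    moreover have "unit (int k)"
      by (rule unit_less) (use k2 km m nm in auto)
    moreover have "int k \<notin> A" using Pk by (simp add: P_def)
    ultimately show ?thesis by (intro exI [of _ "int (k - 1)"]) (simp only: eq simp_thms)
  qed
  then obtain x where x: "x \<in> A" "unit (x + 1)" "x + 1 \<notin> A" by blast
  have ux: "unit x" by (rule A_unit [OF x(1)])
  define z where "z = x + 1"
  have Wm1: "W (- 1) \<approx> - 1"
    by (rule cong_comb1 [OF W_A [OF m1], where u = "- 1"]) simp
  have Wx: "x * W x \<approx> 1" by (rule W_A [OF x(1)])
  have WxA: "W x \<in> A" by (rule A_inverse [OF x(1) Wx])
  have mu1: "\<mu> 1 \<approx> - 1"
  proof -
    have 1: "\<mu> 1 * W 1 \<approx> - W (- W (- 1))" by (rule mu_mult_W [OF unit_one])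
    have "- W (- 1) \<approx> 1" by (rule cong_comb1 [OF Wm1, where u = "- 1"]) simp
    then have "W (- W (- 1)) = W 1" by (rule W_cong)
    then have 1: "\<mu> 1 * W 1 \<approx> - W 1" using 1 by simp
    show ?thesis
      by (rule cong_comb2 [OF 1 W1, where u = 1 and v = "- \<mu> 1 - 1"]) (simp add: algebra_simps)
  qed
  have "\<not> x \<approx> - 1" using x(2) by (simp add: cong_iff_dvd_diff)
  then have ne: "\<not> x \<approx> W (- 1)" using Wm1 cong_trans by blast
  have s: "W (W x + 1) \<approx> W 1 + W (\<mu> 1 * (x - W (- 1)))" by (rule W_shift [OF ux unit_one ne])
  have "\<mu> 1 * (x - W (- 1)) \<approx> - 1 * (x - - 1)" by (intro cong_mult cong_diff mu1 Wm1 cong_refl)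
  then have e1: "W (\<mu> 1 * (x - W (- 1))) = W (- 1 * z)" by (intro W_cong) (simp add: z_def)
  have "W x + 1 \<approx> W x * z"
    by (rule cong_comb1 [OF Wx, where u = "- 1"]) (simp add: z_def algebra_simps)
  then have e2: "W (W x + 1) = W (W x * z)" by (rule W_cong)
  have 1: "W (W x * z) \<approx> W 1 + W (- 1 * z)" using s unfolding e1 e2 .
  have 2: "W x * W (W x * z) \<approx> W z" by (rule W_scale [OF WxA])
  have 3: "- 1 * W (- 1 * z) \<approx> W z" by (rule W_scale [OF m1])
  \<comment> \<open>\<open>W z\<close> occurs on both sides because \<open>W_scale\<close> expresses
    \<open>W (W x * z)\<close> and \<open>W (- z)\<close> through it. Solving yields (x + 1) W z =
    1.\<close>
  have 4: "W z \<approx> W x * (1 - W z)"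
  proof -
    have "W x * W (W x * z) \<approx> W x * (1 - W z)"
      by (rule cong_comb3 [OF 1 W1 3, where u = "W x" and v = "W x" and w = "- W x"]) (simp add: algebra_simps)
    then show ?thesis using cong_trans [OF cong_sym [OF 2]] by blast
  qed
  have Wz: "z * W z \<approx> 1"
    by (rule cong_comb2 [OF 4 Wx, where u = x and v = "1 - W z"]) (simp add: z_def algebra_simps)
  have uz: "unit z" and zA: "z \<notin> A" using x by (simp_all add: z_def)
  have W_all: "y * W y \<approx> 1" if y: "unit y" for y
  proof (cases "y \<in> A")
    case False
    obtain t where t: "unit t" "z * t \<approx> 1" using unit_inverse [OF uz] .
    have "t \<notin> A"
    proof
      assume "t \<in> A"
      moreover have "t * z \<approx> 1" using t(2) by (simp add: mult.commute)
      ultimately show False using A_inverse zA by blast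
    qed
    then have a: "y * t \<in> A" using two(1) [OF y t(1)] False by blast
    have "y * t * z \<approx> y"
      by (rule cong_comb1 [OF t(2), where u = y]) (simp add: algebra_simps)
    then have e: "W (y * t * z) = W y" by (rule W_cong)
    have 1: "y * t * W y \<approx> W z" using W_scale [OF a, of z] unfolding e .
    show ?thesis
      by (rule cong_comb3 [OF 1 Wz t(2), where u = z and v = 1 and w = "- y * W y"]) (simp add: algebra_simps)
  qed (rule W_A)
  have "act (hh (- 1) \<otimes> w) (pt x) = pt y" if x: "unit x" and xy: "x * y \<approx> - 1" for x y
  proof -
    have "x * (- 1 * W x) \<approx> x * y"
      by (rule cong_comb2 [OF W_all [OF x] xy, where u = "- 1" and v = "- 1"]) simp
    then have "- 1 * W x \<approx> y" by (rule cancel [OF x])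
    then show ?thesis by (simp add: act_hh_w m1 x)
  qed
  then have 3: "\<exists>v\<in>carrier G. act v None = pt 0 \<and> act v (pt 0) = None \<and>
      (\<forall>x y. unit x \<longrightarrow> x * y \<approx> - 1 \<longrightarrow> act v (pt x) = pt y)"
    using act_hh_w_0 [OF m1] by (intro bexI [of _ "hh (- 1) \<otimes> w"]) (simp_all add: hh_closed m1 w_closed)
  have 1: "\<forall>s. unit s \<longrightarrow> s ^ 2 \<in> A" using sq by (intro allI impI)
  have 2: "\<forall>a\<in>A. \<exists>s. unit s \<and> a \<approx> s ^ 2" using two(2) by (intro ballI)
  show ?thesis unfolding standard_def using 1 2 3 by (intro conjI)
qed

end

section \<open>Parity of the permutations of the projective line\<close>

lemma sign_cycle_of_list:
  assumes "distinct cs" "cs \<noteq> []" shows "sign (cycle_of_list cs) = (- 1) ^ (length cs - 1)"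
  using assms
proof (induction cs rule: cycle_of_list.induct)
  case (1 i j cs)
  have "i \<noteq> j" using 1(2) by simp
  then have "sign (cycle_of_list (i # j # cs)) = - sign (cycle_of_list (j # cs))"
    unfolding cycle_of_list.simps
    by (subst sign_compose) (simp_all only: permutation_swap_id permutation_of_cycle sign_swap_id, simp)
  then show ?case using 1 by (simp del: cycle_of_list.simps)
qed simp_all

context affine_stabilizer begin

text \<open>\<open>sign\<close> refers to permutations of the whole type, so the action is extended
  by the identity.\<close>

definition perm :: "'a \<Rightarrow> int option \<Rightarrow> int option"
  where "perm g z = (if z \<in> \<Omega> then act g z else z)"

lemma permutation_perm: "g \<in> carrier G \<Longrightarrow> permutation (perm g)"
proof -
  assume g: "g \<in> carrier G"
  have "bij_betw (perm g) \<Omega> \<Omega>"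
    using bij_act [OF g] by (rule bij_betw_cong [THEN iffD1, rotated]) (simp add: perm_def)
  then have "perm g permutes \<Omega>" by (rule bij_imp_permutes) (simp add: perm_def)
  then show ?thesis using finite_Omega by (rule permutes_imp_permutation [rotated])
qed

lemma perm_mult: "g \<in> carrier G \<Longrightarrow> h \<in> carrier G \<Longrightarrow> perm (g \<otimes> h) = perm g \<circ> perm h"
  by (rule ext) (simp add: perm_def act_act)

end

context simple_affine_stabilizer begin

text \<open>The sign is multiplicative; the modulus 0 turns the congruence of
  \<open>invariant_trivial\<close> into an equation.\<close>

lemma even_perm: "g \<in> carrier G \<Longrightarrow> sign (perm g) = 1"
proof -
  assume g: "g \<in> carrier G"
  have "[sign (perm g) = sign (perm \<one>)] (mod 0)"
    by (rule simple_group.invariant_trivial [OF simple noncomm _ g, where \<tau> = "\<lambda>g. sign (perm g)"])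
      (simp add: perm_mult sign_compose permutation_perm)
  moreover have "perm \<one> = id" by (rule ext) (simp add: perm_def)
  ultimately show ?thesis by simp
qed

text \<open>A generator of the full multiplicative group would act as a cycle of even length \<open>p - 1\<close>.\<close>

lemma exists_nonmember: "\<exists>n. unit n \<and> n \<notin> A"
proof -
  obtain g :: int where g: "unit g" "\<And>k. g ^ k \<approx> 1 \<longleftrightarrow> p - 1 dvd k"
    and bij: "bij_betw (\<lambda>i. g ^ i mod int p) {..<p - 1} {1..<int p}"
    by (rule exists_generator) blast
  have "g \<notin> A"
  proof
    assume gA: "g \<in> A"
    define f where "f i = pt (g ^ i)" for i :: nat
    define cs where "cs = map f [0..<p - 1]"
    have inj: "inj_on f {..<p - 1}"
    proof (rule inj_onI)
      fix i j assume ij: "i \<in> {..<p - 1}" "j \<in> {..<p - 1}" and "f i = f j"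
      then have "g ^ i mod int p = g ^ j mod int p" by (simp add: f_def cong_def)
      then show "i = j" by (rule inj_onD [OF bij_betw_imp_inj_on [OF bij] _ ij])
    qed
    have d: "distinct cs" unfolding cs_def using inj by (simp add: distinct_map atLeast0LessThan)
    have p2: "p - 1 > 1" using p_odd p_gt_1 by (cases "p = 2") auto
    have last: "f (p - 1) = f 0" unfolding f_def using g(2) [of "p - 1"] by simp
    have rot: "map (cycle_of_list cs) cs = rotate1 cs" using cyclic_rotation [OF d, of 1] by simp
    have hg: "act (hh g) (f i) = f (Suc i)" for i unfolding f_def by (simp add: hh_pt gA)
    have "perm (hh g) = cycle_of_list cs"
    proof
      fix z
      show "perm (hh g) z = cycle_of_list cs z"
      proof (cases "z \<in> set cs")
        case True
        then obtain i where i: "i < p - 1" "z = f i" unfolding cs_def by auto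
        have "cycle_of_list cs z = map (cycle_of_list cs) cs ! i" using i by (simp add: cs_def)
        also have "\<dots> = rotate1 cs ! i" by (simp only: rot)
        also have "\<dots> = cs ! (Suc i mod (p - 1))" using i by (subst nth_rotate1) (simp_all add: cs_def)
        also have "\<dots> = f (Suc i)"
        proof (cases "Suc i = p - 1")
          case True
          then show ?thesis using last p2 by (simp add: cs_def)
        next
          case False
          then show ?thesis using i by (simp add: cs_def)
        qed
        finally show ?thesis using i hg [of i] by (simp add: perm_def) (simp add: f_def)
      next
        case False
        then have "cycle_of_list cs z = z" by (rule id_outside_supp)
        moreover have "perm (hh g) z = z"
        proof (cases "z \<in> \<Omega>")
          case True
          then show ?thesis
          proof (rule Omega_cases)
            assume "z = None"
            then show ?thesis by (simp add: perm_def hh_None gA)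
          next
            fix x assume z: "z = pt x"
            have "\<not> unit x"
            proof
              assume "unit x"
              then have "x mod int p \<in> (\<lambda>i. g ^ i mod int p) ` {..<p - 1}"
                using unit_mod bij by (simp add: bij_betw_def)
              then obtain i where i: "i \<in> {..<p - 1}" "x mod int p = g ^ i mod int p" by (elim imageE)
              have "z = f i" unfolding z f_def pt_eq_iff cong_def by (rule i(2))
              then have "z \<in> set cs" unfolding cs_def using i(1) by simp
              then show False using False by simp
            qed
            then have "z = pt 0" by (simp add: z cong_0_iff)
            then show ?thesis by (simp add: perm_def hh_pt gA)
          qed
        qed (simp add: perm_def)
        ultimately show ?thesis by simp
      qed
    qed
    then have "(- 1) ^ (length cs - 1) = (1 :: int)"
      using sign_cycle_of_list [OF d] even_perm [OF hh_closed [OF gA]] p2 by (simp add: cs_def)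
    moreover have "odd (length cs - 1)" unfolding cs_def using p_odd p2 by simp
    ultimately show False by simp
  qed
  then show ?thesis using g(1) by blast
qed

text \<open>By \<open>twist_square\<close> the product a a' is 1 or -1, and -1 is excluded because
  the product lies in \<open>A\<close>. The slope of \<open>w \<otimes> w\<close> is fixed by
  \<open>tw\<close>, so it squares to 1 and equals 1.\<close>

theorem standard_if_minus_one_notin:
  assumes m1: "- 1 \<notin> A" shows standard
proof -
  have inverse: "a * tw a \<approx> 1" if a: "a \<in> A" for a
  proof -
    consider "a * tw a \<approx> 1" | "a * tw a \<approx> - 1" using square_one [OF twist_square [OF a]] by blast
    then show ?thesis
    proof cases
      case 2
      then have "- 1 \<in> A" by (rule A_cong [OF A_mult [OF a tw_A [OF a]]])
      then show ?thesis using m1 by simp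
    qed
  qed
  define b where "b = scale (w \<otimes> w)"
  have b: "b \<in> A" unfolding b_def by (intro scale_A H_N ww_H)
  have hb: "hh b = w \<otimes> w" unfolding b_def by (rule hh_eqI [OF scale_A [OF H_N [OF ww_H]] ww_H]) simp
  have "tw b = b" unfolding tw_def hb using w_closed by (simp add: b_def inv_cancel m_assoc)
  then have "b ^ 2 \<approx> 1" using inverse [OF b] by (simp add: power2_eq_square)
  then have b1: "b \<approx> 1" using square_one A_cong [OF b] m1 by blast
  have "w \<otimes> w = \<one>"
    by (rule H_eqI [OF ww_H H_one]) (use b1 cong_sym [OF scale_one] cong_trans in \<open>simp only: b_def, blast\<close>)
  then interpret inverting G p act T w by unfold_locales (rule inverse)
  show ?thesis by (rule standard_minus_one_notin [OF m1])
qed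

text \<open>Let g send c to infinity and infinity to 0. The reflection x -> v - x, where v is the
  image of 0 under g, fixes infinity and exchanges 0 and v. Conjugated back by g, it fixes c and
  exchanges infinity and 0, so it differs from \<open>w\<close> by an element of
  \<open>H\<close>.\<close>

lemma exists_involution:
  assumes m1: "- 1 \<in> A" and c: "unit c"
  obtains a where "a \<in> A" "act (hh a \<otimes> w) (pt c) = pt c" "(hh a \<otimes> w) \<otimes> (hh a \<otimes> w) = \<one>"
proof -
  define g where "g = w \<otimes> shift (- c)"
  have g: "g \<in> carrier G" "act g (pt c) = None" "act g None = pt 0"
    unfolding g_def using w_closed by (simp_all add: act_act w_zero w_infinity)
  have "act g (pt 0) \<noteq> act g (pt c)" using c by (simp add: act_inj g(1) cong_sym_eq [of 0] cong_0_iff)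
  then have ne: "act g (pt 0) \<noteq> None" by (simp add: g(2))
  obtain v where v: "act g (pt 0) = pt v"
    by (rule Omega_cases [OF act_Omega [OF g(1), of "pt 0"]]) (use ne that in blast)+
  define n where "n = shift v \<otimes> hh (- 1)"
  have nc: "n \<in> carrier G" unfolding n_def using hh_closed [OF m1] by simp
  have n: "act n None = None" "\<And>x. act n (pt x) = pt (v - x)"
    unfolding n_def using hh_closed [OF m1] by (simp_all add: act_act hh_None hh_pt m1)
  have nn: "n \<otimes> n = \<one>"
  proof (rule act_eqI)
    fix z assume "z \<in> \<Omega>"
    then show "act (n \<otimes> n) z = act \<one> z" by (rule Omega_cases) (simp_all add: act_act nc n)
  qed (simp_all add: nc)
  define U where "U = inv g \<otimes> n \<otimes> g"
  have Uc: "U \<in> carrier G" unfolding U_def using g nc by simp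
  have U: "act U (pt c) = pt c" "act U None = pt 0" "act U (pt 0) = None"
    unfolding U_def using g nc v by (simp_all add: act_act n act_inv_eq)
  have UU: "U \<otimes> U = \<one>"
  proof -
    have "U \<otimes> U = inv g \<otimes> (n \<otimes> n) \<otimes> g" unfolding U_def using g(1) nc by (simp add: m_assoc inv_cancel)
    then show ?thesis unfolding nn using g(1) by simp
  qed
  have k: "U \<otimes> inv w \<in> H"
  proof -
    have "act (inv w) None = pt 0" "act (inv w) (pt 0) = None"
      using w_closed by (simp_all add: act_inv_eq w_zero w_infinity)
    then show ?thesis unfolding H_def N_def using Uc w_closed by (simp add: act_act U)
  qed
  have a: "scale (U \<otimes> inv w) \<in> A" by (rule scale_A [OF H_N [OF k]])
  have "hh (scale (U \<otimes> inv w)) = U \<otimes> inv w" by (rule hh_eqI [OF a k]) simp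
  then have "hh (scale (U \<otimes> inv w)) \<otimes> w = U" using Uc w_closed by (simp add: m_assoc)
  then show ?thesis using that [OF a] U(1) UU by simp
qed

end

lemma card_le_fibres:
  assumes "finite S" "finite C" "f ` S \<subseteq> C" "\<And>y. y \<in> C \<Longrightarrow> card {x \<in> S. f x = y} \<le> k"
  shows "card S \<le> k * card C"
proof -
  have "S = (\<Union>y\<in>C. {x \<in> S. f x = y})" using assms(3) by blast
  then have "card S \<le> (\<Sum>y\<in>C. card {x \<in> S. f x = y})" using card_UN_le [OF assms(2)] by metis
  also have "\<dots> \<le> (\<Sum>y\<in>C. k)" by (rule sum_mono) (rule assms(4))
  finally show ?thesis by (simp add: mult.commute)
qed

context simple_affine_stabilizer begin

lemma A_quotient:
  assumes "y * c \<approx> d" "c \<in> A" "d \<in> A" shows "y \<in> A"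
proof -
  obtain c' where c': "c * c' \<approx> 1" using unit_inverse [OF A_unit [OF assms(2)]] by blast
  have "d * c' \<approx> y"
    by (rule cong_comb2 [OF assms(1) c', where u = "- c'" and v = y]) (simp add: algebra_simps)
  then show ?thesis by (rule A_cong [OF A_mult [OF assms(3) A_inverse [OF assms(2) c']]])
qed

text \<open>Each unit \<open>c\<close> is fixed by an involution \<open>hh a \<otimes> w\<close>, and each such involution fixes at most two points, so
  at least \<open>(p - 1) / 2\<close> elements \<open>a\<close> satisfy \<open>a * tw a = 1\<close>.\<close>

lemma standard_if_fixed:
  assumes m1: "- 1 \<in> A" and ww: "w \<otimes> w = \<one>" and w1: "act w (pt 1) = pt 1"
  shows standard
proof -
  have iw: "inv w = w" by (rule inv_equality [OF ww w_closed w_closed])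
  define B where "B = {a \<in> A. a * tw a \<approx> 1}"
  have BA: "B \<subseteq> A" unfolding B_def by blast
  have B_cong: "b \<in> B" if "a \<in> B" "a \<approx> b" for a b
  proof -
    have a: "a \<in> A" "a * tw a \<approx> 1" using that(1) by (simp_all add: B_def)
    have "a * tw a \<approx> b * tw b" unfolding tw_cong [OF a(1) that(2)] by (intro cong_mult that(2) cong_refl)
    then have "b * tw b \<approx> 1" using a(2) cong_sym cong_trans by blast
    then show ?thesis unfolding B_def using A_cong [OF a(1) that(2)] by simp
  qed
  have involution: "a \<in> B" if a: "a \<in> A" and inv: "(hh a \<otimes> w) \<otimes> (hh a \<otimes> w) = \<one>" for a
  proof -
    have ac: "hh a \<in> carrier G" "hh (tw a) \<in> carrier G" by (intro hh_closed tw_A a)+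
    have "hh (a * tw a) = hh a \<otimes> (inv w \<otimes> hh a \<otimes> w)"
      unfolding wconj_hh [OF a] by (rule hh_mult [OF a tw_A [OF a]])
    also have "\<dots> = (hh a \<otimes> w) \<otimes> (hh a \<otimes> w)" unfolding iw using ac w_closed by (simp add: m_assoc)
    finally have "hh (a * tw a) = \<one>" unfolding inv .
    then have "a * tw a \<approx> scale \<one>"
      using scale_hh [OF A_mult [OF a tw_A [OF a]]] by (simp add: cong_sym_eq)
    then show ?thesis unfolding B_def using a cong_trans [OF _ scale_one] by simp
  qed
  have B_quot: "y \<in> B" if "y \<in> A" "y * c \<approx> d" "c \<in> B" "d \<in> B" for y c d
  proof -
    have cd: "c \<in> A" "c * tw c \<approx> 1" "d \<in> A" "d * tw d \<approx> 1" using that by (simp_all add: B_def)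
    have 1: "tw y * tw c \<approx> tw d"
      using cong_sym [OF tw_mult [OF that(1) cd(1)]] tw_cong [OF A_mult [OF that(1) cd(1)] that(2)] by simp
    have "(y * c) * (tw y * tw c) \<approx> d * tw d" by (rule cong_mult [OF that(2) 1])
    then have 2: "(y * c) * (tw y * tw c) \<approx> 1" by (rule cong_trans [OF _ cd(4)])
    have "y * tw y \<approx> 1"
      by (rule cong_comb2 [OF 2 cd(2), where u = 1 and v = "- (y * tw y)"]) (simp add: algebra_simps)
    then show ?thesis unfolding B_def using that(1) by simp
  qed
  have "\<exists>a. a \<in> residues_in B \<and> act (hh a \<otimes> w) (pt c) = pt c" if c: "c \<in> {1..<int p}" for c
  proof -
    obtain a where a: "a \<in> A" "act (hh a \<otimes> w) (pt c) = pt c" "(hh a \<otimes> w) \<otimes> (hh a \<otimes> w) = \<one>"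
      by (rule exists_involution [OF m1 unit_less [OF c]]) blast
    have am: "a \<approx> a mod int p" by simp
    have "a mod int p \<in> residues_in B"
      unfolding residues_in_def using unit_mod [OF A_unit [OF a(1)]] B_cong [OF involution [OF a(1,3)] am] by simp
    moreover have "hh (a mod int p) = hh a" by (rule hh_cong [symmetric, OF a(1) am])
    ultimately show ?thesis using a(2) by (intro exI [of _ "a mod int p"]) simp
  qed
  then obtain f where f: "\<And>c. c \<in> {1..<int p} \<Longrightarrow> f c \<in> residues_in B"
    "\<And>c. c \<in> {1..<int p} \<Longrightarrow> act (hh (f c) \<otimes> w) (pt c) = pt c" by metis
  have "card {1..<int p} \<le> 2 * card (residues_in B)"
  proof (rule card_le_fibres)
    fix a assume "a \<in> residues_in B"
    then have aA: "a \<in> A" using BA unfolding residues_in_def by blast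
    \<comment> \<open>With three fixed points \<open>hh a \<otimes> w\<close> would be trivial, but
      it moves infinity to 0.\<close>
    show "card {c \<in> {1..<int p}. f c = a} \<le> 2"
    proof (rule ccontr)
      assume "\<not> card {c \<in> {1..<int p}. f c = a} \<le> 2"
      then have "3 \<le> card {c \<in> {1..<int p}. f c = a}" by simp
      then obtain S where S: "S \<subseteq> {c \<in> {1..<int p}. f c = a}" "card S = 3" by (rule obtain_subset_with_card_n)
      then obtain c d e where cde: "S = {c, d, e}" "c \<noteq> d" "c \<noteq> e" "d \<noteq> e" by (auto simp: card_3_iff)
      have mem: "x \<in> {1..<int p}" "act (hh a \<otimes> w) (pt x) = pt x" if "x \<in> S" for x
        using S(1) that f(2) [of x] by auto
      have ne: "\<not> x \<approx> y" if "x \<in> S" "y \<in> S" "x \<noteq> y" for x y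
        using mem(1) [OF that(1)] mem(1) [OF that(2)] that(3) cong_less_imp_eq_int [of x "int p" y] by auto
      have "hh a \<otimes> w = \<one>"
        by (rule three_fixed_points [of _ c d e]; (intro mem ne)?) (use cde hh_closed [OF aA] w_closed in auto)
      then have "act (hh a \<otimes> w) None = None" by simp
      then show False by (simp add: act_act hh_closed aA w_closed w_infinity hh_pt)
    qed
  qed (use f(1) finite_residues_in in auto)
  then have count: "p - 1 \<le> 2 * card (residues_in B)" by simp
  have subAB: "residues_in B \<subseteq> residues_in A" unfolding residues_in_def using BA by blast
  then have le: "card (residues_in B) \<le> card (residues_in A)" by (intro card_mono finite_residues_in)
  \<comment> \<open>Otherwise the cosets of 1, s and \<open>s ^ 2\<close> would be disjoint, and 3
    |A| <= p - 1 <= 2 |B| <= 2 |A| is impossible.\<close>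
  have sq: "s ^ 2 \<in> A" if s: "unit s" for s
  proof (rule ccontr)
    assume s2: "s ^ 2 \<notin> A"
    have sA: "s \<notin> A" using s2 A_power by blast
    have us2: "unit (s ^ 2)" by (rule unit_power [OF s])
    have 1: "coset 1 A \<inter> coset s A = {}"
    proof (rule coset_disjoint)
      fix c d assume "c \<in> A" "d \<in> A"
      then show "\<not> 1 * c \<approx> s * d" using A_quotient [of s d c] sA by (auto simp: cong_sym_eq)
    qed
    have 2: "coset 1 A \<inter> coset (s ^ 2) A = {}"
    proof (rule coset_disjoint)
      fix c d assume "c \<in> A" "d \<in> A"
      then show "\<not> 1 * c \<approx> s ^ 2 * d" using A_quotient [of "s ^ 2" d c] s2 by (auto simp: cong_sym_eq)
    qed
    have 3: "coset s A \<inter> coset (s ^ 2) A = {}"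
    proof (rule coset_disjoint)
      fix c d assume cd: "c \<in> A" "d \<in> A"
      show "\<not> s * c \<approx> s ^ 2 * d"
      proof
        assume "s * c \<approx> s ^ 2 * d"
        then have "s * c \<approx> s * (s * d)" by (simp add: power2_eq_square mult.assoc)
        then have "c \<approx> s * d" by (rule cancel [OF s])
        then show False using A_quotient [of s d c] sA cd by (auto simp: cong_sym_eq)
      qed
    qed
    have "card (coset 1 A \<union> coset s A \<union> coset (s ^ 2) A) = 3 * card (residues_in A)"
      using 1 2 3 by (simp add: card_Un_disjoint finite_coset Int_Un_distrib2
          card_coset [OF s] card_coset [OF us2] card_coset [OF unit_one])
    moreover have "card (coset 1 A \<union> coset s A \<union> coset (s ^ 2) A) \<le> card {1..<int p}"
      by (rule card_mono) (use coset_subset [OF s, of A] coset_subset [OF us2, of A] coset_subset [OF unit_one, of A] in auto)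
    ultimately have "3 * card (residues_in A) \<le> p - 1" by simp
    then show False using count le p_gt_1 by simp
  qed
  obtain n where n: "unit n" "n \<notin> A" using exists_nonmember by blast
  have half: "2 * card (residues_in A) \<le> p - 1"
  proof -
    have "coset 1 A \<inter> coset n A = {}"
    proof (rule coset_disjoint, rule notI)
      fix c d assume cd: "c \<in> A" "d \<in> A" "1 * c \<approx> n * d"
      then have "n * d \<approx> c" by (simp add: cong_sym_eq)
      then have "n \<in> A" by (rule A_quotient [OF _ cd(2,1)])
      then show False using n(2) by simp
    qed
    then have "card (coset 1 A \<union> coset n A) = 2 * card (residues_in A)"
      by (subst card_Un_disjoint) (simp_all add: finite_coset card_coset [OF unit_one] card_coset [OF n(1)])
    moreover have "card (coset 1 A \<union> coset n A) \<le> card {1..<int p}"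
      by (rule card_mono) (use coset_subset [OF n(1), of A] coset_subset [OF unit_one, of A] in auto)
    ultimately show ?thesis by simp
  qed
  \<comment> \<open>A proper subgroup \<open>A\<close> has at most (p - 1) / 2 residues, and
    \<open>B\<close> already has that many; hence \<open>w\<close> inverts all slopes.\<close>
  have eq: "residues_in B = residues_in A"
    by (rule card_subset_eq) (use subAB count half le finite_residues_in in auto)
  have inverse: "a * tw a \<approx> 1" if a: "a \<in> A" for a
  proof -
    have am: "a \<approx> a mod int p" by simp
    have "a mod int p \<in> residues_in A"
      unfolding residues_in_def using unit_mod [OF A_unit [OF a]] A_cong [OF a am] by simp
    then have "a mod int p \<in> B" unfolding eq [symmetric] by (simp add: residues_in_def)
    then have "a \<in> B" by (rule B_cong) simp
    then show ?thesis by (simp add: B_def)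
  qed
  interpret inverting G p act T w by unfold_locales (rule inverse, assumption, rule ww)
  show ?thesis by (rule standard_minus_one_in [OF m1 W_eqI [OF unit_one w1] sq n])
qed

theorem standard: standard
proof (cases "- 1 \<in> A")
  case True
  obtain a where a: "a \<in> A" "act (hh a \<otimes> w) (pt 1) = pt 1" "(hh a \<otimes> w) \<otimes> (hh a \<otimes> w) = \<one>"
    by (rule exists_involution [OF True unit_one]) blast
  \<comment> \<open>Neither \<open>A\<close> nor \<open>standard\<close> involves \<open>w\<close>,
    so \<open>w\<close> may be replaced by an involution that exchanges 0 and infinity and fixes
    1.\<close>
  interpret w1: simple_affine_stabilizer G p act T "hh a \<otimes> w"
  proof (unfold_locales)
    show "hh a \<otimes> w \<in> carrier G" using hh_closed [OF a(1)] w_closed by simp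
    show "act (hh a \<otimes> w) None = Some (0 mod int p)" "act (hh a \<otimes> w) (Some (0 mod int p)) = None"
      unfolding pt_def [symmetric]
      by (simp_all add: act_act hh_closed a(1) w_closed w_infinity w_zero hh_pt hh_None)
  qed ((fact fin act_None_or act_mult act_one faithful T_closed T_None T_Some affine
        simple_group.order_gt_one [OF simple] simple_group.no_real_normal_subgroup [OF simple] noncomm)+)
  show ?thesis by (rule w1.standard_if_fixed [OF True a(3,2)])
qed (rule standard_if_minus_one_notin)

text \<open>For p = 3 the only square of a unit is 1, so the slopes would be trivial, against
  \<open>A_nontrivial\<close>.\<close>

lemma p_ge_5: "p \<ge> 5"
proof -
  have "p \<noteq> 3"
  proof
    assume p3: "p = 3"
    obtain a where a: "a \<in> A" "\<not> a \<approx> 1" using A_nontrivial by blast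
    have "\<forall>a\<in>A. \<exists>s. unit s \<and> a \<approx> s ^ 2" using standard unfolding standard_def by (elim conjE)
    then obtain s where s: "unit s" "a \<approx> s ^ 2" using a(1) by blast
    have "s ^ 2 \<approx> 1" using fermat [OF s(1)] by (simp add: p3)
    then show False using a(2) cong_trans [OF s(2)] by blast
  qed
  moreover have "p \<noteq> 4" "p \<noteq> 2" using p_odd by auto
  ultimately show ?thesis using p_gt_1 by linarith
qed

end

section \<open>Sylow subgroups as points of the projective line\<close>

context cyclic_sylow begin

lemma Syl_normalizes_only_self:
  assumes Q: "Q \<in> Syl" "R \<in> Syl" "Q \<noteq> R" and q: "q \<in> Q" "conjg q ` R = R"
  shows "q = \<one>"
proof (rule ccontr)
  assume q1: "q \<noteq> \<one>"
  have "{q} \<subseteq> {s \<in> carrier G. conjg s ` R = R}" using q SylD(3) [OF Q(1)] by blast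
  then have "generate G {q} \<subseteq> {s \<in> carrier G. conjg s ` R = R}"
    by (rule generate_subgroup_incl [OF _ subgroup_normalizing [OF subgroup_self SylD(3) [OF Q(2)]]])
  then have "Q \<subseteq> {s \<in> carrier G. conjg s ` R = R}" using Syl_eq_generate [OF Q(1) q(1) q1] by simp
  then have "Q = R" by (intro Syl_normalizing [OF Q(1,2)]) blast
  then show False using Q(3) by simp
qed

lemma Syl_orbit_inj:
  assumes Q: "Q \<in> Syl" "R \<in> Syl" "Q \<noteq> R"
  shows "inj_on (\<lambda>q. conjg q ` R) Q"
proof (rule inj_onI)
  fix q q' assume q: "q \<in> Q" "q' \<in> Q" and eq: "conjg q ` R = conjg q' ` R"
  have c: "q \<in> carrier G" "q' \<in> carrier G" "R \<subseteq> carrier G" using q Q SylD(3) by auto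
  have "conjg (inv q' \<otimes> q) ` R = conjg (inv q') ` conjg q ` R"
    using c by (simp add: conjg_image_conjg_image)
  also have "\<dots> = R" unfolding eq using c by (simp add: conjg_image_cancel)
  finally have "inv q' \<otimes> q = \<one>"
    using SylD(1) [OF Q(1)] q
    by (intro Syl_normalizes_only_self [OF Q]) (simp_all add: subgroup.m_closed subgroup.m_inv_closed)
  then show "q = q'" using c by (metis inv_equality inv_inv inv_closed)
qed

lemma Syl_orbit_subset:
  assumes Q: "Q \<in> Syl" "R \<in> Syl" "Q \<noteq> R"
  shows "(\<lambda>q. conjg q ` R) ` Q \<subseteq> Syl - {Q}"
proof
  fix S assume "S \<in> (\<lambda>q. conjg q ` R) ` Q"
  then obtain q where q: "q \<in> Q" "S = conjg q ` R" by blast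
  have c: "q \<in> carrier G" "R \<subseteq> carrier G" "Q \<subseteq> carrier G" using q Q SylD(3) by auto
  have "S \<noteq> Q"
  proof
    assume "S = Q"
    then have "conjg (inv q) ` Q = R" unfolding q(2) using c by (metis conjg_image_cancel(1))
    moreover have "conjg (inv q) ` Q = Q"
      by (rule conjg_image_self [OF SylD(1) [OF Q(1)] subgroup.m_inv_closed [OF SylD(1) [OF Q(1)] q(1)]])
    ultimately show False using Q(3) by simp
  qed
  then show "S \<in> Syl - {Q}" using Syl_conjg [OF Q(2) c(1)] q(2) by simp
qed

text \<open>Under conjugation by \<open>Q\<close> the only Sylow subgroup that is fixed is
  \<open>Q\<close> itself.\<close>

lemma conjg_Syl_fixed:
  assumes X: "X \<subseteq> Syl" "\<And>g S. g \<in> carrier G \<Longrightarrow> S \<in> X \<Longrightarrow> conjg g ` S \<in> X" and Q: "Q \<in> Syl"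
  shows "card X mod p = (if Q \<in> X then 1 else 0)"
proof -
  have c: "S \<subseteq> carrier G" if "S \<in> X" for S using that X(1) SylD(3) by blast
  have Qc: "b \<in> carrier G" if "b \<in> Q" for b using that SylD(3) [OF Q] by blast
  have "card X mod p = card {S \<in> X. \<forall>b\<in>Q. conjg b ` S = S} mod p"
  proof (rule p_group_fixed_points [OF SylD(1) [OF Q] SylD(5) [OF Q]])
    show "finite X" using X(1) finite_Syl finite_subset by blast
  qed (use c Qc X(2) in \<open>auto simp: conjg_image_one conjg_image_conjg_image\<close>)
  also have "{S \<in> X. \<forall>b\<in>Q. conjg b ` S = S} = (if Q \<in> X then {Q} else {})"
  proof -
    have "(\<forall>b\<in>Q. conjg b ` S = S) \<longleftrightarrow> S = Q" if "S \<in> X" for S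
    proof
      assume fixed: "\<forall>b\<in>Q. conjg b ` S = S"
      have "S \<in> Syl" using X(1) that by blast
      then show "S = Q" using Syl_normalizing [OF Q] fixed by (metis (no_types))
    next
      assume "S = Q"
      then show "\<forall>b\<in>Q. conjg b ` S = S" using conjg_image_self [OF SylD(1) [OF Q]] by simp
    qed
    then have "{S \<in> X. \<forall>b\<in>Q. conjg b ` S = S} = {S \<in> X. S = Q}" by (intro Collect_cong conj_cong refl)
    then show ?thesis by auto
  qed
  finally show ?thesis using p_gt_1 by (simp split: if_splits)
qed

lemma card_Syl_mod: "card Syl mod p = 1"
  using conjg_Syl_fixed [of Syl] Syl_conjg Syl_nonempty by auto

text \<open>The class of \<open>P\<close> contains \<open>P\<close>, so its size is 1 modulo
  \<open>p\<close>; if it missed \<open>Q\<close>, the size would be 0 modulo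
  \<open>p\<close>.\<close>

lemma Syl_conjugate:
  assumes P: "P \<in> Syl" and Q: "Q \<in> Syl"
  obtains g where "g \<in> carrier G" "conjg g ` P = Q"
proof -
  define X where "X = (\<lambda>g. conjg g ` P) ` carrier G"
  have X: "X \<subseteq> Syl" unfolding X_def using Syl_conjg [OF P] by blast
  have closed: "conjg g ` S \<in> X" if g: "g \<in> carrier G" and S: "S \<in> X" for g S
  proof -
    obtain h where h: "h \<in> carrier G" "S = conjg h ` P" using S unfolding X_def by blast
    have "conjg g ` S = conjg (g \<otimes> h) ` P"
      unfolding h(2) using g h(1) SylD(3) [OF P] by (rule conjg_image_conjg_image)
    then show ?thesis unfolding X_def using g h(1) by blast
  qed
  have "P \<in> X" unfolding X_def
    by (rule image_eqI [where x = \<one>]) (simp_all add: conjg_image_one [OF SylD(3) [OF P]])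
  then have 1: "card X mod p = 1" using conjg_Syl_fixed [OF X closed P] by (simp only: if_True)
  have "Q \<in> X"
  proof (rule ccontr)
    assume "Q \<notin> X"
    then have "card X mod p = 0" using conjg_Syl_fixed [OF X closed Q] by (simp only: if_False)
    then show False using 1 by simp
  qed
  then obtain g where g: "g \<in> carrier G" "Q = conjg g ` P" unfolding X_def by (elim imageE)
  show ?thesis by (rule that [OF g(1) g(2) [symmetric]])
qed

end

locale simple_sylow = cyclic_sylow +
  assumes simple: "simple_group G" and card_Syl: "card Syl = p + 1"
begin

text \<open>The orbit of \<open>R\<close> under \<open>Q\<close> has p members, and there are only p
  Sylow subgroups other than \<open>Q\<close>.\<close>

lemma Syl_orbit_eq:
  assumes Q: "Q \<in> Syl" "R \<in> Syl" "Q \<noteq> R"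
  shows "(\<lambda>q. conjg q ` R) ` Q = Syl - {Q}"
proof (rule card_subset_eq)
  have "card ((\<lambda>q. conjg q ` R) ` Q) = p"
    using card_image [OF Syl_orbit_inj [OF Q]] SylD(2) [OF Q(1)] by simp
  then show "card ((\<lambda>q. conjg q ` R) ` Q) = card (Syl - {Q})" using Q(1) card_Syl finite_Syl by simp
qed (use finite_Syl Syl_orbit_subset [OF Q] in auto)

text \<open>The kernel of the action is normal. If it were the whole group, any two Sylow subgroups
  would normalize each other and coincide.\<close>

lemma Syl_kernel_trivial:
  assumes g: "g \<in> carrier G" "\<And>S. S \<in> Syl \<Longrightarrow> conjg g ` S = S"
  shows "g = \<one>"
proof -
  define K where "K = {g \<in> carrier G. \<forall>S\<in>Syl. conjg g ` S = S}"
  have "K = (\<Inter>S\<in>Syl. {g \<in> carrier G. conjg g ` S = S})" unfolding K_def using Syl_nonempty by blast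
  moreover have "subgroup (\<Inter>S\<in>Syl. {g \<in> carrier G. conjg g ` S = S}) G"
  proof (rule subgroups_Inter)
    fix H assume "H \<in> (\<lambda>S. {g \<in> carrier G. conjg g ` S = S}) ` Syl"
    then obtain S where S: "S \<in> Syl" "H = {g \<in> carrier G. conjg g ` S = S}" by (elim imageE)
    show "subgroup H G" unfolding S(2) by (rule subgroup_normalizing [OF subgroup_self SylD(3) [OF S(1)]])
  qed (use Syl_nonempty in simp)
  ultimately have K: "subgroup K G" by simp
  have conj: "conjg h n \<in> K" if h: "h \<in> carrier G" and n: "n \<in> K" for h n
  proof -
    have nc: "n \<in> carrier G" using n by (simp add: K_def)
    have "conjg (conjg h n) ` S = S" if S: "S \<in> Syl" for S
    proof -
      have Sc: "S \<subseteq> carrier G" using S by (rule SylD(3))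
      have S': "conjg (inv h) ` S \<in> Syl" using Syl_conjg [OF S] h by simp
      have "conjg n ` conjg (inv h) ` S = conjg (inv h) ` S" using n S' by (simp add: K_def)
      then have "conjg h ` conjg n ` conjg (inv h) ` S = S" using h Sc by (simp add: conjg_image_cancel)
      moreover have "conjg (conjg h n) ` S = conjg h ` conjg n ` conjg (inv h) ` S"
        using h nc Sc SylD(3) [OF S'] Syl_conjg [OF S'] SylD(3)
        by (simp add: conjg_def [of h n] flip: conjg_image_conjg_image)
      ultimately show ?thesis by simp
    qed
    then show ?thesis using h nc by (simp add: K_def)
  qed
  have "K \<lhd> G" unfolding normal_conjg_iff using K conj by blast
  then consider "K = carrier G" | "K = {\<one>}" using simple_group.no_real_normal_subgroup [OF simple] by blast
  then show ?thesis
  proof cases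
    case 1
    have all: "conjg a ` S = S" if "a \<in> carrier G" "S \<in> Syl" for a S
      using that 1 unfolding K_def by blast
    have "P = Q" if "P \<in> Syl" "Q \<in> Syl" for P Q
      using Syl_normalizing [OF that] all that SylD(3) by blast
    then have "card Syl \<le> 1" using Syl_nonempty by (metis card_le_Suc0_iff_eq finite_Syl One_nat_def)
    then show ?thesis using card_Syl p_gt_1 by simp
  next
    case 2
    then show ?thesis using g unfolding K_def by blast
  qed
qed

end

locale sylow_coordinates = simple_sylow + prime_modulus p +
  fixes t :: 'a and Q0 :: "'a set"
  assumes t: "t \<in> Gp" "t \<noteq> \<one>" and Q0: "Q0 \<in> Syl" "generate G {t} \<noteq> Q0"
begin

definition points :: "int option set"
  where "points = insert None (Some ` {0..<int p})"

text \<open>The group generated by \<open>t\<close> becomes infinity, \<open>Q0\<close> becomes the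
  origin, and conjugation by \<open>t\<close> becomes translation by 1.\<close>

definition coord :: "int option \<Rightarrow> 'a set"
  where "coord z = (case z of None \<Rightarrow> generate G {t} | Some x \<Rightarrow> conjg (t [^] x) ` Q0)"

definition act :: "'a \<Rightarrow> int option \<Rightarrow> int option"
  where "act g z = inv_into points coord (conjg g ` coord z)"

lemma t_closed [simp]: "t \<in> carrier G" using t(1) by (rule Gp_carrier)

lemma P_Syl: "generate G {t} \<in> Syl" by (rule generate_Syl(1) [OF t])

lemma t_pow_eq_iff: "t [^] (x :: int) = t [^] y \<longleftrightarrow> x \<approx> y"
  using ord_eq_p [OF t] by (simp add: int_pow_eq cong_iff_dvd_diff dvd_diff_commute)

lemma t_pow_mod: "t [^] (x mod int p) = t [^] x"
  by (simp add: t_pow_eq_iff)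

lemma P_eq: "generate G {t} = (\<lambda>x :: int. t [^] x) ` {0..<int p}"
proof -
  have "(\<lambda>x :: int. t [^] x) ` {0..<int p} = (\<lambda>x :: int. t [^] x) ` int ` {..<p}"
    by (simp add: image_int_atLeastLessThan lessThan_atLeast0)
  also have "\<dots> = generate G {t}" unfolding generate_Syl(2) [OF t] image_image by (simp add: int_pow_int)
  finally show ?thesis by simp
qed

lemma points_iff: "z \<in> points \<longleftrightarrow> z = None \<or> (\<exists>x. z = Some (x mod int p))"
proof
  assume "z \<in> points"
  then show "z = None \<or> (\<exists>x. z = Some (x mod int p))"
    unfolding points_def by (auto intro: exI [of _ "_ :: int"]) (metis mod_pos_pos_trivial)
next
  assume "z = None \<or> (\<exists>x. z = Some (x mod int p))"
  then show "z \<in> points" unfolding points_def using p_gt_1 by auto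
qed

lemma coord_None: "coord None = generate G {t}" by (simp add: coord_def)

lemma coord_Some: "coord (Some (x mod int p)) = conjg (t [^] x) ` Q0"
  by (simp add: coord_def t_pow_mod)

lemma coord_image: "coord ` points = Syl"
proof -
  have "coord ` Some ` {0..<int p} = (\<lambda>q. conjg q ` Q0) ` generate G {t}"
    unfolding P_eq by (simp add: image_image coord_def)
  also have "\<dots> = Syl - {generate G {t}}" by (rule Syl_orbit_eq [OF P_Syl Q0])
  finally show ?thesis unfolding points_def using P_Syl by (auto simp: coord_None)
qed

lemma coord_inj: "inj_on coord points"
proof (rule eq_card_imp_inj_on)
  have "card (Some ` {0..<int p}) = p" by (simp add: card_image)
  then show "card (coord ` points) = card points"
    unfolding coord_image card_Syl by (simp add: points_def)
qed (simp add: points_def)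

lemma coord_Syl: "coord z \<in> Syl"
  by (cases z) (simp_all add: coord_def P_Syl Syl_conjg Q0)

lemma coord_carrier: "coord z \<subseteq> carrier G" by (rule SylD(3) [OF coord_Syl])

lemma act_points: "g \<in> carrier G \<Longrightarrow> act g z \<in> points"
  unfolding act_def by (rule inv_into_into) (simp add: coord_image Syl_conjg coord_Syl)

lemma coord_act: "g \<in> carrier G \<Longrightarrow> coord (act g z) = conjg g ` coord z"
  unfolding act_def by (rule f_inv_into_f) (simp add: coord_image Syl_conjg coord_Syl)

lemma act_eqI: "z \<in> points \<Longrightarrow> coord z = conjg g ` coord y \<Longrightarrow> act g y = z"
  unfolding act_def using inv_into_f_f [OF coord_inj] by metis

lemma None_points: "None \<in> points" and Some_points: "Some (x mod int p) \<in> points"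
  unfolding points_iff by blast+

text \<open>An element that fixes infinity sends t to some \<open>t [^] a\<close> under conjugation,
  and \<open>Q0\<close> to its conjugate by some \<open>t [^] b\<close>. It therefore sends the
  point x, the conjugate of \<open>Q0\<close> by \<open>t [^] x\<close>, to the point a x +
  b.\<close>

lemma act_affine:
  assumes g: "g \<in> carrier G" "act g None = None"
  shows "\<exists>a b. unit a \<and> (\<forall>x. act g (Some (x mod int p)) = Some ((a * x + b) mod int p))"
proof -
  have "t \<in> generate G {t}" by (rule generate.incl) simp
  then have "conjg g t \<in> conjg g ` coord None" unfolding coord_None by (rule imageI)
  then have "conjg g t \<in> generate G {t}" using coord_act [OF g(1), of None] g(2) by (simp add: coord_None)
  then obtain a :: int where a: "conjg g t = t [^] a" unfolding P_eq by (elim imageE)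
  have "unit a"
  proof
    assume "int p dvd a"
    then have "t [^] a = t [^] (0 :: int)" unfolding t_pow_eq_iff by (simp add: cong_0_iff)
    then have "conjg g t = conjg g \<one>" using a g by simp
    then show False using t(2) conjg_eq_iff [OF g(1) t_closed one_closed] by simp
  qed
  have pow: "conjg g (t [^] x) = t [^] (a * x)" for x :: int
  proof -
    have "conjg g (t [^] (x mod int p)) = conjg g t [^] (nat (x mod int p))"
      using p_gt_1 conjg_pow [OF g(1) t_closed, of "nat (x mod int p)"] by (simp flip: int_pow_int)
    also have "\<dots> = t [^] (a * (x mod int p))"
      unfolding a using p_gt_1 by (simp add: int_pow_pow flip: int_pow_int)
    also have "\<dots> = t [^] (a * x)" unfolding t_pow_eq_iff by (intro cong_mult cong_refl) simp
    finally show ?thesis by (simp only: t_pow_mod)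
  qed
  have "act g (Some (0 mod int p)) \<noteq> None"
  proof
    assume "act g (Some (0 mod int p)) = None"
    then have "conjg g ` coord (Some (0 mod int p)) = conjg g ` coord None"
      using coord_act [OF g(1), of "Some (0 mod int p)"] coord_act [OF g(1), of None] g(2) by simp
    then have "conjg (inv g) ` conjg g ` coord (Some (0 mod int p)) = conjg (inv g) ` conjg g ` coord None" by simp
    then have "coord (Some (0 mod int p)) = coord None"
      using g(1) by (simp add: conjg_image_cancel coord_carrier del: mod_0)
    then show False using inj_onD [OF coord_inj _ Some_points None_points] by blast
  qed
  moreover have "act g (Some (0 mod int p)) \<in> points" by (rule act_points [OF g(1)])
  ultimately obtain b where b: "act g (Some (0 mod int p)) = Some (b mod int p)"
    unfolding points_iff by (elim disjE exE) simp_all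
  have Q0c: "Q0 \<subseteq> carrier G" using Q0(1) by (rule SylD(3))
  have "conjg g ` coord (Some (0 mod int p)) = coord (Some (b mod int p))"
    unfolding b [symmetric] by (rule coord_act [OF g(1), symmetric])
  then have gQ: "conjg g ` Q0 = conjg (t [^] b) ` Q0"
    unfolding coord_Some using Q0c by (simp add: conjg_image_one)
  have "act g (Some (x mod int p)) = Some ((a * x + b) mod int p)" for x
  proof (rule act_eqI [OF Some_points])
    have "g \<otimes> t [^] x = conjg g (t [^] x) \<otimes> g" using g(1) by (simp add: conjg_def m_assoc)
    then have "conjg g ` conjg (t [^] x) ` Q0 = conjg (conjg g (t [^] x)) ` conjg g ` Q0"
      using g(1) Q0c by (simp add: conjg_image_conjg_image)
    also have "\<dots> = conjg (t [^] (a * x) \<otimes> t [^] b) ` Q0"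
      unfolding pow gQ using Q0c by (simp add: conjg_image_conjg_image)
    finally show "coord (Some ((a * x + b) mod int p)) = conjg g ` coord (Some (x mod int p))"
      unfolding coord_Some by (simp add: int_pow_mult)
  qed
  then show ?thesis using \<open>unit a\<close> by blast
qed

text \<open>Some g sends infinity to \<open>Q0\<close>. The group \<open>Q0\<close> is transitive on
  the other points, so an element of it moves the image of \<open>Q0\<close> under g to infinity
  while fixing \<open>Q0\<close>.\<close>

lemma exists_swap:
  obtains w where "w \<in> carrier G" "act w None = Some (0 mod int p)" "act w (Some (0 mod int p)) = None"
proof -
  let ?P = "generate G {t}"
  obtain g where g: "g \<in> carrier G" "conjg g ` ?P = Q0" by (rule Syl_conjugate [OF P_Syl Q0(1)])
  have c: "Q0 \<subseteq> carrier G" "?P \<subseteq> carrier G" using Q0(1) P_Syl SylD(3) by auto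
  let ?R = "conjg g ` Q0"
  have R: "?R \<in> Syl" using Syl_conjg [OF Q0(1) g(1)] .
  have "Q0 \<noteq> ?R"
  proof
    assume "Q0 = ?R"
    then have "conjg (inv g) ` conjg g ` ?P = conjg (inv g) ` conjg g ` Q0" using g(2) by simp
    then show False using Q0(2) g(1) c by (simp add: conjg_image_cancel)
  qed
  then have "?P \<in> (\<lambda>q. conjg q ` ?R) ` Q0" using Syl_orbit_eq [OF Q0(1) R] P_Syl Q0(2) by simp
  then obtain q where q: "q \<in> Q0" "?P = conjg q ` ?R" by blast
  have qc: "q \<in> carrier G" using q c by blast
  have "conjg q ` Q0 = Q0" using SylD(1) [OF Q0(1)] q(1) by (rule conjg_image_self)
  then have 1: "conjg (q \<otimes> g) ` ?P = Q0" using g qc c by (simp flip: conjg_image_conjg_image)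
  have 2: "conjg (q \<otimes> g) ` Q0 = ?P" using g(1) qc c q(2) by (simp flip: conjg_image_conjg_image)
  have C0: "coord (Some (0 mod int p)) = Q0" unfolding coord_Some using c(1) by (simp add: conjg_image_one)
  show ?thesis
  proof (rule that)
    show "q \<otimes> g \<in> carrier G" using qc g(1) by simp
    show "act (q \<otimes> g) None = Some (0 mod int p)"
      by (rule act_eqI [OF Some_points]) (simp only: C0 coord_None 1)
    show "act (q \<otimes> g) (Some (0 mod int p)) = None"
      by (rule act_eqI [OF None_points]) (simp only: C0 coord_None 2)
  qed
qed

lemma affine_stabilizer: "\<exists>w. affine_stabilizer G p act t w"
proof -
  obtain w where w: "w \<in> carrier G" "act w None = Some (0 mod int p)" "act w (Some (0 mod int p)) = None"
    by (rule exists_swap)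
  have "affine_stabilizer G p act t w"
  proof (intro affine_stabilizer.intro affine_stabilizer_axioms.intro)
    show "group G" by (rule is_group)
    show "prime_modulus p" by (rule prime_modulus.intro) (rule p_prime)
  next
    fix g z assume "g \<in> carrier G" 
    then show "act g z = None \<or> (\<exists>x. act g z = Some (x mod int p))"
      using act_points [of g z] by (simp only: points_iff)
  next
    fix g h z assume g: "g \<in> carrier G" "h \<in> carrier G" and "z = None \<or> (\<exists>x. z = Some (x mod int p))"
    then have z: "z \<in> points" by (simp only: points_iff)
    show "act (g \<otimes> h) z = act g (act h z)"
    proof (rule act_eqI)
      show "act g (act h z) \<in> points" by (rule act_points [OF g(1)])
      show "coord (act g (act h z)) = conjg (g \<otimes> h) ` coord z"
        using g by (simp add: coord_act conjg_image_conjg_image coord_carrier)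
    qed
  next
    fix z assume "z = None \<or> (\<exists>x. z = Some (x mod int p))"
    then have z: "z \<in> points" by (simp only: points_iff)
    show "act \<one> z = z" by (rule act_eqI [OF z]) (simp add: conjg_image_one coord_carrier)
  next
    fix g assume g: "g \<in> carrier G" "act g None = None" "\<And>x. act g (Some (x mod int p)) = Some (x mod int p)"
    have fixed: "act g z = z" if "z \<in> points" for z using that g(2,3) unfolding points_iff by (elim disjE exE) simp_all
    show "g = \<one>"
    proof (rule Syl_kernel_trivial [OF g(1)])
      fix S assume "S \<in> Syl"
      then obtain z where z: "z \<in> points" "S = coord z" unfolding coord_image [symmetric] by (elim imageE)
      show "conjg g ` S = S" unfolding z(2) coord_act [OF g(1), symmetric] fixed [OF z(1)] ..
    qed
  next
    have tt: "conjg t ` generate G {t} = generate G {t}"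
      by (rule conjg_image_self [OF SylD(1) [OF P_Syl]]) (rule generate.incl, simp)
    show "act t None = None" by (rule act_eqI [OF None_points]) (simp only: coord_None tt)
  next
    fix x :: int
    have "t \<otimes> t [^] x = t [^] (x + 1)"
      using int_pow_mult [OF t_closed, of 1 x] by (simp add: add.commute)
    then show "act t (Some (x mod int p)) = Some ((x + 1) mod int p)"
      by (intro act_eqI [OF Some_points]) (simp add: coord_Some conjg_image_conjg_image SylD(3) [OF Q0(1)])
  qed (fact fin t_closed w act_affine)+
  then show ?thesis by blast
qed

end

section \<open>Matrices\<close>

context prime_modulus begin

abbreviation SLp :: "(int \<times> int \<times> int \<times> int) monoid"
  where "SLp \<equiv> SL2 (residue_ring (int p))"

lemma residues_p: "residues (int p)"
  using p_gt_1 by unfold_locales simp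

lemma group_SLp: "group SLp"
proof -
  interpret residues "int p" "residue_ring (int p)" by (rule residues_p) simp
  show ?thesis by (rule group_SL2)
qed

lemma SLp_carrier:
  "(a, b, c, d) \<in> carrier SLp \<longleftrightarrow> a \<in> {0..<int p} \<and> b \<in> {0..<int p} \<and> c \<in> {0..<int p} \<and> d \<in> {0..<int p} \<and>
    a * d - b * c \<approx> 1"
proof -
  interpret residues "int p" "residue_ring (int p)" by (rule residues_p) simp
  have c: "carrier (residue_ring (int p)) = {0..<int p}" unfolding res_carrier_eq by auto
  have "a \<otimes>\<^bsub>residue_ring (int p)\<^esub> d \<ominus>\<^bsub>residue_ring (int p)\<^esub> b \<otimes>\<^bsub>residue_ring (int p)\<^esub> c = (a * d - b * c) mod int p"
    unfolding a_minus_def res_mult_eq res_neg_eq res_add_eq by (simp add: mod_simps)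
  moreover have "1 mod int p = 1" using p_gt_1 by simp
  ultimately show ?thesis by (simp add: SL2_def c res_one_eq cong_def)
qed

lemma SLp_mult:
  "(a, b, c, d) \<otimes>\<^bsub>SLp\<^esub> (a', b', c', d') =
    ((a * a' + b * c') mod int p, (a * b' + b * d') mod int p, (c * a' + d * c') mod int p, (c * b' + d * d') mod int p)"
proof -
  interpret residues "int p" "residue_ring (int p)" by (rule residues_p) simp
  show ?thesis by (simp add: SL2_def res_mult_eq res_add_eq mod_simps)
qed

lemma SLp_cases:
  assumes "M \<in> carrier SLp"
  obtains a b c d where "M = (a, b, c, d)" "a \<in> {0..<int p}" "b \<in> {0..<int p}" "c \<in> {0..<int p}" "d \<in> {0..<int p}"
    "a * d - b * c \<approx> 1"
proof -
  obtain a b c d where M: "M = (a, b, c, d)" by (cases M)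
  show ?thesis using that [OF M] assms unfolding M SLp_carrier by blast
qed

lemma residue_eqI: "x \<in> {0..<int p} \<Longrightarrow> y \<in> {0..<int p} \<Longrightarrow> x \<approx> y \<Longrightarrow> x = y"
  using cong_less_imp_eq_int [of x "int p" y] by simp

lemma scalar_central:
  assumes "(a, 0, 0, a) \<in> carrier SLp" shows "(a, 0, 0, a) \<in> group_center SLp"
  unfolding group_center_def
proof (intro CollectI conjI ballI assms)
  fix M assume "M \<in> carrier SLp"
  then obtain a' b' c' d' where "M = (a', b', c', d')" by (rule SLp_cases)
  then show "(a, 0, 0, a) \<otimes>\<^bsub>SLp\<^esub> M = M \<otimes>\<^bsub>SLp\<^esub> (a, 0, 0, a)" by (simp add: SLp_mult mult.commute)
qed

end

section \<open>Fractional linear maps and the isomorphism with PSL_2(p)\<close>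

context simple_affine_stabilizer begin

text \<open>The point with homogeneous coordinates \<open>(u, v)\<close>; the value at \<open>(0, 0)\<close> is meaningless.\<close>

definition proj :: "int \<Rightarrow> int \<Rightarrow> int option"
  where "proj u v = (if unit v then pt (u * (SOME y. v * y \<approx> 1)) else None)"

lemma proj_None: "\<not> unit v \<Longrightarrow> proj u v = None" by (simp add: proj_def)

lemma proj_pt:
  assumes v: "unit v" and u: "u \<approx> x * v"
  shows "proj u v = pt x"
proof -
  define y where "y = (SOME y. v * y \<approx> 1)"
  have "\<exists>y. v * y \<approx> 1" using unit_inverse [OF v] by blast
  then have y: "v * y \<approx> 1" unfolding y_def by (rule someI_ex)
  have "u * y \<approx> x" by (rule cong_comb2 [OF u y, where u = y and v = x]) (simp add: algebra_simps)
  then show ?thesis using v by (simp add: proj_def flip: y_def)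
qed

lemma proj_finite:
  assumes v: "unit v" obtains x where "u \<approx> x * v"
proof -
  obtain y where y: "v * y \<approx> 1" using unit_inverse [OF v] by blast
  have "u \<approx> (u * y) * v" by (rule cong_comb1 [OF y, where u = "- u"]) (simp add: algebra_simps)
  then show ?thesis by (rule that)
qed

text \<open>The entries are arbitrary integers with determinant 1 modulo \<open>p\<close>, so that
  products need not be reduced.\<close>

definition represents :: "'a \<Rightarrow> int \<Rightarrow> int \<Rightarrow> int \<Rightarrow> int \<Rightarrow> bool"
  where "represents g a b c d \<longleftrightarrow> g \<in> carrier G \<and> a * d - b * c \<approx> 1 \<and>
    (\<forall>u v. unit u \<or> unit v \<longrightarrow> act g (proj u v) = proj (a * u + b * v) (c * u + d * v))"

lemma proj_Omega: "proj u v \<in> \<Omega>" by (simp add: proj_def)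

lemma nonzero_image:
  assumes det: "a * d - b * c \<approx> 1" and uv: "unit u \<or> unit v"
  shows "unit (a * u + b * v) \<or> unit (c * u + d * v)"
proof (rule ccontr)
  assume "\<not> (unit (a * u + b * v) \<or> unit (c * u + d * v))"
  then have 0: "a * u + b * v \<approx> 0" "c * u + d * v \<approx> 0" by (simp_all add: cong_0_iff)
  have "u \<approx> 0"
    by (rule cong_comb3 [OF det 0, where u = "- u" and v = d and w = "- b"]) (simp add: algebra_simps)
  moreover have "v \<approx> 0"
    by (rule cong_comb3 [OF det 0, where u = "- v" and v = "- c" and w = a]) (simp add: algebra_simps)
  ultimately show False using uv by (simp add: cong_0_iff)
qed

lemma proj_cong: "u \<approx> u' \<Longrightarrow> v \<approx> v' \<Longrightarrow> proj u v = proj u' v'"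
proof (cases "unit v")
  case True
  assume u: "u \<approx> u'" and v: "v \<approx> v'"
  obtain x where x: "u \<approx> x * v" by (rule proj_finite [OF True])
  have v': "unit v'" using unit_cong [OF v] True by simp
  have "u' \<approx> x * v'"
    by (rule cong_comb3 [OF u v x, where u = "- 1" and v = x and w = 1]) (simp add: algebra_simps)
  then show ?thesis using proj_pt [OF True x] proj_pt [OF v'] by simp
next
  case False
  assume v: "v \<approx> v'"
  then show ?thesis using unit_cong [OF v] False by (simp add: proj_None)
qed

lemma represents_cong:
  assumes g: "represents g a b c d" and eq: "a \<approx> a'" "b \<approx> b'" "c \<approx> c'" "d \<approx> d'"
  shows "represents g a' b' c' d'"
  unfolding represents_def
proof (intro conjI allI impI)
  show "g \<in> carrier G" using g by (simp add: represents_def)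
  have det: "a * d - b * c \<approx> 1" using g by (simp add: represents_def)
  have "a' * d' - b' * c' \<approx> a * d - b * c"
    by (intro cong_diff cong_mult cong_sym [OF eq(1)] cong_sym [OF eq(2)] cong_sym [OF eq(3)] cong_sym [OF eq(4)])
  then show "a' * d' - b' * c' \<approx> 1" using det by (rule cong_trans)
  fix u v assume uv: "unit u \<or> unit v"
  have "act g (proj u v) = proj (a * u + b * v) (c * u + d * v)" using g uv unfolding represents_def by blast
  also have "\<dots> = proj (a' * u + b' * v) (c' * u + d' * v)"
    by (intro proj_cong cong_add cong_mult eq cong_refl)
  finally show "act g (proj u v) = proj (a' * u + b' * v) (c' * u + d' * v)" .
qed

lemma represents_mult:
  assumes g: "represents g a b c d" and h: "represents h a' b' c' d'"
  shows "represents (g \<otimes> h) (a * a' + b * c') (a * b' + b * d') (c * a' + d * c') (c * b' + d * d')"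
  unfolding represents_def
proof (intro conjI allI impI)
  have gh: "g \<in> carrier G" "h \<in> carrier G" using g h by (simp_all add: represents_def)
  then show "g \<otimes> h \<in> carrier G" by simp
  have det: "a * d - b * c \<approx> 1" "a' * d' - b' * c' \<approx> 1" using g h by (simp_all add: represents_def)
  show "(a * a' + b * c') * (c * b' + d * d') - (a * b' + b * d') * (c * a' + d * c') \<approx> 1"
    by (rule cong_comb2 [OF det, where u = "a' * d' - b' * c'" and v = 1]) (simp add: algebra_simps)
  fix u v assume uv: "unit u \<or> unit v"
  have "act h (proj u v) = proj (a' * u + b' * v) (c' * u + d' * v)" using h uv unfolding represents_def by blast
  moreover have "act g (proj (a' * u + b' * v) (c' * u + d' * v)) =
      proj (a * (a' * u + b' * v) + b * (c' * u + d' * v)) (c * (a' * u + b' * v) + d * (c' * u + d' * v))"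
    using g nonzero_image [OF det(2) uv] unfolding represents_def by blast
  ultimately have "act (g \<otimes> h) (proj u v) =
      proj (a * (a' * u + b' * v) + b * (c' * u + d' * v)) (c * (a' * u + b' * v) + d * (c' * u + d' * v))"
    using gh by (simp add: act_act proj_Omega)
  moreover have "a * (a' * u + b' * v) + b * (c' * u + d' * v) = (a * a' + b * c') * u + (a * b' + b * d') * v"
    "c * (a' * u + b' * v) + d * (c' * u + d' * v) = (c * a' + d * c') * u + (c * b' + d * d') * v"
    by (simp_all add: algebra_simps)
  ultimately show "act (g \<otimes> h) (proj u v) =
      proj ((a * a' + b * c') * u + (a * b' + b * d') * v) ((c * a' + d * c') * u + (c * b' + d * d') * v)"
    by simp
qed

lemma proj_scale:
  assumes k: "unit k" shows "proj (k * u) (k * v) = proj u v"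
proof (cases "unit v")
  case True
  obtain x where x: "u \<approx> x * v" by (rule proj_finite [OF True])
  have "k * u \<approx> x * (k * v)" by (rule cong_comb1 [OF x, where u = k]) (simp add: algebra_simps)
  then have "proj (k * u) (k * v) = pt x" using k True by (intro proj_pt) (simp_all add: unit_mult)
  then show ?thesis using proj_pt [OF True x] by simp
qed (simp add: proj_None unit_mult)

text \<open>By homogeneity it suffices to check the points (1 : 0) and (x : 1).\<close>

lemma representsI:
  assumes g: "g \<in> carrier G" and det: "a * d - b * c \<approx> 1"
    and None: "act g None = proj a c" and pt: "\<And>x. act g (pt x) = proj (a * x + b) (c * x + d)"
  shows "represents g a b c d"
  unfolding represents_def
proof (intro conjI allI impI g det)
  fix u v assume uv: "unit u \<or> unit v"
  show "act g (proj u v) = proj (a * u + b * v) (c * u + d * v)"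
  proof (cases "unit v")
    case True
    obtain x where x: "u \<approx> x * v" by (rule proj_finite [OF True])
    have "proj (a * u + b * v) (c * u + d * v) = proj (v * (a * x + b)) (v * (c * x + d))"
    proof (rule proj_cong)
      show "a * u + b * v \<approx> v * (a * x + b)"
        by (rule cong_comb1 [OF x, where u = a]) (simp add: algebra_simps)
      show "c * u + d * v \<approx> v * (c * x + d)"
        by (rule cong_comb1 [OF x, where u = c]) (simp add: algebra_simps)
    qed
    then show ?thesis using proj_pt [OF True x] pt proj_scale [OF True] by simp
  next
    case False
    then have u: "unit u" and v: "v \<approx> 0" using uv by (simp_all add: cong_0_iff)
    have "proj (a * u + b * v) (c * u + d * v) = proj (u * a) (u * c)"
    proof (rule proj_cong)
      show "a * u + b * v \<approx> u * a" by (rule cong_comb1 [OF v, where u = b]) (simp add: algebra_simps)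
      show "c * u + d * v \<approx> u * c" by (rule cong_comb1 [OF v, where u = d]) (simp add: algebra_simps)
    qed
    then show ?thesis using proj_None [OF False] None proj_scale [OF u] by simp
  qed
qed

lemma proj_1: "proj x 1 = pt x"
  by (rule proj_pt [OF unit_one]) simp

lemma proj_1_0: "proj 1 0 = None"
  by (rule proj_None) simp

lemma represents_unique:
  assumes "represents g a b c d" "represents h a b c d" shows "g = h"
proof (rule act_eqI)
  show "g \<in> carrier G" "h \<in> carrier G" using assms by (simp_all add: represents_def)
  have eq: "act g (proj u v) = act h (proj u v)" if "unit u \<or> unit v" for u v
    using assms that unfolding represents_def by presburger
  fix z assume "z \<in> \<Omega>"
  then show "act g z = act h z"
  proof (rule Omega_cases)
    assume z: "z = None"
    show ?thesis unfolding z proj_1_0 [symmetric] by (rule eq) (use unit_one in blast)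
  next
    fix x assume z: "z = pt x"
    show ?thesis unfolding z proj_1 [symmetric] by (rule eq) (use unit_one in blast)
  qed
qed

lemma represents_uminus:
  assumes "represents g a b c d" shows "represents g (- a) (- b) (- c) (- d)"
  unfolding represents_def
proof (intro conjI allI impI)
  show "g \<in> carrier G" "- a * - d - - b * - c \<approx> 1" using assms by (simp_all add: represents_def)
  fix u v assume "unit u \<or> unit v"
  then have "act g (proj u v) = proj (a * u + b * v) (c * u + d * v)" using assms unfolding represents_def by blast
  also have "\<dots> = proj (- 1 * (a * u + b * v)) (- 1 * (c * u + d * v))"
    by (rule proj_scale [symmetric]) (use unit_one in simp)
  finally show "act g (proj u v) = proj (- a * u + - b * v) (- c * u + - d * v)" by (simp add: algebra_simps)
qed

lemma represents_one: "represents \<one> 1 0 0 1"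
  by (simp add: represents_def proj_Omega)

lemma represents_shift: "represents (shift e) 1 e 0 1"
  by (rule representsI) (simp_all add: proj_1 proj_1_0)

text \<open>The diagonal matrix with entries r and 1/r multiplies the affine coordinate by r^2;
  hence the squares.\<close>

lemma represents_hh:
  assumes r: "r * r' \<approx> 1" and s: "s \<approx> r ^ 2" "s \<in> A"
  shows "represents (hh s) r 0 0 r'"
proof (rule representsI)
  show "hh s \<in> carrier G" using s by (simp add: hh_closed)
  show "r * r' - 0 * 0 \<approx> 1" using r by simp
  show "act (hh s) None = proj r 0" using s by (simp add: hh_None proj_None)
  fix x
  have u: "unit r'" using unit_cong [OF r] unit_one by (simp add: unit_mult)
  have "proj (r * x + 0) (0 * x + r') = pt (s * x)"
    by (rule proj_pt)
      (simp add: u, rule cong_comb2 [OF s(1) r, where u = "- x * r'" and v = "- r * x"],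
        simp add: algebra_simps power2_eq_square)
  then show "act (hh s) (pt x) = proj (r * x + 0) (0 * x + r')" using s by (simp add: hh_pt)
qed

lemma squares_A: "unit s \<Longrightarrow> s ^ 2 \<in> A"
  using standard unfolding standard_def by (elim conjE) blast

lemma exists_weyl: "\<exists>v. represents v 0 (- 1) 1 0 \<and> act v (pt 0) = None"
proof -
  obtain v where v: "v \<in> carrier G" "act v None = pt 0" "act v (pt 0) = None"
    and vx: "\<And>x y. unit x \<Longrightarrow> x * y \<approx> - 1 \<Longrightarrow> act v (pt x) = pt y"
    using standard unfolding standard_def by (elim conjE bexE) blast
  have "represents v 0 (- 1) 1 0"
  proof (rule representsI [OF v(1)])
    show "act v None = proj 0 1" by (simp add: v proj_1)
    fix x
    show "act v (pt x) = proj (0 * x + - 1) (1 * x + 0)"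
    proof (cases "unit x")
      case True
      obtain y where y: "x * y \<approx> 1" using unit_inverse [OF True] by blast
      have xy: "x * - y \<approx> - 1" by (rule cong_comb1 [OF y, where u = "- 1"]) simp
      have "proj (0 * x + - 1) (1 * x + 0) = pt (- y)"
        by (rule proj_pt) (use True cong_sym [OF xy] in \<open>simp_all add: mult.commute\<close>)
      then show ?thesis using vx [OF True xy] by simp
    next
      case False
      then have "pt x = pt 0" by (simp add: cong_0_iff)
      then have "act v (pt x) = None" by (simp only: v)
      then show ?thesis using False by (simp add: proj_None)
    qed
  qed simp
  then show ?thesis using v(3) by blast
qed

text \<open>This is the Bruhat decomposition: a matrix with c = 0 is a translation times a diagonal
  matrix, and every other one involves the Weyl element exactly once.\<close>

lemma exists_represented:
  assumes det: "a * d - b * c \<approx> 1"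
  shows "\<exists>g. represents g a b c d"
proof (cases "unit c")
  case False
  then have c: "c \<approx> 0" by (simp add: cong_0_iff)
  have ad: "a * d \<approx> 1" by (rule cong_comb2 [OF det c, where u = 1 and v = b]) (simp add: algebra_simps)
  have ua: "unit a" using unit_cong [OF ad] unit_one by (simp add: unit_mult)
  have h: "represents (hh (a ^ 2)) a 0 0 d" by (rule represents_hh [OF ad _ squares_A [OF ua]]) simp
  have "represents (shift (a * b) \<otimes> hh (a ^ 2)) a b c d"
  proof (rule represents_cong [OF represents_mult [OF represents_shift h]])
    show "1 * 0 + a * b * d \<approx> b" by (rule cong_comb1 [OF ad, where u = b]) (simp add: algebra_simps)
    show "0 * a + 1 * 0 \<approx> c" using cong_sym [OF c] by simp
  qed simp_all
  then show ?thesis ..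
next
  case True
  obtain v where v: "represents v 0 (- 1) 1 0" using exists_weyl by blast
  obtain c' where c': "c * c' \<approx> 1" using unit_inverse [OF True] by blast
  have h: "represents (hh (c ^ 2)) c 0 0 c'" by (rule represents_hh [OF c' _ squares_A [OF True]]) simp
  \<comment> \<open>Translation by a/c, then the Weyl element, diag(c, 1/c) and translation by d/c;
    the upper right entry comes out as (a d - 1)/c, which is b.\<close>
  let ?g = "shift (a * c') \<otimes> (v \<otimes> (hh (c ^ 2) \<otimes> shift (d * c')))"
  have "represents ?g a b c d"
  proof (rule represents_cong [OF represents_mult [OF represents_shift represents_mult [OF v
          represents_mult [OF h represents_shift]]]])
    show "1 * (0 * (c * 1 + 0 * 0) + - 1 * (0 * 1 + c' * 0)) + a * c' * (1 * (c * 1 + 0 * 0) + 0 * (0 * 1 + c' * 0)) \<approx> a"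
      by (rule cong_comb1 [OF c', where u = a]) (simp add: algebra_simps)
    show "1 * (0 * (c * (d * c') + 0 * 1) + - 1 * (0 * (d * c') + c' * 1)) +
        a * c' * (1 * (c * (d * c') + 0 * 1) + 0 * (0 * (d * c') + c' * 1)) \<approx> b"
      by (rule cong_comb2 [OF c' det, where u = "a * d * c' + b" and v = c']) (simp add: algebra_simps)
    show "0 * (0 * (c * 1 + 0 * 0) + - 1 * (0 * 1 + c' * 0)) + 1 * (1 * (c * 1 + 0 * 0) + 0 * (0 * 1 + c' * 0)) \<approx> c"
      by simp
    show "0 * (0 * (c * (d * c') + 0 * 1) + - 1 * (0 * (d * c') + c' * 1)) +
        1 * (1 * (c * (d * c') + 0 * 1) + 0 * (0 * (d * c') + c' * 1)) \<approx> d"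
      by (rule cong_comb1 [OF c', where u = d]) (simp add: algebra_simps)
  qed
  then show ?thesis ..
qed

lemma represented_N:
  assumes n: "n \<in> N"
  shows "\<exists>a b c d. represents n a b c d"
proof -
  obtain b where b: "\<And>x. act n (pt x) = pt (scale n * x + b)" using N_affine [OF n] by metis
  have "\<forall>a\<in>A. \<exists>s. unit s \<and> a \<approx> s ^ 2" using standard unfolding standard_def by (elim conjE)
  then obtain r where r: "unit r" "scale n \<approx> r ^ 2" using scale_A [OF n] by blast
  obtain r' where r': "r * r' \<approx> 1" using unit_inverse [OF r(1)] by blast
  have h: "represents (hh (scale n)) r 0 0 r'" by (rule represents_hh [OF r' r(2) scale_A [OF n]])
  have "n = shift b \<otimes> hh (scale n)"
  proof (rule act_eqI)
    fix z assume "z \<in> \<Omega>"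
    then show "act n z = act (shift b \<otimes> hh (scale n)) z"
      by (rule Omega_cases) (simp_all add: act_act hh_closed scale_A n hh_None hh_pt b N_D [OF n])
  qed (simp_all add: N_D n hh_closed scale_A)
  then show ?thesis using represents_mult [OF represents_shift h] by metis
qed

text \<open>If g moves infinity to x, then translation by -x followed by the involution
  \<open>v\<close> brings the image of infinity back, which reduces the claim to the stabilizer of
  infinity.\<close>

lemma all_represented:
  assumes g: "g \<in> carrier G"
  shows "\<exists>a b c d. represents g a b c d"
proof (rule Omega_cases [OF act_Omega [OF g, of None]])
  assume "act g None = None"
  then show ?thesis using g by (intro represented_N) (simp add: N_def)
next
  fix x assume x: "act g None = pt x"
  obtain v where v: "represents v 0 (- 1) 1 0" "act v (pt 0) = None" using exists_weyl by blast
  have vc: "v \<in> carrier G" using v(1) by (simp add: represents_def)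
  have vv: "v \<otimes> v = \<one>"
  proof (rule represents_unique)
    show "represents (v \<otimes> v) (- 1) 0 0 (- 1)" using represents_mult [OF v(1) v(1)] by simp
    show "represents \<one> (- 1) 0 0 (- 1)" using represents_uminus [OF represents_one] by simp
  qed
  define n where "n = v \<otimes> (shift (- x) \<otimes> g)"
  have "n \<in> N" unfolding n_def N_def using vc g by (simp add: act_act x v(2))
  then obtain a b c d where n: "represents n a b c d" using represented_N by blast
  have "shift x \<otimes> (v \<otimes> n) = shift x \<otimes> ((v \<otimes> v) \<otimes> (shift (- x) \<otimes> g))"
    unfolding n_def using vc g by (simp add: m_assoc)
  also have "\<dots> = g" unfolding vv using g by (simp add: inv_cancel flip: inv_shift)
  finally have "shift x \<otimes> (v \<otimes> n) = g" .
  then show ?thesis using represents_mult [OF represents_shift represents_mult [OF v(1) n]] by metis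
qed

text \<open>The map starts from matrices because a group element is represented by a matrix and
  equally by its negative, whereas a matrix determines its element.\<close>

definition of_matrix :: "int \<times> int \<times> int \<times> int \<Rightarrow> 'a"
  where "of_matrix M = (case M of (a, b, c, d) \<Rightarrow> THE g. represents g a b c d)"

lemma of_matrix_eq: "represents g a b c d \<Longrightarrow> of_matrix (a, b, c, d) = g"
  unfolding of_matrix_def prod.case by (rule the_equality) (auto intro: represents_unique)

lemma represents_of_matrix: "a * d - b * c \<approx> 1 \<Longrightarrow> represents (of_matrix (a, b, c, d)) a b c d"
  using exists_represented of_matrix_eq by metis

lemma of_matrix_hom: "of_matrix \<in> hom SLp G"
proof (rule homI)
  fix M assume "M \<in> carrier SLp"
  then obtain a b c d where M: "M = (a, b, c, d)" "a * d - b * c \<approx> 1" by (rule SLp_cases)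
  show "of_matrix M \<in> carrier G" using represents_of_matrix [OF M(2)] by (simp add: M(1) represents_def)
next
  fix M M' assume "M \<in> carrier SLp" "M' \<in> carrier SLp"
  obtain a b c d where M: "M = (a, b, c, d)" "a * d - b * c \<approx> 1" using \<open>M \<in> carrier SLp\<close> by (rule SLp_cases)
  obtain a' b' c' d' where M': "M' = (a', b', c', d')" "a' * d' - b' * c' \<approx> 1"
    using \<open>M' \<in> carrier SLp\<close> by (rule SLp_cases)
  show "of_matrix (M \<otimes>\<^bsub>SLp\<^esub> M') = of_matrix M \<otimes> of_matrix M'"
    unfolding M(1) M'(1) SLp_mult
    by (rule of_matrix_eq, rule represents_cong [OF represents_mult [OF represents_of_matrix [OF M(2)] represents_of_matrix [OF M'(2)]]])
      simp_all
qed

lemma of_matrix_surj: "of_matrix ` carrier SLp = carrier G"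
proof
  show "of_matrix ` carrier SLp \<subseteq> carrier G" using of_matrix_hom by (auto simp: hom_def)
  show "carrier G \<subseteq> of_matrix ` carrier SLp"
  proof
    fix g assume "g \<in> carrier G"
    then obtain a b c d where g: "represents g a b c d" using all_represented by blast
    have r: "represents g (a mod int p) (b mod int p) (c mod int p) (d mod int p)"
      by (rule represents_cong [OF g]) simp_all
    then have "(a mod int p) * (d mod int p) - (b mod int p) * (c mod int p) \<approx> 1" by (simp only: represents_def)
    moreover have "x mod int p \<in> {0..<int p}" for x using p_gt_1 by simp
    ultimately have "(a mod int p, b mod int p, c mod int p, d mod int p) \<in> carrier SLp"
      unfolding SLp_carrier by blast
    then show "g \<in> of_matrix ` carrier SLp" using of_matrix_eq [OF r] by (metis imageI)
  qed
qed

text \<open>A matrix that fixes all points is scalar, hence central. Conversely, by surjectivity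
  central matrices map into the center of the simple group, which is trivial.\<close>

lemma kernel_of_matrix: "kernel SLp G of_matrix = group_center SLp"
proof
  interpret S: group SLp by (rule group_SLp)
  interpret hom: group_hom SLp G of_matrix
    by (intro group_hom.intro group_hom_axioms.intro group_SLp is_group of_matrix_hom)
  show "kernel SLp G of_matrix \<subseteq> group_center SLp"
  proof
    fix M assume "M \<in> kernel SLp G of_matrix"
    then have Mc: "M \<in> carrier SLp" and M1: "of_matrix M = \<one>" by (simp_all add: kernel_def)
    obtain a b c d where M: "M = (a, b, c, d)" and r: "a \<in> {0..<int p}" "b \<in> {0..<int p}" "c \<in> {0..<int p}" "d \<in> {0..<int p}"
      and det: "a * d - b * c \<approx> 1" using Mc by (rule SLp_cases)
    have "represents \<one> a b c d" using represents_of_matrix [OF det] M1 by (simp add: M)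
    then have rep: "proj u v = proj (a * u + b * v) (c * u + d * v)" if "unit u \<or> unit v" for u v
      using that unfolding represents_def by (simp add: proj_Omega)
    have c0: "c \<approx> 0"
    proof (rule ccontr)
      assume "\<not> c \<approx> 0"
      then have "unit c" by (simp add: cong_0_iff)
      then show False using rep [of 1 0] unit_one by (simp add: proj_1_0) (simp add: proj_def)
    qed
    have ad: "a * d \<approx> 1" by (rule cong_comb2 [OF det c0, where u = 1 and v = b]) (simp add: algebra_simps)
    have ud: "unit d" using unit_cong [OF ad] unit_one by (simp add: unit_mult)
    have affine: "x * d \<approx> a * x + b" for x
    proof -
      have cd: "c * x + d * 1 \<approx> d" by (rule cong_comb1 [OF c0, where u = x]) simp
      obtain y where y: "a * x + b * 1 \<approx> y * d" by (rule proj_finite [OF ud])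
      have "pt x = proj (a * x + b * 1) (c * x + d * 1)" using rep [of x 1] unit_one by (simp add: proj_1)
      also have "\<dots> = proj (a * x + b * 1) d" by (rule proj_cong [OF cong_refl cd])
      also have "\<dots> = pt y" by (rule proj_pt [OF ud y])
      finally have "x \<approx> y" by simp
      then show ?thesis by (rule cong_comb2 [OF _ y, where u = d and v = "- 1"]) (simp add: algebra_simps)
    qed
    have b0: "b \<approx> 0" using affine [of 0] by (simp add: cong_sym_eq)
    have "d \<approx> a" by (rule cong_comb2 [OF affine [of 1] b0, where u = 1 and v = 1]) simp
    then have "d = a" using r by (intro residue_eqI)
    moreover have "b = 0" "c = 0" using r b0 c0 p_gt_1 by (intro residue_eqI; simp)+
    ultimately show "M \<in> group_center SLp" using Mc scalar_central unfolding M by simp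
  qed
  show "group_center SLp \<subseteq> kernel SLp G of_matrix"
  proof
    fix M assume M: "M \<in> group_center SLp"
    then have Mc: "M \<in> carrier SLp" by (simp add: group_center_def)
    have "of_matrix M \<in> group_center G"
      unfolding group_center_def
    proof (intro CollectI conjI ballI)
      show "of_matrix M \<in> carrier G" by (rule hom.hom_closed [OF Mc])
      fix g assume "g \<in> carrier G"
      then obtain M' where M': "M' \<in> carrier SLp" "g = of_matrix M'" unfolding of_matrix_surj [symmetric] by (elim imageE)
      have "M \<otimes>\<^bsub>SLp\<^esub> M' = M' \<otimes>\<^bsub>SLp\<^esub> M" using M M'(1) by (simp add: group_center_def)
      then show "of_matrix M \<otimes> g = g \<otimes> of_matrix M"
        unfolding M'(2) using hom.hom_mult [OF Mc M'(1)] hom.hom_mult [OF M'(1) Mc] by simp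
    qed
    moreover have "group_center G = {\<one>}"
    proof -
      consider "group_center G = carrier G" | "group_center G = {\<one>}"
        using simple_group.no_real_normal_subgroup [OF simple normal_group_center] by blast
      then show ?thesis
      proof cases
        case 1
        then have "comm_group G" by (intro group_comm_groupI) (auto simp: group_center_def)
        then show ?thesis using noncomm by simp
      qed
    qed
    ultimately show "M \<in> kernel SLp G of_matrix" using Mc by (simp add: kernel_def)
  qed
qed

theorem iso_PSL2: "G \<cong> PSL2 (residue_ring (int p))"
proof -
  interpret S: group SLp by (rule group_SLp)
  interpret hom: group_hom SLp G of_matrix
    by (intro group_hom.intro group_hom_axioms.intro group_SLp is_group of_matrix_hom)
  have "PSL2 (residue_ring (int p)) \<cong> G"
    unfolding PSL2_def kernel_of_matrix [symmetric] by (rule hom.FactGroup_iso [OF of_matrix_surj])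
  then show ?thesis
    using group.iso_sym normal.factorgroup_is_group [OF S.normal_group_center] unfolding PSL2_def by blast
qed

end

section \<open>The number of Sylow subgroups\<close>

context prime_modulus begin

text \<open>If c is not 0, then b is determined by a, c and d; if c = 0, then a is a unit and
  determines d, while b is free. This gives p^2 (p - 1) + p (p - 1) matrices.\<close>

lemma card_SLp: "card (carrier SLp) = p * (p ^ 2 - 1)"
proof -
  define iv where "iv c = (SOME y. c * y \<approx> 1)" for c
  have iv: "c * iv c \<approx> 1" if "unit c" for c
  proof -
    have "\<exists>y. c * y \<approx> 1" using unit_inverse [OF that] by blast
    then show ?thesis unfolding iv_def by (rule someI_ex)
  qed
  let ?F = "{0..<int p}" and ?U = "{1..<int p}"
  define f where "f = (\<lambda>(a, c, d). (a, (a * d - 1) * iv c mod int p, c, d))"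
  define g where "g = (\<lambda>(a, b :: int). (a, b, 0 :: int, iv a mod int p))"
  have mod_F: "x mod int p \<in> ?F" for x using p_gt_1 by simp
  have UF: "?U \<subseteq> ?F" by auto
  have f: "f ` (?F \<times> ?U \<times> ?F) \<subseteq> carrier SLp"
  proof
    fix M assume "M \<in> f ` (?F \<times> ?U \<times> ?F)"
    then obtain a c d where acd: "a \<in> ?F" "c \<in> ?U" "d \<in> ?F" and M: "M = (a, (a * d - 1) * iv c mod int p, c, d)"
      unfolding f_def by auto
    have "(a * d - 1) * iv c mod int p \<approx> (a * d - 1) * iv c" by simp
    then have "a * d - ((a * d - 1) * iv c mod int p) * c \<approx> 1"
      by (rule cong_comb2 [OF _ iv [OF unit_less [OF acd(2)]], where u = "- c" and v = "- (a * d - 1)"])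
        (simp add: algebra_simps)
    then show "M \<in> carrier SLp" unfolding M SLp_carrier using acd mod_F UF by blast
  qed
  have g: "g ` (?U \<times> ?F) \<subseteq> carrier SLp"
  proof
    fix M assume "M \<in> g ` (?U \<times> ?F)"
    then obtain a b where ab: "a \<in> ?U" "b \<in> ?F" and M: "M = (a, b, 0, iv a mod int p)"
      unfolding g_def by auto
    have "iv a mod int p \<approx> iv a" by simp
    then have "a * (iv a mod int p) - b * 0 \<approx> 1"
      by (rule cong_comb2 [OF _ iv [OF unit_less [OF ab(1)]], where u = a and v = 1]) (simp add: algebra_simps)
    moreover have "0 \<in> ?F" using p_gt_1 by simp
    ultimately show "M \<in> carrier SLp" unfolding M SLp_carrier using ab mod_F UF by blast
  qed
  have sub: "carrier SLp \<subseteq> f ` (?F \<times> ?U \<times> ?F) \<union> g ` (?U \<times> ?F)"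
  proof
    fix M assume "M \<in> carrier SLp"
    then obtain a b c d where M: "M = (a, b, c, d)" and F: "a \<in> ?F" "b \<in> ?F" "c \<in> ?F" "d \<in> ?F"
      and det: "a * d - b * c \<approx> 1" by (rule SLp_cases)
    show "M \<in> f ` (?F \<times> ?U \<times> ?F) \<union> g ` (?U \<times> ?F)"
    proof (cases "c = 0")
      case False
      then have c: "c \<in> ?U" using F(3) by simp
      have "(a * d - 1) * iv c mod int p \<approx> (a * d - 1) * iv c" by simp
      then have "b \<approx> (a * d - 1) * iv c mod int p"
        by (rule cong_comb3 [OF _ det iv [OF unit_less [OF c]], where u = "- 1" and v = "- iv c" and w = "- b"])
          (simp add: algebra_simps)
      then have "b = (a * d - 1) * iv c mod int p" by (rule residue_eqI [OF F(2) mod_F])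
      then have "M = f (a, c, d)" by (simp add: f_def M)
      then show ?thesis using F c by blast
    next
      case True
      have ad: "a * d \<approx> 1" using det by (simp add: True)
      have "a \<noteq> 0"
      proof
        assume "a = 0"
        then have "0 \<approx> 1" using ad by simp
        then show False using unit_one by (simp add: cong_sym_eq cong_0_iff)
      qed
      then have a: "a \<in> ?U" using F(1) by simp
      have "iv a mod int p \<approx> iv a" by simp
      then have "d \<approx> iv a mod int p"
        by (rule cong_comb3 [OF _ ad iv [OF unit_less [OF a]], where u = "- 1" and v = "iv a" and w = "- d"])
          (simp add: algebra_simps)
      then have "d = iv a mod int p" by (rule residue_eqI [OF F(4) mod_F])
      then have "M = g (a, b)" by (simp add: g_def M True)
      then show ?thesis using F a by blast
    qed
  qed
  have "carrier SLp = f ` (?F \<times> ?U \<times> ?F) \<union> g ` (?U \<times> ?F)" using f g sub by blast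
  moreover have "f ` (?F \<times> ?U \<times> ?F) \<inter> g ` (?U \<times> ?F) = {}" unfolding f_def g_def by auto
  ultimately have "card (carrier SLp) = card (f ` (?F \<times> ?U \<times> ?F)) + card (g ` (?U \<times> ?F))"
    by (simp add: card_Un_disjoint)
  also have "card (f ` (?F \<times> ?U \<times> ?F)) = p * ((p - 1) * p)"
    by (subst card_image) (auto simp: f_def inj_on_def card_cartesian_product)
  also have "card (g ` (?U \<times> ?F)) = (p - 1) * p"
    by (subst card_image) (auto simp: g_def inj_on_def card_cartesian_product)
  also have "p * ((p - 1) * p) + (p - 1) * p = p * (p ^ 2 - 1)"
    using p_gt_1 by (cases p) (simp_all add: power2_eq_square algebra_simps)
  finally show ?thesis .
qed

lemma order_PSL2_dvd: "order (PSL2 (residue_ring (int p))) dvd p * (p ^ 2 - 1)"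
proof -
  interpret S: group SLp by (rule group_SLp)
  have "subgroup (group_center SLp) SLp" using S.normal_group_center by (rule normal_imp_subgroup)
  then have "card (rcosets\<^bsub>SLp\<^esub> group_center SLp) * card (group_center SLp) = order SLp" by (rule S.lagrange)
  then show ?thesis unfolding PSL2_def by (simp add: order_def FactGroup_def card_SLp) (metis dvd_triv_left)
qed

end

text \<open>With n = k p + 1 the cofactor has the form j p - 1, and comparing the product with p^2 -
  1 gives k - j = p (k j - 1). For k > 1 the right side exceeds k j - 1, which is at least k - 1,
  while the left side is at most k - 1.\<close>

lemma one_mod_divisor_eq:
  fixes p n :: nat
  assumes p: "p > 1" and n: "n mod p = 1" "n dvd p ^ 2 - 1" "n \<noteq> 1"
  shows "n = p + 1"
proof -
  define k where "k = n div p"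
  have nk: "n = k * p + 1" using n(1) div_mult_mod_eq [of n p] by (simp add: k_def)
  have k: "k \<ge> 1" using n(3) nk by (cases k) auto
  obtain m where m: "p ^ 2 - 1 = n * m" using n(2) by blast
  have eq: "int p ^ 2 - 1 = int n * int m"
    using m p by (metis of_nat_1 of_nat_diff of_nat_mult of_nat_power one_le_power less_imp_le)
  have "int m + 1 = int p * (int p - int k * int m)"
    using eq by (simp add: nk algebra_simps power2_eq_square)
  then obtain j where j: "int m + 1 = int p * j" by blast
  have "int p * j > 0" using j by linarith
  then have j1: "j \<ge> 1" using p by (simp add: zero_less_mult_iff)
  have m': "int m = int p * j - 1" using j by simp
  have "int p * (int k - j) = int p * (int p * (int k * j - 1))"
    using eq unfolding m' nk by (simp add: algebra_simps power2_eq_square)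
  then have e: "int k - j = int p * (int k * j - 1)" using p by simp
  have "int k = 1"
  proof (rule ccontr)
    assume "int k \<noteq> 1"
    then have k2: "int k > 1" using k by simp
    have le: "int k * 1 \<le> int k * j" using j1 k2 by (intro mult_left_mono) simp_all
    then have "int k - 1 \<le> 1 * (int k * j - 1)" by simp
    also have "1 * (int k * j - 1) < int p * (int k * j - 1)"
    proof (rule mult_strict_right_mono)
      show "1 < int p" using p by simp
      show "0 < int k * j - 1" using le k2 by linarith
    qed
    finally show False using e j1 by simp
  qed
  then show ?thesis using nk by simp
qed

context cyclic_sylow begin

text \<open>The conjugation action on Sylow subgroups is transitive, and the elements carrying
  \<open>P\<close> to a given one form a coset of the normalizer of \<open>P\<close>.\<close>

lemma order_eq_card_Syl:
  assumes P: "P \<in> Syl"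
  shows "order G = card Syl * card {g \<in> carrier G. conjg g ` P = P}"
proof -
  define N where "N = {g \<in> carrier G. conjg g ` P = P}"
  define F where "F Q = {g \<in> carrier G. conjg g ` P = Q}" for Q
  have Pc: "P \<subseteq> carrier G" using P by (rule SylD(3))
  have F: "card (F Q) = card N" if Q: "Q \<in> Syl" for Q
  proof -
    obtain h where h: "h \<in> carrier G" "conjg h ` P = Q" by (rule Syl_conjugate [OF P Q])
    have "bij_betw (\<lambda>g. h \<otimes> g) N (F Q)"
    proof (rule bij_betwI [where g = "\<lambda>g. inv h \<otimes> g"])
      show "(\<lambda>g. h \<otimes> g) \<in> N \<rightarrow> F Q"
        unfolding N_def F_def using h Pc by (auto simp flip: conjg_image_conjg_image)
      show "(\<lambda>g. inv h \<otimes> g) \<in> F Q \<rightarrow> N"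
      proof
        fix g assume "g \<in> F Q"
        then have g: "g \<in> carrier G" and gP: "conjg g ` P = conjg h ` P" using h(2) by (simp_all add: F_def)
        have "conjg (inv h \<otimes> g) ` P = conjg (inv h) ` conjg g ` P"
          using g h(1) Pc by (simp add: conjg_image_conjg_image)
        also have "\<dots> = P" unfolding gP using h(1) Pc by (rule conjg_image_cancel)
        finally have "conjg (inv h \<otimes> g) ` P = P" .
        then show "inv h \<otimes> g \<in> N" using g h by (simp add: N_def)
      qed
    qed (use h in \<open>auto simp: N_def F_def inv_cancel\<close>)
    then show ?thesis by (rule bij_betw_same_card [symmetric])
  qed
  have "carrier G = (\<Union>Q\<in>Syl. F Q)"
  proof
    show "carrier G \<subseteq> (\<Union>Q\<in>Syl. F Q)"
    proof
      fix g assume g: "g \<in> carrier G"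
      show "g \<in> (\<Union>Q\<in>Syl. F Q)" by (rule UN_I [OF Syl_conjg [OF P g]]) (simp add: F_def g)
    qed
  qed (auto simp: F_def)
  then have "order G = card (\<Union>Q\<in>Syl. F Q)" by (simp add: order_def)
  also have "\<dots> = (\<Sum>Q\<in>Syl. card (F Q))"
    by (rule card_UN_disjoint) (use finite_Syl fin in \<open>auto simp: F_def\<close>)
  also have "\<dots> = (\<Sum>Q\<in>Syl. card N)" by (rule sum.cong) (simp_all add: F)
  finally show ?thesis by (simp add: N_def)
qed

lemma card_Syl_mult_p_dvd: "card Syl * p dvd order G"
proof -
  obtain P where P: "P \<in> Syl" using Syl_nonempty by blast
  define N where "N = {g \<in> carrier G. conjg g ` P = P}"
  have N: "subgroup N G" unfolding N_def by (rule subgroup_normalizing [OF subgroup_self SylD(3) [OF P]])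
  interpret N: group "G\<lparr>carrier := N\<rparr>" using N by (rule subgroup.subgroup_is_group) (rule is_group)
  have "P \<subseteq> N"
  proof
    fix q assume q: "q \<in> P"
    have "conjg q ` P = P" using SylD(1) [OF P] q by (rule conjg_image_self)
    then show "q \<in> N" unfolding N_def using q SylD(3) [OF P] by blast
  qed
  then have "subgroup P (G\<lparr>carrier := N\<rparr>)" by (rule subgroup_incl [OF SylD(1) [OF P] N])
  then have "card (rcosets\<^bsub>G\<lparr>carrier := N\<rparr>\<^esub> P) * card P = order (G\<lparr>carrier := N\<rparr>)" by (rule N.lagrange)
  then have "card N = card (rcosets\<^bsub>G\<lparr>carrier := N\<rparr>\<^esub> P) * p"
    using SylD(2) [OF P] by (simp add: order_def)
  then have "p dvd card N" by simp
  then show ?thesis unfolding order_eq_card_Syl [OF P] N_def [symmetric] by (rule mult_dvd_mono [OF dvd_refl])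
qed

lemma card_Syl_neq_1:
  assumes "simple_group G" "\<not> comm_group G" shows "card Syl \<noteq> 1"
proof
  assume "card Syl = 1"
  then obtain P where P: "Syl = {P}" by (rule card_1_singletonE)
  then have PS: "P \<in> Syl" by simp
  have "conjg g ` P = P" if "g \<in> carrier G" for g using Syl_conjg [OF PS that] P by simp
  then have "\<forall>g\<in>carrier G. \<forall>n\<in>P. conjg g n \<in> P" by blast
  then have "pnormal P (carrier G)"
    unfolding pnormal_def using SylD [OF PS] by simp
  then have "P \<subseteq> {\<one>}" using pnormal_subset_core simple_core [OF assms p_dvd] by blast
  then have "card P \<le> 1" using card_mono [of "{\<one>}" P] by simp
  then show False using SylD(2) [OF PS] p_gt_1 by simp
qed

end

theorem (in finite_group_prime) Pr_p_if_iso: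
  assumes s: "simple_group G" "\<not> comm_group G" and p: "p dvd order G"
    and iso: "G \<cong> PSL2 (residue_ring (int p))"
  shows "Pr_p p G = (real p ^ 2 + real p - 1) / real p ^ 3"
proof -
  interpret prime_modulus p by (rule prime_modulus.intro) (rule p_prime)
  have "order G = order (PSL2 (residue_ring (int p)))"
    using iso iso_same_card unfolding is_iso_def order_def by blast
  then have dvd: "order G dvd p * (p ^ 2 - 1)" using order_PSL2_dvd by simp
  have p0: "p \<noteq> 0" and p2: "p ^ 2 \<ge> 1" using p_gt_1 by simp_all
  have n: "\<not> p dvd p ^ 2 - 1"
  proof
    assume "p dvd p ^ 2 - 1"
    moreover have "p dvd p ^ 2" by simp
    ultimately have "p dvd p ^ 2 - (p ^ 2 - 1)" by (rule dvd_diff_nat [rotated])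
    then show False using p2 p_gt_1 by simp
  qed
  interpret cyclic_sylow G p
  proof (intro cyclic_sylow.intro cyclic_sylow_axioms.intro p)
    show "finite_group_prime G p" by unfold_locales
    show "\<not> p ^ 2 dvd order G"
    proof
      assume "p ^ 2 dvd order G"
      then have "p ^ 2 dvd p * (p ^ 2 - 1)" using dvd by (rule dvd_trans)
      then have "p * p dvd p * (p ^ 2 - 1)" by (simp only: power2_eq_square)
      then show False using n p0 by simp
    qed
  qed
  have "card Syl * p dvd p * (p ^ 2 - 1)" using card_Syl_mult_p_dvd dvd by (rule dvd_trans)
  then have "card Syl dvd p ^ 2 - 1" using p0 by (simp add: mult.commute)
  then have "card Syl = p + 1" by (intro one_mod_divisor_eq p_gt_1 card_Syl_mod card_Syl_neq_1 s)
  then show ?thesis by (rule Pr_p_formula)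
qed

theorem (in finite_group_prime) iso_if_Pr_p:
  assumes s: "simple_group G" "\<not> comm_group G" and p: "p dvd order G"
    and Pr: "Pr_p p G = (real p ^ 2 + real p - 1) / real p ^ 3"
  shows "p \<ge> 5" "G \<cong> PSL2 (residue_ring (int p))"
proof -
  have N: "card Gp = p ^ 2" by (rule card_Gp_eq [OF s p Pr])
  interpret cyclic_sylow G p
    by (intro cyclic_sylow.intro cyclic_sylow_axioms.intro p p_square_not_dvd [OF s p N]) unfold_locales
  have "(p + 1) * (p - 1) + 1 = p ^ 2" using p_gt_1 by (cases p) (simp_all add: power2_eq_square)
  then have "card Syl * (p - 1) = (p + 1) * (p - 1)" using card_Gp N by linarith
  then have n: "card Syl = p + 1" using p_gt_1 unfolding mult_cancel2 by linarith
  interpret simple_sylow G p by (intro simple_sylow.intro simple_sylow_axioms.intro s n) unfold_locales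
  obtain P where P: "P \<in> Syl" using Syl_nonempty by blast
  have "P \<noteq> {\<one>}" using SylD(2) [OF P] p_gt_1 by auto
  then obtain t where t: "t \<in> P" "t \<noteq> \<one>" using SylD(4) [OF P] by blast
  have "Syl \<noteq> {generate G {t}}" using n p_gt_1 by auto
  then obtain Q0 where Q0: "Q0 \<in> Syl" "Q0 \<noteq> generate G {t}" using Syl_nonempty by blast
  interpret sylow_coordinates G p t Q0
    by (intro sylow_coordinates.intro sylow_coordinates_axioms.intro prime_modulus.intro p_prime t Q0 Q0(2) [symmetric])
      (unfold_locales, use SylD(5) [OF P] t in blast)
  obtain w where "affine_stabilizer G p act t w" using affine_stabilizer by blast
  then interpret simple_affine_stabilizer G p act t w
    by (intro simple_affine_stabilizer.intro simple_affine_stabilizer_axioms.intro s)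
  show "p \<ge> 5" by (rule p_ge_5)
  show "G \<cong> PSL2 (residue_ring (int p))" by (rule iso_PSL2)
qed

theorem theoremB:
  fixes G :: "('a, 'b) monoid_scheme" and p :: nat
  assumes "simple_group G" and "finite (carrier G)" and "\<not> comm_group G"
    and "prime p" and "p dvd order G"
  shows "Pr_p p G = (real p ^ 2 + real p - 1) / real p ^ 3 \<longleftrightarrow>
    p \<ge> 5 \<and> G \<cong> PSL2 (residue_ring (int p))"
proof -
  interpret finite_group_prime G p
    using assms by (intro finite_group_prime.intro finite_group_prime_axioms.intro) (simp_all add: simple_group.axioms(1))
  show ?thesis
    using iso_if_Pr_p [OF assms(1,3,5)] Pr_p_if_iso [OF assms(1,3,5)] by blast
qed

end
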